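(* Let $m, n \in \mathbb{N}$ with $m \geq 3$, $n \geq 2$, and let $K$ be a field containing a primitive $m$-th root of unity $q$. Let $\xi$ be a generator of the cyclic group $U_n(K)$, let $\nu(n)=|U_n(K)|$ and $d = \gcd(m,\nu(n))$. 1) For any $t \in \{0, 1,\dots, \nu(n)-1\}$ there exists an isomorphism of Hopf algebras $T_{nm^{2}}^{\xi^{t}}(q) \simeq T_{nm^{2}}^{\xi^{u}}(q)$, where $u=\gcd\big(t, \frac{\nu(n)}{d}\big)$. 2) If $d_{1}, d_{2}$ are positive divisors of $\frac{\nu(n)}{d}$ with $d_{1} \neq d_{2}$, then the Hopf algebras $T_{nm^{2}}^{\xi^{d_{1}}}(q)$ and $T_{nm^{2}}^{\xi^{d_{2}}}(q)$ are not isomorphic. 3) If $\frac{\nu(n)}{d} = p_1^{\alpha_1} \cdots p_r^{\alpha_r}$ is the prime decomposition of $\frac{\nu(n)}{d}$, then the number of isomorphism types of Hopf algebras that factorize through $T_{m^{2}}(q)$ and $K[C_n]$ is equal to $(\alpha_1 + 1)(\alpha_2 + 1) \cdots (\alpha_r + 1)$.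
   Context: All algebras, Hopf algebras and tensor products are over $K$. $U_n(K)=\{\omega\in K \mid \omega^n=1\}$ is the cyclic group of $n$-th roots of unity in $K$ (its order $\nu(n)$ divides $n$). A primitive $m$-th root of unity is a generator of $U_m(K)$ when $|U_m(K)|=m$. Convention: $\gcd(0,N)=N$. $C_n$ is the cyclic group of order $n$ and $K[C_n]$ its group Hopf algebra. Taft algebra: $T_{m^2}(q)$ is the Hopf algebra generated as an algebra by $h$ and $x$ subject to $h^m=1$, $x^m=0$, $xh=qhx$, with $\Delta(h)=h\otimes h$, $\Delta(x)=x\otimes h+1\otimes x$, $\varepsilon(h)=1$, $\varepsilon(x)=0$, $S(h)=h^{-1}$, $S(x)=-xh^{-1}$. For $\omega\in U_n(K)$, $T_{nm^{2}}^{\omega}(q)$ denotes the $nm^2$-dimensional Hopf algebra generated as an algebra by $g$, $h$, $x$ subject to $g^{n}=h^{m}=1$, $x^{m}=0$, $xh=qhx$, $hg=gh$, $gx=\omega xg$, with $\Delta(g)=g\otimes g$, $\Delta(h)=h\otimes h$, $\Delta(x)=x\otimes h+1\otimes x$, $\varepsilon(h)=\varepsilon(g)=1$, $\varepsilon(x)=0$, $S(h)=h^{m-1}$, $S(x)=-xh^{m-1}$, $S(g)=g^{n-1}$. Factorization: a Hopf algebra $E$ factorizes through two Hopf algebras $A$ and $H$ if there exist injective Hopf algebra maps $i\colon A\to E$ and $j\colon H\to E$ such that the map $A\otimes H\to E$, $a\otimes y\mapsto i(a)j(y)$, is bijective. *)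

theory Defs
  imports
    "HOL-Algebra.QuotRing"
    "HOL-Algebra.Module"
    "HOL-Algebra.Elementary_Groups"
    "HOL-Library.Poly_Mapping"
    "HOL-Library.Equipollence"
    "HOL-Computational_Algebra.Primes"
begin

section \<open>Roots of unity\<close>

definition roots_of_unity :: "nat \<Rightarrow> 'k::field set" where
  "roots_of_unity n = {\<omega>. \<omega> ^ n = 1}"

definition generates_roots :: "nat \<Rightarrow> 'k::field \<Rightarrow> bool" where
  "generates_roots n \<omega> \<longleftrightarrow> roots_of_unity n = range (\<lambda>i::nat. \<omega> ^ i)"

definition primitive_root_of_unity :: "nat \<Rightarrow> 'k::field \<Rightarrow> bool" where
  "primitive_root_of_unity m q \<longleftrightarrow>
     card (roots_of_unity m :: 'k set) = m \<and> generates_roots m q"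


section \<open>Algebras over a field\<close>

text \<open>The field is a type \<open>'k\<close> of class \<open>field\<close>; algebras are records with explicit carriers,
  and need not be commutative (unlike those of the locale \<open>algebra\<close>).\<close>

definition scalars :: "('k::field, 'k) module" where
  "scalars = \<lparr>carrier = UNIV, monoid.mult = (*), one = 1, zero = 0, add = (+), smult = (*)\<rparr>"

locale k_algebra = ring A for A :: "('k::field, 'a, 'z) module_scheme" (structure) +
  assumes module_scalars: "module scalars A"
    and smult_mult_left:
      "x \<in> carrier A \<Longrightarrow> y \<in> carrier A \<Longrightarrow> (c \<odot> x) \<otimes> y = c \<odot> (x \<otimes> y)"
    and smult_mult_right:
      "x \<in> carrier A \<Longrightarrow> y \<in> carrier A \<Longrightarrow> x \<otimes> (c \<odot> y) = c \<odot> (x \<otimes> y)"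

definition linear_map ::
  "('k::field, 'a, 'y) module_scheme \<Rightarrow> ('k, 'b, 'z) module_scheme \<Rightarrow> ('a \<Rightarrow> 'b) \<Rightarrow> bool" where
  "linear_map A B f \<longleftrightarrow> f \<in> carrier A \<rightarrow> carrier B \<and>
     (\<forall>x\<in>carrier A. \<forall>y\<in>carrier A. f (x \<oplus>\<^bsub>A\<^esub> y) = f x \<oplus>\<^bsub>B\<^esub> f y) \<and>
     (\<forall>c. \<forall>x\<in>carrier A. f (c \<odot>\<^bsub>A\<^esub> x) = c \<odot>\<^bsub>B\<^esub> f x)"

definition algebra_hom ::
  "('k::field, 'a, 'y) module_scheme \<Rightarrow> ('k, 'b, 'z) module_scheme \<Rightarrow> ('a \<Rightarrow> 'b) \<Rightarrow> bool" where
  "algebra_hom A B f \<longleftrightarrow> linear_map A B f \<and> f \<in> ring_hom A B"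

definition opposite_algebra ::
  "('k::field, 'a, 'z) module_scheme \<Rightarrow> ('k, 'a, 'z) module_scheme" where
  "opposite_algebra A = A\<lparr>monoid.mult := \<lambda>x y. y \<otimes>\<^bsub>A\<^esub> x\<rparr>"

definition quotient_algebra ::
  "('k::field, 'a, 'z) module_scheme \<Rightarrow> 'a set \<Rightarrow> ('k, 'a set) module" (infixl \<open>Quot\<^sub>K\<close> 65) where
  "A Quot\<^sub>K I = ring.extend (A Quot I)
     (module.fields (\<lambda>c C. I <+>\<^bsub>A\<^esub> ((\<lambda>x. c \<odot>\<^bsub>A\<^esub> x) ` C)))"

text \<open>The \<open>'k\<close>-vector space with basis \<^term>\<open>carrier G\<close>, multiplied through \<open>G\<close>.
  It yields group algebras, free algebras (words under concatenation) and the free vector space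
  on a product of two carriers, from which the tensor product is formed.\<close>

definition monoid_algebra :: "('g, 'z) monoid_scheme \<Rightarrow> ('k::field, 'g \<Rightarrow>\<^sub>0 'k) module" where
  "monoid_algebra G =
     \<lparr>carrier = {p. Poly_Mapping.keys p \<subseteq> carrier G},
      monoid.mult = \<lambda>p r. \<Sum>x\<in>Poly_Mapping.keys p. \<Sum>y\<in>Poly_Mapping.keys r.
        Poly_Mapping.single (x \<otimes>\<^bsub>G\<^esub> y) (Poly_Mapping.lookup p x * Poly_Mapping.lookup r y),
      one = Poly_Mapping.single \<one>\<^bsub>G\<^esub> 1, zero = 0, add = (+),
      smult = \<lambda>c. Poly_Mapping.map ((*) c)\<rparr>"

definition linear_extension ::
  "('k::field, 'b, 'z) module_scheme \<Rightarrow> ('g \<Rightarrow> 'b) \<Rightarrow> ('g \<Rightarrow>\<^sub>0 'k) \<Rightarrow> 'b" where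
  "linear_extension B b p =
     (\<Oplus>\<^bsub>B\<^esub>g\<in>Poly_Mapping.keys p. Poly_Mapping.lookup p g \<odot>\<^bsub>B\<^esub> b g)"


section \<open>Tensor products\<close>

definition tensor_relators ::
  "('k::field, 'a, 'y) module_scheme \<Rightarrow> ('k, 'b, 'z) module_scheme \<Rightarrow> ('a \<times> 'b \<Rightarrow>\<^sub>0 'k) set" where
  "tensor_relators A B =
     {Poly_Mapping.single (a \<oplus>\<^bsub>A\<^esub> a', b) 1 - Poly_Mapping.single (a, b) 1 - Poly_Mapping.single (a', b) 1
       | a a' b. a \<in> carrier A \<and> a' \<in> carrier A \<and> b \<in> carrier B} \<union>
     {Poly_Mapping.single (a, b \<oplus>\<^bsub>B\<^esub> b') 1 - Poly_Mapping.single (a, b) 1 - Poly_Mapping.single (a, b') 1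
       | a b b'. a \<in> carrier A \<and> b \<in> carrier B \<and> b' \<in> carrier B} \<union>
     {Poly_Mapping.single (c \<odot>\<^bsub>A\<^esub> a, b) 1 - Poly_Mapping.single (a, b) c
       | c a b. a \<in> carrier A \<and> b \<in> carrier B} \<union>
     {Poly_Mapping.single (a, c \<odot>\<^bsub>B\<^esub> b) 1 - Poly_Mapping.single (a, b) c
       | c a b. a \<in> carrier A \<and> b \<in> carrier B}"

text \<open>For algebras \<open>A\<close> and \<open>B\<close> the relators span a two-sided ideal, so that the quotient below is
  the usual tensor product of vector spaces (free space on pairs modulo the span of the bilinearity
  relators), together with the multiplication \<open>(a \<otimes> b)(a' \<otimes> b') = aa' \<otimes> bb'\<close>.\<close>

definition tensor_ideal ::
  "('k::field, 'a, 'y) module_scheme \<Rightarrow> ('k, 'b, 'z) module_scheme \<Rightarrow> ('a \<times> 'b \<Rightarrow>\<^sub>0 'k) set" where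
  "tensor_ideal A B = Idl\<^bsub>monoid_algebra (A \<times>\<times> B)\<^esub> (tensor_relators A B)"

definition tensor ::
  "('k::field, 'a, 'y) module_scheme \<Rightarrow> ('k, 'b, 'z) module_scheme \<Rightarrow>
   ('k, ('a \<times> 'b \<Rightarrow>\<^sub>0 'k) set) module" where
  "tensor A B = monoid_algebra (A \<times>\<times> B) Quot\<^sub>K tensor_ideal A B"

definition pure_tensor ::
  "('k::field, 'a, 'y) module_scheme \<Rightarrow> ('k, 'b, 'z) module_scheme \<Rightarrow>
   'a \<Rightarrow> 'b \<Rightarrow> ('a \<times> 'b \<Rightarrow>\<^sub>0 'k) set" where
  "pure_tensor A B a b =
     tensor_ideal A B +>\<^bsub>monoid_algebra (A \<times>\<times> B)\<^esub> Poly_Mapping.single (a, b) 1"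

text \<open>The linear map out of \<^term>\<open>tensor A B\<close> induced by a bilinear map \<open>\<phi>\<close>
  (unique on the carrier, unspecified elsewhere).\<close>

definition tensor_lift ::
  "('k::field, 'a, 'x) module_scheme \<Rightarrow> ('k, 'b, 'y) module_scheme \<Rightarrow> ('k, 'c, 'z) module_scheme \<Rightarrow>
   ('a \<Rightarrow> 'b \<Rightarrow> 'c) \<Rightarrow> ('a \<times> 'b \<Rightarrow>\<^sub>0 'k) set \<Rightarrow> 'c" where
  "tensor_lift A B C \<phi> = (SOME f. linear_map (tensor A B) C f \<and>
     (\<forall>a\<in>carrier A. \<forall>b\<in>carrier B. f (pure_tensor A B a b) = \<phi> a b))"

definition tensor_map ::
  "('k::field, 'a, 'w) module_scheme \<Rightarrow> ('k, 'b, 'x) module_scheme \<Rightarrow>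
   ('k, 'c, 'y) module_scheme \<Rightarrow> ('k, 'd, 'z) module_scheme \<Rightarrow>
   ('a \<Rightarrow> 'c) \<Rightarrow> ('b \<Rightarrow> 'd) \<Rightarrow> ('a \<times> 'b \<Rightarrow>\<^sub>0 'k) set \<Rightarrow> ('c \<times> 'd \<Rightarrow>\<^sub>0 'k) set" where
  "tensor_map A B C D f g =
     tensor_lift A B (tensor C D) (\<lambda>a b. pure_tensor C D (f a) (g b))"

definition tensor_assoc ::
  "('k::field, 'a, 'x) module_scheme \<Rightarrow> ('k, 'b, 'y) module_scheme \<Rightarrow> ('k, 'c, 'z) module_scheme \<Rightarrow>
   (('a \<times> 'b \<Rightarrow>\<^sub>0 'k) set \<times> 'c \<Rightarrow>\<^sub>0 'k) set \<Rightarrow> ('a \<times> ('b \<times> 'c \<Rightarrow>\<^sub>0 'k) set \<Rightarrow>\<^sub>0 'k) set" where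
  "tensor_assoc A B C =
     tensor_lift (tensor A B) C (tensor A (tensor B C))
       (\<lambda>t c. tensor_lift A B (tensor A (tensor B C))
          (\<lambda>a b. pure_tensor A (tensor B C) a (pure_tensor B C b c)) t)"


section \<open>Hopf algebras\<close>

record (overloaded) ('k::field, 'a) hopf = "('k, 'a) module" +
  comult :: "'a \<Rightarrow> ('a \<times> 'a \<Rightarrow>\<^sub>0 'k) set"
  counit :: "'a \<Rightarrow> 'k"
  antipode :: "'a \<Rightarrow> 'a"

locale hopf_algebra = k_algebra H for H :: "('k::field, 'a, 'z) hopf_scheme" (structure) +
  assumes comult_hom: "algebra_hom H (tensor H H) (comult H)"
    and counit_hom: "algebra_hom H scalars (counit H)"
    and coassoc: "x \<in> carrier H \<Longrightarrow>
      tensor_assoc H H H (tensor_map H H (tensor H H) H (comult H) (\<lambda>y. y) (comult H x)) =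
      tensor_map H H H (tensor H H) (\<lambda>y. y) (comult H) (comult H x)"
    and counit_left: "x \<in> carrier H \<Longrightarrow>
      tensor_lift H H H (\<lambda>a b. counit H a \<odot> b) (comult H x) = x"
    and counit_right: "x \<in> carrier H \<Longrightarrow>
      tensor_lift H H H (\<lambda>a b. counit H b \<odot> a) (comult H x) = x"
    and antipode_linear: "linear_map H H (antipode H)"
    and antipode_left: "x \<in> carrier H \<Longrightarrow>
      tensor_lift H H H (\<lambda>a b. antipode H a \<otimes> b) (comult H x) = counit H x \<odot> \<one>"
    and antipode_right: "x \<in> carrier H \<Longrightarrow>
      tensor_lift H H H (\<lambda>a b. a \<otimes> antipode H b) (comult H x) = counit H x \<odot> \<one>"

text \<open>Bialgebra maps between Hopf algebras commute with the antipodes automatically.\<close>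

definition hopf_hom ::
  "('k::field, 'a, 'y) hopf_scheme \<Rightarrow> ('k, 'b, 'z) hopf_scheme \<Rightarrow> ('a \<Rightarrow> 'b) \<Rightarrow> bool" where
  "hopf_hom A B f \<longleftrightarrow> algebra_hom A B f \<and>
     (\<forall>x\<in>carrier A. comult B (f x) = tensor_map A A B B f f (comult A x)) \<and>
     (\<forall>x\<in>carrier A. counit B (f x) = counit A x)"

definition hopf_isomorphic ::
  "('k::field, 'a, 'y) hopf_scheme \<Rightarrow> ('k, 'b, 'z) hopf_scheme \<Rightarrow> bool" (infix \<open>\<cong>\<^sub>H\<close> 50) where
  "A \<cong>\<^sub>H B \<longleftrightarrow> (\<exists>f. hopf_hom A B f \<and> bij_betw f (carrier A) (carrier B))"

definition isomorphism_types ::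
  "('k::field, 'a, 'z) hopf_scheme set \<Rightarrow> ('k, 'a, 'z) hopf_scheme set set" where
  "isomorphism_types \<E> = \<E> // {(E, F). E \<in> \<E> \<and> F \<in> \<E> \<and> E \<cong>\<^sub>H F}"

definition factorizes_through ::
  "('k::field, 'e, 'x) hopf_scheme \<Rightarrow> ('k, 'a, 'y) hopf_scheme \<Rightarrow> ('k, 'b, 'z) hopf_scheme \<Rightarrow> bool" where
  "factorizes_through E A H \<longleftrightarrow>
     (\<exists>i j. hopf_hom A E i \<and> inj_on i (carrier A) \<and> hopf_hom H E j \<and> inj_on j (carrier H) \<and>
        bij_betw (tensor_lift A H E (\<lambda>a y. i a \<otimes>\<^bsub>E\<^esub> j y)) (carrier (tensor A H)) (carrier E))"


section \<open>Group algebras and presented Hopf algebras\<close>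

definition group_hopf_algebra :: "('g, 'z) monoid_scheme \<Rightarrow> ('k::field, 'g \<Rightarrow>\<^sub>0 'k) hopf" where
  "group_hopf_algebra G =
     (let A = monoid_algebra G; \<delta> = (\<lambda>g. Poly_Mapping.single g 1) in
      module.extend A (hopf.fields
        (linear_extension (tensor A A) (\<lambda>g. pure_tensor A A (\<delta> g) (\<delta> g)))
        (linear_extension scalars (\<lambda>g. 1))
        (linear_extension A (\<lambda>g. \<delta> (inv\<^bsub>G\<^esub> g)))))"

definition free_algebra :: "'s set \<Rightarrow> ('k::field, 's list \<Rightarrow>\<^sub>0 'k) module" where
  "free_algebra X = monoid_algebra \<lparr>carrier = lists X, monoid.mult = (@), one = []\<rparr>"

definition presented_algebra ::
  "'s set \<Rightarrow> ('s list \<Rightarrow>\<^sub>0 'k) set \<Rightarrow> ('k::field, ('s list \<Rightarrow>\<^sub>0 'k) set) module" where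
  "presented_algebra X R = free_algebra X Quot\<^sub>K (Idl\<^bsub>free_algebra X\<^esub> R)"

definition presented_gen ::
  "'s set \<Rightarrow> ('s list \<Rightarrow>\<^sub>0 'k::field) set \<Rightarrow> 's \<Rightarrow> ('s list \<Rightarrow>\<^sub>0 'k) set" where
  "presented_gen X R s = Idl\<^bsub>free_algebra X\<^esub> R +>\<^bsub>free_algebra X\<^esub> Poly_Mapping.single [s] 1"

text \<open>The algebra map with prescribed values on the generators, which exists (and is then unique on
  the carrier) when these values satisfy the relations.\<close>

definition presented_hom ::
  "'s set \<Rightarrow> ('s list \<Rightarrow>\<^sub>0 'k) set \<Rightarrow> ('k::field, 'b, 'z) module_scheme \<Rightarrow> ('s \<Rightarrow> 'b) \<Rightarrow>
   ('s list \<Rightarrow>\<^sub>0 'k) set \<Rightarrow> 'b" where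
  "presented_hom X R B b = (SOME f. algebra_hom (presented_algebra X R) B f \<and>
     (\<forall>s\<in>X. f (presented_gen X R s) = b s))"

text \<open>Comultiplication and counit are multiplicative and the antipode is antimultiplicative, so
  all three are determined by their values \<open>\<Delta>\<close>, \<open>\<epsilon>\<close>, \<open>S\<close> on the generators.\<close>

definition presented_hopf ::
  "'s set \<Rightarrow> ('s list \<Rightarrow>\<^sub>0 'k) set \<Rightarrow>
   ('s \<Rightarrow> (('s list \<Rightarrow>\<^sub>0 'k) set \<times> ('s list \<Rightarrow>\<^sub>0 'k) set \<Rightarrow>\<^sub>0 'k) set) \<Rightarrow> ('s \<Rightarrow> 'k) \<Rightarrow>
   ('s \<Rightarrow> ('s list \<Rightarrow>\<^sub>0 'k) set) \<Rightarrow> ('k::field, ('s list \<Rightarrow>\<^sub>0 'k) set) hopf" where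
  "presented_hopf X R \<Delta> \<epsilon> S =
     (let A = presented_algebra X R in
      module.extend A (hopf.fields
        (presented_hom X R (tensor A A) \<Delta>)
        (presented_hom X R scalars \<epsilon>)
        (presented_hom X R (opposite_algebra A) S)))"


section \<open>Taft algebras and their extensions by a cyclic group\<close>

datatype gen = gen_g | gen_h | gen_x

text \<open>A relation \<open>u = v\<close> is encoded as \<open>u - v\<close>, and a word \<open>[a, b, \<dots>]\<close> stands for \<open>ab\<dots>\<close>.\<close>

definition taft_relators :: "nat \<Rightarrow> 'k::field \<Rightarrow> (gen list \<Rightarrow>\<^sub>0 'k) set" where
  "taft_relators m q =
     {Poly_Mapping.single (replicate m gen_h) 1 - Poly_Mapping.single [] 1,
      Poly_Mapping.single (replicate m gen_x) 1,
      Poly_Mapping.single [gen_x, gen_h] 1 - Poly_Mapping.single [gen_h, gen_x] q}"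

definition taft_algebra :: "nat \<Rightarrow> 'k::field \<Rightarrow> ('k, (gen list \<Rightarrow>\<^sub>0 'k) set) hopf" where
  "taft_algebra m q =
     (let X = {gen_h, gen_x}; R = taft_relators m q;
          A = presented_algebra X R; h = presented_gen X R gen_h; x = presented_gen X R gen_x
      in presented_hopf X R
        (\<lambda>s. if s = gen_h then pure_tensor A A h h
             else pure_tensor A A x h \<oplus>\<^bsub>tensor A A\<^esub> pure_tensor A A \<one>\<^bsub>A\<^esub> x)
        (\<lambda>s. if s = gen_h then 1 else 0)
        (\<lambda>s. if s = gen_h then inv\<^bsub>A\<^esub> h else \<ominus>\<^bsub>A\<^esub> (x \<otimes>\<^bsub>A\<^esub> inv\<^bsub>A\<^esub> h)))"

definition T_relators :: "nat \<Rightarrow> nat \<Rightarrow> 'k::field \<Rightarrow> 'k \<Rightarrow> (gen list \<Rightarrow>\<^sub>0 'k) set" where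
  "T_relators n m \<omega> q = taft_relators m q \<union>
     {Poly_Mapping.single (replicate n gen_g) 1 - Poly_Mapping.single [] 1,
      Poly_Mapping.single [gen_h, gen_g] 1 - Poly_Mapping.single [gen_g, gen_h] 1,
      Poly_Mapping.single [gen_g, gen_x] 1 - Poly_Mapping.single [gen_x, gen_g] \<omega>}"

definition T_algebra :: "nat \<Rightarrow> nat \<Rightarrow> 'k::field \<Rightarrow> 'k \<Rightarrow> ('k, (gen list \<Rightarrow>\<^sub>0 'k) set) hopf" where
  "T_algebra n m \<omega> q =
     (let X = {gen_g, gen_h, gen_x}; R = T_relators n m \<omega> q; A = presented_algebra X R;
          g = presented_gen X R gen_g; h = presented_gen X R gen_h; x = presented_gen X R gen_x
      in presented_hopf X R
        (\<lambda>s. case s of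
             gen_g \<Rightarrow> pure_tensor A A g g
           | gen_h \<Rightarrow> pure_tensor A A h h
           | gen_x \<Rightarrow> pure_tensor A A x h \<oplus>\<^bsub>tensor A A\<^esub> pure_tensor A A \<one>\<^bsub>A\<^esub> x)
        (\<lambda>s. case s of gen_g \<Rightarrow> 1 | gen_h \<Rightarrow> 1 | gen_x \<Rightarrow> 0)
        (\<lambda>s. case s of
             gen_g \<Rightarrow> g [^]\<^bsub>A\<^esub> (n - 1)
           | gen_h \<Rightarrow> h [^]\<^bsub>A\<^esub> (m - 1)
           | gen_x \<Rightarrow> \<ominus>\<^bsub>A\<^esub> (x \<otimes>\<^bsub>A\<^esub> h [^]\<^bsub>A\<^esub> (m - 1))))"

end

theory Submission
  imports Defs "HOL-Number_Theory.Cong"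
begin

text \<open>A Hopf algebra \<open>E\<close> that factorizes through the Taft algebra and the group algebra has the monomials
  \<open>h\<^sup>i x\<^sup>j g\<^sup>k\<close> as a basis, and its comultiplication on them is given by Gaussian binomial coefficients that do
  not vanish below \<open>m\<close>. Comparing coefficients, the group-likes are the \<open>h\<^sup>i g\<^sup>k\<close>, and an element with
  \<open>\<Delta>(y) = y \<otimes> v + u \<otimes> y\<close> is a multiple of \<open>v - u\<close> unless \<open>v = u h\<close>, when a multiple of \<open>u x\<close> may be added.
  Applied to \<open>g x\<close> this gives \<open>g h = h g\<close> and \<open>g x = \<omega> x g\<close>, so that \<open>E\<close> is some \<open>T\<^sup>\<omega>\<close>. Applied to the
  images of the generators under an isomorphism from \<open>T\<^sup>\<omega>\<close> to \<open>T\<^sup>\<omega>'\<close>, it shows that \<open>h\<close> is sent to \<open>h\<close> and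
  \<open>g\<close> to some \<open>h\<^sup>b g\<^sup>a\<close>, whence \<open>\<omega>'\<^sup>a = \<omega> q\<^sup>b\<close>; conversely such a relation with \<open>a\<close> prime to \<open>n\<close> yields an
  isomorphism. So the isomorphism types correspond to the subgroups of the cyclic group \<open>U\<^sub>n / U\<^sub>d\<close> of
  order \<open>\<nu> / d\<close>. Linear independence of the monomials in \<open>T\<^sup>\<omega>\<close> is read off from a representation
  on the functions of the exponents \<open>(i, j, k)\<close>.\<close>

section \<open>Algebras over K: quotients, monoid algebras and tensor products\<close>

section \<open>Algebras and linear maps\<close>

text \<open>Isomorphism and factorization see only the algebra, the comultiplication and the counit.
  Almost everything is therefore done in \<open>prebialgebra\<close>; the remaining Hopf axioms are
  proved for copies of the algebras T inside the type \<open>'e\<close> in which classes are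
  counted. Copies are required because T itself consists of cosets in a free algebra; coordinates
  embed it into \<open>K^(n m^2)\<close>, which explains the bound on \<open>'e\<close>.

  Maps out of tensor products and presented algebras are defined by choice, so each one becomes
  usable only after a map with the prescribed values has been shown to exist.

  In \<open>\<omega>'^a = \<omega> q^b\<close> the powers of q are removed by raising to the power
  m, which leaves a congruence of exponents of \<xi> modulo \<open>N = \<nu> / d\<close>. To reach
  the exponent \<open>gcd t N\<close>, a multiplier known only modulo N must be chosen prime to n;
  adding multiples of a suitable number achieves this. From an isomorphism only the bare relation is
  extracted, with no statement about a: for divisors of N it yields one divisibility, and the
  inverse isomorphism yields the other.\<close>

lemma scalars_simps [simp]:
  "carrier scalars = UNIV" "x \<otimes>\<^bsub>scalars\<^esub> y = x * y" "\<one>\<^bsub>scalars\<^esub> = 1" "\<zero>\<^bsub>scalars\<^esub> = 0"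
  "x \<oplus>\<^bsub>scalars\<^esub> y = x + y" "x \<odot>\<^bsub>scalars\<^esub> y = x * y"
  by (simp_all add: scalars_def)

lemma cring_scalars: "cring (scalars :: ('k::field, 'k) module)"
proof (rule cringI)
  show "abelian_group (scalars :: ('k, 'k) module)"
  proof (rule abelian_groupI)
    fix x :: 'k
    show "\<exists>y\<in>carrier scalars. y \<oplus>\<^bsub>scalars\<^esub> x = \<zero>\<^bsub>scalars\<^esub>"
      by (intro bexI[of _ "- x"]) auto
  qed (auto simp: algebra_simps)
  show "Group.comm_monoid (scalars :: ('k, 'k) module)"
    by (rule comm_monoidI) (auto simp: algebra_simps)
qed (auto simp: algebra_simps)

lemma k_algebraI:
  fixes A :: "('k::field, 'a, 'z) module_scheme" (structure)
  assumes "ring A"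
    and "\<And>c x. x \<in> carrier A \<Longrightarrow> c \<odot> x \<in> carrier A"
    and "\<And>c d x. x \<in> carrier A \<Longrightarrow> (c + d) \<odot> x = c \<odot> x \<oplus> d \<odot> x"
    and "\<And>c x y. x \<in> carrier A \<Longrightarrow> y \<in> carrier A \<Longrightarrow> c \<odot> (x \<oplus> y) = c \<odot> x \<oplus> c \<odot> y"
    and "\<And>c d x. x \<in> carrier A \<Longrightarrow> (c * d) \<odot> x = c \<odot> (d \<odot> x)"
    and "\<And>x. x \<in> carrier A \<Longrightarrow> 1 \<odot> x = x"
    and "\<And>c x y. x \<in> carrier A \<Longrightarrow> y \<in> carrier A \<Longrightarrow> (c \<odot> x) \<otimes> y = c \<odot> (x \<otimes> y)"
    and "\<And>c x y. x \<in> carrier A \<Longrightarrow> y \<in> carrier A \<Longrightarrow> x \<otimes> (c \<odot> y) = c \<odot> (x \<otimes> y)"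
  shows "k_algebra A"
proof -
  interpret ring A by fact
  have "module scalars A"
    by (rule moduleI) (use assms is_abelian_group cring_scalars in auto)
  then show ?thesis
    using assms by (intro k_algebra.intro k_algebra_axioms.intro)
qed

context k_algebra
begin

lemma is_k_algebra: "k_algebra A" ..

lemma smult_closed [simp, intro]: "x \<in> carrier A \<Longrightarrow> c \<odot> x \<in> carrier A"
  using module.smult_closed[OF module_scalars] by simp

lemma smult_add_left: "x \<in> carrier A \<Longrightarrow> (c + d) \<odot> x = c \<odot> x \<oplus> d \<odot> x"
  using module.smult_l_distr[OF module_scalars] by simp

lemma smult_add_right: "x \<in> carrier A \<Longrightarrow> y \<in> carrier A \<Longrightarrow> c \<odot> (x \<oplus> y) = c \<odot> x \<oplus> c \<odot> y"
  using module.smult_r_distr[OF module_scalars] by simp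

lemma smult_smult: "x \<in> carrier A \<Longrightarrow> c \<odot> (d \<odot> x) = (c * d) \<odot> x"
  using module.smult_assoc1[OF module_scalars] by simp

lemma smult_1 [simp]: "x \<in> carrier A \<Longrightarrow> 1 \<odot> x = x"
  using module.smult_one[OF module_scalars] by simp

lemma smult_0 [simp]: "x \<in> carrier A \<Longrightarrow> 0 \<odot> x = \<zero>"
  using module.smult_l_null[OF module_scalars] by simp

lemma smult_zero [simp]: "c \<odot> \<zero> = \<zero>"
  using module.smult_r_null[OF module_scalars] by simp

lemma smult_minus1: "x \<in> carrier A \<Longrightarrow> (- 1) \<odot> x = \<ominus> x"
  by (metis add.inv_equality ab_left_minus smult_0 smult_1 smult_add_left smult_closed)

lemma smult_finsum:
  "f \<in> I \<rightarrow> carrier A \<Longrightarrow> c \<odot> (\<Oplus>i\<in>I. f i) = (\<Oplus>i\<in>I. c \<odot> f i)"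
  by (induction I rule: infinite_finite_induct)
     (auto simp: smult_add_right Pi_def finsum_insert finsum_infinite)

lemma smult_pow: "x \<in> carrier A \<Longrightarrow> (c \<odot> x) [^] (k::nat) = c ^ k \<odot> (x [^] k)"
  by (induction k) (auto simp: smult_mult_left smult_mult_right smult_smult mult.commute)

end

lemma k_algebra_scalars: "k_algebra (scalars :: ('k::field, 'k) module)"
  using cring_scalars by (intro k_algebraI) (auto simp: cring_def algebra_simps)

lemma k_algebra_opposite:
  assumes "k_algebra A" shows "k_algebra (opposite_algebra A)"
proof -
  interpret k_algebra A by fact
  have simps: "carrier (opposite_algebra A) = carrier A" "\<zero>\<^bsub>opposite_algebra A\<^esub> = \<zero>\<^bsub>A\<^esub>"
    "\<one>\<^bsub>opposite_algebra A\<^esub> = \<one>\<^bsub>A\<^esub>"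
    "\<And>x y. x \<otimes>\<^bsub>opposite_algebra A\<^esub> y = y \<otimes>\<^bsub>A\<^esub> x"
    "\<And>x y. x \<oplus>\<^bsub>opposite_algebra A\<^esub> y = x \<oplus>\<^bsub>A\<^esub> y"
    "\<And>c x. c \<odot>\<^bsub>opposite_algebra A\<^esub> x = c \<odot>\<^bsub>A\<^esub> x"
    by (simp_all add: opposite_algebra_def)
  have "ring (opposite_algebra A)"
  proof (rule ringI)
    show "abelian_group (opposite_algebra A)"
      by (rule abelian_groupI) (auto simp: simps a_ac intro: add.l_inv_ex)
    show "Group.monoid (opposite_algebra A)"
      by (rule monoidI) (auto simp: simps m_assoc)
  qed (auto simp: simps l_distr r_distr)
  then show ?thesis
    by (rule k_algebraI)
       (auto simp: simps smult_add_left smult_add_right smult_smult smult_mult_left smult_mult_right)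
qed

lemma opposite_algebra_simps [simp]:
  "carrier (opposite_algebra A) = carrier A" "\<zero>\<^bsub>opposite_algebra A\<^esub> = \<zero>\<^bsub>A\<^esub>"
  "\<one>\<^bsub>opposite_algebra A\<^esub> = \<one>\<^bsub>A\<^esub>" "x \<otimes>\<^bsub>opposite_algebra A\<^esub> y = y \<otimes>\<^bsub>A\<^esub> x"
  "x \<oplus>\<^bsub>opposite_algebra A\<^esub> y = x \<oplus>\<^bsub>A\<^esub> y" "c \<odot>\<^bsub>opposite_algebra A\<^esub> x = c \<odot>\<^bsub>A\<^esub> x"
  by (simp_all add: opposite_algebra_def)

lemma linear_mapI:
  assumes "\<And>x. x \<in> carrier A \<Longrightarrow> f x \<in> carrier B"
    and "\<And>x y. x \<in> carrier A \<Longrightarrow> y \<in> carrier A \<Longrightarrow> f (x \<oplus>\<^bsub>A\<^esub> y) = f x \<oplus>\<^bsub>B\<^esub> f y"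
    and "\<And>c x. x \<in> carrier A \<Longrightarrow> f (c \<odot>\<^bsub>A\<^esub> x) = c \<odot>\<^bsub>B\<^esub> f x"
  shows "linear_map A B f"
  using assms by (auto simp: linear_map_def)

lemma linear_map_closed: "linear_map A B f \<Longrightarrow> x \<in> carrier A \<Longrightarrow> f x \<in> carrier B"
  and linear_map_add:
    "linear_map A B f \<Longrightarrow> x \<in> carrier A \<Longrightarrow> y \<in> carrier A \<Longrightarrow> f (x \<oplus>\<^bsub>A\<^esub> y) = f x \<oplus>\<^bsub>B\<^esub> f y"
  and linear_map_smult:
    "linear_map A B f \<Longrightarrow> x \<in> carrier A \<Longrightarrow> f (c \<odot>\<^bsub>A\<^esub> x) = c \<odot>\<^bsub>B\<^esub> f x"
  by (auto simp: linear_map_def)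

lemma linear_map_id: "linear_map A A (\<lambda>x. x)"
  by (simp add: linear_map_def)

lemma linear_map_compose:
  "linear_map A B f \<Longrightarrow> linear_map B C g \<Longrightarrow> linear_map A C (\<lambda>x. g (f x))"
  by (auto simp: linear_map_def Pi_def)

lemma linear_map_zero:
  assumes "k_algebra A" "k_algebra B" "linear_map A B f"
  shows "f \<zero>\<^bsub>A\<^esub> = \<zero>\<^bsub>B\<^esub>"
proof -
  interpret A: k_algebra A by fact
  interpret B: k_algebra B by fact
  show ?thesis
    using linear_map_smult[OF assms(3), of "\<zero>\<^bsub>A\<^esub>" 0] linear_map_closed[OF assms(3), of "\<zero>\<^bsub>A\<^esub>"] by simp
qed

lemma linear_map_minus:
  assumes "k_algebra A" "k_algebra B" "linear_map A B f" "x \<in> carrier A"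
  shows "f (\<ominus>\<^bsub>A\<^esub> x) = \<ominus>\<^bsub>B\<^esub> f x"
  by (metis assms k_algebra.smult_minus1 linear_map_closed linear_map_smult)

lemma linear_map_finsum:
  assumes "k_algebra A" "k_algebra B" "linear_map A B f" "g \<in> I \<rightarrow> carrier A"
  shows "f (\<Oplus>\<^bsub>A\<^esub>i\<in>I. g i) = (\<Oplus>\<^bsub>B\<^esub>i\<in>I. f (g i))"
proof -
  interpret A: k_algebra A by fact
  interpret B: k_algebra B by fact
  show ?thesis
    using assms(4)
    by (induction I rule: infinite_finite_induct)
       (auto simp: A.finsum_insert B.finsum_insert A.finsum_infinite B.finsum_infinite Pi_def
          linear_map_zero[OF assms(1-3)] linear_map_add[OF assms(3)] linear_map_closed[OF assms(3)])
qed

lemma algebra_hom_linear: "algebra_hom A B f \<Longrightarrow> linear_map A B f"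
  and algebra_hom_closed: "algebra_hom A B f \<Longrightarrow> x \<in> carrier A \<Longrightarrow> f x \<in> carrier B"
  and algebra_hom_add:
    "algebra_hom A B f \<Longrightarrow> x \<in> carrier A \<Longrightarrow> y \<in> carrier A \<Longrightarrow> f (x \<oplus>\<^bsub>A\<^esub> y) = f x \<oplus>\<^bsub>B\<^esub> f y"
  and algebra_hom_mult:
    "algebra_hom A B f \<Longrightarrow> x \<in> carrier A \<Longrightarrow> y \<in> carrier A \<Longrightarrow> f (x \<otimes>\<^bsub>A\<^esub> y) = f x \<otimes>\<^bsub>B\<^esub> f y"
  and algebra_hom_one: "algebra_hom A B f \<Longrightarrow> f \<one>\<^bsub>A\<^esub> = \<one>\<^bsub>B\<^esub>"
  and algebra_hom_smult: "algebra_hom A B f \<Longrightarrow> x \<in> carrier A \<Longrightarrow> f (c \<odot>\<^bsub>A\<^esub> x) = c \<odot>\<^bsub>B\<^esub> f x"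
  by (auto simp: algebra_hom_def linear_map_def ring_hom_def)

lemma algebra_homI:
  assumes "linear_map A B f"
    and "\<And>x y. x \<in> carrier A \<Longrightarrow> y \<in> carrier A \<Longrightarrow> f (x \<otimes>\<^bsub>A\<^esub> y) = f x \<otimes>\<^bsub>B\<^esub> f y"
    and "f \<one>\<^bsub>A\<^esub> = \<one>\<^bsub>B\<^esub>"
  shows "algebra_hom A B f"
  using assms by (auto simp: algebra_hom_def linear_map_def ring_hom_def)

lemma algebra_hom_id: "algebra_hom A A (\<lambda>x. x)"
  by (simp add: algebra_homI linear_map_id)

lemma algebra_hom_compose:
  "algebra_hom A B f \<Longrightarrow> algebra_hom B C g \<Longrightarrow> algebra_hom A C (\<lambda>x. g (f x))"
  by (auto simp: algebra_hom_def linear_map_def ring_hom_def Pi_def)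

lemma algebra_hom_pow:
  assumes "k_algebra A" "k_algebra B" "algebra_hom A B f" "x \<in> carrier A"
  shows "f (x [^]\<^bsub>A\<^esub> (k::nat)) = f x [^]\<^bsub>B\<^esub> k"
proof -
  interpret A: k_algebra A by fact
  interpret B: k_algebra B by fact
  show ?thesis
    by (induction k) (auto simp: algebra_hom_one[OF assms(3)] algebra_hom_mult[OF assms(3)] assms(4))
qed

lemma inverse_linear_map:
  assumes "k_algebra A" "linear_map A B f" "bij_betw f (carrier A) (carrier B)"
  shows "linear_map B A (inv_into (carrier A) f)"
proof -
  interpret A: k_algebra A by fact
  let ?f' = "inv_into (carrier A) f"
  have f': "y \<in> carrier B \<Longrightarrow> ?f' y \<in> carrier A \<and> f (?f' y) = y" for y
    using assms(3) by (metis bij_betw_def f_inv_into_f inv_into_into)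
  have eq: "a \<in> carrier A \<Longrightarrow> ?f' (f a) = a" for a
    using assms(3) by (simp add: bij_betw_def)
  show ?thesis
  proof (rule linear_mapI)
    fix x y assume *: "x \<in> carrier B" "y \<in> carrier B"
    show "?f' (x \<oplus>\<^bsub>B\<^esub> y) = ?f' x \<oplus>\<^bsub>A\<^esub> ?f' y"
      using eq[of "?f' x \<oplus>\<^bsub>A\<^esub> ?f' y"] f' * by (simp add: linear_map_add[OF assms(2)])
  next
    fix c x assume *: "x \<in> carrier B"
    show "?f' (c \<odot>\<^bsub>B\<^esub> x) = c \<odot>\<^bsub>A\<^esub> ?f' x"
      using eq[of "c \<odot>\<^bsub>A\<^esub> ?f' x"] f' * by (simp add: linear_map_smult[OF assms(2)])
  qed (use f' in auto)
qed

lemma inverse_algebra_hom: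
  assumes "k_algebra A" "algebra_hom A B f" "bij_betw f (carrier A) (carrier B)"
  shows "algebra_hom B A (inv_into (carrier A) f)"
proof -
  interpret A: k_algebra A by fact
  let ?f' = "inv_into (carrier A) f"
  have f': "y \<in> carrier B \<Longrightarrow> ?f' y \<in> carrier A \<and> f (?f' y) = y" for y
    using assms(3) by (metis bij_betw_def f_inv_into_f inv_into_into)
  have eq: "a \<in> carrier A \<Longrightarrow> ?f' (f a) = a" for a
    using assms(3) by (simp add: bij_betw_def)
  show ?thesis
  proof (rule algebra_homI)
    show "linear_map B A ?f'"
      using assms inverse_linear_map algebra_hom_linear by blast
    fix x y assume *: "x \<in> carrier B" "y \<in> carrier B"
    show "?f' (x \<otimes>\<^bsub>B\<^esub> y) = ?f' x \<otimes>\<^bsub>A\<^esub> ?f' y"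
      using eq[of "?f' x \<otimes>\<^bsub>A\<^esub> ?f' y"] f' * by (simp add: algebra_hom_mult[OF assms(2)])
  next
    show "?f' \<one>\<^bsub>B\<^esub> = \<one>\<^bsub>A\<^esub>"
      using eq[of "\<one>\<^bsub>A\<^esub>"] algebra_hom_one[OF assms(2)] by simp
  qed
qed


section \<open>Quotients\<close>

lemma carrier_quotient_algebra: "carrier (A Quot\<^sub>K I) = a_rcosets\<^bsub>A\<^esub> I"
  and one_quotient_algebra: "\<one>\<^bsub>A Quot\<^sub>K I\<^esub> = I +>\<^bsub>A\<^esub> \<one>\<^bsub>A\<^esub>"
  and mult_quotient_algebra: "C \<otimes>\<^bsub>A Quot\<^sub>K I\<^esub> D = rcoset_mult A I C D"
  and add_quotient_algebra: "C \<oplus>\<^bsub>A Quot\<^sub>K I\<^esub> D = C <+>\<^bsub>A\<^esub> D"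
  and smult_quotient_algebra: "c \<odot>\<^bsub>A Quot\<^sub>K I\<^esub> C = I <+>\<^bsub>A\<^esub> ((\<lambda>x. c \<odot>\<^bsub>A\<^esub> x) ` C)"
  by (simp_all add: quotient_algebra_def FactRing_def ring.defs module.defs)

context
  fixes A :: "('k::field, 'a, 'z) module_scheme" (structure) and I
  assumes A: "k_algebra A" and I: "ideal I A"
begin

interpretation k_algebra A by (rule A)
interpretation ideal I A by (rule I)

lemma ideal_smult_closed: "x \<in> I \<Longrightarrow> c \<odot> x \<in> I"
  using I_l_closed[of x "c \<odot> \<one>"] by (simp add: smult_mult_left Icarr)

lemma coset_in_quotient [simp]: "x \<in> carrier A \<Longrightarrow> I +> x \<in> carrier (A Quot\<^sub>K I)"
  by (simp add: carrier_quotient_algebra a_rcosetsI a_subset)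

lemma quotient_cases:
  assumes "C \<in> carrier (A Quot\<^sub>K I)"
  obtains x where "x \<in> carrier A" "C = I +> x"
  using assms by (auto simp: carrier_quotient_algebra A_RCOSETS_def RCOSETS_def a_r_coset_def)

lemma coset_eq_iff:
  "x \<in> carrier A \<Longrightarrow> y \<in> carrier A \<Longrightarrow> I +> x = I +> y \<longleftrightarrow> x \<ominus> y \<in> I"
  using quotient_eq_iff_same_a_r_cos[OF I] by auto

lemma coset_add: "x \<in> carrier A \<Longrightarrow> y \<in> carrier A \<Longrightarrow>
    (I +> x) \<oplus>\<^bsub>A Quot\<^sub>K I\<^esub> (I +> y) = I +> (x \<oplus> y)"
  by (simp add: add_quotient_algebra a_rcos_sum)

lemma coset_mult: "x \<in> carrier A \<Longrightarrow> y \<in> carrier A \<Longrightarrow>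
    (I +> x) \<otimes>\<^bsub>A Quot\<^sub>K I\<^esub> (I +> y) = I +> (x \<otimes> y)"
  by (simp add: mult_quotient_algebra rcoset_mult_add)

text \<open>The summand \<open>I\<close> in the scalar multiplication of a quotient matters for
  \<open>c = 0\<close>, where the scaled coset is only the zero element.\<close>

lemma coset_smult:
  assumes "x \<in> carrier A"
  shows "c \<odot>\<^bsub>A Quot\<^sub>K I\<^esub> (I +> x) = I +> (c \<odot> x)"
proof -
  have "c \<odot>\<^bsub>A Quot\<^sub>K I\<^esub> (I +> x) = (\<Union>i\<in>I. \<Union>j\<in>I. {i \<oplus> c \<odot> (j \<oplus> x)})"
    unfolding smult_quotient_algebra set_add_def' a_r_coset_def' by blast
  also have "\<dots> = (\<Union>i\<in>I. \<Union>j\<in>I. {(i \<oplus> c \<odot> j) \<oplus> c \<odot> x})"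
    using assms by (simp add: smult_add_right Icarr a_assoc)
  also have "\<dots> = (\<Union>i\<in>I. {i \<oplus> c \<odot> x})"
  proof (intro equalityI subsetI)
    fix y assume "y \<in> (\<Union>i\<in>I. {i \<oplus> c \<odot> x})"
    then obtain i where "i \<in> I" "y = (i \<oplus> c \<odot> \<zero>) \<oplus> c \<odot> x" by (auto simp: Icarr)
    then show "y \<in> (\<Union>i\<in>I. \<Union>j\<in>I. {(i \<oplus> c \<odot> j) \<oplus> c \<odot> x})"
      using additive_subgroup.zero_closed[OF is_additive_subgroup] by blast
  qed (use ideal_smult_closed in blast)
  also have "\<dots> = I +> (c \<odot> x)"
    by (simp add: a_r_coset_def')
  finally show ?thesis .
qed

lemma k_algebra_quotient: "k_algebra (A Quot\<^sub>K I)"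
proof (rule k_algebraI)
  interpret Q: ring "A Quot I" by (rule quotient_is_ring)
  have eqs: "carrier (A Quot\<^sub>K I) = carrier (A Quot I)" "\<zero>\<^bsub>A Quot\<^sub>K I\<^esub> = \<zero>\<^bsub>A Quot I\<^esub>"
    "\<one>\<^bsub>A Quot\<^sub>K I\<^esub> = \<one>\<^bsub>A Quot I\<^esub>" "\<And>x y. x \<otimes>\<^bsub>A Quot\<^sub>K I\<^esub> y = x \<otimes>\<^bsub>A Quot I\<^esub> y"
    "\<And>x y. x \<oplus>\<^bsub>A Quot\<^sub>K I\<^esub> y = x \<oplus>\<^bsub>A Quot I\<^esub> y"
    by (simp_all add: quotient_algebra_def ring.defs FactRing_def)
  show "ring (A Quot\<^sub>K I)"
  proof (rule ringI)
    show "abelian_group (A Quot\<^sub>K I)"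
      by (rule abelian_groupI) (auto simp: eqs Q.a_ac intro: Q.add.l_inv_ex)
    show "Group.monoid (A Quot\<^sub>K I)"
      by (rule monoidI) (auto simp: eqs Q.m_assoc)
  qed (auto simp: eqs Q.l_distr Q.r_distr)
qed (elim quotient_cases; simp add: coset_add coset_mult coset_smult smult_add_left
      smult_add_right smult_smult smult_mult_left smult_mult_right)+

lemma algebra_hom_coset: "algebra_hom A (A Quot\<^sub>K I) (\<lambda>x. I +> x)"
  by (intro algebra_homI linear_mapI)
     (auto simp: coset_add coset_mult coset_smult one_quotient_algebra)

text \<open>Only linearity is asked of \<open>f\<close>, so that this also lifts bilinear maps to
  tensor products, which are quotients by a two-sided ideal. Multiplicativity is added where it is
  available.\<close>

lemma quotient_lift_linear:
  assumes B: "k_algebra B" and f: "linear_map A B f" and van: "\<And>x. x \<in> I \<Longrightarrow> f x = \<zero>\<^bsub>B\<^esub>"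
  obtains f' where "linear_map (A Quot\<^sub>K I) B f'" "\<And>x. x \<in> carrier A \<Longrightarrow> f' (I +> x) = f x"
proof -
  interpret B: k_algebra B by fact
  define f' where "f' C = f (SOME x. x \<in> carrier A \<and> C = I +> x)" for C
  have f': "f' (I +> x) = f x" if x: "x \<in> carrier A" for x
  proof -
    let ?y = "SOME y. y \<in> carrier A \<and> I +> x = I +> y"
    have y: "?y \<in> carrier A \<and> I +> x = I +> ?y"
      by (rule someI[of _ x]) (use x in auto)
    then have "f (x \<ominus> ?y) = \<zero>\<^bsub>B\<^esub>" using x coset_eq_iff van by blast
    then have "f x \<ominus>\<^bsub>B\<^esub> f ?y = \<zero>\<^bsub>B\<^esub>"
      using x y by (simp add: a_minus_def linear_map_add[OF f] linear_map_minus[OF A B f])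
    then have "f x = f ?y"
      using B.minus_equality[of "f x" "\<ominus>\<^bsub>B\<^esub> f ?y"]
        linear_map_closed[OF f x] linear_map_closed[OF f conjunct1[OF y]] by (simp add: a_minus_def)
    then show ?thesis by (simp add: f'_def)
  qed
  have "linear_map (A Quot\<^sub>K I) B f'"
    by (rule linear_mapI; elim quotient_cases)
       (auto simp: f' coset_add coset_smult linear_map_closed[OF f] linear_map_add[OF f] linear_map_smult[OF f])
  with f' show ?thesis using that by blast
qed

end


section \<open>Monoid algebras\<close>

lemma poly_mapping_map_lookup [simp]:
  "Poly_Mapping.lookup (Poly_Mapping.map ((*) c) p) k = c * Poly_Mapping.lookup p (k::'g)" for c :: "'k::field"
  by (simp add: Poly_Mapping.map.rep_eq when_def)

lemma monoid_algebra_simps: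
  "carrier (monoid_algebra G) = {p. Poly_Mapping.keys p \<subseteq> carrier G}"
  "\<one>\<^bsub>monoid_algebra G\<^esub> = Poly_Mapping.single \<one>\<^bsub>G\<^esub> 1"
  "\<zero>\<^bsub>monoid_algebra G\<^esub> = 0" "p \<oplus>\<^bsub>monoid_algebra G\<^esub> r = p + r"
  "c \<odot>\<^bsub>monoid_algebra G\<^esub> p = Poly_Mapping.map ((*) c) p"
  by (simp_all add: monoid_algebra_def)

lemma keys_map_mult_subset: "Poly_Mapping.keys (Poly_Mapping.map ((*) c) p) \<subseteq> Poly_Mapping.keys p"
  for c :: "'k::field"
  by (auto simp: in_keys_iff)

lemma poly_mapping_single_induct [consumes 1, case_names zero single add]:
  assumes "Poly_Mapping.keys p \<subseteq> X"
    and "P 0" and "\<And>x c. x \<in> X \<Longrightarrow> P (Poly_Mapping.single x c)"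
    and "\<And>p r. Poly_Mapping.keys p \<subseteq> X \<Longrightarrow> Poly_Mapping.keys r \<subseteq> X \<Longrightarrow> P p \<Longrightarrow> P r \<Longrightarrow> P (p + r)"
  shows "P (p :: 'g \<Rightarrow>\<^sub>0 'k::field)"
proof -
  have "finite (Poly_Mapping.keys p)" by simp
  then show ?thesis
    using assms(1)
  proof (induction "Poly_Mapping.keys p" arbitrary: p rule: finite_induct)
    case empty
    then have "p = 0" by (intro poly_mapping_eqI) (metis empty_iff in_keys_iff lookup_zero)
    then show ?case using assms(2) by simp
  next
    case (insert x F)
    define r where "r = p - Poly_Mapping.single x (Poly_Mapping.lookup p x)"
    have F: "Poly_Mapping.keys r = F"
    proof -
      have "Poly_Mapping.keys r = Poly_Mapping.keys p - {x}"
        by (auto simp: r_def in_keys_iff lookup_minus lookup_single when_def split: if_splits)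
      then show ?thesis using insert.hyps by auto
    qed
    have "P r" "Poly_Mapping.keys r \<subseteq> X"
      using insert F by blast+
    moreover have "x \<in> X" using insert by blast
    moreover have "p = Poly_Mapping.single x (Poly_Mapping.lookup p x) + r" by (simp add: r_def)
    ultimately show ?case using assms(3,4)
      by (metis empty_subsetI insert_subset keys_single)
  qed
qed

context
  fixes G :: "('g, 'z) monoid_scheme" (structure)
  assumes G: "Group.monoid G"
begin

interpretation Group.monoid G by (rule G)

text \<open>The keys of a sum are not determined by the keys of the summands. Summing over any
  finite supersets instead makes distributivity a rearrangement of sums.\<close>

lemma monoid_algebra_mult_superset:
  assumes "finite X" "Poly_Mapping.keys p \<subseteq> X" "finite Y" "Poly_Mapping.keys r \<subseteq> Y"
  shows "p \<otimes>\<^bsub>monoid_algebra G\<^esub> r = (\<Sum>x\<in>X. \<Sum>y\<in>Y.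
    Poly_Mapping.single (x \<otimes> y) (Poly_Mapping.lookup p x * Poly_Mapping.lookup r y :: 'k::field))"
proof -
  have "(\<Sum>y\<in>Poly_Mapping.keys r. Poly_Mapping.single (x \<otimes> y) (Poly_Mapping.lookup p x * Poly_Mapping.lookup r y)) =
     (\<Sum>y\<in>Y. Poly_Mapping.single (x \<otimes> y) (Poly_Mapping.lookup p x * Poly_Mapping.lookup r y))" for x
    using assms by (intro sum.mono_neutral_left) (auto simp: in_keys_iff)
  then have "p \<otimes>\<^bsub>monoid_algebra G\<^esub> r = (\<Sum>x\<in>Poly_Mapping.keys p. \<Sum>y\<in>Y.
    Poly_Mapping.single (x \<otimes> y) (Poly_Mapping.lookup p x * Poly_Mapping.lookup r y))"
    by (simp add: monoid_algebra_def)
  also have "\<dots> = (\<Sum>x\<in>X. \<Sum>y\<in>Y.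
    Poly_Mapping.single (x \<otimes> y) (Poly_Mapping.lookup p x * Poly_Mapping.lookup r y))"
    using assms by (intro sum.mono_neutral_left) (auto simp: in_keys_iff)
  finally show ?thesis .
qed

lemma monoid_algebra_mult_single:
  "Poly_Mapping.single x c \<otimes>\<^bsub>monoid_algebra G\<^esub> Poly_Mapping.single y d =
     Poly_Mapping.single (x \<otimes> y) (c * d :: 'k::field)"
  using monoid_algebra_mult_superset[of "{x}" "Poly_Mapping.single x c" "{y}" "Poly_Mapping.single y d"]
  by (auto split: if_splits)

lemma monoid_algebra_mult_add_left:
  "(p + p') \<otimes>\<^bsub>monoid_algebra G\<^esub> r = p \<otimes>\<^bsub>monoid_algebra G\<^esub> r + p' \<otimes>\<^bsub>monoid_algebra G\<^esub> (r :: 'g \<Rightarrow>\<^sub>0 'k::field)"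
  using keys_add[of p p']
  by (simp add: monoid_algebra_mult_superset[of "Poly_Mapping.keys p \<union> Poly_Mapping.keys p'" _ "Poly_Mapping.keys r"]
      lookup_add distrib_right single_add sum.distrib)

lemma monoid_algebra_mult_add_right:
  "r \<otimes>\<^bsub>monoid_algebra G\<^esub> (p + p') = r \<otimes>\<^bsub>monoid_algebra G\<^esub> p + r \<otimes>\<^bsub>monoid_algebra G\<^esub> (p' :: 'g \<Rightarrow>\<^sub>0 'k::field)"
  using keys_add[of p p']
  by (simp add: monoid_algebra_mult_superset[of "Poly_Mapping.keys r" _ "Poly_Mapping.keys p \<union> Poly_Mapping.keys p'"]
      lookup_add distrib_left single_add sum.distrib)

lemma monoid_algebra_mult_zero [simp]:
  "0 \<otimes>\<^bsub>monoid_algebra G\<^esub> p = 0" "p \<otimes>\<^bsub>monoid_algebra G\<^esub> (0 :: 'g \<Rightarrow>\<^sub>0 'k::field) = 0"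
  by (simp_all add: monoid_algebra_def)

lemma monoid_algebra_mult_closed:
  assumes "Poly_Mapping.keys p \<subseteq> carrier G" "Poly_Mapping.keys r \<subseteq> carrier G"
  shows "Poly_Mapping.keys (p \<otimes>\<^bsub>monoid_algebra G\<^esub> (r :: 'g \<Rightarrow>\<^sub>0 'k::field)) \<subseteq> carrier G"
proof -
  have "Poly_Mapping.keys (Poly_Mapping.single (x \<otimes> y) (Poly_Mapping.lookup p x * Poly_Mapping.lookup r y)) \<subseteq> carrier G"
    if "x \<in> Poly_Mapping.keys p" "y \<in> Poly_Mapping.keys r" for x y
    using that assms by auto
  then show ?thesis
    unfolding monoid_algebra_def monoid.simps
    by (intro order.trans[OF keys_sum] UN_least)
qed

lemma single_map_mult [simp]:
  "Poly_Mapping.map ((*) c) (Poly_Mapping.single x d) = Poly_Mapping.single x (c * d :: 'k::field)"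
  by (rule poly_mapping_eqI) (simp add: lookup_single when_def)

lemma map_mult_0 [simp]: "Poly_Mapping.map ((*) c) 0 = (0 :: 'g \<Rightarrow>\<^sub>0 'k::field)"
  by (rule poly_mapping_eqI) simp

lemma map_mult_add:
  "Poly_Mapping.map ((*) c) (p + r) = Poly_Mapping.map ((*) c) p + Poly_Mapping.map ((*) (c::'k::field)) r"
  by (rule poly_mapping_eqI) (simp add: lookup_add distrib_left)

lemma k_algebra_monoid_algebra: "k_algebra (monoid_algebra G :: ('k::field, 'g \<Rightarrow>\<^sub>0 'k) module)"
proof -
  let ?K = "monoid_algebra G :: ('k, 'g \<Rightarrow>\<^sub>0 'k) module"
  have closed: "p \<in> carrier ?K \<Longrightarrow> r \<in> carrier ?K \<Longrightarrow> p + r \<in> carrier ?K" for p r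
    using keys_add[of p r] by (auto simp: monoid_algebra_simps)
  have assoc: "(p \<otimes>\<^bsub>?K\<^esub> r) \<otimes>\<^bsub>?K\<^esub> s = p \<otimes>\<^bsub>?K\<^esub> (r \<otimes>\<^bsub>?K\<^esub> s)"
    if "p \<in> carrier ?K" "r \<in> carrier ?K" "s \<in> carrier ?K" for p r s
  proof -
    \<comment> \<open>Associativity is checked on monomials and extended by additivity in one
      argument after the other: here in the first, below in the second and finally in the
      third.\<close>
    have 1: "(p \<otimes>\<^bsub>?K\<^esub> Poly_Mapping.single y d) \<otimes>\<^bsub>?K\<^esub> Poly_Mapping.single z e =
       p \<otimes>\<^bsub>?K\<^esub> (Poly_Mapping.single y d \<otimes>\<^bsub>?K\<^esub> Poly_Mapping.single z e)"
      if "p \<in> carrier ?K" "y \<in> carrier G" "z \<in> carrier G" for p y z d e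
      using that(1) unfolding monoid_algebra_simps mem_Collect_eq
      by (induction rule: poly_mapping_single_induct)
         (simp_all add: monoid_algebra_mult_add_left monoid_algebra_mult_single m_assoc mult.assoc that)
    have 2: "(p \<otimes>\<^bsub>?K\<^esub> r) \<otimes>\<^bsub>?K\<^esub> Poly_Mapping.single z e =
       p \<otimes>\<^bsub>?K\<^esub> (r \<otimes>\<^bsub>?K\<^esub> Poly_Mapping.single z e)"
      if "p \<in> carrier ?K" "r \<in> carrier ?K" "z \<in> carrier G" for p r z e
      using that(2) unfolding monoid_algebra_simps mem_Collect_eq
      by (induction rule: poly_mapping_single_induct)
         (simp_all add: monoid_algebra_mult_add_left monoid_algebra_mult_add_right 1 that)
    show ?thesis
      using that(3) unfolding monoid_algebra_simps mem_Collect_eq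
      by (induction rule: poly_mapping_single_induct)
         (simp_all add: monoid_algebra_mult_add_left monoid_algebra_mult_add_right 2 that)
  qed
  have one: "\<one>\<^bsub>?K\<^esub> \<otimes>\<^bsub>?K\<^esub> p = p" "p \<otimes>\<^bsub>?K\<^esub> \<one>\<^bsub>?K\<^esub> = p" if "p \<in> carrier ?K" for p
    using that unfolding monoid_algebra_simps mem_Collect_eq
    by (induction rule: poly_mapping_single_induct;
        simp add: monoid_algebra_mult_add_left monoid_algebra_mult_add_right monoid_algebra_mult_single)+
  have "ring ?K"
  proof (rule ringI)
    show "abelian_group ?K"
    proof (rule abelian_groupI)
      fix p assume "p \<in> carrier ?K"
      then show "\<exists>r\<in>carrier ?K. r \<oplus>\<^bsub>?K\<^esub> p = \<zero>\<^bsub>?K\<^esub>"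
        by (intro bexI[of _ "- p"]) (auto simp: monoid_algebra_simps)
    qed (use closed in \<open>simp_all add: monoid_algebra_simps algebra_simps\<close>)
    show "Group.monoid ?K"
      by (rule monoidI) (use assoc one monoid_algebra_mult_closed in \<open>simp_all add: monoid_algebra_simps\<close>)
  qed (auto simp: monoid_algebra_mult_add_left monoid_algebra_mult_add_right monoid_algebra_simps(4))
  then show ?thesis
  proof (rule k_algebraI)
    fix c :: 'k and p r assume *: "p \<in> carrier ?K" "r \<in> carrier ?K"
    have 1: "Poly_Mapping.map ((*) c) p \<otimes>\<^bsub>?K\<^esub> r = Poly_Mapping.map ((*) c) (p \<otimes>\<^bsub>?K\<^esub> r)
      \<and> p \<otimes>\<^bsub>?K\<^esub> Poly_Mapping.map ((*) c) r = Poly_Mapping.map ((*) c) (p \<otimes>\<^bsub>?K\<^esub> r)"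
      if r: "r = Poly_Mapping.single y d" for y d r
      using *(1) unfolding monoid_algebra_simps mem_Collect_eq
      by (induction rule: poly_mapping_single_induct)
         (auto simp: monoid_algebra_mult_add_left monoid_algebra_mult_single mult.assoc mult.left_commute r map_mult_add)
    have "Poly_Mapping.map ((*) c) p \<otimes>\<^bsub>?K\<^esub> r = Poly_Mapping.map ((*) c) (p \<otimes>\<^bsub>?K\<^esub> r)
      \<and> p \<otimes>\<^bsub>?K\<^esub> Poly_Mapping.map ((*) c) r = Poly_Mapping.map ((*) c) (p \<otimes>\<^bsub>?K\<^esub> r)"
      using *(2) unfolding monoid_algebra_simps mem_Collect_eq
    proof (induction rule: poly_mapping_single_induct)
      case (single x c) then show ?case using 1 by blast
    qed (auto simp: monoid_algebra_mult_add_right map_mult_add)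
    then show "(c \<odot>\<^bsub>?K\<^esub> p) \<otimes>\<^bsub>?K\<^esub> r = c \<odot>\<^bsub>?K\<^esub> (p \<otimes>\<^bsub>?K\<^esub> r)" "p \<otimes>\<^bsub>?K\<^esub> (c \<odot>\<^bsub>?K\<^esub> r) = c \<odot>\<^bsub>?K\<^esub> (p \<otimes>\<^bsub>?K\<^esub> r)"
      by (simp_all add: monoid_algebra_simps)
  next
    fix c :: 'k and p assume "p \<in> carrier ?K"
    then show "c \<odot>\<^bsub>?K\<^esub> p \<in> carrier ?K"
      using keys_map_mult_subset[of c p] by (auto simp: monoid_algebra_simps)
  qed (simp_all only: monoid_algebra_simps poly_mapping_eq_iff fun_eq_iff lookup_add poly_mapping_map_lookup
         distrib_left distrib_right mult.assoc mult_1_left simp_thms)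
qed

end

section \<open>Linear extensions\<close>

lemma monoid_algebra_minus:
  assumes "Group.monoid G" "p \<in> carrier (monoid_algebra G)" "r \<in> carrier (monoid_algebra G)"
  shows "p \<ominus>\<^bsub>monoid_algebra G\<^esub> (r :: 'g \<Rightarrow>\<^sub>0 'k::field) = p - r"
proof -
  interpret k_algebra "monoid_algebra G :: ('k, 'g \<Rightarrow>\<^sub>0 'k) module"
    by (rule k_algebra_monoid_algebra) fact
  have "\<ominus>\<^bsub>monoid_algebra G\<^esub> r = - r"
    by (rule minus_equality) (use assms in \<open>auto simp: monoid_algebra_simps\<close>)
  then show ?thesis
    by (simp add: a_minus_def monoid_algebra_simps)
qed

lemma monoid_algebra_induct [consumes 1, case_names zero single add]:
  fixes p :: "'g \<Rightarrow>\<^sub>0 'k::field" and G :: "('g, 'y) monoid_scheme"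
  assumes "p \<in> carrier (monoid_algebra G)"
    and "P 0" and "\<And>x c. x \<in> carrier G \<Longrightarrow> P (Poly_Mapping.single x c)"
    and "\<And>p r. p \<in> carrier (monoid_algebra G) \<Longrightarrow> r \<in> carrier (monoid_algebra G) \<Longrightarrow> P p \<Longrightarrow> P r \<Longrightarrow> P (p + r)"
  shows "P p"
  using assms(1) unfolding monoid_algebra_simps(1) mem_Collect_eq
  by (induction rule: poly_mapping_single_induct) (use assms in \<open>auto simp: monoid_algebra_simps(1)\<close>)

lemma single_in_monoid_algebra [simp]:
  "x \<in> carrier G \<Longrightarrow> Poly_Mapping.single x (c::'k::field) \<in> carrier (monoid_algebra G)"
  by (simp add: monoid_algebra_simps)

lemma linear_map_monoid_algebra_eq:
  fixes f f' :: "('g \<Rightarrow>\<^sub>0 'k::field) \<Rightarrow> 'b"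
  assumes "Group.monoid G" "k_algebra B"
    and f: "linear_map (monoid_algebra G) B f" "linear_map (monoid_algebra G) B f'"
    and eq: "\<And>x. x \<in> carrier G \<Longrightarrow> f (Poly_Mapping.single x 1) = f' (Poly_Mapping.single x 1)"
    and "p \<in> carrier (monoid_algebra G)"
  shows "f p = f' p"
  using assms(6)
proof (induction rule: monoid_algebra_induct)
  case zero
  then show ?case
    using linear_map_zero[OF k_algebra_monoid_algebra assms(2)] assms(1) f by (metis monoid_algebra_simps(3))
next
  case (single x c)
  have "Poly_Mapping.single x c = c \<odot>\<^bsub>monoid_algebra G\<^esub> Poly_Mapping.single x 1"
    by (simp add: monoid_algebra_simps)
  then show ?case
    using single by (simp add: linear_map_smult[OF f(1)] linear_map_smult[OF f(2)] eq)
next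
  case (add p r)
  then show ?case
    using linear_map_add[OF f(1), of p r] linear_map_add[OF f(2), of p r] by (simp add: monoid_algebra_simps(4))
qed

context
  fixes B :: "('k::field, 'b, 'z) module_scheme" (structure)
  assumes B: "k_algebra B"
begin

interpretation k_algebra B by (rule B)

lemma linear_extension_superset:
  assumes "finite X" "Poly_Mapping.keys p \<subseteq> X" "b \<in> X \<rightarrow> carrier B"
  shows "linear_extension B b p = (\<Oplus>g\<in>X. Poly_Mapping.lookup p g \<odot> b g)"
  unfolding linear_extension_def
  by (rule add.finprod_mono_neutral_cong_left)
     (use assms in \<open>auto simp: in_keys_iff Pi_def\<close>)

lemma linear_extension_single [simp]:
  "b x \<in> carrier B \<Longrightarrow> linear_extension B b (Poly_Mapping.single x c) = c \<odot> b x"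
  by (subst linear_extension_superset[of "{x}"]) (auto simp: finsum_insert)

lemma linear_extension_linear:
  fixes G :: "('g, 'y) monoid_scheme"
  assumes "b \<in> carrier G \<rightarrow> carrier B"
  shows "linear_map (monoid_algebra G) B (linear_extension B b)"
proof (rule linear_mapI)
  fix p r :: "'g \<Rightarrow>\<^sub>0 'k"
  assume p: "p \<in> carrier (monoid_algebra G)" and r: "r \<in> carrier (monoid_algebra G)"
  let ?X = "Poly_Mapping.keys p \<union> Poly_Mapping.keys r"
  have b: "b \<in> ?X \<rightarrow> carrier B" using p r assms by (auto simp: monoid_algebra_simps)
  have keys: "Poly_Mapping.keys (p + r) \<subseteq> ?X" by (rule keys_add)
  have bx: "x \<in> ?X \<Longrightarrow> b x \<in> carrier B" for x using b by blast
  have "linear_extension B b (p + r) = (\<Oplus>g\<in>?X. Poly_Mapping.lookup (p + r) g \<odot> b g)"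
    by (rule linear_extension_superset[OF _ keys b]) simp
  also have "\<dots> = (\<Oplus>g\<in>?X. Poly_Mapping.lookup p g \<odot> b g \<oplus> Poly_Mapping.lookup r g \<odot> b g)"
    by (rule add.finprod_cong') (use bx in \<open>auto simp: lookup_add smult_add_left\<close>)
  also have "\<dots> = (\<Oplus>g\<in>?X. Poly_Mapping.lookup p g \<odot> b g) \<oplus> (\<Oplus>g\<in>?X. Poly_Mapping.lookup r g \<odot> b g)"
    by (rule finsum_addf) (use bx in auto)
  also have "\<dots> = linear_extension B b p \<oplus> linear_extension B b r"
    by (intro arg_cong2[of _ _ _ _ "(\<oplus>)"] linear_extension_superset[symmetric]) (use b in auto)
  finally show "linear_extension B b (p \<oplus>\<^bsub>monoid_algebra G\<^esub> r) = linear_extension B b p \<oplus> linear_extension B b r"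
    by (simp only: monoid_algebra_simps)
  show "linear_extension B b p \<in> carrier B"
    using p assms unfolding linear_extension_def by (intro finsum_closed) (auto simp: monoid_algebra_simps)
next
  fix p :: "'g \<Rightarrow>\<^sub>0 'k" and c
  assume p: "p \<in> carrier (monoid_algebra G)"
  have b: "b \<in> Poly_Mapping.keys p \<rightarrow> carrier B" using p assms by (auto simp: monoid_algebra_simps)
  have "linear_extension B b (Poly_Mapping.map ((*) c) p) =
      (\<Oplus>g\<in>Poly_Mapping.keys p. Poly_Mapping.lookup (Poly_Mapping.map ((*) c) p) g \<odot> b g)"
    by (rule linear_extension_superset[OF _ keys_map_mult_subset b]) simp
  also have "\<dots> = (\<Oplus>g\<in>Poly_Mapping.keys p. c \<odot> (Poly_Mapping.lookup p g \<odot> b g))"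
    by (rule add.finprod_cong') (use funcset_mem[OF b] in \<open>auto simp: smult_smult\<close>)
  also have "\<dots> = c \<odot> linear_extension B b p"
    unfolding linear_extension_def by (rule smult_finsum[symmetric]) (use b in auto)
  finally show "linear_extension B b (c \<odot>\<^bsub>monoid_algebra G\<^esub> p) = c \<odot> linear_extension B b p"
    by (simp only: monoid_algebra_simps)
qed

lemma linear_extension_algebra_hom:
  fixes G :: "('g, 'y) monoid_scheme"
  assumes G: "Group.monoid G" and b: "b \<in> carrier G \<rightarrow> carrier B"
    and one: "b \<one>\<^bsub>G\<^esub> = \<one>"
    and mult: "\<And>x y. x \<in> carrier G \<Longrightarrow> y \<in> carrier G \<Longrightarrow> b (x \<otimes>\<^bsub>G\<^esub> y) = b x \<otimes> b y"
  shows "algebra_hom (monoid_algebra G) B (linear_extension B b)"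
proof (rule algebra_homI)
  interpret G: Group.monoid G by fact
  interpret KG: k_algebra "monoid_algebra G :: ('k, 'g \<Rightarrow>\<^sub>0 'k) module" by (rule k_algebra_monoid_algebra[OF G])
  let ?F = "linear_extension B b"
  note lin = linear_extension_linear[OF b]
  show "linear_map (monoid_algebra G) B ?F" by (rule lin)
  show "?F \<one>\<^bsub>monoid_algebra G\<^esub> = \<one>" using one by (simp add: monoid_algebra_simps)
  note cl = linear_map_closed[OF lin]
  note ad = linear_map_add[OF lin, unfolded monoid_algebra_simps(4)]
  have F0: "?F 0 = \<zero>" by (simp add: linear_extension_def)
  have single: "?F (Poly_Mapping.single x c \<otimes>\<^bsub>monoid_algebra G\<^esub> r) = ?F (Poly_Mapping.single x c) \<otimes> ?F r"
    if "r \<in> carrier (monoid_algebra G)" "x \<in> carrier G" for x c r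
    using that(1)
  proof (induction rule: monoid_algebra_induct)
    case (single y d)
    then show ?case
      using that b funcset_mem[OF b]
      by (simp add: monoid_algebra_mult_single[OF G] mult smult_mult_left smult_mult_right smult_smult mult.commute)
  next
    case (add p r)
    then show ?case
      using that KG.m_closed[OF _ add(1), of "Poly_Mapping.single x c"]
        KG.m_closed[OF _ add(2), of "Poly_Mapping.single x c"]
      by (simp add: monoid_algebra_mult_add_right[OF G] ad cl r_distr)
  qed (use that cl in \<open>simp_all add: F0 G monoid_algebra_mult_zero\<close>)
  fix p r :: "'g \<Rightarrow>\<^sub>0 'k"
  assume p: "p \<in> carrier (monoid_algebra G)" and r: "r \<in> carrier (monoid_algebra G)"
  show "?F (p \<otimes>\<^bsub>monoid_algebra G\<^esub> r) = ?F p \<otimes> ?F r"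
    using p
  proof (induction rule: monoid_algebra_induct)
    case (add p p')
    then show ?case
      using r KG.m_closed[OF add(1) r] KG.m_closed[OF add(2) r]
      by (simp add: monoid_algebra_mult_add_left[OF G] ad cl l_distr)
  qed (use r single cl in \<open>simp_all add: F0 G monoid_algebra_mult_zero\<close>)
qed

text \<open>Two-sided ideals of a monoid algebra are spanned by the products \<open>x r y\<close> with monoid
  elements \<open>x\<close>, \<open>y\<close> and generators \<open>r\<close>.\<close>

lemma linear_map_vanishes_on_genideal:
  fixes F :: "('g \<Rightarrow>\<^sub>0 'k) \<Rightarrow> 'b" and G :: "('g, 'y) monoid_scheme"
  assumes G: "Group.monoid G" and F: "linear_map (monoid_algebra G) B F"
    and R: "R \<subseteq> carrier (monoid_algebra G)"
    and van: "\<And>r x y. r \<in> R \<Longrightarrow> x \<in> carrier G \<Longrightarrow> y \<in> carrier G \<Longrightarrow>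
      F (Poly_Mapping.single x 1 \<otimes>\<^bsub>monoid_algebra G\<^esub> r \<otimes>\<^bsub>monoid_algebra G\<^esub> Poly_Mapping.single y 1) = \<zero>"
    and p: "p \<in> Idl\<^bsub>monoid_algebra G\<^esub> R"
  shows "F p = \<zero>"
proof -
  interpret G: Group.monoid G by fact
  let ?K = "monoid_algebra G :: ('k, 'g \<Rightarrow>\<^sub>0 'k) module"
  interpret KG: k_algebra ?K by (rule k_algebra_monoid_algebra[OF G])
  note KA = KG.is_k_algebra
  let ?s = "\<lambda>x. Poly_Mapping.single x (1::'k)"
  \<comment> \<open>The elements that \<open>F\<close> kills even after multiplication by monomials
    on both sides. They form an ideal although \<open>F\<close> is merely linear, and this ideal
    contains \<open>R\<close>; taking both monomials to be the unit shows that \<open>F\<close>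
    vanishes on it.\<close>
  define N where "N = {p \<in> carrier ?K. \<forall>x\<in>carrier G. \<forall>y\<in>carrier G. F (?s x \<otimes>\<^bsub>?K\<^esub> p \<otimes>\<^bsub>?K\<^esub> ?s y) = \<zero>}"
  have Nz: "\<zero>\<^bsub>?K\<^esub> \<in> N"
    by (auto simp: N_def linear_map_zero[OF KA B F])
  have Na: "p + r \<in> N" if "p \<in> N" "r \<in> N" for p r
  proof -
    have "p + r \<in> carrier ?K"
      using that KG.a_closed by (auto simp: N_def monoid_algebra_simps(4))
    then show ?thesis
      using that by (auto simp: N_def monoid_algebra_mult_add_left[OF G] monoid_algebra_mult_add_right[OF G]
        linear_map_add[OF F, unfolded monoid_algebra_simps(4)])
  qed
  have Nl: "a \<otimes>\<^bsub>?K\<^esub> p \<in> N \<and> p \<otimes>\<^bsub>?K\<^esub> a \<in> N" if "p \<in> N" "a \<in> carrier ?K" for p a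
    using that(2)
  proof (induction rule: monoid_algebra_induct)
    case zero
    then show ?case using Nz by (simp add: monoid_algebra_mult_zero[OF G] monoid_algebra_simps(3))
  next
    case (add a a')
    then show ?case using Na by (simp add: monoid_algebra_mult_add_left[OF G] monoid_algebra_mult_add_right[OF G])
  next
    case (single z c)
    have p: "p \<in> carrier ?K" using that by (simp add: N_def)
    have sc: "Poly_Mapping.single z c = c \<odot>\<^bsub>?K\<^esub> ?s z"
      by (simp add: monoid_algebra_simps)
    have "?s x \<otimes>\<^bsub>?K\<^esub> (Poly_Mapping.single z c \<otimes>\<^bsub>?K\<^esub> p) \<otimes>\<^bsub>?K\<^esub> ?s y =
        c \<odot>\<^bsub>?K\<^esub> ((?s x \<otimes>\<^bsub>?K\<^esub> ?s z) \<otimes>\<^bsub>?K\<^esub> p \<otimes>\<^bsub>?K\<^esub> ?s y)"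
      "?s x \<otimes>\<^bsub>?K\<^esub> (p \<otimes>\<^bsub>?K\<^esub> Poly_Mapping.single z c) \<otimes>\<^bsub>?K\<^esub> ?s y =
        c \<odot>\<^bsub>?K\<^esub> (?s x \<otimes>\<^bsub>?K\<^esub> p \<otimes>\<^bsub>?K\<^esub> (?s z \<otimes>\<^bsub>?K\<^esub> ?s y))"
      if "x \<in> carrier G" "y \<in> carrier G" for x y
      unfolding sc using p single that by (simp_all add: KG.smult_mult_left KG.smult_mult_right KG.m_assoc)
    then have "F (?s x \<otimes>\<^bsub>?K\<^esub> (Poly_Mapping.single z c \<otimes>\<^bsub>?K\<^esub> p) \<otimes>\<^bsub>?K\<^esub> ?s y) = \<zero>"
      "F (?s x \<otimes>\<^bsub>?K\<^esub> (p \<otimes>\<^bsub>?K\<^esub> Poly_Mapping.single z c) \<otimes>\<^bsub>?K\<^esub> ?s y) = \<zero>"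
      if "x \<in> carrier G" "y \<in> carrier G" for x y
      using p single that \<open>p \<in> N\<close> by (simp_all add: linear_map_smult[OF F] monoid_algebra_mult_single[OF G] N_def)
    then show ?case using p single by (simp add: N_def)
  qed
  have "ideal N ?K"
  proof (rule idealI)
    show "ring ?K" by (rule KG.ring_axioms)
    show "subgroup N (add_monoid ?K)"
    proof (rule KG.add.subgroupI)
      show "N \<subseteq> carrier ?K" by (auto simp: N_def)
      show "N \<noteq> {}" using Nz by auto
      fix a assume a: "a \<in> N"
      have "(\<ominus>\<^bsub>?K\<^esub> \<one>\<^bsub>?K\<^esub>) \<otimes>\<^bsub>?K\<^esub> a \<in> N" using Nl a by simp
      then show "\<ominus>\<^bsub>?K\<^esub> a \<in> N" using a by (simp add: N_def KG.l_minus)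
    qed (simp add: Na monoid_algebra_simps(4))
  qed (use Nl in auto)
  moreover have "R \<subseteq> N" using R van by (auto simp: N_def)
  ultimately have "p \<in> N" using p KG.genideal_minimal by blast
  then have "F (?s \<one>\<^bsub>G\<^esub> \<otimes>\<^bsub>?K\<^esub> p \<otimes>\<^bsub>?K\<^esub> ?s \<one>\<^bsub>G\<^esub>) = \<zero>" by (simp add: N_def)
  then show ?thesis
    using \<open>p \<in> N\<close> by (simp add: N_def flip: monoid_algebra_simps(2))
qed

end


section \<open>Tensor products of algebras\<close>

definition bilinear_map where
  "bilinear_map A B C \<phi> \<longleftrightarrow>
     (\<forall>b\<in>carrier B. linear_map A C (\<lambda>a. \<phi> a b)) \<and> (\<forall>a\<in>carrier A. linear_map B C (\<phi> a))"

context
  fixes A :: "('k::field, 'a, 'y) module_scheme" and B :: "('k, 'b, 'z) module_scheme"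
  assumes A: "k_algebra A" and B: "k_algebra B"
begin

interpretation A: k_algebra A by (rule A)
interpretation B: k_algebra B by (rule B)

lemma DirProd_algebras_monoid: "Group.monoid (A \<times>\<times> B)"
  by (rule DirProd_monoid) (rule A.monoid_axioms B.monoid_axioms)+

private abbreviation (input) "F \<equiv> (monoid_algebra (A \<times>\<times> B) :: ('k, 'a \<times> 'b \<Rightarrow>\<^sub>0 'k) module)"

interpretation F: k_algebra F
  by (rule k_algebra_monoid_algebra[OF DirProd_algebras_monoid])

lemma single_pair_closed [simp]:
  "a \<in> carrier A \<Longrightarrow> b \<in> carrier B \<Longrightarrow> Poly_Mapping.single (a, b) (c::'k) \<in> carrier (monoid_algebra (A \<times>\<times> B))"
  by (simp add: DirProd_def)

private lemma minus_F: "p \<in> carrier F \<Longrightarrow> r \<in> carrier F \<Longrightarrow> p - r = p \<ominus>\<^bsub>F\<^esub> r"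
  by (simp add: monoid_algebra_minus[OF DirProd_algebras_monoid])

lemma tensor_relators_closed: "tensor_relators A B \<subseteq> carrier F"
proof -
  have 1: "p \<in> carrier F \<Longrightarrow> r \<in> carrier F \<Longrightarrow> p - r \<in> carrier F" for p r
    by (simp add: minus_F)
  show ?thesis unfolding tensor_relators_def
    by (intro Un_least subsetI) (auto intro!: 1 single_pair_closed)
qed

lemma tensor_ideal: "ideal (tensor_ideal A B) F"
  unfolding tensor_ideal_def by (rule F.genideal_ideal[OF tensor_relators_closed])

lemma k_algebra_tensor: "k_algebra (tensor A B)"
  unfolding tensor_def by (rule k_algebra_quotient[OF F.is_k_algebra tensor_ideal])

interpretation T: k_algebra "tensor A B" by (rule k_algebra_tensor)

lemma pure_tensor_closed [simp]:
  "a \<in> carrier A \<Longrightarrow> b \<in> carrier B \<Longrightarrow> pure_tensor A B a b \<in> carrier (tensor A B)"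
  unfolding tensor_def pure_tensor_def
  by (rule coset_in_quotient[OF F.is_k_algebra tensor_ideal]) simp

private lemma smult_F_single: "c \<odot>\<^bsub>F\<^esub> Poly_Mapping.single (a, b) d = Poly_Mapping.single (a, b) (c * d)"
  by (simp add: monoid_algebra_simps)

private lemma relator_coset:
  assumes "p - r \<in> tensor_relators A B" "p \<in> carrier F" "r \<in> carrier F"
  shows "tensor_ideal A B +>\<^bsub>F\<^esub> p = tensor_ideal A B +>\<^bsub>F\<^esub> r"
proof -
  have "p \<ominus>\<^bsub>F\<^esub> r \<in> tensor_ideal A B"
    using assms F.genideal_self[OF tensor_relators_closed] unfolding tensor_ideal_def
    by (auto simp flip: minus_F)
  then show ?thesis
    by (simp add: coset_eq_iff[OF F.is_k_algebra tensor_ideal] assms)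
qed

lemma pure_tensor_add_left:
  assumes "a \<in> carrier A" "a' \<in> carrier A" "b \<in> carrier B"
  shows "pure_tensor A B (a \<oplus>\<^bsub>A\<^esub> a') b = pure_tensor A B a b \<oplus>\<^bsub>tensor A B\<^esub> pure_tensor A B a' b"
proof -
  have "Poly_Mapping.single (a \<oplus>\<^bsub>A\<^esub> a', b) (1::'k) - (Poly_Mapping.single (a, b) 1 + Poly_Mapping.single (a', b) 1)
      \<in> tensor_relators A B"
    using assms unfolding tensor_relators_def diff_diff_eq[symmetric] by blast
  from relator_coset[OF this] show ?thesis
    using F.a_closed[OF single_pair_closed single_pair_closed, of a b a' b 1 1] assms unfolding pure_tensor_def tensor_def
    by (simp add: coset_add[OF F.is_k_algebra tensor_ideal] monoid_algebra_simps(4))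
qed

lemma pure_tensor_add_right:
  assumes "a \<in> carrier A" "b \<in> carrier B" "b' \<in> carrier B"
  shows "pure_tensor A B a (b \<oplus>\<^bsub>B\<^esub> b') = pure_tensor A B a b \<oplus>\<^bsub>tensor A B\<^esub> pure_tensor A B a b'"
proof -
  have "Poly_Mapping.single (a, b \<oplus>\<^bsub>B\<^esub> b') (1::'k) - (Poly_Mapping.single (a, b) 1 + Poly_Mapping.single (a, b') 1)
      \<in> tensor_relators A B"
    using assms unfolding tensor_relators_def diff_diff_eq[symmetric] by blast
  from relator_coset[OF this] show ?thesis
    using F.a_closed[OF single_pair_closed single_pair_closed, of a b a b' 1 1] assms unfolding pure_tensor_def tensor_def
    by (simp add: coset_add[OF F.is_k_algebra tensor_ideal] monoid_algebra_simps(4))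
qed

lemma pure_tensor_smult_left:
  assumes "a \<in> carrier A" "b \<in> carrier B"
  shows "pure_tensor A B (c \<odot>\<^bsub>A\<^esub> a) b = c \<odot>\<^bsub>tensor A B\<^esub> pure_tensor A B a b"
proof -
  have "Poly_Mapping.single (c \<odot>\<^bsub>A\<^esub> a, b) (1::'k) - Poly_Mapping.single (a, b) c \<in> tensor_relators A B"
    using assms unfolding tensor_relators_def by blast
  from relator_coset[OF this] show ?thesis
    using assms unfolding pure_tensor_def tensor_def
    by (simp add: coset_smult[OF F.is_k_algebra tensor_ideal] smult_F_single)
qed

lemma pure_tensor_smult_right:
  assumes "a \<in> carrier A" "b \<in> carrier B"
  shows "pure_tensor A B a (c \<odot>\<^bsub>B\<^esub> b) = c \<odot>\<^bsub>tensor A B\<^esub> pure_tensor A B a b"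
proof -
  have "Poly_Mapping.single (a, c \<odot>\<^bsub>B\<^esub> b) (1::'k) - Poly_Mapping.single (a, b) c \<in> tensor_relators A B"
    using assms unfolding tensor_relators_def by blast
  from relator_coset[OF this] show ?thesis
    using assms unfolding pure_tensor_def tensor_def
    by (simp add: coset_smult[OF F.is_k_algebra tensor_ideal] smult_F_single)
qed

lemma pure_tensor_mult:
  assumes "a \<in> carrier A" "b \<in> carrier B" "a' \<in> carrier A" "b' \<in> carrier B"
  shows "pure_tensor A B a b \<otimes>\<^bsub>tensor A B\<^esub> pure_tensor A B a' b' =
    pure_tensor A B (a \<otimes>\<^bsub>A\<^esub> a') (b \<otimes>\<^bsub>B\<^esub> b')"
  using assms unfolding pure_tensor_def tensor_def
  by (simp add: coset_mult[OF F.is_k_algebra tensor_ideal] monoid_algebra_mult_single[OF DirProd_algebras_monoid])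

lemma one_tensor: "\<one>\<^bsub>tensor A B\<^esub> = pure_tensor A B \<one>\<^bsub>A\<^esub> \<one>\<^bsub>B\<^esub>"
  unfolding pure_tensor_def tensor_def
  by (simp add: one_quotient_algebra monoid_algebra_simps(2))

lemma zero_tensor: "\<zero>\<^bsub>tensor A B\<^esub> = pure_tensor A B \<zero>\<^bsub>A\<^esub> \<zero>\<^bsub>B\<^esub>"
  using pure_tensor_smult_left[of "\<zero>\<^bsub>A\<^esub>" "\<zero>\<^bsub>B\<^esub>" 0] by simp

text \<open>Pure tensors and sums suffice: a coefficient is absorbed into the left factor, and zero
  is the pure tensor of two zeros.\<close>

lemma tensor_induct [consumes 1, case_names pure add]:
  assumes "t \<in> carrier (tensor A B)"
    and pure: "\<And>a b. a \<in> carrier A \<Longrightarrow> b \<in> carrier B \<Longrightarrow> P (pure_tensor A B a b)"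
    and add: "\<And>s t. s \<in> carrier (tensor A B) \<Longrightarrow> t \<in> carrier (tensor A B) \<Longrightarrow> P s \<Longrightarrow> P t \<Longrightarrow>
      P (s \<oplus>\<^bsub>tensor A B\<^esub> t)"
  shows "P t"
proof -
  obtain p where p: "p \<in> carrier F" and t: "t = tensor_ideal A B +>\<^bsub>F\<^esub> p"
    using assms(1) unfolding tensor_def by (rule quotient_cases[OF F.is_k_algebra tensor_ideal])
  note coset_cl = coset_in_quotient[OF F.is_k_algebra tensor_ideal, folded tensor_def]
  have "P (tensor_ideal A B +>\<^bsub>F\<^esub> p)"
    using p
  proof (induction rule: monoid_algebra_induct)
    case zero
    have "tensor_ideal A B +>\<^bsub>F\<^esub> \<zero>\<^bsub>F\<^esub> = 0 \<odot>\<^bsub>tensor A B\<^esub> (tensor_ideal A B +>\<^bsub>F\<^esub> \<zero>\<^bsub>F\<^esub>)"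
      by (simp add: tensor_def coset_smult[OF F.is_k_algebra tensor_ideal])
    also have "\<dots> = pure_tensor A B \<zero>\<^bsub>A\<^esub> \<zero>\<^bsub>B\<^esub>"
      using coset_cl[OF F.zero_closed] by (simp add: zero_tensor)
    finally show ?case using pure by (simp add: monoid_algebra_simps)
  next
    case (single x c)
    obtain a b where [simp]: "x = (a, b)" "a \<in> carrier A" "b \<in> carrier B"
      using single by (cases x) (auto simp: DirProd_def)
    have "tensor_ideal A B +>\<^bsub>F\<^esub> Poly_Mapping.single x c = pure_tensor A B (c \<odot>\<^bsub>A\<^esub> a) b"
      unfolding pure_tensor_smult_left[OF \<open>a \<in> carrier A\<close> \<open>b \<in> carrier B\<close>] unfolding pure_tensor_def tensor_def
      by (simp add: coset_smult[OF F.is_k_algebra tensor_ideal] smult_F_single)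
    then show ?case using pure by simp
  next
    case (add p r)
    then show ?case
      using assms(3)[OF coset_cl coset_cl, of p r]
      by (simp add: tensor_def coset_add[OF F.is_k_algebra tensor_ideal] monoid_algebra_simps(4))
  qed
  then show ?thesis by (simp add: t)
qed

lemma linear_map_tensor_eq:
  assumes "linear_map (tensor A B) C f" "linear_map (tensor A B) C f'"
    and "\<And>a b. a \<in> carrier A \<Longrightarrow> b \<in> carrier B \<Longrightarrow> f (pure_tensor A B a b) = f' (pure_tensor A B a b)"
    and "t \<in> carrier (tensor A B)"
  shows "f t = f' t"
  using assms(4)
  by (induction rule: tensor_induct)
     (auto simp: assms(3) linear_map_add[OF assms(1)] linear_map_add[OF assms(2)])

context
  fixes C :: "('k, 'c, 'x) module_scheme" and \<phi>
  assumes C: "k_algebra C" and bil: "bilinear_map A B C \<phi>"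
begin

interpretation C: k_algebra C by (rule C)

private lemma bil_left: "b \<in> carrier B \<Longrightarrow> linear_map A C (\<lambda>a. \<phi> a b)"
  and bil_right: "a \<in> carrier A \<Longrightarrow> linear_map B C (\<phi> a)"
  and bil_closed: "a \<in> carrier A \<Longrightarrow> b \<in> carrier B \<Longrightarrow> \<phi> a b \<in> carrier C"
  using bil linear_map_closed by (fastforce simp: bilinear_map_def)+

text \<open>Shows that the choice in \<open>tensor_lift\<close> succeeds. The relators generate a
  two-sided ideal whereas \<open>\<phi>\<close> is only bilinear; this does no harm, because
  multiplying a bilinearity relator by monomials on both sides gives a relator of the same
  kind.\<close>

lemma tensor_lift_exists:
  "\<exists>f. linear_map (tensor A B) C f \<and>
     (\<forall>a\<in>carrier A. \<forall>b\<in>carrier B. f (pure_tensor A B a b) = \<phi> a b)"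
proof -
  let ?\<Phi> = "linear_extension C (\<lambda>(a, b). \<phi> a b)"
  have in_C: "(\<lambda>(a, b). \<phi> a b) \<in> carrier (A \<times>\<times> B) \<rightarrow> carrier C"
    using bil_closed by (auto simp: DirProd_def)
  have lin: "linear_map F C ?\<Phi>"
    by (rule linear_extension_linear[OF C in_C])
  have single: "?\<Phi> (Poly_Mapping.single (a, b) c) = c \<odot>\<^bsub>C\<^esub> \<phi> a b" if "a \<in> carrier A" "b \<in> carrier B" for a b c
    using that bil_closed by (simp add: linear_extension_single[OF C])
  have diff: "?\<Phi> (p - r) = ?\<Phi> p \<ominus>\<^bsub>C\<^esub> ?\<Phi> r" if "p \<in> carrier F" "r \<in> carrier F" for p r
    using that
    by (simp add: minus_F a_minus_def linear_map_add[OF lin] linear_map_minus[OF F.is_k_algebra C lin])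
  have mult_single: "Poly_Mapping.single (u, v) (1::'k) \<otimes>\<^bsub>F\<^esub> Poly_Mapping.single (a, b) c \<otimes>\<^bsub>F\<^esub> Poly_Mapping.single (u', v') 1 =
      Poly_Mapping.single (u \<otimes>\<^bsub>A\<^esub> a \<otimes>\<^bsub>A\<^esub> u', v \<otimes>\<^bsub>B\<^esub> b \<otimes>\<^bsub>B\<^esub> v') c" for u v a b u' v' c
    by (simp add: monoid_algebra_mult_single[OF DirProd_algebras_monoid])
  have mult_diff: "x \<otimes>\<^bsub>F\<^esub> (p - r) \<otimes>\<^bsub>F\<^esub> y = x \<otimes>\<^bsub>F\<^esub> p \<otimes>\<^bsub>F\<^esub> y - x \<otimes>\<^bsub>F\<^esub> r \<otimes>\<^bsub>F\<^esub> y"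
    if "p \<in> carrier F" "r \<in> carrier F" "x \<in> carrier F" "y \<in> carrier F" for p r x y
    using that by (simp add: minus_F a_minus_def F.r_distr F.l_distr F.l_minus F.r_minus)
  have diff_closed: "p \<in> carrier F \<Longrightarrow> r \<in> carrier F \<Longrightarrow> p - r \<in> carrier F" for p r
    by (simp add: minus_F)
  have cancel: "(x \<oplus>\<^bsub>C\<^esub> y) \<ominus>\<^bsub>C\<^esub> x \<ominus>\<^bsub>C\<^esub> y = \<zero>\<^bsub>C\<^esub>" if "x \<in> carrier C" "y \<in> carrier C" for x y
  proof -
    have "(x \<oplus>\<^bsub>C\<^esub> y) \<ominus>\<^bsub>C\<^esub> x \<ominus>\<^bsub>C\<^esub> y = (\<ominus>\<^bsub>C\<^esub> x \<oplus>\<^bsub>C\<^esub> (x \<oplus>\<^bsub>C\<^esub> y)) \<oplus>\<^bsub>C\<^esub> \<ominus>\<^bsub>C\<^esub> y"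
      using that by (simp add: a_minus_def C.a_comm[of "x \<oplus>\<^bsub>C\<^esub> y"])
    then show ?thesis using that by (simp add: C.r_neg1 C.r_neg)
  qed
  have "?\<Phi> p = \<zero>\<^bsub>C\<^esub>" if p: "p \<in> tensor_ideal A B" for p
  proof (rule linear_map_vanishes_on_genideal[OF C DirProd_algebras_monoid lin tensor_relators_closed _ p[unfolded tensor_ideal_def]])
    fix r x y
    assume r: "r \<in> tensor_relators A B" and "x \<in> carrier (A \<times>\<times> B)" "y \<in> carrier (A \<times>\<times> B)"
    then obtain u v u' v' where [simp]: "x = (u, v)" "y = (u', v')" and
      [simp]: "u \<in> carrier A" "v \<in> carrier B" "u' \<in> carrier A" "v' \<in> carrier B"
      by (cases x; cases y) (auto simp: DirProd_def)
    show "?\<Phi> (Poly_Mapping.single x 1 \<otimes>\<^bsub>F\<^esub> r \<otimes>\<^bsub>F\<^esub> Poly_Mapping.single y 1) = \<zero>\<^bsub>C\<^esub>"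
      using r unfolding tensor_relators_def
      by (elim UnE CollectE exE conjE)
         (simp_all add: mult_diff mult_single diff_closed diff single bil_closed cancel C.r_neg[folded a_minus_def]
          A.l_distr A.r_distr B.l_distr B.r_distr
          A.smult_mult_left A.smult_mult_right B.smult_mult_left B.smult_mult_right
          linear_map_add[OF bil_left] linear_map_add[OF bil_right]
          linear_map_smult[OF bil_left] linear_map_smult[OF bil_right])
  qed
  from quotient_lift_linear[OF F.is_k_algebra tensor_ideal C lin this]
  obtain f where f: "linear_map (tensor A B) C f" "\<And>p. p \<in> carrier F \<Longrightarrow> f (tensor_ideal A B +>\<^bsub>F\<^esub> p) = ?\<Phi> p"
    unfolding tensor_def by blast
  show ?thesis
    using f bil_closed by (intro exI[of _ f]) (simp add: pure_tensor_def single)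
qed

lemma tensor_lift_linear: "linear_map (tensor A B) C (tensor_lift A B C \<phi>)"
  and tensor_lift_pure: "a \<in> carrier A \<Longrightarrow> b \<in> carrier B \<Longrightarrow> tensor_lift A B C \<phi> (pure_tensor A B a b) = \<phi> a b"
  using someI_ex[OF tensor_lift_exists] unfolding tensor_lift_def by auto

lemma tensor_lift_algebra_hom:
  assumes one: "\<phi> \<one>\<^bsub>A\<^esub> \<one>\<^bsub>B\<^esub> = \<one>\<^bsub>C\<^esub>"
    and mult: "\<And>a b a' b'. a \<in> carrier A \<Longrightarrow> a' \<in> carrier A \<Longrightarrow> b \<in> carrier B \<Longrightarrow> b' \<in> carrier B \<Longrightarrow>
      \<phi> (a \<otimes>\<^bsub>A\<^esub> a') (b \<otimes>\<^bsub>B\<^esub> b') = \<phi> a b \<otimes>\<^bsub>C\<^esub> \<phi> a' b'"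
  shows "algebra_hom (tensor A B) C (tensor_lift A B C \<phi>)"
proof (rule algebra_homI)
  note lin = tensor_lift_linear
  let ?f = "tensor_lift A B C \<phi>"
  show "linear_map (tensor A B) C ?f" by (rule lin)
  show "?f \<one>\<^bsub>tensor A B\<^esub> = \<one>\<^bsub>C\<^esub>" by (simp add: one_tensor tensor_lift_pure one)
  have pure: "?f (pure_tensor A B a b \<otimes>\<^bsub>tensor A B\<^esub> t) = ?f (pure_tensor A B a b) \<otimes>\<^bsub>C\<^esub> ?f t"
    if "t \<in> carrier (tensor A B)" "a \<in> carrier A" "b \<in> carrier B" for a b t
    using that(1)
    by (induction rule: tensor_induct)
       (simp_all add: that tensor_lift_pure pure_tensor_mult mult bil_closed T.r_distr C.r_distr
         linear_map_add[OF lin] linear_map_closed[OF lin])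
  fix s t assume s: "s \<in> carrier (tensor A B)" and t: "t \<in> carrier (tensor A B)"
  show "?f (s \<otimes>\<^bsub>tensor A B\<^esub> t) = ?f s \<otimes>\<^bsub>C\<^esub> ?f t"
    using s
    by (induction rule: tensor_induct)
       (simp_all add: t pure bil_closed T.l_distr C.l_distr linear_map_add[OF lin] linear_map_closed[OF lin])
qed

end

end

lemma bilinear_mapI:
  assumes "\<And>a b. a \<in> carrier A \<Longrightarrow> b \<in> carrier B \<Longrightarrow> \<phi> a b \<in> carrier C"
    and "\<And>a a' b. a \<in> carrier A \<Longrightarrow> a' \<in> carrier A \<Longrightarrow> b \<in> carrier B \<Longrightarrow> \<phi> (a \<oplus>\<^bsub>A\<^esub> a') b = \<phi> a b \<oplus>\<^bsub>C\<^esub> \<phi> a' b"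
    and "\<And>a b b'. a \<in> carrier A \<Longrightarrow> b \<in> carrier B \<Longrightarrow> b' \<in> carrier B \<Longrightarrow> \<phi> a (b \<oplus>\<^bsub>B\<^esub> b') = \<phi> a b \<oplus>\<^bsub>C\<^esub> \<phi> a b'"
    and "\<And>c a b. a \<in> carrier A \<Longrightarrow> b \<in> carrier B \<Longrightarrow> \<phi> (c \<odot>\<^bsub>A\<^esub> a) b = c \<odot>\<^bsub>C\<^esub> \<phi> a b"
    and "\<And>c a b. a \<in> carrier A \<Longrightarrow> b \<in> carrier B \<Longrightarrow> \<phi> a (c \<odot>\<^bsub>B\<^esub> b) = c \<odot>\<^bsub>C\<^esub> \<phi> a b"
  shows "bilinear_map A B C \<phi>"
  using assms unfolding bilinear_map_def by (intro conjI ballI linear_mapI) auto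

lemma bilinear_map_mult:
  assumes "k_algebra E" "linear_map A E f" "linear_map B E g"
  shows "bilinear_map A B E (\<lambda>a b. f a \<otimes>\<^bsub>E\<^esub> g b)"
proof -
  interpret E: k_algebra E by fact
  show ?thesis
    by (rule bilinear_mapI)
       (simp_all add: linear_map_closed[OF assms(2)] linear_map_closed[OF assms(3)]
        linear_map_add[OF assms(2)] linear_map_add[OF assms(3)] linear_map_smult[OF assms(2)]
        linear_map_smult[OF assms(3)] E.l_distr E.r_distr E.smult_mult_left E.smult_mult_right)
qed

lemma bilinear_map_pure_tensor:
  assumes "k_algebra C" "k_algebra D" "linear_map A C f" "linear_map B D g"
  shows "bilinear_map A B (tensor C D) (\<lambda>a b. pure_tensor C D (f a) (g b))"
  by (rule bilinear_mapI)
     (simp_all add: linear_map_closed[OF assms(3)] linear_map_closed[OF assms(4)]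
      linear_map_add[OF assms(3)] linear_map_add[OF assms(4)] linear_map_smult[OF assms(3)]
      linear_map_smult[OF assms(4)] pure_tensor_closed[OF assms(1,2)]
      pure_tensor_add_left[OF assms(1,2)] pure_tensor_add_right[OF assms(1,2)]
      pure_tensor_smult_left[OF assms(1,2)] pure_tensor_smult_right[OF assms(1,2)])

context
  fixes A :: "('k::field, 'a, 'w) module_scheme" and B :: "('k, 'b, 'x) module_scheme"
    and C :: "('k, 'c, 'y) module_scheme" and D :: "('k, 'd, 'z) module_scheme"
  assumes A: "k_algebra A" and B: "k_algebra B" and C: "k_algebra C" and D: "k_algebra D"
begin

lemma tensor_map_linear:
  "linear_map A C f \<Longrightarrow> linear_map B D g \<Longrightarrow> linear_map (tensor A B) (tensor C D) (tensor_map A B C D f g)"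
  and tensor_map_pure:
  "linear_map A C f \<Longrightarrow> linear_map B D g \<Longrightarrow> a \<in> carrier A \<Longrightarrow> b \<in> carrier B \<Longrightarrow>
    tensor_map A B C D f g (pure_tensor A B a b) = pure_tensor C D (f a) (g b)"
  unfolding tensor_map_def
  using tensor_lift_linear[OF A B k_algebra_tensor[OF C D] bilinear_map_pure_tensor[OF C D]]
    tensor_lift_pure[OF A B k_algebra_tensor[OF C D] bilinear_map_pure_tensor[OF C D]]
  by blast+

lemma tensor_map_algebra_hom:
  assumes f: "algebra_hom A C f" and g: "algebra_hom B D g"
  shows "algebra_hom (tensor A B) (tensor C D) (tensor_map A B C D f g)"
proof -
  interpret A: k_algebra A by (rule A)
  interpret B: k_algebra B by (rule B)
  show ?thesis
    unfolding tensor_map_def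
    by (rule tensor_lift_algebra_hom[OF A B k_algebra_tensor[OF C D]
          bilinear_map_pure_tensor[OF C D algebra_hom_linear[OF f] algebra_hom_linear[OF g]]])
       (simp_all add: algebra_hom_one[OF f] algebra_hom_one[OF g] one_tensor[OF C D]
         pure_tensor_mult[OF C D] algebra_hom_mult[OF f] algebra_hom_mult[OF g]
         algebra_hom_closed[OF f] algebra_hom_closed[OF g])
qed

end

lemma tensor_map_compose:
  assumes "k_algebra A" "k_algebra B" "k_algebra C" "k_algebra D" "k_algebra E" "k_algebra F"
    and "linear_map A C f" "linear_map B D g" "linear_map C E f'" "linear_map D F g'"
    and "t \<in> carrier (tensor A B)"
  shows "tensor_map C D E F f' g' (tensor_map A B C D f g t) =
    tensor_map A B E F (\<lambda>x. f' (f x)) (\<lambda>x. g' (g x)) t"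
proof (rule linear_map_tensor_eq[OF assms(1,2) _ _ _ assms(11)])
  show "linear_map (tensor A B) (tensor E F) (\<lambda>t. tensor_map C D E F f' g' (tensor_map A B C D f g t))"
    by (rule linear_map_compose[OF tensor_map_linear[OF assms(1-4,7,8)] tensor_map_linear[OF assms(3-6,9,10)]])
  show "linear_map (tensor A B) (tensor E F) (tensor_map A B E F (\<lambda>x. f' (f x)) (\<lambda>x. g' (g x)))"
    by (rule tensor_map_linear[OF assms(1,2,5,6) linear_map_compose[OF assms(7,9)] linear_map_compose[OF assms(8,10)]])
  fix a b assume "a \<in> carrier A" "b \<in> carrier B"
  then show "tensor_map C D E F f' g' (tensor_map A B C D f g (pure_tensor A B a b)) =
      tensor_map A B E F (\<lambda>x. f' (f x)) (\<lambda>x. g' (g x)) (pure_tensor A B a b)"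
    by (simp add: tensor_map_pure[OF assms(1-4,7,8)] tensor_map_pure[OF assms(3-6,9,10)]
        tensor_map_pure[OF assms(1,2,5,6) linear_map_compose[OF assms(7,9)] linear_map_compose[OF assms(8,10)]]
        linear_map_closed[OF assms(7)] linear_map_closed[OF assms(8)])
qed

lemma tensor_map_cong:
  assumes "k_algebra A" "k_algebra B" "k_algebra C" "k_algebra D"
    and "linear_map A C f" "linear_map B D g" "linear_map A C f'" "linear_map B D g'"
    and "\<And>x. x \<in> carrier A \<Longrightarrow> f x = f' x" "\<And>x. x \<in> carrier B \<Longrightarrow> g x = g' x"
    and "t \<in> carrier (tensor A B)"
  shows "tensor_map A B C D f g t = tensor_map A B C D f' g' t"
  by (rule linear_map_tensor_eq[OF assms(1,2) tensor_map_linear[OF assms(1-6)]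
        tensor_map_linear[OF assms(1-4,7,8)] _ assms(11)])
     (simp add: tensor_map_pure[OF assms(1-4)] assms)

lemma tensor_map_id:
  assumes "k_algebra A" "k_algebra B" "t \<in> carrier (tensor A B)"
  shows "tensor_map A B A B (\<lambda>x. x) (\<lambda>x. x) t = t"
  by (rule linear_map_tensor_eq[OF assms(1,2) tensor_map_linear[OF assms(1,2,1,2) linear_map_id linear_map_id]
        linear_map_id _ assms(3)])
     (simp add: tensor_map_pure[OF assms(1,2,1,2)] linear_map_id)

context
  fixes A :: "('k::field, 'a, 'x) module_scheme" and B :: "('k, 'b, 'y) module_scheme"
    and C :: "('k, 'c, 'z) module_scheme"
  assumes A: "k_algebra A" and B: "k_algebra B" and C: "k_algebra C"
begin

interpretation A: k_algebra A by (rule A)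
interpretation B: k_algebra B by (rule B)
interpretation C: k_algebra C by (rule C)

private lemmas BC = k_algebra_tensor[OF B C]
private lemmas ABC = k_algebra_tensor[OF A k_algebra_tensor[OF B C]]

interpretation ABC: k_algebra "tensor A (tensor B C)" by (rule ABC)

private lemma assoc_bilinear_inner:
  assumes c: "c \<in> carrier C"
  shows "bilinear_map A B (tensor A (tensor B C)) (\<lambda>a b. pure_tensor A (tensor B C) a (pure_tensor B C b c))"
  by (rule bilinear_map_pure_tensor[OF A BC linear_map_id])
     (rule linear_mapI; simp add: c pure_tensor_closed[OF B C] pure_tensor_add_left[OF B C]
        pure_tensor_smult_left[OF B C])

private lemma assoc_bilinear_outer:
  "bilinear_map (tensor A B) C (tensor A (tensor B C)) (\<lambda>t c. tensor_lift A B (tensor A (tensor B C))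
     (\<lambda>a b. pure_tensor A (tensor B C) a (pure_tensor B C b c)) t)" (is "bilinear_map _ _ _ ?\<psi>")
proof -
  note lin = tensor_lift_linear[OF A B ABC assoc_bilinear_inner]
  note pure = tensor_lift_pure[OF A B ABC assoc_bilinear_inner]
  note pt = pure_tensor_closed[OF A BC] pure_tensor_closed[OF B C]
  show ?thesis
  proof (rule bilinear_mapI)
    fix t c c' assume t: "t \<in> carrier (tensor A B)" and c: "c \<in> carrier C" "c' \<in> carrier C"
    show "?\<psi> t (c \<oplus>\<^bsub>C\<^esub> c') = ?\<psi> t c \<oplus>\<^bsub>tensor A (tensor B C)\<^esub> ?\<psi> t c'"
      using t
      by (induction rule: tensor_induct[OF A B, consumes 1])
         (simp_all add: c pure pt pure_tensor_add_right[OF B C] pure_tensor_add_right[OF A BC]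
           linear_map_add[OF lin] linear_map_closed[OF lin] ABC.a_ac)
  next
    fix t c k assume t: "t \<in> carrier (tensor A B)" and c: "c \<in> carrier C"
    show "?\<psi> t (k \<odot>\<^bsub>C\<^esub> c) = k \<odot>\<^bsub>tensor A (tensor B C)\<^esub> ?\<psi> t c"
      using t
      by (induction rule: tensor_induct[OF A B, consumes 1])
         (simp_all add: c pure pt pure_tensor_smult_right[OF B C] pure_tensor_smult_right[OF A BC]
           linear_map_add[OF lin] linear_map_closed[OF lin] ABC.smult_add_right)
  qed (simp_all add: linear_map_closed[OF lin] linear_map_add[OF lin] linear_map_smult[OF lin])
qed

lemma tensor_assoc_linear: "linear_map (tensor (tensor A B) C) (tensor A (tensor B C)) (tensor_assoc A B C)"
  unfolding tensor_assoc_def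
  by (rule tensor_lift_linear[OF k_algebra_tensor[OF A B] C ABC assoc_bilinear_outer])

lemma tensor_assoc_pure:
  assumes "a \<in> carrier A" "b \<in> carrier B" "c \<in> carrier C"
  shows "tensor_assoc A B C (pure_tensor (tensor A B) C (pure_tensor A B a b) c) =
    pure_tensor A (tensor B C) a (pure_tensor B C b c)"
  unfolding tensor_assoc_def
  using assms by (simp add: tensor_lift_pure[OF k_algebra_tensor[OF A B] C ABC assoc_bilinear_outer]
    tensor_lift_pure[OF A B ABC assoc_bilinear_inner] pure_tensor_closed[OF A B])

text \<open>Makes both sides of coassociativity algebra maps, so that the law can be checked on
  generators.\<close>

lemma tensor_assoc_algebra_hom:
  "algebra_hom (tensor (tensor A B) C) (tensor A (tensor B C)) (tensor_assoc A B C)"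
  unfolding tensor_assoc_def
proof (rule tensor_lift_algebra_hom[OF k_algebra_tensor[OF A B] C ABC assoc_bilinear_outer])
  note lin = tensor_lift_linear[OF A B ABC assoc_bilinear_inner]
  note pure = tensor_lift_pure[OF A B ABC assoc_bilinear_inner]
  note pt = pure_tensor_closed[OF A BC] pure_tensor_closed[OF B C] pure_tensor_closed[OF A B]
  interpret AB: k_algebra "tensor A B" by (rule k_algebra_tensor[OF A B])
  let ?\<psi> = "\<lambda>t c. tensor_lift A B (tensor A (tensor B C))
     (\<lambda>a b. pure_tensor A (tensor B C) a (pure_tensor B C b c)) t"
  show "?\<psi> \<one>\<^bsub>tensor A B\<^esub> \<one>\<^bsub>C\<^esub> = \<one>\<^bsub>tensor A (tensor B C)\<^esub>"
    by (simp add: one_tensor[OF A B] one_tensor[OF B C] one_tensor[OF A BC] pure)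
  have 1: "?\<psi> (pure_tensor A B a b \<otimes>\<^bsub>tensor A B\<^esub> t') (c \<otimes>\<^bsub>C\<^esub> c') =
      ?\<psi> (pure_tensor A B a b) c \<otimes>\<^bsub>tensor A (tensor B C)\<^esub> ?\<psi> t' c'"
    if "t' \<in> carrier (tensor A B)" "a \<in> carrier A" "b \<in> carrier B" "c \<in> carrier C" "c' \<in> carrier C" for a b t' c c'
    using that(1)
    by (induction rule: tensor_induct[OF A B, consumes 1])
       (simp_all add: that pure pt pure_tensor_mult[OF A B] pure_tensor_mult[OF A BC] pure_tensor_mult[OF B C]
         linear_map_add[OF lin] linear_map_closed[OF lin] AB.r_distr ABC.r_distr)
  fix t c t' c'
  assume t: "t \<in> carrier (tensor A B)" and *: "t' \<in> carrier (tensor A B)" "c \<in> carrier C" "c' \<in> carrier C"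
  show "?\<psi> (t \<otimes>\<^bsub>tensor A B\<^esub> t') (c \<otimes>\<^bsub>C\<^esub> c') = ?\<psi> t c \<otimes>\<^bsub>tensor A (tensor B C)\<^esub> ?\<psi> t' c'"
    using t
    by (induction rule: tensor_induct[OF A B, consumes 1])
       (simp_all add: * 1 linear_map_add[OF lin] linear_map_closed[OF lin] AB.l_distr ABC.l_distr)
qed

end


section \<open>Presentations by generators and relations, and bialgebra maps determined on
  generators\<close>

section \<open>Presented algebras\<close>

definition word_eval :: "('k::field, 'b, 'z) module_scheme \<Rightarrow> ('s \<Rightarrow> 'b) \<Rightarrow> 's list \<Rightarrow> 'b" where
  "word_eval B b w = foldr (\<lambda>s y. b s \<otimes>\<^bsub>B\<^esub> y) w \<one>\<^bsub>B\<^esub>"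

lemma word_eval_simps [simp]:
  "word_eval B b [] = \<one>\<^bsub>B\<^esub>" "word_eval B b (s # w) = b s \<otimes>\<^bsub>B\<^esub> word_eval B b w"
  by (simp_all add: word_eval_def)

lemma monoid_words: "Group.monoid \<lparr>carrier = lists X, monoid.mult = (@), one = []\<rparr>"
  by (rule monoidI) auto

lemma k_algebra_free: "k_algebra (free_algebra X)"
  unfolding free_algebra_def by (rule k_algebra_monoid_algebra[OF monoid_words])

lemma single_in_free [simp]:
  "w \<in> lists X \<Longrightarrow> Poly_Mapping.single w (c::'k::field) \<in> carrier (free_algebra X)"
  by (simp add: free_algebra_def)

lemma diff_in_free:
  assumes "p \<in> carrier (free_algebra X)" "r \<in> carrier (free_algebra X)"
  shows "p - (r :: 's list \<Rightarrow>\<^sub>0 'k::field) \<in> carrier (free_algebra X)"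
proof -
  interpret k_algebra "free_algebra X :: ('k, 's list \<Rightarrow>\<^sub>0 'k) module" by (rule k_algebra_free)
  show ?thesis
    using assms minus_closed[OF assms] monoid_algebra_minus[OF monoid_words, of p X r]
    by (simp add: free_algebra_def)
qed

context
  fixes B :: "('k::field, 'b, 'z) module_scheme" and X :: "'s set" and b :: "'s \<Rightarrow> 'b"
  assumes B: "k_algebra B" and b: "b \<in> X \<rightarrow> carrier B"
begin

interpretation B: k_algebra B by (rule B)

lemma word_eval_closed: "w \<in> lists X \<Longrightarrow> word_eval B b w \<in> carrier B"
  using b by (induction w) auto

lemma word_eval_append:
  "w \<in> lists X \<Longrightarrow> w' \<in> lists X \<Longrightarrow> word_eval B b (w @ w') = word_eval B b w \<otimes>\<^bsub>B\<^esub> word_eval B b w'"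
  using funcset_mem[OF b] by (induction w) (auto simp: word_eval_closed B.m_assoc)

lemma word_eval_replicate:
  assumes "s \<in> X" shows "word_eval B b (replicate k s) = b s [^]\<^bsub>B\<^esub> k"
proof -
  have "b s \<in> carrier B" using assms b by auto
  then have "b s [^]\<^bsub>B\<^esub> Suc k = b s \<otimes>\<^bsub>B\<^esub> b s [^]\<^bsub>B\<^esub> k" for k by (rule B.nat_pow_Suc2)
  then show ?thesis by (induction k) (simp_all only: replicate_Suc replicate_0 word_eval_simps B.nat_pow_0)
qed

lemma free_eval_algebra_hom: "algebra_hom (free_algebra X) B (linear_extension B (word_eval B b))"
  unfolding free_algebra_def
  by (rule linear_extension_algebra_hom[OF B monoid_words]) (auto simp: word_eval_closed word_eval_append)

lemma free_eval_diff:
  assumes "w \<in> lists X" "w' \<in> lists X"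
  shows "linear_extension B (word_eval B b) (Poly_Mapping.single w c - Poly_Mapping.single w' d) =
    c \<odot>\<^bsub>B\<^esub> word_eval B b w \<ominus>\<^bsub>B\<^esub> d \<odot>\<^bsub>B\<^esub> word_eval B b w'"
proof -
  interpret free: k_algebra "free_algebra X :: ('k, 's list \<Rightarrow>\<^sub>0 'k) module" by (rule k_algebra_free)
  note lin = algebra_hom_linear[OF free_eval_algebra_hom]
  have "Poly_Mapping.single w c - Poly_Mapping.single w' d =
      Poly_Mapping.single w c \<ominus>\<^bsub>free_algebra X\<^esub> Poly_Mapping.single w' d"
    using assms unfolding free_algebra_def by (intro monoid_algebra_minus[symmetric] monoid_words) auto
  then show ?thesis
    using assms word_eval_closed
    by (simp add: a_minus_def linear_map_add[OF lin] linear_map_minus[OF k_algebra_free B lin]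
        linear_extension_single[OF B])
qed

end

context
  fixes X :: "'s set" and R :: "('s list \<Rightarrow>\<^sub>0 'k::field) set"
  assumes R: "R \<subseteq> carrier (free_algebra X)"
begin

private abbreviation (input) "P \<equiv> presented_algebra X R"
private abbreviation (input) "I \<equiv> Idl\<^bsub>free_algebra X\<^esub> R"

interpretation free: k_algebra "free_algebra X :: ('k, 's list \<Rightarrow>\<^sub>0 'k) module" by (rule k_algebra_free)

private lemma ideal_I: "ideal I (free_algebra X)"
  by (rule free.genideal_ideal[OF R])

lemma k_algebra_presented: "k_algebra (presented_algebra X R)"
  unfolding presented_algebra_def by (rule k_algebra_quotient[OF k_algebra_free ideal_I])

interpretation P: k_algebra "presented_algebra X R" by (rule k_algebra_presented)

lemma presented_gen_closed [simp]: "s \<in> X \<Longrightarrow> presented_gen X R s \<in> carrier (presented_algebra X R)"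
  unfolding presented_gen_def presented_algebra_def
  by (rule coset_in_quotient[OF k_algebra_free ideal_I]) simp

lemma presented_gen_funcset: "presented_gen X R \<in> X \<rightarrow> carrier (presented_algebra X R)"
  by simp

private lemmas coset_hom = algebra_hom_coset[OF k_algebra_free ideal_I, folded presented_algebra_def]

text \<open>Identifies the projection from the free algebra with evaluation of words at the
  generators. Relators thereby turn into equations between the generators of the presented
  algebra.\<close>

lemma coset_eq_free_eval:
  assumes "p \<in> carrier (free_algebra X)"
  shows "I +>\<^bsub>free_algebra X\<^esub> p = linear_extension P (word_eval P (presented_gen X R)) p"
proof (rule linear_map_monoid_algebra_eq[OF monoid_words[of X] k_algebra_presented])
  show "linear_map (monoid_algebra \<lparr>carrier = lists X, monoid.mult = (@), one = []\<rparr>) P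
     (\<lambda>p. I +>\<^bsub>free_algebra X\<^esub> p)"
    using algebra_hom_linear[OF coset_hom] by (simp add: free_algebra_def)
  show "linear_map (monoid_algebra \<lparr>carrier = lists X, monoid.mult = (@), one = []\<rparr>) P
     (linear_extension P (word_eval P (presented_gen X R)))"
    using algebra_hom_linear[OF free_eval_algebra_hom[OF k_algebra_presented presented_gen_funcset]]
    by (simp add: free_algebra_def)
  show "p \<in> carrier (monoid_algebra \<lparr>carrier = lists X, monoid.mult = (@), one = []\<rparr>)"
    using assms by (simp add: free_algebra_def)
  fix w assume "w \<in> carrier \<lparr>carrier = lists X, monoid.mult = (@), one = []\<rparr>"
  then have w: "w \<in> lists X" by simp
  have "I +>\<^bsub>free_algebra X\<^esub> Poly_Mapping.single w 1 = word_eval P (presented_gen X R) w"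
    using w
  proof (induction w)
    case Nil
    then show ?case
      using algebra_hom_one[OF coset_hom] by (simp add: free_algebra_def monoid_algebra_simps)
  next
    case (Cons s w)
    have "Poly_Mapping.single (s # w) 1 =
        Poly_Mapping.single [s] (1::'k) \<otimes>\<^bsub>free_algebra X\<^esub> Poly_Mapping.single w 1"
      using monoid_algebra_mult_single[OF monoid_words, of X "[s]" "1::'k" w 1] by (simp add: free_algebra_def)
    then show ?case
      using Cons by (simp add: algebra_hom_mult[OF coset_hom] presented_gen_def)
  qed
  then show "I +>\<^bsub>free_algebra X\<^esub> Poly_Mapping.single w 1 =
      linear_extension P (word_eval P (presented_gen X R)) (Poly_Mapping.single w 1)"
    using word_eval_closed[OF k_algebra_presented presented_gen_funcset w]
    by (simp add: linear_extension_single[OF k_algebra_presented])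
qed

lemma presented_relation:
  assumes "r \<in> R"
  shows "linear_extension P (word_eval P (presented_gen X R)) r = \<zero>\<^bsub>P\<^esub>"
proof -
  have r: "r \<in> carrier (free_algebra X)" "r \<in> I" using assms R free.genideal_self[OF R] by auto
  have "I +>\<^bsub>free_algebra X\<^esub> r = I +>\<^bsub>free_algebra X\<^esub> \<zero>\<^bsub>free_algebra X\<^esub>"
    by (subst coset_eq_iff[OF k_algebra_free ideal_I]) (use r in \<open>auto simp: a_minus_def\<close>)
  also have "\<dots> = \<zero>\<^bsub>P\<^esub>"
    by (rule linear_map_zero[OF k_algebra_free k_algebra_presented algebra_hom_linear[OF coset_hom]])
  finally show ?thesis using coset_eq_free_eval[OF r(1)] by simp
qed

lemma presented_induct [consumes 1, case_names gen one add mult smult]: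
  assumes y: "y \<in> carrier P"
    and gen: "\<And>s. s \<in> X \<Longrightarrow> Q (presented_gen X R s)" and one: "Q \<one>\<^bsub>P\<^esub>"
    and add: "\<And>y z. y \<in> carrier P \<Longrightarrow> z \<in> carrier P \<Longrightarrow> Q y \<Longrightarrow> Q z \<Longrightarrow> Q (y \<oplus>\<^bsub>P\<^esub> z)"
    and mult: "\<And>y z. y \<in> carrier P \<Longrightarrow> z \<in> carrier P \<Longrightarrow> Q y \<Longrightarrow> Q z \<Longrightarrow> Q (y \<otimes>\<^bsub>P\<^esub> z)"
    and smult: "\<And>c y. y \<in> carrier P \<Longrightarrow> Q y \<Longrightarrow> Q (c \<odot>\<^bsub>P\<^esub> y)"
  shows "Q y"
proof -
  obtain p where p: "p \<in> carrier (free_algebra X)" and y: "y = I +>\<^bsub>free_algebra X\<^esub> p"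
    using y unfolding presented_algebra_def by (rule quotient_cases[OF k_algebra_free ideal_I])
  let ?e = "word_eval P (presented_gen X R)"
  note lin = algebra_hom_linear[OF free_eval_algebra_hom[OF k_algebra_presented presented_gen_funcset]]
  note ec = word_eval_closed[OF k_algebra_presented presented_gen_funcset]
  have word: "Q (?e w)" if "w \<in> lists X" for w
    using that by (induction w) (auto intro: one mult gen ec)
  have zero: "Q \<zero>\<^bsub>P\<^esub>" using smult[OF P.one_closed one, of 0] by simp
  have "Q (linear_extension P ?e p)"
    using p unfolding free_algebra_def
  proof (induction rule: monoid_algebra_induct)
    case zero
    then show ?case using \<open>Q \<zero>\<^bsub>P\<^esub>\<close> by (simp add: linear_extension_def)
  next
    case (single w c)
    then have "w \<in> lists X" by simp
    then show ?case using ec word smult by (simp add: linear_extension_single[OF k_algebra_presented])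
  next
    case (add p r)
    then show ?case
      using assms(4) linear_map_closed[OF lin] linear_map_add[OF lin, of p r]
      by (simp add: free_algebra_def monoid_algebra_simps(4))
  qed
  then show ?thesis using y coset_eq_free_eval[OF p] by simp
qed

context
  fixes B :: "('k, 'b, 'z) module_scheme" and b
  assumes B: "k_algebra B" and b: "b \<in> X \<rightarrow> carrier B"
    and rel: "\<And>r. r \<in> R \<Longrightarrow> linear_extension B (word_eval B b) r = \<zero>\<^bsub>B\<^esub>"
begin

interpretation B: k_algebra B by (rule B)

text \<open>The universal property, which makes the choice in \<open>presented_hom\<close>
  meaningful: evaluation of words is multiplicative, so together with the relators it kills the
  whole ideal that they generate.\<close>

lemma presented_hom_exists:
  "\<exists>f. algebra_hom P B f \<and> (\<forall>s\<in>X. f (presented_gen X R s) = b s)"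
proof -
  let ?E = "linear_extension B (word_eval B b)"
  note hom = free_eval_algebra_hom[OF B b]
  note lin = algebra_hom_linear[OF hom]
  have van: "?E p = \<zero>\<^bsub>B\<^esub>" if p: "p \<in> I" for p
  proof (rule linear_map_vanishes_on_genideal[OF B monoid_words])
    show "linear_map (monoid_algebra \<lparr>carrier = lists X, monoid.mult = (@), one = []\<rparr>) B ?E"
      using lin by (simp add: free_algebra_def)
    show "R \<subseteq> carrier (monoid_algebra \<lparr>carrier = lists X, monoid.mult = (@), one = []\<rparr>)"
      using R by (simp add: free_algebra_def)
    show "p \<in> Idl\<^bsub>monoid_algebra \<lparr>carrier = lists X, monoid.mult = (@), one = []\<rparr>\<^esub> R"
      using p by (simp add: free_algebra_def)
    fix r w w'
    assume r: "r \<in> R" and "w \<in> carrier \<lparr>carrier = lists X, monoid.mult = (@), one = []\<rparr>"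
      "w' \<in> carrier \<lparr>carrier = lists X, monoid.mult = (@), one = []\<rparr>"
    then have w: "w \<in> lists X" "w' \<in> lists X" by simp_all
    have "r \<in> carrier (free_algebra X)" using r R by auto
    then show "?E (Poly_Mapping.single w 1 \<otimes>\<^bsub>monoid_algebra \<lparr>carrier = lists X, monoid.mult = (@), one = []\<rparr>\<^esub> r
        \<otimes>\<^bsub>monoid_algebra \<lparr>carrier = lists X, monoid.mult = (@), one = []\<rparr>\<^esub> Poly_Mapping.single w' 1) = \<zero>\<^bsub>B\<^esub>"
      unfolding free_algebra_def[symmetric]
      using w algebra_hom_closed[OF hom single_in_free] by (simp add: algebra_hom_mult[OF hom] rel[OF r])
  qed
  obtain f where f: "linear_map P B f"
    "\<And>p. p \<in> carrier (free_algebra X) \<Longrightarrow> f (I +>\<^bsub>free_algebra X\<^esub> p) = ?E p"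
    using quotient_lift_linear[OF k_algebra_free ideal_I B lin van] unfolding presented_algebra_def by blast
  have "algebra_hom P B f"
  proof (rule algebra_homI[OF f(1)])
    show "f \<one>\<^bsub>P\<^esub> = \<one>\<^bsub>B\<^esub>"
      using f(2)[of "\<one>\<^bsub>free_algebra X\<^esub>"] algebra_hom_one[OF coset_hom] algebra_hom_one[OF hom] by simp
    fix y z assume "y \<in> carrier P" "z \<in> carrier P"
    then obtain p r where *: "p \<in> carrier (free_algebra X)" "y = I +>\<^bsub>free_algebra X\<^esub> p"
      "r \<in> carrier (free_algebra X)" "z = I +>\<^bsub>free_algebra X\<^esub> r"
      unfolding presented_algebra_def by (metis quotient_cases[OF k_algebra_free ideal_I])
    then show "f (y \<otimes>\<^bsub>P\<^esub> z) = f y \<otimes>\<^bsub>B\<^esub> f z"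
      using f(2) algebra_hom_mult[OF hom, of p r] by (simp flip: algebra_hom_mult[OF coset_hom])
  qed
  moreover have "f (presented_gen X R s) = b s" if "s \<in> X" for s
    using that funcset_mem[OF b that] f(2)[of "Poly_Mapping.single [s] 1"]
    by (simp add: presented_gen_def linear_extension_single[OF B])
  ultimately show ?thesis by blast
qed

lemma presented_hom_algebra_hom: "algebra_hom P B (presented_hom X R B b)"
  and presented_hom_gen: "s \<in> X \<Longrightarrow> presented_hom X R B b (presented_gen X R s) = b s"
  using someI_ex[OF presented_hom_exists] unfolding presented_hom_def by auto

end

end

section \<open>Generation and bialgebra maps\<close>

text \<open>Hopf records extend algebra records, so a Hopf algebra and its underlying algebra have
  different types and cannot be equated. This relation carries over whatever depends on the algebra
  fields alone.\<close>

definition same_algebra ::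
  "('k::field, 'a, 'y) module_scheme \<Rightarrow> ('k, 'a, 'z) module_scheme \<Rightarrow> bool" where
  "same_algebra A A' \<longleftrightarrow> carrier A = carrier A' \<and> monoid.mult A = monoid.mult A' \<and> one A = one A' \<and>
     zero A = zero A' \<and> add A = add A' \<and> smult A = smult A'"

lemma same_algebra_linear_map:
  "same_algebra A A' \<Longrightarrow> same_algebra B B' \<Longrightarrow> linear_map A B = linear_map A' B'"
  by (simp add: same_algebra_def linear_map_def fun_eq_iff)

lemma same_algebra_algebra_hom:
  "same_algebra A A' \<Longrightarrow> same_algebra B B' \<Longrightarrow> algebra_hom A B = algebra_hom A' B'"
  by (simp add: same_algebra_def algebra_hom_def linear_map_def ring_hom_def fun_eq_iff)

lemma same_algebra_refl: "same_algebra A A"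
  by (simp add: same_algebra_def)

lemma same_algebra_k_algebra:
  assumes "same_algebra A A'" "k_algebra A"
  shows "k_algebra A'"
proof -
  interpret A: k_algebra A by fact
  have s: "carrier A' = carrier A" "\<And>x y. x \<otimes>\<^bsub>A'\<^esub> y = x \<otimes>\<^bsub>A\<^esub> y" "\<one>\<^bsub>A'\<^esub> = \<one>\<^bsub>A\<^esub>" "\<zero>\<^bsub>A'\<^esub> = \<zero>\<^bsub>A\<^esub>"
    "\<And>x y. x \<oplus>\<^bsub>A'\<^esub> y = x \<oplus>\<^bsub>A\<^esub> y" "\<And>c x. c \<odot>\<^bsub>A'\<^esub> x = c \<odot>\<^bsub>A\<^esub> x"
    using assms(1) by (simp_all add: same_algebra_def)
  have "ring A'"
  proof (rule ringI)
    show "abelian_group A'"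
      by (rule abelian_groupI) (simp_all add: s A.a_ac A.add.l_inv_ex)
    show "Group.monoid A'"
      by (rule monoidI) (simp_all add: s A.m_assoc)
  qed (simp_all add: s A.l_distr A.r_distr)
  then show ?thesis
    by (rule k_algebraI) (simp_all add: s A.smult_add_left A.smult_add_right A.smult_smult
      A.smult_mult_left A.smult_mult_right)
qed

text \<open>A genuine equality, since a tensor product is built as a plain algebra record and
  forgets all further fields of its factors. It reconciles the tensor square in the definition of a
  presented Hopf algebra with the tensor square of that Hopf algebra.\<close>

lemma same_algebra_tensor:
  assumes "same_algebra A A'" "same_algebra B B'"
  shows "tensor A B = tensor A' B'" "pure_tensor A B = pure_tensor A' B'"
proof -
  have "A \<times>\<times> B = A' \<times>\<times> B'" "tensor_relators A B = tensor_relators A' B'"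
    using assms by (simp_all add: same_algebra_def DirProd_def tensor_relators_def)
  then show "tensor A B = tensor A' B'" "pure_tensor A B = pure_tensor A' B'"
    by (simp_all add: tensor_def tensor_ideal_def pure_tensor_def fun_eq_iff)
qed

text \<open>The generated subalgebra in inductive form, so that statements known on generators,
  including the antipode laws, extend by rule induction.\<close>

inductive_set alg_span :: "('k::field, 'a, 'z) module_scheme \<Rightarrow> 'a set \<Rightarrow> 'a set"
  for A S where
  gen: "s \<in> S \<Longrightarrow> s \<in> alg_span A S"
| one: "\<one>\<^bsub>A\<^esub> \<in> alg_span A S"
| add: "y \<in> alg_span A S \<Longrightarrow> z \<in> alg_span A S \<Longrightarrow> y \<oplus>\<^bsub>A\<^esub> z \<in> alg_span A S"
| mult: "y \<in> alg_span A S \<Longrightarrow> z \<in> alg_span A S \<Longrightarrow> y \<otimes>\<^bsub>A\<^esub> z \<in> alg_span A S"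
| smult: "y \<in> alg_span A S \<Longrightarrow> c \<odot>\<^bsub>A\<^esub> y \<in> alg_span A S"

lemma alg_span_closed:
  assumes "k_algebra A" "S \<subseteq> carrier A" "y \<in> alg_span A S"
  shows "y \<in> carrier A"
proof -
  interpret k_algebra A by fact
  show ?thesis
    using assms(3) by induction (use assms(2) in auto)
qed

lemma algebra_hom_eq_on_alg_span:
  assumes "k_algebra A" "S \<subseteq> carrier A" and f: "algebra_hom A B f" and f': "algebra_hom A B f'"
    and eq: "\<And>s. s \<in> S \<Longrightarrow> f s = f' s" and y: "y \<in> alg_span A S"
  shows "f y = f' y"
  using y
  by induction
     (simp_all add: eq alg_span_closed[OF assms(1,2)] algebra_hom_one[OF f] algebra_hom_one[OF f']
       algebra_hom_add[OF f] algebra_hom_add[OF f'] algebra_hom_mult[OF f] algebra_hom_mult[OF f']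
       algebra_hom_smult[OF f] algebra_hom_smult[OF f'])

lemma alg_span_hom_image:
  assumes "k_algebra A" "S \<subseteq> carrier A" and f: "algebra_hom A B f" and y: "y \<in> alg_span A S"
  shows "f y \<in> alg_span B (f ` S)"
  using y
proof induction
  case (gen s)
  then show ?case by (auto intro: alg_span.gen)
next
  case one
  show ?case unfolding algebra_hom_one[OF f] by (rule alg_span.one)
next
  case (add y z)
  then show ?case
    using alg_span_closed[OF assms(1,2)] alg_span.add by (simp add: algebra_hom_add[OF f])
next
  case (mult y z)
  then show ?case
    using alg_span_closed[OF assms(1,2)] alg_span.mult by (simp add: algebra_hom_mult[OF f])
next
  case (smult y c)
  then show ?case
    using alg_span_closed[OF assms(1,2)] alg_span.smult by (simp add: algebra_hom_smult[OF f])
qed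

lemma presented_alg_span:
  assumes "R \<subseteq> carrier (free_algebra X)"
  shows "carrier (presented_algebra X R) = alg_span (presented_algebra X R) (presented_gen X R ` X)"
proof (intro equalityI subsetI)
  fix y assume "y \<in> carrier (presented_algebra X R)"
  then show "y \<in> alg_span (presented_algebra X R) (presented_gen X R ` X)"
    by (induction rule: presented_induct[OF assms, consumes 1]) (auto intro: alg_span.intros)
next
  fix y assume y: "y \<in> alg_span (presented_algebra X R) (presented_gen X R ` X)"
  show "y \<in> carrier (presented_algebra X R)"
    using alg_span_closed[OF k_algebra_presented[OF assms] _ y] presented_gen_closed[OF assms] by blast
qed

text \<open>The structure that Hopf algebra maps, isomorphisms and factorizations refer to. It holds
  for the presented algebras as soon as their comultiplication and counit are known to be well
  defined.\<close>

locale prebialgebra = k_algebra H for H :: "('k::field, 'a, 'z) hopf_scheme" (structure) +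
  assumes comult_hom: "algebra_hom H (tensor H H) (comult H)"
    and counit_hom: "algebra_hom H scalars (counit H)"

lemma (in hopf_algebra) prebialgebra: "prebialgebra H"
  by (intro prebialgebra.intro prebialgebra_axioms.intro is_k_algebra comult_hom counit_hom)

lemma hopf_homD:
  assumes "hopf_hom A B f"
  shows "algebra_hom A B f" "linear_map A B f"
    and "x \<in> carrier A \<Longrightarrow> comult B (f x) = tensor_map A A B B f f (comult A x)"
    and "x \<in> carrier A \<Longrightarrow> counit B (f x) = counit A x"
    and "x \<in> carrier A \<Longrightarrow> f x \<in> carrier B"
  using assms algebra_hom_linear algebra_hom_closed by (auto simp: hopf_hom_def)

text \<open>For a multiplicative \<open>f\<close>, both sides of each compatibility condition are
  algebra maps, hence agree once they agree on generators.\<close>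

lemma hopf_hom_on_generators:
  assumes "prebialgebra A" "prebialgebra B" and f: "algebra_hom A B f"
    and S: "S \<subseteq> carrier A" "carrier A \<subseteq> alg_span A S"
    and comult: "\<And>s. s \<in> S \<Longrightarrow> comult B (f s) = tensor_map A A B B f f (comult A s)"
    and counit: "\<And>s. s \<in> S \<Longrightarrow> counit B (f s) = counit A s"
  shows "hopf_hom A B f"
proof -
  interpret A: prebialgebra A by fact
  interpret B: prebialgebra B by fact
  note AA = A.is_k_algebra and BB = B.is_k_algebra
  have 1: "algebra_hom A (tensor B B) (\<lambda>x. comult B (f x))"
    by (rule algebra_hom_compose[OF f B.comult_hom])
  have 2: "algebra_hom A (tensor B B) (\<lambda>x. tensor_map A A B B f f (comult A x))"
    by (rule algebra_hom_compose[OF A.comult_hom tensor_map_algebra_hom[OF AA AA BB BB f f]])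
  have 3: "algebra_hom A scalars (\<lambda>x. counit B (f x))"
    by (rule algebra_hom_compose[OF f B.counit_hom])
  show ?thesis
    unfolding hopf_hom_def
    using f S(2) algebra_hom_eq_on_alg_span[OF AA S(1) 1 2 comult]
      algebra_hom_eq_on_alg_span[OF AA S(1) 3 A.counit_hom counit] by auto
qed

lemma hopf_hom_compose:
  assumes "prebialgebra A" "prebialgebra B" "prebialgebra C" and f: "hopf_hom A B f" and g: "hopf_hom B C g"
  shows "hopf_hom A C (\<lambda>x. g (f x))"
proof -
  interpret A: prebialgebra A by fact
  interpret B: prebialgebra B by fact
  interpret C: prebialgebra C by fact
  note AA = A.is_k_algebra and BB = B.is_k_algebra and CC = C.is_k_algebra
  show ?thesis
    unfolding hopf_hom_def
    using algebra_hom_compose[OF hopf_homD(1)[OF f] hopf_homD(1)[OF g]]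
    by (simp add: hopf_homD[OF f] hopf_homD[OF g] algebra_hom_closed[OF A.comult_hom]
      tensor_map_compose[OF AA AA BB BB CC CC hopf_homD(2)[OF f] hopf_homD(2)[OF f] hopf_homD(2)[OF g] hopf_homD(2)[OF g]])
qed

lemma hopf_hom_inverse:
  assumes "prebialgebra A" "prebialgebra B" and f: "hopf_hom A B f" and bij: "bij_betw f (carrier A) (carrier B)"
  shows "hopf_hom B A (inv_into (carrier A) f)"
proof -
  interpret A: prebialgebra A by fact
  interpret B: prebialgebra B by fact
  note AA = A.is_k_algebra and BB = B.is_k_algebra
  let ?g = "inv_into (carrier A) f"
  have g: "algebra_hom B A ?g"
    by (rule inverse_algebra_hom[OF AA hopf_homD(1)[OF f] bij])
  have gf: "?g (f x) = x" if "x \<in> carrier A" for x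
    using bij that by (simp add: bij_betw_def)
  have fg: "?g y \<in> carrier A" "f (?g y) = y" if "y \<in> carrier B" for y
    using bij that by (metis bij_betw_def inv_into_into, metis bij_betw_def f_inv_into_f)
  note gl = algebra_hom_linear[OF g] and fl = hopf_homD(2)[OF f]
  \<comment> \<open>Apply the tensor square of the inverse to the compatibility of \<open>f\<close>
    with the comultiplications at the element \<open>?g y\<close>.\<close>
  have "comult A (?g y) = tensor_map B B A A ?g ?g (comult B y)" if y: "y \<in> carrier B" for y
  proof -
    have c: "comult A (?g y) \<in> carrier (tensor A A)"
      using algebra_hom_closed[OF A.comult_hom] fg y by blast
    have "tensor_map B B A A ?g ?g (comult B y) =
        tensor_map B B A A ?g ?g (tensor_map A A B B f f (comult A (?g y)))"
      using hopf_homD(3)[OF f, of "?g y"] fg[OF y] by simp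
    also have "\<dots> = tensor_map A A A A (\<lambda>x. ?g (f x)) (\<lambda>x. ?g (f x)) (comult A (?g y))"
      by (rule tensor_map_compose[OF AA AA BB BB AA AA fl fl gl gl c])
    also have "\<dots> = tensor_map A A A A (\<lambda>x. x) (\<lambda>x. x) (comult A (?g y))"
      by (rule tensor_map_cong[OF AA AA AA AA _ _ linear_map_id linear_map_id])
         (use c linear_map_compose[OF fl gl] gf in auto)
    also have "\<dots> = comult A (?g y)"
      by (rule tensor_map_id[OF AA AA c])
    finally show ?thesis by simp
  qed
  moreover have "counit A (?g y) = counit B y" if y: "y \<in> carrier B" for y
    using hopf_homD(4)[OF f, of "?g y"] fg[OF y] by simp
  ultimately show ?thesis using g by (simp add: hopf_hom_def)
qed

lemma hopf_isomorphic_refl: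
  assumes "prebialgebra A" shows "A \<cong>\<^sub>H A"
proof -
  interpret A: prebialgebra A by fact
  have "hopf_hom A A (\<lambda>x. x)"
    unfolding hopf_hom_def
    using algebra_hom_id tensor_map_id[OF A.is_k_algebra A.is_k_algebra] algebra_hom_closed[OF A.comult_hom] by simp
  then show ?thesis
    unfolding hopf_isomorphic_def by (intro exI[of _ "\<lambda>x. x"]) (auto simp: bij_betw_def)
qed

lemma hopf_isomorphic_sym:
  assumes "prebialgebra A" "prebialgebra B" "A \<cong>\<^sub>H B" shows "B \<cong>\<^sub>H A"
  using assms hopf_hom_inverse bij_betw_inv_into unfolding hopf_isomorphic_def by blast

lemma hopf_isomorphic_trans:
  assumes "prebialgebra A" "prebialgebra B" "prebialgebra C" "A \<cong>\<^sub>H B" "B \<cong>\<^sub>H C" shows "A \<cong>\<^sub>H C"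
proof -
  obtain f g where f: "hopf_hom A B f" "bij_betw f (carrier A) (carrier B)"
    and g: "hopf_hom B C g" "bij_betw g (carrier B) (carrier C)"
    using assms(4,5) unfolding hopf_isomorphic_def by blast
  have "bij_betw (\<lambda>x. g (f x)) (carrier A) (carrier C)"
    using bij_betw_trans[OF f(2) g(2)] by (simp add: comp_def)
  then show ?thesis
    unfolding hopf_isomorphic_def using hopf_hom_compose[OF assms(1-3) f(1) g(1)] by blast
qed

text \<open>Composing both embeddings with the isomorphism composes the multiplication map out of
  the tensor product with it, so bijectivity is kept.\<close>

lemma factorizes_through_isomorphic:
  assumes "prebialgebra A" "prebialgebra H" "prebialgebra E" "prebialgebra F"
    and "factorizes_through E A H" "E \<cong>\<^sub>H F"
  shows "factorizes_through F A H"
proof -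
  interpret A: prebialgebra A by fact
  interpret H: prebialgebra H by fact
  interpret E: prebialgebra E by fact
  interpret F: prebialgebra F by fact
  note AA = A.is_k_algebra and HH = H.is_k_algebra and EE = E.is_k_algebra and FF = F.is_k_algebra
  obtain i j where i: "hopf_hom A E i" "inj_on i (carrier A)" and j: "hopf_hom H E j" "inj_on j (carrier H)"
    and bij: "bij_betw (tensor_lift A H E (\<lambda>a y. i a \<otimes>\<^bsub>E\<^esub> j y)) (carrier (tensor A H)) (carrier E)"
    using assms(5) unfolding factorizes_through_def by blast
  obtain f where f: "hopf_hom E F f" "bij_betw f (carrier E) (carrier F)"
    using assms(6) unfolding hopf_isomorphic_def by blast
  let ?L = "tensor_lift A H E (\<lambda>a y. i a \<otimes>\<^bsub>E\<^esub> j y)"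
  let ?L' = "tensor_lift A H F (\<lambda>a y. f (i a) \<otimes>\<^bsub>F\<^esub> f (j y))"
  note il = hopf_homD(2)[OF i(1)] and jl = hopf_homD(2)[OF j(1)] and fl = hopf_homD(2)[OF f(1)]
  note fi = hopf_hom_compose[OF assms(1,3,4) i(1) f(1)] and fj = hopf_hom_compose[OF assms(2,3,4) j(1) f(1)]
  note b1 = bilinear_map_mult[OF EE il jl]
  note b2 = bilinear_map_mult[OF FF linear_map_compose[OF il fl] linear_map_compose[OF jl fl]]
  have "?L' t = f (?L t)" if "t \<in> carrier (tensor A H)" for t
    by (rule linear_map_tensor_eq[OF AA HH tensor_lift_linear[OF AA HH FF b2]
          linear_map_compose[OF tensor_lift_linear[OF AA HH EE b1] fl] _ that])
       (simp add: tensor_lift_pure[OF AA HH FF b2] tensor_lift_pure[OF AA HH EE b1]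
          algebra_hom_mult[OF hopf_homD(1)[OF f(1)]] hopf_homD(5)[OF i(1)] hopf_homD(5)[OF j(1)])
  then have "bij_betw ?L' (carrier (tensor A H)) (carrier F)"
    using bij_betw_trans[OF bij f(2)] bij_betw_cong[of "carrier (tensor A H)" ?L' "f \<circ> ?L"] by simp
  moreover have "inj_on (\<lambda>a. f (i a)) (carrier A)" "inj_on (\<lambda>y. f (j y)) (carrier H)"
    using i(2) j(2) f(2) hopf_homD(5)[OF i(1)] hopf_homD(5)[OF j(1)]
    by (auto simp: inj_on_def bij_betw_def)
  ultimately show ?thesis
    unfolding factorizes_through_def using fi fj by blast
qed


section \<open>Hopf algebras generated by group-likes and a skew-primitive\<close>

locale pointed_generators = prebialgebra H for H :: "('k::field, 'a, 'z) hopf_scheme" (structure) +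
  fixes g h x :: 'a
  assumes gens: "g \<in> carrier H" "h \<in> carrier H" "x \<in> carrier H"
    and generated: "carrier H \<subseteq> alg_span H {g, h, x}"
    and comult_g: "comult H g = pure_tensor H H g g"
    and comult_h: "comult H h = pure_tensor H H h h"
    and comult_x: "comult H x = pure_tensor H H x h \<oplus>\<^bsub>tensor H H\<^esub> pure_tensor H H \<one> x"
    and counit_g: "counit H g = 1" and counit_h: "counit H h = 1" and counit_x: "counit H x = 0"
begin

lemmas HH = k_algebra_tensor[OF is_k_algebra is_k_algebra]

text \<open>Coassociativity and the counit laws equate algebra maps and are settled on generators.
  The antipode laws do not, because the antipode reverses products; for them, the elements
  satisfying the laws are shown to be closed under all algebra operations.\<close>

lemma hopf_algebra_if_antipode:
  assumes anti: "algebra_hom H (opposite_algebra H) (antipode H)"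
    and Sg: "antipode H g \<otimes> g = \<one>" "g \<otimes> antipode H g = \<one>"
    and Sh: "antipode H h \<otimes> h = \<one>" "h \<otimes> antipode H h = \<one>"
    and Sx: "antipode H x = \<ominus> (x \<otimes> antipode H h)"
  shows "hopf_algebra H"
proof -
  note KA = is_k_algebra
  interpret HH: k_algebra "tensor H H" by (rule HH)
  interpret HHH: k_algebra "tensor H (tensor H H)" by (rule k_algebra_tensor[OF KA HH])
  note gen_S = gens
  have S_sub: "{g, h, x} \<subseteq> carrier H" using gens by auto
  note cm = algebra_hom_closed[OF comult_hom] and cl = algebra_hom_linear[OF comult_hom]
  note ptc = pure_tensor_closed[OF KA KA]
  note id = algebra_hom_id[of H] and idl = linear_map_id[of H]
  let ?S = "antipode H"
  have S_lin: "linear_map H H ?S"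
    using algebra_hom_linear[OF anti] by (simp add: linear_map_def)
  have S_cl: "y \<in> carrier H \<Longrightarrow> ?S y \<in> carrier H" for y by (rule linear_map_closed[OF S_lin])
  have S_mult: "y \<in> carrier H \<Longrightarrow> z \<in> carrier H \<Longrightarrow> ?S (y \<otimes> z) = ?S z \<otimes> ?S y" for y z
    using algebra_hom_mult[OF anti] by simp
  have S_one: "?S \<one> = \<one>" using algebra_hom_one[OF anti] by simp
  have comult_one: "comult H \<one> = pure_tensor H H \<one> \<one>"
    by (simp add: algebra_hom_one[OF comult_hom] one_tensor[OF KA KA])

  have coassoc: "tensor_assoc H H H (tensor_map H H (tensor H H) H (comult H) (\<lambda>y. y) (comult H y)) =
      tensor_map H H H (tensor H H) (\<lambda>y. y) (comult H) (comult H y)" if "y \<in> carrier H" for y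
  proof (rule algebra_hom_eq_on_alg_span[OF KA S_sub])
    show "algebra_hom H (tensor H (tensor H H))
        (\<lambda>y. tensor_assoc H H H (tensor_map H H (tensor H H) H (comult H) (\<lambda>y. y) (comult H y)))"
      by (rule algebra_hom_compose[OF algebra_hom_compose[OF comult_hom
            tensor_map_algebra_hom[OF KA KA HH KA comult_hom id]] tensor_assoc_algebra_hom[OF KA KA KA]])
    show "algebra_hom H (tensor H (tensor H H))
        (\<lambda>y. tensor_map H H H (tensor H H) (\<lambda>y. y) (comult H) (comult H y))"
      by (rule algebra_hom_compose[OF comult_hom tensor_map_algebra_hom[OF KA KA KA HH id comult_hom]])
    show "y \<in> alg_span H {g, h, x}" using that generated by auto
    note l1 = tensor_map_linear[OF KA KA HH KA cl idl] and l2 = tensor_map_linear[OF KA KA KA HH idl cl]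
      and l3 = tensor_assoc_linear[OF KA KA KA]
    note p1 = tensor_map_pure[OF KA KA HH KA cl idl] and p2 = tensor_map_pure[OF KA KA KA HH idl cl]
      and p3 = tensor_assoc_pure[OF KA KA KA]
    fix s assume "s \<in> {g, h, x}"
    then consider "s = g" | "s = h" | "s = x" by auto
    then show "tensor_assoc H H H (tensor_map H H (tensor H H) H (comult H) (\<lambda>y. y) (comult H s)) =
      tensor_map H H H (tensor H H) (\<lambda>y. y) (comult H) (comult H s)"
    proof cases
      case 3
      have 1: "tensor_map H H (tensor H H) H (comult H) (\<lambda>y. y) (comult H x) =
         (pure_tensor (tensor H H) H (pure_tensor H H x h) h \<oplus>\<^bsub>tensor (tensor H H) H\<^esub>
          pure_tensor (tensor H H) H (pure_tensor H H \<one> x) h) \<oplus>\<^bsub>tensor (tensor H H) H\<^esub>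
          pure_tensor (tensor H H) H (pure_tensor H H \<one> \<one>) x"
        by (simp add: comult_x linear_map_add[OF l1] p1 gens ptc comult_one
            pure_tensor_add_left[OF HH KA])
      have 2: "tensor_map H H H (tensor H H) (\<lambda>y. y) (comult H) (comult H x) =
         pure_tensor H (tensor H H) x (pure_tensor H H h h) \<oplus>\<^bsub>tensor H (tensor H H)\<^esub>
         (pure_tensor H (tensor H H) \<one> (pure_tensor H H x h) \<oplus>\<^bsub>tensor H (tensor H H)\<^esub>
          pure_tensor H (tensor H H) \<one> (pure_tensor H H \<one> x))"
        by (simp add: comult_x comult_h linear_map_add[OF l2] p2 gens ptc
            pure_tensor_add_right[OF KA HH])
      interpret HH_H: k_algebra "tensor (tensor H H) H" by (rule k_algebra_tensor[OF HH KA])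
      show ?thesis
        unfolding 3 1 2
        by (simp add: linear_map_add[OF l3] p3 gens ptc pure_tensor_closed[OF HH KA]
            pure_tensor_closed[OF KA HH] HHH.a_assoc)
    qed (simp_all add: comult_g comult_h p1 p2 p3 gens ptc)
  qed
  have bl: "bilinear_map H H H (\<lambda>a b. counit H a \<odot> b)"
    by (rule bilinear_mapI)
       (simp_all add: algebra_hom_add[OF counit_hom] algebra_hom_smult[OF counit_hom] smult_add_left
         smult_add_right smult_smult mult.commute)
  have br: "bilinear_map H H H (\<lambda>a b. counit H b \<odot> a)"
    by (rule bilinear_mapI)
       (simp_all add: algebra_hom_add[OF counit_hom] algebra_hom_smult[OF counit_hom] smult_add_left
         smult_add_right smult_smult mult.commute)
  have counit_one: "counit H \<one> = 1" using algebra_hom_one[OF counit_hom] by simp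
  have counit_mult: "counit H (y \<otimes> z) = counit H y * counit H z" if "y \<in> carrier H" "z \<in> carrier H" for y z
    using algebra_hom_mult[OF counit_hom that] by simp
  have cul: "algebra_hom H H (\<lambda>y. tensor_lift H H H (\<lambda>a b. counit H a \<odot> b) (comult H y))"
    by (rule algebra_hom_compose[OF comult_hom tensor_lift_algebra_hom[OF KA KA KA bl]])
       (simp_all add: counit_one counit_mult smult_mult_left smult_mult_right smult_smult mult.commute)
  have cur: "algebra_hom H H (\<lambda>y. tensor_lift H H H (\<lambda>a b. counit H b \<odot> a) (comult H y))"
    by (rule algebra_hom_compose[OF comult_hom tensor_lift_algebra_hom[OF KA KA KA br]])
       (simp_all add: counit_one counit_mult smult_mult_left smult_mult_right smult_smult mult.commute)
  have counit_left: "tensor_lift H H H (\<lambda>a b. counit H a \<odot> b) (comult H y) = y" if "y \<in> carrier H" for y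
  proof (rule algebra_hom_eq_on_alg_span[OF KA S_sub cul id])
    show "y \<in> alg_span H {g, h, x}" using that generated by auto
    fix s assume "s \<in> {g, h, x}"
    then show "tensor_lift H H H (\<lambda>a b. counit H a \<odot> b) (comult H s) = s"
      by (auto simp: comult_g comult_h comult_x counit_g counit_h counit_x counit_one gens ptc
          tensor_lift_pure[OF KA KA KA bl] linear_map_add[OF tensor_lift_linear[OF KA KA KA bl]])
  qed
  have counit_right: "tensor_lift H H H (\<lambda>a b. counit H b \<odot> a) (comult H y) = y" if "y \<in> carrier H" for y
  proof (rule algebra_hom_eq_on_alg_span[OF KA S_sub cur id])
    show "y \<in> alg_span H {g, h, x}" using that generated by auto
    fix s assume "s \<in> {g, h, x}"
    then show "tensor_lift H H H (\<lambda>a b. counit H b \<odot> a) (comult H s) = s"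
      by (auto simp: comult_g comult_h comult_x counit_g counit_h counit_x counit_one gens ptc
          tensor_lift_pure[OF KA KA KA br] linear_map_add[OF tensor_lift_linear[OF KA KA KA br]])
  qed

  let ?L = "tensor_lift H H H (\<lambda>a b. ?S a \<otimes> b)" and ?R = "tensor_lift H H H (\<lambda>a b. a \<otimes> ?S b)"
  note bL = bilinear_map_mult[OF KA S_lin idl] and bR = bilinear_map_mult[OF KA idl S_lin]
  note Ll = tensor_lift_linear[OF KA KA KA bL] and Rl = tensor_lift_linear[OF KA KA KA bR]
  note Lp = tensor_lift_pure[OF KA KA KA bL] and Rp = tensor_lift_pure[OF KA KA KA bR]
  text \<open>Sandwiching by \<open>S(y\<^sub>1)\<close> and \<open>y\<^sub>2\<close> lets the antipode identities pass to products.\<close>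
  have L_mult: "?L (t \<otimes>\<^bsub>tensor H H\<^esub> s) = c \<odot> ?L s"
    if t: "t \<in> carrier (tensor H H)" and s: "s \<in> carrier (tensor H H)" and Lt: "?L t = c \<odot> \<one>" for s t c
    using s
  proof (induction rule: tensor_induct[OF KA KA, consumes 1, case_names pure add])
    case (pure y\<^sub>1 y\<^sub>2)
    have "?L (t \<otimes>\<^bsub>tensor H H\<^esub> pure_tensor H H y\<^sub>1 y\<^sub>2) = ?S y\<^sub>1 \<otimes> ?L t \<otimes> y\<^sub>2"
      using t
      by (induction rule: tensor_induct[OF KA KA, consumes 1, case_names pure add])
         (simp_all add: pure pure_tensor_mult[OF KA KA] Lp ptc S_mult S_cl m_assoc HH.l_distr
           linear_map_add[OF Ll] linear_map_closed[OF Ll] l_distr r_distr)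
    then show ?case using pure by (simp add: Lt Lp S_cl smult_mult_left smult_mult_right)
  next
    case (add r s)
    then show ?case
      using t by (simp add: HH.r_distr linear_map_add[OF Ll] linear_map_closed[OF Ll] smult_add_right)
  qed
  have R_mult: "?R (s \<otimes>\<^bsub>tensor H H\<^esub> t) = c \<odot> ?R s"
    if t: "t \<in> carrier (tensor H H)" and s: "s \<in> carrier (tensor H H)" and Rt: "?R t = c \<odot> \<one>" for s t c
    using s
  proof (induction rule: tensor_induct[OF KA KA, consumes 1, case_names pure add])
    case (pure y\<^sub>1 y\<^sub>2)
    have "?R (pure_tensor H H y\<^sub>1 y\<^sub>2 \<otimes>\<^bsub>tensor H H\<^esub> t) = y\<^sub>1 \<otimes> ?R t \<otimes> ?S y\<^sub>2"
      using t
      by (induction rule: tensor_induct[OF KA KA, consumes 1, case_names pure add])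
         (simp_all add: pure pure_tensor_mult[OF KA KA] Rp ptc S_mult S_cl m_assoc HH.r_distr
           linear_map_add[OF Rl] linear_map_closed[OF Rl] l_distr r_distr)
    then show ?case using pure by (simp add: Rt Rp S_cl smult_mult_left smult_mult_right)
  next
    case (add r s)
    then show ?case
      using t by (simp add: HH.l_distr linear_map_add[OF Rl] linear_map_closed[OF Rl] smult_add_right)
  qed
  have "x \<otimes> ?S h \<in> carrier H" using gens S_cl by blast
  then have Sx_closed: "?S x \<in> carrier H" by (simp add: Sx)
  \<comment> \<open>The left antipode law at \<open>x\<close>: the two terms come from
    \<open>x \<otimes> h\<close> and \<open>1 \<otimes> x\<close>. The value of the antipode at
    \<open>x\<close> is exactly the one that makes them cancel.\<close>
  have L_x: "?S x \<otimes> h \<oplus> x = \<zero>"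
    using gens S_cl by (simp add: Sx l_minus m_assoc Sh l_neg)
  have R_x: "x \<otimes> ?S h \<oplus> ?S x = \<zero>"
    using gens S_cl by (simp add: Sx r_neg)
  have antipode_both: "?L (comult H y) = counit H y \<odot> \<one> \<and> ?R (comult H y) = counit H y \<odot> \<one>"
    if "y \<in> carrier H" for y
  proof -
    have "y \<in> alg_span H {g, h, x}" using that generated by auto
    then show ?thesis
    proof induction
      case (gen s)
      then consider "s = g" | "s = h" | "s = x" by auto
      then show ?case
      proof cases
        case 3
        then show ?thesis
          by (simp add: comult_x counit_x ptc gens Lp Rp linear_map_add[OF Ll] linear_map_add[OF Rl]
              L_x R_x S_one Sx_closed)
      qed (simp_all add: comult_g comult_h counit_g counit_h gens Lp Rp Sg Sh)
    next
      case one
      then show ?case by (simp add: comult_one counit_one Lp Rp S_one)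
    next
      case (add y z)
      then show ?case
        using alg_span_closed[OF KA S_sub] cm algebra_hom_add[OF counit_hom]
        by (simp add: algebra_hom_add[OF comult_hom] linear_map_add[OF Ll] linear_map_add[OF Rl] smult_add_left)
    next
      case (mult y z)
      then show ?case
        using alg_span_closed[OF KA S_sub] cm
        by (simp add: algebra_hom_mult[OF comult_hom] L_mult[of "comult H y" "comult H z" "counit H y"]
            R_mult[of "comult H z" "comult H y" "counit H z"] counit_mult smult_smult mult.commute)
    next
      case (smult y c)
      then show ?case
        using alg_span_closed[OF KA S_sub] cm algebra_hom_smult[OF counit_hom]
        by (simp add: algebra_hom_smult[OF comult_hom] linear_map_smult[OF Ll] linear_map_smult[OF Rl] smult_smult)
    qed
  qed
  show ?thesis
    by (intro hopf_algebra.intro hopf_algebra_axioms.intro KA comult_hom counit_hom coassoc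
        counit_left counit_right S_lin)
       (use antipode_both in auto)
qed

end

section \<open>Gaussian binomials and the noncommutative binomial theorem at a root of unity\<close>

section \<open>Gaussian binomial coefficients\<close>

text \<open>Of the two Pascal rules this is the one that arises when a power of \<open>a + b\<close>
  with \<open>b a = q a b\<close> is multiplied by \<open>a + b\<close> from the left.\<close>

fun qbin :: "'k::field \<Rightarrow> nat \<Rightarrow> nat \<Rightarrow> 'k" where
  "qbin q j 0 = 1"
| "qbin q 0 (Suc l) = 0"
| "qbin q (Suc j) (Suc l) = qbin q j l + q ^ Suc l * qbin q j (Suc l)"

definition qint :: "'k::field \<Rightarrow> nat \<Rightarrow> 'k" where
  "qint q k = (\<Sum>i<k. q ^ i)"

definition qfact :: "'k::field \<Rightarrow> nat \<Rightarrow> 'k" where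
  "qfact q k = (\<Prod>i<k. qint q (Suc i))"

lemma qint_add: "qint q (a + b) = qint q a + q ^ a * qint q b"
  by (induction b) (simp_all add: qint_def algebra_simps power_add)

lemma qfact_Suc: "qfact q (Suc k) = qint q (Suc k) * qfact q k"
  by (simp add: qfact_def)

lemma qbin_eq_0: "j < l \<Longrightarrow> qbin q j l = 0"
  by (induction q j l rule: qbin.induct) auto

text \<open>The quotient formula for Gaussian binomials, written without division because the
  q-factorials vanish from \<open>m\<close> on when \<open>q\<close> has order \<open>m\<close>. The
  induction combines the Pascal rule with \<open>qint_add\<close>.\<close>

lemma qbin_qfact: "l \<le> j \<Longrightarrow> qbin q j l * (qfact q l * qfact q (j - l)) = qfact q j"
proof (induction q j l rule: qbin.induct)
  case (3 q j l)
  show ?case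
  proof (cases "l = j")
    case True
    then show ?thesis
      using 3 by (simp add: qbin_eq_0 qfact_Suc mult.left_commute)
  next
    case False
    then have l: "Suc l \<le> j" using 3 by simp
    have jl: "j - l = Suc (j - Suc l)" using l by simp
    have "qbin q (Suc j) (Suc l) * (qfact q (Suc l) * qfact q (Suc j - Suc l)) =
        qint q (Suc l) * (qbin q j l * (qfact q l * qfact q (j - l))) +
        q ^ Suc l * qint q (j - l) * (qbin q j (Suc l) * (qfact q (Suc l) * qfact q (j - Suc l)))"
      by (simp add: jl qfact_Suc algebra_simps)
    also have "\<dots> = (qint q (Suc l) + q ^ Suc l * qint q (j - l)) * qfact q j"
      using 3 l by (simp add: algebra_simps)
    also have "qint q (Suc l) + q ^ Suc l * qint q (j - l) = qint q (Suc j)"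
      using l by (subst qint_add[symmetric]) simp
    finally show ?thesis by (simp add: qfact_Suc)
  qed
qed (auto simp: qfact_def)

text \<open>The bound on \<open>m\<close> is included so that \<open>q\<close> is different from
  1.\<close>

definition has_order :: "'k::field \<Rightarrow> nat \<Rightarrow> bool" where
  "has_order q m \<longleftrightarrow> m \<ge> 2 \<and> q ^ m = 1 \<and> (\<forall>k. 0 < k \<and> k < m \<longrightarrow> q ^ k \<noteq> 1)"

text \<open>If \<open>q ^ k = 1\<close> with \<open>k > 0\<close>, then \<open>q\<close> has at most
  \<open>k\<close> distinct powers, while its powers exhaust a set of \<open>m\<close>
  elements.\<close>

lemma primitive_root_has_order:
  assumes "primitive_root_of_unity m q" "m \<ge> 2"
  shows "has_order q m"
proof -
  have card: "card (range (\<lambda>i::nat. q ^ i)) = m" and roots: "roots_of_unity m = range (\<lambda>i::nat. q ^ i)"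
    using assms unfolding primitive_root_of_unity_def generates_roots_def by auto
  have "q \<in> roots_of_unity m" unfolding roots by (rule range_eqI[of _ _ 1]) simp
  then have qm: "q ^ m = 1" by (simp add: roots_of_unity_def)
  have "q ^ k \<noteq> 1" if "0 < k" "k < m" for k
  proof
    assume "q ^ k = 1"
    have "q ^ i = q ^ (i mod k)" for i
    proof -
      have "q ^ i = q ^ (k * (i div k) + i mod k)" by simp
      then show ?thesis by (simp only: power_add power_mult \<open>q ^ k = 1\<close> power_one mult_1_left)
    qed
    then have "range (\<lambda>i::nat. q ^ i) \<subseteq> (\<lambda>i. q ^ i) ` {..<k}"
      using \<open>0 < k\<close> by (metis (no_types, lifting) image_subsetI lessThan_iff mod_less_divisor rev_image_eqI)
    then have "card (range (\<lambda>i::nat. q ^ i)) \<le> k"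
      by (metis card_image_le card_lessThan card_mono finite_imageI finite_lessThan order_trans)
    then show False using card that by simp
  qed
  then show ?thesis using qm assms(2) by (simp add: has_order_def)
qed

context
  fixes q :: "'k::field" and m
  assumes q: "has_order q m"
begin

lemma order_ge_2: "m \<ge> 2" and order_power: "q ^ m = 1" and order_nonzero: "q \<noteq> 0" and order_neq_1: "q \<noteq> 1"
  using q unfolding has_order_def by (auto simp: power_0_left split: if_splits dest: spec[of _ 1])

lemma qint_mult: "(q - 1) * qint q k = q ^ k - 1"
  by (induction k) (simp_all add: qint_def algebra_simps)

lemma qint_order: "qint q m = 0"
  using qint_mult[of m] order_power order_neq_1 by simp

lemma qint_nonzero: "0 < k \<Longrightarrow> k < m \<Longrightarrow> qint q k \<noteq> 0"
  using qint_mult[of k] q by (auto simp: has_order_def)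

lemma qfact_nonzero: "k < m \<Longrightarrow> qfact q k \<noteq> 0"
  using qint_nonzero by (auto simp: qfact_def)

lemma qbin_nonzero: "l \<le> j \<Longrightarrow> j < m \<Longrightarrow> qbin q j l \<noteq> 0"
  using qbin_qfact[of l j q] qfact_nonzero[of j] by auto

text \<open>The q-factorial of \<open>m\<close> contains the factor \<open>qint q m = 0\<close>,
  while those of \<open>l\<close> and \<open>m - l\<close> do not vanish.\<close>

lemma qbin_order: "0 < l \<Longrightarrow> l < m \<Longrightarrow> qbin q m l = 0"
proof -
  assume "0 < l" "l < m"
  moreover have "qfact q m = 0"
    using order_ge_2 qint_order by (cases m) (auto simp: qfact_Suc)
  ultimately show "qbin q m l = 0"
    using qbin_qfact[of l m q] qfact_nonzero[of l] qfact_nonzero[of "m - l"] by auto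
qed

end

context k_algebra
begin

lemma qcommute_pow:
  assumes "a \<in> carrier A" "b \<in> carrier A" "b \<otimes> a = q \<odot> (a \<otimes> b)"
  shows "b \<otimes> (a [^] (l::nat)) = q ^ l \<odot> (a [^] l \<otimes> b)"
proof (induction l)
  case (Suc l)
  have "b \<otimes> (a [^] Suc l) = (b \<otimes> a [^] l) \<otimes> a" using assms by (simp add: m_assoc)
  also have "\<dots> = q ^ l \<odot> (a [^] l \<otimes> (b \<otimes> a))"
    using assms(1,2) by (simp add: Suc smult_mult_left m_assoc)
  also have "\<dots> = q ^ Suc l \<odot> (a [^] Suc l \<otimes> b)"
    unfolding assms(3) using assms(1,2) by (simp add: smult_mult_right smult_smult m_assoc mult.commute)
  finally show ?case .
qed (use assms in simp)

lemma qcommute_pow':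
  assumes "a \<in> carrier A" "b \<in> carrier A" "b \<otimes> a = q \<odot> (a \<otimes> b)"
  shows "b [^] (l::nat) \<otimes> a = q ^ l \<odot> (a \<otimes> b [^] l)"
proof (induction l)
  case (Suc l)
  have "b [^] Suc l \<otimes> a = b [^] l \<otimes> (b \<otimes> a)" using assms by (simp add: m_assoc)
  also have "\<dots> = q \<odot> ((b [^] l \<otimes> a) \<otimes> b)"
    unfolding assms(3) using assms(1,2) by (simp add: smult_mult_right m_assoc)
  also have "\<dots> = q ^ Suc l \<odot> (a \<otimes> b [^] Suc l)"
    using assms(1,2) by (simp add: Suc smult_mult_left smult_smult m_assoc)
  finally show ?case .
qed (use assms in simp)

lemma qbinomial:
  assumes a: "a \<in> carrier A" and b: "b \<in> carrier A" and ba: "b \<otimes> a = q \<odot> (a \<otimes> b)"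
  shows "(a \<oplus> b) [^] j = (\<Oplus>l\<in>{..j}. qbin q j l \<odot> (a [^] l \<otimes> b [^] (j - l)))"
proof (induction j)
  case 0
  then show ?case by (simp add: finsum_insert)
next
  case (Suc j)
  let ?t = "\<lambda>l. a [^] l \<otimes> b [^] (j - l)"
  let ?u = "\<lambda>l. a [^] l \<otimes> b [^] (Suc j - l)"
  have cl: "?t l \<in> carrier A" "?u l \<in> carrier A" for l using a b by auto
  have at: "a \<otimes> ?t l = ?u (Suc l)" for l
    using a b by (simp add: m_assoc[symmetric] nat_pow_Suc2[symmetric] del: nat_pow_Suc)
  have bt: "b \<otimes> ?t l = q ^ l \<odot> ?u l" if "l \<le> j" for l
  proof -
    have "b \<otimes> ?t l = q ^ l \<odot> (a [^] l \<otimes> (b \<otimes> b [^] (j - l)))"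
      using a b by (simp add: m_assoc[symmetric] qcommute_pow[OF a b ba] smult_mult_left)
    also have "b \<otimes> b [^] (j - l) = b [^] (Suc j - l)"
      using that b by (simp add: nat_pow_Suc2[symmetric] Suc_diff_le del: nat_pow_Suc)
    finally show ?thesis .
  qed
  have "(a \<oplus> b) [^] Suc j = (a \<oplus> b) \<otimes> (\<Oplus>l\<in>{..j}. qbin q j l \<odot> ?t l)"
    using a b Suc nat_pow_Suc2[of "a \<oplus> b" j] by simp
  also have "\<dots> = a \<otimes> (\<Oplus>l\<in>{..j}. qbin q j l \<odot> ?t l) \<oplus> b \<otimes> (\<Oplus>l\<in>{..j}. qbin q j l \<odot> ?t l)"
    using a b cl by (intro l_distr finsum_closed) auto
  also have "a \<otimes> (\<Oplus>l\<in>{..j}. qbin q j l \<odot> ?t l) = (\<Oplus>l\<in>{..j}. a \<otimes> (qbin q j l \<odot> ?t l))"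
    by (rule finsum_rdistr) (use a cl in auto)
  also have "\<dots> = (\<Oplus>l\<in>{..j}. qbin q j l \<odot> ?u (Suc l))"
    by (rule finsum_cong') (use a b cl in \<open>auto simp: smult_mult_right at simp del: nat_pow_Suc\<close>)
  also have "b \<otimes> (\<Oplus>l\<in>{..j}. qbin q j l \<odot> ?t l) = (\<Oplus>l\<in>{..j}. b \<otimes> (qbin q j l \<odot> ?t l))"
    by (rule finsum_rdistr) (use b cl in auto)
  also have "\<dots> = (\<Oplus>l\<in>{..j}. (q ^ l * qbin q j l) \<odot> ?u l)"
    by (rule finsum_cong') (use b cl in \<open>auto simp: smult_mult_right bt smult_smult mult.commute simp del: nat_pow_Suc\<close>)
  \<comment> \<open>The added summand is zero by \<open>qbin_eq_0\<close>. Extending the range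
    allows the summand at index 0 to be split off, after which both sums run over the same shifted
    terms.\<close>
  also have "\<dots> = (\<Oplus>l\<in>{..Suc j}. (q ^ l * qbin q j l) \<odot> ?u l)"
    by (rule add.finprod_mono_neutral_cong_left)
       (use a b cl in \<open>auto simp: qbin_eq_0 simp del: nat_pow_Suc\<close>)
  also have "\<dots> = (\<Oplus>l\<in>{..j}. (q ^ Suc l * qbin q j (Suc l)) \<odot> ?u (Suc l)) \<oplus> qbin q j 0 \<odot> ?u 0"
    using a b cl by (subst finsum_Suc2) (auto simp del: nat_pow_Suc)
  also have "(\<Oplus>l\<in>{..j}. qbin q j l \<odot> ?u (Suc l)) \<oplus>
      ((\<Oplus>l\<in>{..j}. (q ^ Suc l * qbin q j (Suc l)) \<odot> ?u (Suc l)) \<oplus> qbin q j 0 \<odot> ?u 0) =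
      (\<Oplus>l\<in>{..j}. qbin q j l \<odot> ?u (Suc l) \<oplus> (q ^ Suc l * qbin q j (Suc l)) \<odot> ?u (Suc l)) \<oplus> qbin q j 0 \<odot> ?u 0"
    using a b cl by (subst a_assoc[symmetric]) (auto simp: finsum_addf simp del: nat_pow_Suc)
  also have "\<dots> = (\<Oplus>l\<in>{..j}. qbin q (Suc j) (Suc l) \<odot> ?u (Suc l)) \<oplus> qbin q (Suc j) 0 \<odot> ?u 0"
  proof -
    have "(\<Oplus>l\<in>{..j}. qbin q j l \<odot> ?u (Suc l) \<oplus> (q ^ Suc l * qbin q j (Suc l)) \<odot> ?u (Suc l)) =
        (\<Oplus>l\<in>{..j}. qbin q (Suc j) (Suc l) \<odot> ?u (Suc l))"
      by (rule finsum_cong') (use a b in \<open>auto simp: smult_add_left\<close>)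
    then show ?thesis by simp
  qed
  also have "\<dots> = (\<Oplus>l\<in>{..Suc j}. qbin q (Suc j) l \<odot> ?u l)"
    using a b cl by (subst finsum_Suc2) (auto simp del: nat_pow_Suc)
  finally show ?case .
qed

lemma finsum_pair: "i \<noteq> j \<Longrightarrow> f i \<in> carrier A \<Longrightarrow> f j \<in> carrier A \<Longrightarrow> (\<Oplus>l\<in>{i, j}. f l) = f i \<oplus> f j"
  by (simp add: finsum_insert)

text \<open>All middle terms of the binomial expansion vanish. This is what makes the
  comultiplication compatible with \<open>x^m = 0\<close>.\<close>

lemma qbinomial_order:
  assumes "has_order q m" and a: "a \<in> carrier A" and b: "b \<in> carrier A" and ba: "b \<otimes> a = q \<odot> (a \<otimes> b)"
  shows "(a \<oplus> b) [^] m = a [^] m \<oplus> b [^] m"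
proof -
  obtain m' where m: "m = Suc m'" using order_ge_2[OF assms(1)] by (cases m) auto
  let ?u = "\<lambda>l. a [^] l \<otimes> b [^] (m - l)"
  have cl: "?u l \<in> carrier A" for l using a b by auto
  have "(a \<oplus> b) [^] m = (\<Oplus>l\<in>{..m}. qbin q m l \<odot> ?u l)"
    by (rule qbinomial[OF a b ba])
  also have "\<dots> = (\<Oplus>l\<in>{0, m}. qbin q m l \<odot> ?u l)"
    by (rule add.finprod_mono_neutral_cong_right)
       (use cl qbin_order[OF assms(1)] in \<open>auto simp: Pi_def\<close>)
  also have "\<dots> = qbin q m 0 \<odot> ?u 0 \<oplus> qbin q m m \<odot> ?u m"
    by (rule finsum_pair) (use a b m in auto)
  also have "qbin q k k = 1" for k
    by (induction k) (simp_all add: qbin_eq_0)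
  finally show ?thesis using a b by (simp add: a_comm)
qed

end


section \<open>From the defining relations to a basis of monomials\<close>

section \<open>The defining relations\<close>

definition taft_relations ::
  "('k::field, 'a, 'z) module_scheme \<Rightarrow> nat \<Rightarrow> 'k \<Rightarrow> 'a \<Rightarrow> 'a \<Rightarrow> bool" where
  "taft_relations A m q h x \<longleftrightarrow> h \<in> carrier A \<and> x \<in> carrier A \<and> h [^]\<^bsub>A\<^esub> m = \<one>\<^bsub>A\<^esub> \<and> x [^]\<^bsub>A\<^esub> m = \<zero>\<^bsub>A\<^esub> \<and>
     x \<otimes>\<^bsub>A\<^esub> h = q \<odot>\<^bsub>A\<^esub> (h \<otimes>\<^bsub>A\<^esub> x)"

definition T_relations ::
  "('k::field, 'a, 'z) module_scheme \<Rightarrow> nat \<Rightarrow> nat \<Rightarrow> 'k \<Rightarrow> 'k \<Rightarrow> 'a \<Rightarrow> 'a \<Rightarrow> 'a \<Rightarrow> bool" where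
  "T_relations A n m \<omega> q g h x \<longleftrightarrow> taft_relations A m q h x \<and> g \<in> carrier A \<and> g [^]\<^bsub>A\<^esub> n = \<one>\<^bsub>A\<^esub> \<and>
     h \<otimes>\<^bsub>A\<^esub> g = g \<otimes>\<^bsub>A\<^esub> h \<and> g \<otimes>\<^bsub>A\<^esub> x = \<omega> \<odot>\<^bsub>A\<^esub> (x \<otimes>\<^bsub>A\<^esub> g)"

lemma (in k_algebra) minus_eq_zero_iff: "a \<in> carrier A \<Longrightarrow> b \<in> carrier A \<Longrightarrow> a \<ominus> b = \<zero> \<longleftrightarrow> a = b"
  using minus_equality[of a "\<ominus> b"] by (auto simp: a_minus_def r_neg)

context
  fixes B :: "('k::field, 'b, 'z) module_scheme" and X :: "gen set" and b :: "gen \<Rightarrow> 'b"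
  assumes B: "k_algebra B" and b: "b \<in> X \<rightarrow> carrier B"
begin

interpretation B: k_algebra B by (rule B)

lemma eval_taft_relators:
  assumes "gen_h \<in> X" "gen_x \<in> X"
  shows "(\<forall>r\<in>taft_relators m q. linear_extension B (word_eval B b) r = \<zero>\<^bsub>B\<^esub>) \<longleftrightarrow>
    taft_relations B m q (b gen_h) (b gen_x)"
proof -
  have [simp]: "b gen_h \<in> carrier B" "b gen_x \<in> carrier B" using b assms by auto
  have [simp]: "replicate m gen_h \<in> lists X" "replicate m gen_x \<in> lists X"
    using assms by (auto simp: in_lists_conv_set)
  show ?thesis
    unfolding taft_relators_def taft_relations_def
    using assms by (simp add: free_eval_diff[OF B b] linear_extension_single[OF B] word_eval_closed[OF B b]
        word_eval_replicate[OF B b] B.minus_eq_zero_iff)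
qed

lemma eval_T_relators:
  assumes "gen_g \<in> X" "gen_h \<in> X" "gen_x \<in> X"
  shows "(\<forall>r\<in>T_relators n m \<omega> q. linear_extension B (word_eval B b) r = \<zero>\<^bsub>B\<^esub>) \<longleftrightarrow>
    T_relations B n m \<omega> q (b gen_g) (b gen_h) (b gen_x)"
proof -
  have [simp]: "b gen_g \<in> carrier B" "b gen_h \<in> carrier B" "b gen_x \<in> carrier B" using b assms by auto
  have [simp]: "replicate n gen_g \<in> lists X"
    using assms by (auto simp: in_lists_conv_set)
  have "(\<forall>r\<in>T_relators n m \<omega> q - taft_relators m q \<union> taft_relators m q. linear_extension B (word_eval B b) r = \<zero>\<^bsub>B\<^esub>)
     \<longleftrightarrow> T_relations B n m \<omega> q (b gen_g) (b gen_h) (b gen_x)"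
    unfolding T_relators_def T_relations_def Un_Diff_cancel2 ball_Un eval_taft_relators[OF assms(2,3)]
    using assms by (auto simp add: free_eval_diff[OF B b] word_eval_closed[OF B b] ball_Un
        word_eval_replicate[OF B b] B.minus_eq_zero_iff eval_taft_relators)
  moreover have "T_relators n m \<omega> q - taft_relators m q \<union> taft_relators m q = T_relators n m \<omega> q"
    by (auto simp: T_relators_def)
  ultimately show ?thesis by simp
qed

end

lemma taft_relators_closed:
  "gen_h \<in> X \<Longrightarrow> gen_x \<in> X \<Longrightarrow> taft_relators m q \<subseteq> carrier (free_algebra X)"
  unfolding taft_relators_def by (auto intro!: diff_in_free single_in_free simp: in_lists_conv_set)

lemma T_relators_closed:
  "gen_g \<in> X \<Longrightarrow> gen_h \<in> X \<Longrightarrow> gen_x \<in> X \<Longrightarrow> T_relators n m \<omega> q \<subseteq> carrier (free_algebra X)"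
  unfolding T_relators_def using taft_relators_closed[of X m q]
  by (auto intro!: diff_in_free single_in_free simp: in_lists_conv_set)


section \<open>Linear combinations and dual bases\<close>

definition lin_combs :: "('k::field, 'a, 'z) module_scheme \<Rightarrow> ('i \<Rightarrow> 'a) \<Rightarrow> 'i set \<Rightarrow> 'a set" where
  "lin_combs A b I = range (\<lambda>c. \<Oplus>\<^bsub>A\<^esub>p\<in>I. c p \<odot>\<^bsub>A\<^esub> b p)"

text \<open>A finite basis bundled with its coordinate functionals: the delta condition contains
  independence, and the expansion formula contains spanning. Equations between elements are thus
  tested one coordinate at a time.\<close>

definition dual_basis ::
  "('k::field, 'a, 'z) module_scheme \<Rightarrow> 'i set \<Rightarrow> ('i \<Rightarrow> 'a) \<Rightarrow> ('i \<Rightarrow> 'a \<Rightarrow> 'k) \<Rightarrow> bool" where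
  "dual_basis A I b co \<longleftrightarrow> finite I \<and> b \<in> I \<rightarrow> carrier A \<and> (\<forall>p\<in>I. linear_map A scalars (co p)) \<and>
     (\<forall>p\<in>I. \<forall>p'\<in>I. co p (b p') = (if p = p' then 1 else 0)) \<and>
     (\<forall>y\<in>carrier A. y = (\<Oplus>\<^bsub>A\<^esub>p\<in>I. co p y \<odot>\<^bsub>A\<^esub> b p))"

lemma finsum_scalars: "finite I \<Longrightarrow> (\<Oplus>\<^bsub>scalars\<^esub>p\<in>I. f p) = (\<Sum>p\<in>I. f p :: 'k::field)"
proof (induction I rule: finite_induct)
  case (insert i I)
  interpret S: k_algebra "scalars :: ('k, 'k) module" by (rule k_algebra_scalars)
  show ?case using insert by (subst S.finsum_insert) auto
next
  case empty
  interpret S: k_algebra "scalars :: ('k, 'k) module" by (rule k_algebra_scalars)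
  show ?case by simp
qed

context k_algebra
begin

lemma lin_combs_zero:
  assumes "b \<in> I \<rightarrow> carrier A" shows "\<zero> \<in> lin_combs A b I"
proof -
  have "\<zero> = (\<Oplus>p\<in>I. 0 \<odot> b p)"
    by (rule add.finprod_one_eqI[symmetric]) (use funcset_mem[OF assms] in auto)
  then show ?thesis by (auto simp: lin_combs_def)
qed

lemma lin_combs_add:
  assumes "b \<in> I \<rightarrow> carrier A" "y \<in> lin_combs A b I" "z \<in> lin_combs A b I"
  shows "y \<oplus> z \<in> lin_combs A b I"
proof -
  obtain c d where y: "y = (\<Oplus>p\<in>I. c p \<odot> b p)" and z: "z = (\<Oplus>p\<in>I. d p \<odot> b p)"
    using assms(2,3) by (auto simp: lin_combs_def)
  have "y \<oplus> z = (\<Oplus>p\<in>I. c p \<odot> b p \<oplus> d p \<odot> b p)"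
    unfolding y z by (rule finsum_addf[symmetric]) (use assms(1) in auto)
  also have "\<dots> = (\<Oplus>p\<in>I. (c p + d p) \<odot> b p)"
    by (rule finsum_cong') (use funcset_mem[OF assms(1)] in \<open>auto simp: smult_add_left\<close>)
  finally show ?thesis by (auto simp: lin_combs_def)
qed

lemma lin_combs_smult:
  assumes "b \<in> I \<rightarrow> carrier A" "y \<in> lin_combs A b I"
  shows "c \<odot> y \<in> lin_combs A b I"
proof -
  obtain d where y: "y = (\<Oplus>p\<in>I. d p \<odot> b p)"
    using assms(2) by (auto simp: lin_combs_def)
  have "c \<odot> y = (\<Oplus>p\<in>I. c \<odot> (d p \<odot> b p))"
    unfolding y by (rule smult_finsum) (use assms(1) in auto)
  also have "\<dots> = (\<Oplus>p\<in>I. (c * d p) \<odot> b p)"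
    by (rule finsum_cong') (use funcset_mem[OF assms(1)] in \<open>auto simp: smult_smult\<close>)
  finally show ?thesis by (auto simp: lin_combs_def)
qed

lemma lin_combs_basis:
  assumes "b \<in> I \<rightarrow> carrier A" "finite I" "p \<in> I"
  shows "b p \<in> lin_combs A b I"
proof -
  have "(\<Oplus>p'\<in>I. (if p' = p then 1 else 0) \<odot> b p') = (\<Oplus>p'\<in>{p}. b p')"
    by (rule add.finprod_mono_neutral_cong_right) (use assms funcset_mem[OF assms(1)] in auto)
  also have "\<dots> = b p" using funcset_mem[OF assms(1,3)] by (simp add: finsum_insert)
  finally show ?thesis unfolding lin_combs_def by (metis (mono_tags) rangeI)
qed

lemma lin_combs_induct [consumes 2, case_names zero step]:
  assumes "b \<in> I \<rightarrow> carrier A" "y \<in> lin_combs A b I"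
    and zero: "P \<zero>" and step: "\<And>c p y. p \<in> I \<Longrightarrow> y \<in> carrier A \<Longrightarrow> P y \<Longrightarrow> P (c \<odot> b p \<oplus> y)"
  shows "P y"
proof -
  obtain c where y: "y = (\<Oplus>p\<in>I. c p \<odot> b p)"
    using assms(2) by (auto simp: lin_combs_def)
  have cl: "p \<in> I \<Longrightarrow> c p \<odot> b p \<in> carrier A" for p using assms(1) by auto
  have "P (\<Oplus>p\<in>J. c p \<odot> b p)" if "J \<subseteq> I" "finite J" for J
    using that(2,1)
  proof (induction J rule: finite_induct)
    case (insert p J)
    have "(\<Oplus>p\<in>J. c p \<odot> b p) \<in> carrier A" using insert cl by (intro finsum_closed) auto
    moreover have "(\<Oplus>p\<in>insert p J. c p \<odot> b p) = c p \<odot> b p \<oplus> (\<Oplus>p\<in>J. c p \<odot> b p)"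
      using insert cl by (intro finsum_insert) auto
    ultimately show ?case using insert step by auto
  qed (simp add: zero)
  then show ?thesis unfolding y by (cases "finite I") (auto simp: zero finsum_infinite)
qed

lemma dual_basisI:
  assumes "finite I" and b: "b \<in> I \<rightarrow> carrier A" and lin: "\<And>p. p \<in> I \<Longrightarrow> linear_map A scalars (co p)"
    and delta: "\<And>p p'. p \<in> I \<Longrightarrow> p' \<in> I \<Longrightarrow> co p (b p') = (if p = p' then 1 else 0)"
    and span: "carrier A \<subseteq> lin_combs A b I"
  shows "dual_basis A I b co"
proof -
  have "y = (\<Oplus>p\<in>I. co p y \<odot> b p)" if y: "y \<in> carrier A" for y
  proof -
    obtain c where yc: "y = (\<Oplus>p\<in>I. c p \<odot> b p)"
      using y span by (auto simp: lin_combs_def)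
    have "co p y = c p" if p: "p \<in> I" for p
    proof -
      have "co p y = (\<Sum>p'\<in>I. co p (c p' \<odot> b p'))"
        unfolding yc using linear_map_finsum[OF is_k_algebra k_algebra_scalars lin[OF p], of "\<lambda>p'. c p' \<odot> b p'" I] b
        by (auto simp: finsum_scalars assms(1))
      also have "\<dots> = (\<Sum>p'\<in>I. c p' * (if p = p' then 1 else 0))"
        using p funcset_mem[OF b] by (intro sum.cong refl) (simp add: linear_map_smult[OF lin[OF p]] delta)
      finally show ?thesis using p assms(1) by (simp add: if_distrib[of "(*) _"] cong: if_cong)
    qed
    then have "(\<Oplus>p\<in>I. c p \<odot> b p) = (\<Oplus>p\<in>I. co p y \<odot> b p)"
      by (intro finsum_cong') (use b in auto)
    then show ?thesis using yc by simp
  qed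
  then show ?thesis using assms by (auto simp: dual_basis_def)
qed

lemma dual_basis_eqI:
  assumes "dual_basis A I b co" "y \<in> carrier A" "z \<in> carrier A" "\<And>p. p \<in> I \<Longrightarrow> co p y = co p z"
  shows "y = z"
proof -
  have "y = (\<Oplus>p\<in>I. co p y \<odot> b p)" "z = (\<Oplus>p\<in>I. co p z \<odot> b p)" "b \<in> I \<rightarrow> carrier A"
    using assms by (auto simp: dual_basis_def)
  moreover have "(\<Oplus>p\<in>I. co p y \<odot> b p) = (\<Oplus>p\<in>I. co p z \<odot> b p)"
    by (rule finsum_cong') (use assms(4) \<open>b \<in> I \<rightarrow> carrier A\<close> in auto)
  ultimately show ?thesis by simp
qed

end

lemma same_algebra_alg_span:
  assumes "same_algebra A A'" shows "alg_span A S \<subseteq> alg_span A' S"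
proof
  fix y assume "y \<in> alg_span A S"
  then show "y \<in> alg_span A' S"
    by induction (use assms in \<open>auto simp: same_algebra_def intro: alg_span.intros\<close>)
qed

section \<open>Monomials\<close>

definition monomial ::
  "('k::field, 'a, 'z) module_scheme \<Rightarrow> 'a \<Rightarrow> 'a \<Rightarrow> 'a \<Rightarrow> nat \<times> nat \<times> nat \<Rightarrow> 'a" where
  "monomial A g h x = (\<lambda>(i, j, k). h [^]\<^bsub>A\<^esub> i \<otimes>\<^bsub>A\<^esub> x [^]\<^bsub>A\<^esub> j \<otimes>\<^bsub>A\<^esub> g [^]\<^bsub>A\<^esub> k)"

abbreviation monomial_index :: "nat \<Rightarrow> nat \<Rightarrow> (nat \<times> nat \<times> nat) set" where
  "monomial_index m n \<equiv> {..<m} \<times> {..<m} \<times> {..<n}"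

lemma (in k_algebra) lin_combs_closed:
  assumes "b \<in> I \<rightarrow> carrier A" "y \<in> lin_combs A b I" shows "y \<in> carrier A"
  using assms by (auto simp: lin_combs_def intro!: finsum_closed)

lemma (in k_algebra) pow_mod:
  assumes "a \<in> carrier A" "a [^] (m::nat) = \<one>"
  shows "a [^] (i::nat) = a [^] (i mod m)"
proof -
  have "a [^] (m * (i div m)) = \<one>"
    using assms by (simp add: nat_pow_pow[symmetric])
  moreover have "a [^] (m * (i div m) + i mod m) = a [^] (m * (i div m)) \<otimes> a [^] (i mod m)"
    by (rule nat_pow_mult[symmetric]) (rule assms)
  ultimately show ?thesis using assms(1) by (simp only: mult_div_mod_eq l_one nat_pow_closed)
qed

text \<open>The elements may live in any algebra and need not generate it. Taft algebras are covered
  with \<open>n = 1\<close> and \<open>g = 1\<close>.\<close>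

locale T_generators = k_algebra A for A :: "('k::field, 'a, 'z) module_scheme" (structure) +
  fixes n m :: nat and \<omega> q :: 'k and g h x :: 'a
  assumes rels: "T_relations A n m \<omega> q g h x"
begin

lemma in_carrier [simp]: "g \<in> carrier A" "h \<in> carrier A" "x \<in> carrier A"
  and h_order: "h [^] m = \<one>" and x_nilpotent: "x [^] m = \<zero>" and g_order: "g [^] n = \<one>"
  and xh: "x \<otimes> h = q \<odot> (h \<otimes> x)" and hg: "h \<otimes> g = g \<otimes> h" and gx: "g \<otimes> x = \<omega> \<odot> (x \<otimes> g)"
  using rels by (auto simp: T_relations_def taft_relations_def)

lemma monomial_closed [simp]: "monomial A g h x p \<in> carrier A"
  by (cases p) (simp add: monomial_def)

lemma gh_pow: "g \<otimes> h [^] (i::nat) = h [^] i \<otimes> g"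
  using qcommute_pow[of h g 1 i] by (simp add: hg)

lemma gx_pow: "g \<otimes> x [^] (j::nat) = \<omega> ^ j \<odot> (x [^] j \<otimes> g)"
  by (rule qcommute_pow) (simp_all add: gx)

lemma xh_pow: "x \<otimes> h [^] (i::nat) = q ^ i \<odot> (h [^] i \<otimes> x)"
  by (rule qcommute_pow) (simp_all add: xh)

lemma h_monomial: "h \<otimes> monomial A g h x (i, j, k) = monomial A g h x (Suc i, j, k)"
proof -
  have "h \<otimes> h [^] i = h [^] Suc i" by (rule nat_pow_Suc2[symmetric]) simp
  then show ?thesis by (simp add: monomial_def m_assoc[symmetric] del: nat_pow_Suc)
qed

lemma x_monomial: "x \<otimes> monomial A g h x (i, j, k) = q ^ i \<odot> monomial A g h x (i, Suc j, k)"
proof -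
  have "x \<otimes> monomial A g h x (i, j, k) = (x \<otimes> h [^] i) \<otimes> (x [^] j \<otimes> g [^] k)"
    by (simp add: monomial_def m_assoc)
  also have "\<dots> = q ^ i \<odot> (h [^] i \<otimes> (x \<otimes> x [^] j) \<otimes> g [^] k)"
    by (simp add: xh_pow smult_mult_left m_assoc)
  also have "x \<otimes> x [^] j = x [^] Suc j" by (rule nat_pow_Suc2[symmetric]) simp
  finally show ?thesis by (simp add: monomial_def)
qed

lemma g_monomial: "g \<otimes> monomial A g h x (i, j, k) = \<omega> ^ j \<odot> monomial A g h x (i, j, Suc k)"
proof -
  have "g \<otimes> monomial A g h x (i, j, k) = (g \<otimes> h [^] i) \<otimes> (x [^] j \<otimes> g [^] k)"
    by (simp add: monomial_def m_assoc)
  also have "\<dots> = h [^] i \<otimes> (g \<otimes> x [^] j) \<otimes> g [^] k"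
    by (simp add: gh_pow m_assoc)
  also have "\<dots> = \<omega> ^ j \<odot> (h [^] i \<otimes> x [^] j \<otimes> (g \<otimes> g [^] k))"
    by (simp add: gx_pow smult_mult_left smult_mult_right m_assoc)
  also have "g \<otimes> g [^] k = g [^] Suc k" by (rule nat_pow_Suc2[symmetric]) simp
  finally show ?thesis by (simp add: monomial_def)
qed

text \<open>The span of the monomials contains the unit and is stable under left multiplication by
  the generated algebra: each generator turns a monomial into a multiple of another, whose exponents
  are brought into range by the power relations.\<close>

lemma carrier_lin_combs:
  assumes "0 < m" "0 < n" and gen: "carrier A \<subseteq> alg_span A {g, h, x}"
  shows "carrier A \<subseteq> lin_combs A (monomial A g h x) (monomial_index m n)"
proof -
  let ?M = "monomial A g h x" and ?I = "monomial_index m n"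
  let ?V = "lin_combs A ?M ?I"
  have M: "?M \<in> ?I \<rightarrow> carrier A" by simp
  note V = lin_combs_zero[OF M] lin_combs_add[OF M] lin_combs_smult[OF M]
  note Vc = lin_combs_closed[OF M]
  have mono: "?M (i, j, k) \<in> ?V" for i j k
  proof (cases "j < m")
    case True
    have "?M (i, j, k) = ?M (i mod m, j, k mod n)"
      using pow_mod[OF _ h_order, of i] pow_mod[OF _ g_order, of k] by (simp add: monomial_def)
    then show ?thesis using True assms by (simp add: lin_combs_basis[OF M])
  next
    case False
    then have "x [^] j = x [^] (m + (j - m))" by simp
    also have "\<dots> = \<zero>" by (subst nat_pow_mult[symmetric]) (simp_all add: x_nilpotent)
    finally show ?thesis using V(1) by (simp add: monomial_def)
  qed
  have left: "y \<otimes> v \<in> ?V" if y: "y \<in> alg_span A {g, h, x}" and v: "v \<in> ?V" for y v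
    using y v
  proof (induction arbitrary: v)
    case (gen s)
    have s: "s \<in> carrier A" using gen by auto
    have sM: "s \<otimes> ?M p \<in> ?V" for p
      using gen mono V(3) by (cases p) (auto simp: g_monomial h_monomial x_monomial)
    from M gen(2) show ?case
    proof (induction rule: lin_combs_induct)
      case zero
      then show ?case using s V(1) by simp
    next
      case (step c p y)
      then show ?case using s sM V(2,3) by (simp add: r_distr smult_mult_right)
    qed
  next
    case one
    then show ?case using Vc by simp
  next
    case (add y z)
    then show ?case using V(2) Vc alg_span_closed[OF is_k_algebra _ add(1)] alg_span_closed[OF is_k_algebra _ add(2)]
      by (simp add: l_distr)
  next
    case (mult y z)
    then show ?case using Vc alg_span_closed[OF is_k_algebra _ mult(1)] alg_span_closed[OF is_k_algebra _ mult(2)]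
      by (simp add: m_assoc)
  next
    case (smult y c)
    then show ?case using V(3) Vc alg_span_closed[OF is_k_algebra _ smult(1)] by (simp add: smult_mult_left)
  qed
  show ?thesis
  proof
    fix y assume "y \<in> carrier A"
    moreover have "\<one> \<in> ?V" using mono[of 0 0 0] by (simp add: monomial_def)
    ultimately show "y \<in> ?V" using left[of y \<one>] gen by auto
  qed
qed

end


section \<open>A faithful representation\<close>

definition operator_algebra :: "('k::field, ('v \<Rightarrow> 'k) \<Rightarrow> 'v \<Rightarrow> 'k) module" where
  "operator_algebra =
     \<lparr>carrier = {f. (\<forall>\<phi> \<psi>. f (\<lambda>v. \<phi> v + \<psi> v) = (\<lambda>v. f \<phi> v + f \<psi> v)) \<and> (\<forall>c \<phi>. f (\<lambda>v. c * \<phi> v) = (\<lambda>v. c * f \<phi> v))},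
      monoid.mult = (\<lambda>f f' \<phi>. f (f' \<phi>)), one = (\<lambda>\<phi>. \<phi>), zero = (\<lambda>\<phi> v. 0), add = (\<lambda>f f' \<phi> v. f \<phi> v + f' \<phi> v),
      smult = (\<lambda>c f \<phi> v. c * f \<phi> v)\<rparr>"

lemma operator_algebra_simps:
  "f \<otimes>\<^bsub>operator_algebra\<^esub> f' = (\<lambda>\<phi>. f (f' \<phi>))" "\<one>\<^bsub>operator_algebra\<^esub> = (\<lambda>\<phi>. \<phi>)"
  "\<zero>\<^bsub>operator_algebra\<^esub> = (\<lambda>\<phi> v. 0)" "f \<oplus>\<^bsub>operator_algebra\<^esub> f' = (\<lambda>\<phi> v. f \<phi> v + f' \<phi> v)"
  "c \<odot>\<^bsub>operator_algebra\<^esub> f = (\<lambda>\<phi> v. c * f \<phi> v)"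
  by (simp_all add: operator_algebra_def)

lemma in_operator_algebra:
  "f \<in> carrier operator_algebra \<longleftrightarrow>
    (\<forall>\<phi> \<psi>. f (\<lambda>v. \<phi> v + \<psi> v) = (\<lambda>v. f \<phi> v + f \<psi> v)) \<and> (\<forall>c \<phi>. f (\<lambda>v. c * \<phi> v) = (\<lambda>v. c * f \<phi> v))"
  by (simp add: operator_algebra_def)

lemma k_algebra_operator: "k_algebra (operator_algebra :: ('k::field, ('v \<Rightarrow> 'k) \<Rightarrow> 'v \<Rightarrow> 'k) module)"
proof -
  let ?E = "operator_algebra :: ('k, ('v \<Rightarrow> 'k) \<Rightarrow> 'v \<Rightarrow> 'k) module"
  have "ring ?E"
  proof (rule ringI)
    show "abelian_group ?E"
    proof (rule abelian_groupI)
      fix f assume "f \<in> carrier ?E"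
      then show "\<exists>f'\<in>carrier ?E. f' \<oplus>\<^bsub>?E\<^esub> f = \<zero>\<^bsub>?E\<^esub>"
        by (intro bexI[of _ "\<lambda>\<phi> v. - f \<phi> v"]) (simp_all add: operator_algebra_simps in_operator_algebra)
    qed (simp_all add: operator_algebra_simps in_operator_algebra fun_eq_iff algebra_simps)
    show "Group.monoid ?E"
      by (rule monoidI) (simp_all add: operator_algebra_simps in_operator_algebra)
  qed (simp_all add: operator_algebra_simps in_operator_algebra)
  then show ?thesis
    by (rule k_algebraI) (simp_all add: operator_algebra_simps in_operator_algebra fun_eq_iff algebra_simps)
qed

text \<open>A cycle on the numbers below \<open>m\<close>, extended by the identity, so that its
  \<open>m\<close>-th power is the identity everywhere and \<open>h^m = 1\<close> holds on all
  functions.\<close>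

definition rotate_below :: "nat \<Rightarrow> nat \<Rightarrow> nat" where
  "rotate_below m i = (if i < m then Suc i mod m else i)"

lemma rotate_below_funpow: "i < m \<Longrightarrow> (rotate_below m ^^ k) i = (i + k) mod m"
  by (induction k) (auto simp: rotate_below_def mod_Suc_eq)

lemma rotate_below_funpow_id: "rotate_below m ^^ m = id"
proof
  fix i
  have "\<not> i < m \<Longrightarrow> (rotate_below m ^^ k) i = i" for k
    by (induction k) (auto simp: rotate_below_def)
  then show "(rotate_below m ^^ m) i = id i"
    by (cases "i < m") (auto simp: rotate_below_funpow)
qed

text \<open>Transposed left regular representation: the entry at the origin of the image of
  \<open>h\<^sup>i x\<^sup>j g\<^sup>k\<close>, applied to \<open>\<phi>\<close>, is a nonzero multiple of \<open>\<phi> (i, j, k)\<close>.\<close>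

definition op_h :: "nat \<Rightarrow> (nat \<times> nat \<times> nat \<Rightarrow> 'k::field) \<Rightarrow> nat \<times> nat \<times> nat \<Rightarrow> 'k" where
  "op_h m \<phi> = (\<lambda>(i, j, k). \<phi> (rotate_below m i, j, k))"

definition op_g :: "nat \<Rightarrow> 'k \<Rightarrow> (nat \<times> nat \<times> nat \<Rightarrow> 'k::field) \<Rightarrow> nat \<times> nat \<times> nat \<Rightarrow> 'k" where
  "op_g n \<omega> \<phi> = (\<lambda>(i, j, k). inverse \<omega> ^ j * \<phi> (i, j, rotate_below n k))"

text \<open>The bound on \<open>j\<close> makes the \<open>m\<close>-th power vanish. The bound on
  \<open>i\<close> is forced by \<open>x h = q h x\<close>: where \<open>rotate_below\<close> is the
  identity, the two operators would commute without the factor \<open>q\<close>.\<close>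

definition op_x :: "nat \<Rightarrow> 'k \<Rightarrow> (nat \<times> nat \<times> nat \<Rightarrow> 'k::field) \<Rightarrow> nat \<times> nat \<times> nat \<Rightarrow> 'k" where
  "op_x m q \<phi> = (\<lambda>(i, j, k). if i < m \<and> Suc j < m then inverse q ^ i * \<phi> (i, Suc j, k) else 0)"

abbreviation OP :: "('k::field, (nat \<times> nat \<times> nat \<Rightarrow> 'k) \<Rightarrow> nat \<times> nat \<times> nat \<Rightarrow> 'k) module" where
  "OP \<equiv> operator_algebra"

lemma op_pow:
  "(op_h m [^]\<^bsub>OP\<^esub> (l::nat)) \<phi> (i, j, k) = \<phi> ((rotate_below m ^^ l) i, j, k)"
  "(op_g n \<omega> [^]\<^bsub>OP\<^esub> l) \<phi> (i, j, k) = (inverse \<omega> ^ j) ^ l * \<phi> (i, j, (rotate_below n ^^ l) k)"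
  "(op_x m q [^]\<^bsub>OP\<^esub> l) \<phi> (i, j, k) = (if l = 0 \<or> i < m \<and> j + l < m then (inverse q ^ i) ^ l * \<phi> (i, j + l, k) else 0)"
proof -
  interpret OP: k_algebra OP by (rule k_algebra_operator)
  show "(op_h m [^]\<^bsub>OP\<^esub> (l::nat)) \<phi> (i, j, k) = \<phi> ((rotate_below m ^^ l) i, j, k)"
    by (induction l arbitrary: \<phi>) (simp_all add: operator_algebra_simps op_h_def)
  show "(op_g n \<omega> [^]\<^bsub>OP\<^esub> l) \<phi> (i, j, k) = (inverse \<omega> ^ j) ^ l * \<phi> (i, j, (rotate_below n ^^ l) k)"
    by (induction l arbitrary: \<phi>) (simp_all add: operator_algebra_simps op_g_def)
  show "(op_x m q [^]\<^bsub>OP\<^esub> l) \<phi> (i, j, k) = (if l = 0 \<or> i < m \<and> j + l < m then (inverse q ^ i) ^ l * \<phi> (i, j + l, k) else 0)"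
    by (induction l arbitrary: \<phi>) (auto simp: operator_algebra_simps op_x_def)
qed

lemma op_T_relations:
  assumes q: "has_order q m" and \<omega>: "\<omega> ^ n = 1" and n: "0 < n"
  shows "T_relations OP n m \<omega> q (op_g n \<omega>) (op_h m) (op_x m q)"
proof -
  interpret OP: k_algebra OP by (rule k_algebra_operator)
  have m: "0 < m" and q0: "q \<noteq> 0" using order_ge_2[OF q] order_nonzero[OF q] by auto
  have \<omega>0: "\<omega> \<noteq> 0" using \<omega> n by (auto simp: power_0_left)
  have "op_h m [^]\<^bsub>OP\<^esub> m = \<one>\<^bsub>OP\<^esub>"
    by (auto simp: fun_eq_iff op_pow operator_algebra_simps rotate_below_funpow_id)
  moreover have "op_x m q [^]\<^bsub>OP\<^esub> m = \<zero>\<^bsub>OP\<^esub>"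
    using m by (auto simp: fun_eq_iff op_pow operator_algebra_simps)
  moreover have "op_g n \<omega> [^]\<^bsub>OP\<^esub> n = \<one>\<^bsub>OP\<^esub>"
  proof -
    have "(inverse \<omega> ^ j) ^ n = 1" for j
      by (metis \<omega> inverse_1 power_inverse power_commutes power_mult power_one mult.commute)
    then show ?thesis
      by (auto simp: fun_eq_iff op_pow operator_algebra_simps rotate_below_funpow_id)
  qed
  moreover have "op_h m \<otimes>\<^bsub>OP\<^esub> op_g n \<omega> = op_g n \<omega> \<otimes>\<^bsub>OP\<^esub> op_h m"
    by (auto simp: fun_eq_iff operator_algebra_simps op_h_def op_g_def)
  moreover have "op_g n \<omega> \<otimes>\<^bsub>OP\<^esub> op_x m q = \<omega> \<odot>\<^bsub>OP\<^esub> (op_x m q \<otimes>\<^bsub>OP\<^esub> op_g n \<omega>)"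
    using \<omega>0 by (auto simp: fun_eq_iff operator_algebra_simps op_x_def op_g_def)
  moreover have "op_x m q \<otimes>\<^bsub>OP\<^esub> op_h m = q \<odot>\<^bsub>OP\<^esub> (op_h m \<otimes>\<^bsub>OP\<^esub> op_x m q)"
  proof -
    have "inverse q ^ i = q * inverse q ^ (Suc i mod m)" if "i < m" for i
    proof (cases "Suc i = m")
      case True
      then have "q ^ i * q = 1" using order_power[OF q] by (simp add: power_Suc2[symmetric] del: power_Suc)
      then show ?thesis using True q0 by (simp add: field_simps)
    next
      case False
      then show ?thesis using that q0 by simp
    qed
    note key = this[symmetric]
    have "(op_x m q \<otimes>\<^bsub>OP\<^esub> op_h m) \<phi> (i, j, k) = (q \<odot>\<^bsub>OP\<^esub> (op_h m \<otimes>\<^bsub>OP\<^esub> op_x m q)) \<phi> (i, j, k)" for \<phi> i j k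
    proof (cases "i < m \<and> Suc j < m")
      case True
      then show ?thesis
        using m by (simp add: operator_algebra_simps op_x_def op_h_def rotate_below_def key
            mult.assoc[symmetric] del: power_inverse)
    qed (use m in \<open>auto simp: operator_algebra_simps op_x_def op_h_def rotate_below_def\<close>)
    then show ?thesis by (auto simp: fun_eq_iff)
  qed
  ultimately show ?thesis
    by (auto simp: T_relations_def taft_relations_def in_operator_algebra op_h_def op_g_def op_x_def
        fun_eq_iff algebra_simps)
qed

context T_generators
begin

text \<open>Spanning comes from the relations and independence from the representation. Stated for
  any algebra with such generators, it serves for T and, with \<open>n = 1\<close>, for Taft
  algebras.\<close>

lemma dual_basis_if_represented:
  assumes q: "has_order q m" and \<omega>: "\<omega> ^ n = 1" and n: "0 < n"
    and gen: "carrier A \<subseteq> alg_span A {g, h, x}"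
    and \<rho>: "algebra_hom A OP \<rho>" "\<rho> g = op_g n \<omega>" "\<rho> h = op_h m" "\<rho> x = op_x m q"
  shows "\<exists>co. dual_basis A (monomial_index m n) (monomial A g h x) co"
proof -
  interpret OP: k_algebra OP by (rule k_algebra_operator)
  have m: "0 < m" and q0: "q \<noteq> 0" using order_ge_2[OF q] order_nonzero[OF q] by auto
  have \<omega>0: "\<omega> \<noteq> 0" using \<omega> n by (auto simp: power_0_left)
  note lin = algebra_hom_linear[OF \<rho>(1)]
  \<comment> \<open>A matrix coefficient: apply the operator of \<open>y\<close> to the indicator
    function of \<open>p\<close> and evaluate at the origin. The prefactor cancels the powers of
    \<open>inverse q\<close> and \<open>inverse \<omega>\<close> that the monomial at
    \<open>p\<close> produces.\<close>
  define co where "co p y = (case p of (i, j, k) \<Rightarrow>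
      (q ^ i) ^ j * (\<omega> ^ j) ^ k * \<rho> y (\<lambda>p'. if p' = (i, j, k) then 1 else 0) (0, 0, 0))" for p y
  have "linear_map A scalars (co p)" for p
    by (cases p, rule linear_mapI)
       (simp_all add: co_def linear_map_add[OF lin] linear_map_smult[OF lin] operator_algebra_simps algebra_simps)
  moreover have "co p (monomial A g h x p') = (if p = p' then 1 else 0)"
    if "p \<in> monomial_index m n" "p' \<in> monomial_index m n" for p p'
  proof -
    obtain i j k where p: "p = (i, j, k)" by (cases p)
    obtain i' j' k' where p': "p' = (i', j', k')" by (cases p')
    have "\<rho> (monomial A g h x p') = (op_h m [^]\<^bsub>OP\<^esub> i' \<otimes>\<^bsub>OP\<^esub> op_x m q [^]\<^bsub>OP\<^esub> j') \<otimes>\<^bsub>OP\<^esub> op_g n \<omega> [^]\<^bsub>OP\<^esub> k'"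
      using algebra_hom_pow[OF is_k_algebra OP.is_k_algebra \<rho>(1)]
      by (simp add: p' monomial_def algebra_hom_mult[OF \<rho>(1)] \<rho>)
    then have "\<rho> (monomial A g h x p') \<phi> (0, 0, 0) = (inverse q ^ i') ^ j' * ((inverse \<omega> ^ j') ^ k' * \<phi> (i', j', k'))" for \<phi>
      using that m n by (simp add: operator_algebra_simps op_pow rotate_below_funpow p')
    then have "co p (monomial A g h x p') = (q ^ i) ^ j * (\<omega> ^ j) ^ k *
        ((inverse q ^ i') ^ j' * ((inverse \<omega> ^ j') ^ k' * (if (i', j', k') = (i, j, k) then 1 else 0)))"
      by (simp only: co_def p prod.case)
    then show ?thesis
      using q0 \<omega>0 by (auto simp: p p' power_inverse field_simps)
  qed
  ultimately show ?thesis
    using carrier_lin_combs[OF m n gen] by (intro exI[of _ co] dual_basisI) auto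
qed

end


section \<open>The presented Hopf algebras T, the Taft algebras and the group algebras\<close>

section \<open>The Hopf algebras \<open>T\<close>\<close>

context
  fixes n m :: nat and \<omega> q :: "'k::field"
begin

private abbreviation (input) "T_gens \<equiv> {gen_g, gen_h, gen_x}"

definition T_gen :: "gen \<Rightarrow> (gen list \<Rightarrow>\<^sub>0 'k) set" where
  "T_gen = presented_gen T_gens (T_relators n m \<omega> q)"

lemma T_relators_closed': "(T_relators n m \<omega> q) \<subseteq> carrier (free_algebra T_gens)"
  by (rule T_relators_closed) auto

lemma same_algebra_T: "same_algebra (presented_algebra T_gens (T_relators n m \<omega> q)) (T_algebra n m \<omega> q)"
  by (simp add: same_algebra_def T_algebra_def presented_hopf_def Let_def module.defs hopf.defs)

lemma k_algebra_T: "k_algebra (T_algebra n m \<omega> q)"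
  by (rule same_algebra_k_algebra[OF same_algebra_T k_algebra_presented[OF T_relators_closed']])

lemma T_gen_closed [simp]: "T_gen s \<in> carrier (T_algebra n m \<omega> q)"
proof -
  have "s \<in> T_gens" by (cases s) auto
  then show ?thesis
    using presented_gen_closed[OF T_relators_closed', of s] same_algebra_T by (simp add: T_gen_def same_algebra_def)
qed

lemma T_generated: "carrier (T_algebra n m \<omega> q) \<subseteq> alg_span (T_algebra n m \<omega> q) {T_gen gen_g, T_gen gen_h, T_gen gen_x}"
proof -
  have "alg_span (presented_algebra T_gens (T_relators n m \<omega> q)) S \<subseteq> alg_span (T_algebra n m \<omega> q) S" for S
    by (rule same_algebra_alg_span[OF same_algebra_T])
  from this[of "presented_gen T_gens (T_relators n m \<omega> q) ` T_gens"] show ?thesis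
    using presented_alg_span[OF T_relators_closed'] same_algebra_T by (simp add: T_gen_def same_algebra_def)
qed

lemma T_presented_relations:
  "T_relations (presented_algebra T_gens (T_relators n m \<omega> q)) n m \<omega> q (T_gen gen_g) (T_gen gen_h) (T_gen gen_x)"
  unfolding T_gen_def
  by (rule eval_T_relators[OF k_algebra_presented[OF T_relators_closed'] presented_gen_funcset[OF T_relators_closed'], THEN iffD1])
     (auto simp: presented_relation[OF T_relators_closed'])

lemma T_relations_T:
  "T_relations (T_algebra n m \<omega> q) n m \<omega> q (T_gen gen_g) (T_gen gen_h) (T_gen gen_x)"
  using T_presented_relations same_algebra_T
  by (simp add: T_relations_def taft_relations_def same_algebra_def nat_pow_def)

context
  fixes B :: "('k, 'b, 'z) module_scheme" and b :: "gen \<Rightarrow> 'b"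
  assumes B: "k_algebra B" and rel: "T_relations B n m \<omega> q (b gen_g) (b gen_h) (b gen_x)"
begin

lemma T_presented_hom:
  "algebra_hom (presented_algebra T_gens (T_relators n m \<omega> q)) B (presented_hom T_gens (T_relators n m \<omega> q) B b)"
  "presented_hom T_gens (T_relators n m \<omega> q) B b (T_gen s) = b s"
proof -
  have b: "b \<in> T_gens \<rightarrow> carrier B"
    using rel by (auto simp: T_relations_def taft_relations_def)
  have r: "r \<in> (T_relators n m \<omega> q) \<Longrightarrow> linear_extension B (word_eval B b) r = \<zero>\<^bsub>B\<^esub>" for r
    using eval_T_relators[OF B b, of n m \<omega> q] rel by simp
  show "algebra_hom (presented_algebra T_gens (T_relators n m \<omega> q)) B (presented_hom T_gens (T_relators n m \<omega> q) B b)"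
    by (rule presented_hom_algebra_hom[OF T_relators_closed' B b r])
  have "s \<in> T_gens" by (cases s) auto
  then show "presented_hom T_gens (T_relators n m \<omega> q) B b (T_gen s) = b s"
    unfolding T_gen_def by (intro presented_hom_gen[OF T_relators_closed' B b] r)
qed

lemma T_hom_exists: "\<exists>f. algebra_hom (T_algebra n m \<omega> q) B f \<and> (\<forall>s. f (T_gen s) = b s)"
  using T_presented_hom same_algebra_algebra_hom[OF same_algebra_T same_algebra_refl] by metis

end

end

lemma pure_tensor_pow:
  assumes "k_algebra A" "k_algebra B" "a \<in> carrier A" "b \<in> carrier B"
  shows "pure_tensor A B a b [^]\<^bsub>tensor A B\<^esub> (k::nat) = pure_tensor A B (a [^]\<^bsub>A\<^esub> k) (b [^]\<^bsub>B\<^esub> k)"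
proof -
  interpret A: k_algebra A by fact
  interpret B: k_algebra B by fact
  interpret T: k_algebra "tensor A B" by (rule k_algebra_tensor[OF assms(1,2)])
  show ?thesis
    by (induction k) (simp_all add: one_tensor[OF assms(1,2)] pure_tensor_mult[OF assms(1,2)] assms)
qed

lemma (in k_algebra) smult_minus: "y \<in> carrier A \<Longrightarrow> c \<odot> (\<ominus> y) = \<ominus> (c \<odot> y)"
  by (simp add: smult_minus1[symmetric] smult_smult mult.commute)

lemma (in k_algebra) pow_pow_order:
  assumes "a \<in> carrier A" "a [^] (m::nat) = \<one>" shows "(a [^] (k::nat)) [^] m = \<one>"
  using assms by (metis nat_pow_pow nat_pow_one mult.commute)

context T_generators
begin

text \<open>Well-definedness of the comultiplication. The critical relation is the
  \<open>m\<close>-th power: the summands satisfy \<open>(1 \<otimes> x)(x \<otimes> h) = q (x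
  \<otimes> h)(1 \<otimes> x)\<close>, so \<open>qbinomial_order\<close> leaves
  \<open>x^m \<otimes> h^m + 1 \<otimes> x^m\<close>, which is zero.\<close>

lemma tensor_T_relations:
  assumes q: "has_order q m"
  shows "T_relations (tensor A A) n m \<omega> q (pure_tensor A A g g) (pure_tensor A A h h)
    (pure_tensor A A x h \<oplus>\<^bsub>tensor A A\<^esub> pure_tensor A A \<one> x)"
proof -
  note KA = is_k_algebra
  interpret T: k_algebra "tensor A A" by (rule k_algebra_tensor[OF KA KA])
  note pm = pure_tensor_mult[OF KA KA] and ptc = pure_tensor_closed[OF KA KA]
    and pl = pure_tensor_smult_left[OF KA KA] and pr = pure_tensor_smult_right[OF KA KA]
    and pp = pure_tensor_pow[OF KA KA]
  have m: "0 < m" using order_ge_2[OF q] by simp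
  have z: "pure_tensor A A \<zero> y = \<zero>\<^bsub>tensor A A\<^esub>" "pure_tensor A A y \<zero> = \<zero>\<^bsub>tensor A A\<^esub>" if "y \<in> carrier A" for y
    using that pl[of \<zero> y 0] pr[of y \<zero> 0] ptc by auto
  have "(pure_tensor A A x h \<oplus>\<^bsub>tensor A A\<^esub> pure_tensor A A \<one> x) [^]\<^bsub>tensor A A\<^esub> m =
      pure_tensor A A x h [^]\<^bsub>tensor A A\<^esub> m \<oplus>\<^bsub>tensor A A\<^esub> pure_tensor A A \<one> x [^]\<^bsub>tensor A A\<^esub> m"
    by (rule T.qbinomial_order[OF q]) (simp_all add: ptc pm xh pr)
  also have "\<dots> = \<zero>\<^bsub>tensor A A\<^esub>"
    by (simp add: pp x_nilpotent z)
  finally have "(pure_tensor A A x h \<oplus>\<^bsub>tensor A A\<^esub> pure_tensor A A \<one> x) [^]\<^bsub>tensor A A\<^esub> m = \<zero>\<^bsub>tensor A A\<^esub>" .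
  then show ?thesis
    by (simp add: T_relations_def taft_relations_def ptc pp h_order g_order one_tensor[OF KA KA] pm hg
        T.l_distr T.r_distr xh gx pl pr T.smult_add_right)
qed

text \<open>The relations that allow an antipode to be defined through the presentation as an
  algebra map into the opposite algebra. Here \<open>m - 1\<close> and \<open>n - 1\<close> serve as
  the exponents of the inverses of \<open>h\<close> and \<open>g\<close>.\<close>

lemma opposite_T_relations:
  assumes q: "q ^ m = 1" and \<omega>: "\<omega> ^ n = 1" and "0 < m" "0 < n"
  shows "T_relations (opposite_algebra A) n m \<omega> q (g [^] (n - 1)) (h [^] (m - 1)) (\<ominus> (x \<otimes> h [^] (m - 1)))"
proof -
  note KA = is_k_algebra
  interpret O: k_algebra "opposite_algebra A" by (rule k_algebra_opposite[OF KA])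
  have opow: "a [^]\<^bsub>opposite_algebra A\<^esub> (k::nat) = a [^] k" if "a \<in> carrier A" for a k
  proof (induction k)
    case (Suc k)
    then show ?case using that nat_pow_Suc2[OF that, of k] by simp
  qed simp
  let ?h = "h [^] (m - 1)" and ?g = "g [^] (n - 1)"
  have hx: "?h \<otimes> x = q \<odot> (x \<otimes> ?h)"
  proof -
    have "q \<odot> (x \<otimes> ?h) = (q * q ^ (m - 1)) \<odot> (?h \<otimes> x)"
      by (simp add: xh_pow smult_smult)
    also have "q * q ^ (m - 1) = 1" using q \<open>0 < m\<close> by (cases m) auto
    finally show ?thesis by simp
  qed
  have hh: "h [^] a \<otimes> h [^] b = h [^] b \<otimes> h [^] a" for a b :: nat
    by (simp add: nat_pow_mult add.commute)
  have gh: "g [^] a \<otimes> h [^] b = h [^] b \<otimes> g [^] a" for a b :: nat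
    using qcommute_pow'[of "h [^] b" g 1 a] by (simp add: gh_pow)
  have xg: "\<omega> \<odot> (?g \<otimes> x) = x \<otimes> ?g"
  proof -
    have "\<omega> \<odot> (?g \<otimes> x) = (\<omega> * \<omega> ^ (n - 1)) \<odot> (x \<otimes> ?g)"
      using qcommute_pow'[of x g \<omega> "n - 1"] by (simp add: gx smult_smult)
    also have "\<omega> * \<omega> ^ (n - 1) = 1" using \<omega> \<open>0 < n\<close> by (cases n) auto
    finally show ?thesis by simp
  qed
  \<comment> \<open>Commuting \<open>h\<close> past \<open>x\<close> produces some power of
    \<open>q\<close>. Its value is immaterial, because at \<open>k = m\<close> the factor
    \<open>x^m\<close> kills the product.\<close>
  have "\<exists>c. (x \<otimes> ?h) [^] k = c \<odot> (x [^] k \<otimes> ?h [^] k)" for k :: nat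
  proof (induction k)
    case 0
    show ?case by (intro exI[of _ 1]) simp
  next
    case (Suc k)
    then obtain c where c: "(x \<otimes> ?h) [^] k = c \<odot> (x [^] k \<otimes> ?h [^] k)" by blast
    have hkx: "?h [^] k \<otimes> x = q ^ k \<odot> (x \<otimes> ?h [^] k)"
      by (rule qcommute_pow'[OF _ _ hx]) simp_all
    have "(x [^] k \<otimes> ?h [^] k) \<otimes> (x \<otimes> ?h) = x [^] k \<otimes> (?h [^] k \<otimes> x) \<otimes> ?h"
      by (simp add: m_assoc)
    also have "\<dots> = q ^ k \<odot> (x [^] Suc k \<otimes> ?h [^] Suc k)"
      unfolding hkx by (simp add: m_assoc smult_mult_left smult_mult_right)
    finally have "(x [^] k \<otimes> ?h [^] k) \<otimes> (x \<otimes> ?h) = q ^ k \<odot> (x [^] Suc k \<otimes> ?h [^] Suc k)" .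
    then show ?case
      using c by (intro exI[of _ "c * q ^ k"]) (simp add: smult_mult_left smult_smult)
  qed
  then obtain c where "(x \<otimes> ?h) [^] m = c \<odot> (x [^] m \<otimes> ?h [^] m)" by blast
  then have "(x \<otimes> ?h) [^] m = \<zero>" by (simp add: x_nilpotent)
  then have nil: "(\<ominus> (x \<otimes> ?h)) [^] m = \<zero>"
    using smult_pow[of "x \<otimes> ?h" "- 1" m] by (simp add: smult_minus1)
  have "?h [^] m = \<one>" "?g [^] n = \<one>"
    by (simp_all add: pow_pow_order h_order g_order)
  moreover have "?h \<otimes> \<ominus> (x \<otimes> ?h) = q \<odot> (\<ominus> (x \<otimes> ?h) \<otimes> ?h)"
  proof -
    have "?h \<otimes> (x \<otimes> ?h) = (?h \<otimes> x) \<otimes> ?h" by (simp add: m_assoc)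
    also have "\<dots> = q \<odot> (x \<otimes> ?h \<otimes> ?h)" unfolding hx by (simp add: smult_mult_left)
    finally show ?thesis by (simp add: l_minus r_minus smult_minus)
  qed
  moreover have "\<ominus> (x \<otimes> ?h) \<otimes> ?g = \<omega> \<odot> (?g \<otimes> \<ominus> (x \<otimes> ?h))"
  proof -
    have "\<omega> \<odot> (?g \<otimes> (x \<otimes> ?h)) = (\<omega> \<odot> (?g \<otimes> x)) \<otimes> ?h"
      by (simp add: m_assoc smult_mult_left)
    also have "\<dots> = x \<otimes> ?g \<otimes> ?h" unfolding xg ..
    also have "\<dots> = x \<otimes> ?h \<otimes> ?g" by (simp add: m_assoc gh)
    finally show ?thesis by (simp add: l_minus r_minus smult_minus)
  qed
  ultimately show ?thesis
    using nil by (simp add: T_relations_def taft_relations_def opow gh)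
qed

end

lemma scalars_pow: "(a::'k::field) [^]\<^bsub>scalars\<^esub> (k::nat) = a ^ k"
proof -
  interpret S: k_algebra "scalars :: ('k, 'k) module" by (rule k_algebra_scalars)
  show ?thesis by (induction k) (simp_all add: mult.commute)
qed

lemma scalars_T_relations: "0 < m \<Longrightarrow> T_relations (scalars :: ('k::field, 'k) module) n m \<omega> q 1 1 0"
  by (simp add: T_relations_def taft_relations_def scalars_pow power_0_left)

lemma T_T_generators:
  "T_generators (T_algebra n m \<omega> q) n m \<omega> q (T_gen n m \<omega> q gen_g) (T_gen n m \<omega> q gen_h) (T_gen n m \<omega> q gen_x)"
  by (intro T_generators.intro T_generators_axioms.intro k_algebra_T T_relations_T)

context
  fixes n m :: nat and \<omega> q :: "'k::field"
  assumes q: "has_order q m"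
begin

private abbreviation (input) "T \<equiv> T_algebra n m \<omega> q"
private abbreviation (input) "Tg \<equiv> T_gen n m \<omega> q"

text \<open>The presentation defines \<open>comult\<close> by choice; the relations in the tensor
  square guarantee that the chosen map has the prescribed values on generators.\<close>

lemma T_comult:
  "algebra_hom T (tensor T T) (comult T)"
  "comult T (Tg gen_g) = pure_tensor T T (Tg gen_g) (Tg gen_g)"
  "comult T (Tg gen_h) = pure_tensor T T (Tg gen_h) (Tg gen_h)"
  "comult T (Tg gen_x) = pure_tensor T T (Tg gen_x) (Tg gen_h) \<oplus>\<^bsub>tensor T T\<^esub> pure_tensor T T \<one>\<^bsub>T\<^esub> (Tg gen_x)"
proof -
  define \<Delta> where "\<Delta> s = (case s of gen_g \<Rightarrow> pure_tensor T T (Tg gen_g) (Tg gen_g)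
           | gen_h \<Rightarrow> pure_tensor T T (Tg gen_h) (Tg gen_h)
           | gen_x \<Rightarrow> pure_tensor T T (Tg gen_x) (Tg gen_h) \<oplus>\<^bsub>tensor T T\<^esub> pure_tensor T T \<one>\<^bsub>T\<^esub> (Tg gen_x))" for s
  note TT = same_algebra_tensor[OF same_algebra_T same_algebra_T, of n m \<omega> q]
  have one: "\<one>\<^bsub>T\<^esub> = \<one>\<^bsub>presented_algebra {gen_g, gen_h, gen_x} (T_relators n m \<omega> q)\<^esub>"
    using same_algebra_T[of n m \<omega> q] by (simp add: same_algebra_def)
  have \<Delta>: "comult T = presented_hom {gen_g, gen_h, gen_x} (T_relators n m \<omega> q) (tensor T T) \<Delta>"
    unfolding \<Delta>_def TT[symmetric] one T_gen_def
    by (simp add: T_algebra_def presented_hopf_def Let_def module.defs hopf.defs fun_eq_iff)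
  have rel: "T_relations (tensor T T) n m \<omega> q (\<Delta> gen_g) (\<Delta> gen_h) (\<Delta> gen_x)"
    unfolding \<Delta>_def gen.case by (rule T_generators.tensor_T_relations[OF T_T_generators q])
  note hom = T_presented_hom[OF k_algebra_tensor[OF k_algebra_T k_algebra_T] rel]
  show "algebra_hom T (tensor T T) (comult T)"
    unfolding \<Delta> same_algebra_algebra_hom[OF same_algebra_T same_algebra_refl, symmetric] by (rule hom(1))
  show "comult T (Tg gen_g) = pure_tensor T T (Tg gen_g) (Tg gen_g)"
    "comult T (Tg gen_h) = pure_tensor T T (Tg gen_h) (Tg gen_h)"
    "comult T (Tg gen_x) = pure_tensor T T (Tg gen_x) (Tg gen_h) \<oplus>\<^bsub>tensor T T\<^esub> pure_tensor T T \<one>\<^bsub>T\<^esub> (Tg gen_x)"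
    unfolding \<Delta> hom(2) by (simp_all add: \<Delta>_def)
qed

lemma T_counit:
  "algebra_hom T scalars (counit T)"
  "counit T (Tg gen_g) = 1" "counit T (Tg gen_h) = 1" "counit T (Tg gen_x) = 0"
proof -
  define \<epsilon> where "\<epsilon> s = (case s of gen_g \<Rightarrow> 1 | gen_h \<Rightarrow> 1 | gen_x \<Rightarrow> (0::'k))" for s
  have \<epsilon>: "counit T = presented_hom {gen_g, gen_h, gen_x} (T_relators n m \<omega> q) scalars \<epsilon>"
    unfolding \<epsilon>_def by (simp add: T_algebra_def presented_hopf_def Let_def module.defs hopf.defs)
  have rel: "T_relations scalars n m \<omega> q (\<epsilon> gen_g) (\<epsilon> gen_h) (\<epsilon> gen_x)"
    using scalars_T_relations[of m n \<omega> q] order_ge_2[OF q] by (simp add: \<epsilon>_def)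
  note hom = T_presented_hom[OF k_algebra_scalars rel]
  show "algebra_hom T scalars (counit T)"
    unfolding \<epsilon> same_algebra_algebra_hom[OF same_algebra_T same_algebra_refl, symmetric] by (rule hom(1))
  show "counit T (Tg gen_g) = 1" "counit T (Tg gen_h) = 1" "counit T (Tg gen_x) = 0"
    unfolding \<epsilon> hom(2) by (simp_all add: \<epsilon>_def)
qed

lemma T_pointed: "pointed_generators T (Tg gen_g) (Tg gen_h) (Tg gen_x)"
  by (intro pointed_generators.intro prebialgebra.intro prebialgebra_axioms.intro pointed_generators_axioms.intro
      k_algebra_T T_comult T_counit T_gen_closed T_generated)

lemma T_dual_basis:
  assumes "\<omega> ^ n = 1" "0 < n"
  shows "\<exists>co. dual_basis T (monomial_index m n) (monomial T (Tg gen_g) (Tg gen_h) (Tg gen_x)) co"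
proof -
  let ?b = "case_gen (op_g n \<omega>) (op_h m) (op_x m q)"
  obtain \<rho> where "algebra_hom T OP \<rho>" "\<And>s. \<rho> (Tg s) = ?b s"
    using T_hom_exists[OF k_algebra_operator, of n m \<omega> q ?b] op_T_relations[OF q assms] by auto
  then show ?thesis
    by (intro T_generators.dual_basis_if_represented[OF T_T_generators q assms T_generated, of \<rho>]) auto
qed

end


section \<open>Taft algebras\<close>

context
  fixes m :: nat and q :: "'k::field"
begin

private abbreviation (input) "taft_gens \<equiv> {gen_h, gen_x}"

definition taft_gen :: "gen \<Rightarrow> (gen list \<Rightarrow>\<^sub>0 'k) set" where
  "taft_gen = presented_gen taft_gens (taft_relators m q)"

lemma taft_relators_closed': "(taft_relators m q) \<subseteq> carrier (free_algebra taft_gens)"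
  by (rule taft_relators_closed) auto

lemma same_algebra_taft: "same_algebra (presented_algebra taft_gens (taft_relators m q)) (taft_algebra m q)"
  by (simp add: same_algebra_def taft_algebra_def presented_hopf_def Let_def module.defs hopf.defs)

lemma k_algebra_taft: "k_algebra (taft_algebra m q)"
  by (rule same_algebra_k_algebra[OF same_algebra_taft k_algebra_presented[OF taft_relators_closed']])

lemma taft_gen_closed [simp]: "taft_gen gen_h \<in> carrier (taft_algebra m q)" "taft_gen gen_x \<in> carrier (taft_algebra m q)"
  using presented_gen_closed[OF taft_relators_closed'] same_algebra_taft by (simp_all add: taft_gen_def same_algebra_def)

lemma taft_generated: "carrier (taft_algebra m q) \<subseteq> alg_span (taft_algebra m q) {taft_gen gen_h, taft_gen gen_x}"
proof -
  have "alg_span (presented_algebra taft_gens (taft_relators m q)) S \<subseteq> alg_span (taft_algebra m q) S" for S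
    by (rule same_algebra_alg_span[OF same_algebra_taft])
  from this[of "presented_gen taft_gens (taft_relators m q) ` taft_gens"] show ?thesis
    using presented_alg_span[OF taft_relators_closed'] same_algebra_taft by (simp add: taft_gen_def same_algebra_def)
qed

lemma taft_relations_taft: "taft_relations (taft_algebra m q) m q (taft_gen gen_h) (taft_gen gen_x)"
proof -
  have "taft_relations (presented_algebra taft_gens (taft_relators m q)) m q (taft_gen gen_h) (taft_gen gen_x)"
    unfolding taft_gen_def
    by (rule eval_taft_relators[OF k_algebra_presented[OF taft_relators_closed'] presented_gen_funcset[OF taft_relators_closed'], THEN iffD1])
       (auto simp: presented_relation[OF taft_relators_closed'])
  then show ?thesis
    using same_algebra_taft by (simp add: taft_relations_def same_algebra_def nat_pow_def)
qed

lemma taft_T_generators: "T_generators (taft_algebra m q) 1 m 1 q \<one>\<^bsub>taft_algebra m q\<^esub> (taft_gen gen_h) (taft_gen gen_x)"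
proof -
  interpret k_algebra "taft_algebra m q" by (rule k_algebra_taft)
  show ?thesis
    by unfold_locales (use taft_relations_taft in \<open>simp add: T_relations_def taft_relations_def\<close>)
qed

context
  fixes B :: "('k, 'b, 'z) module_scheme" and b :: "gen \<Rightarrow> 'b"
  assumes B: "k_algebra B" and rel: "taft_relations B m q (b gen_h) (b gen_x)"
begin

lemma taft_presented_hom:
  "algebra_hom (presented_algebra taft_gens (taft_relators m q)) B (presented_hom taft_gens (taft_relators m q) B b)"
  "presented_hom taft_gens (taft_relators m q) B b (taft_gen gen_h) = b gen_h" "presented_hom taft_gens (taft_relators m q) B b (taft_gen gen_x) = b gen_x"
proof -
  have b: "b \<in> taft_gens \<rightarrow> carrier B"
    using rel by (auto simp: taft_relations_def)
  have r: "r \<in> (taft_relators m q) \<Longrightarrow> linear_extension B (word_eval B b) r = \<zero>\<^bsub>B\<^esub>" for r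
    using eval_taft_relators[OF B b, of m q] rel by simp
  show "algebra_hom (presented_algebra taft_gens (taft_relators m q)) B (presented_hom taft_gens (taft_relators m q) B b)"
    by (rule presented_hom_algebra_hom[OF taft_relators_closed' B b r])
  show "presented_hom taft_gens (taft_relators m q) B b (taft_gen gen_h) = b gen_h" "presented_hom taft_gens (taft_relators m q) B b (taft_gen gen_x) = b gen_x"
    unfolding taft_gen_def by (intro presented_hom_gen[OF taft_relators_closed' B b] r; simp)+
qed

lemma taft_hom_exists:
  "\<exists>f. algebra_hom (taft_algebra m q) B f \<and> f (taft_gen gen_h) = b gen_h \<and> f (taft_gen gen_x) = b gen_x"
  using taft_presented_hom same_algebra_algebra_hom[OF same_algebra_taft same_algebra_refl] by metis

end

context
  assumes q: "has_order q m"
begin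

private abbreviation (input) "Taft \<equiv> taft_algebra m q"
private abbreviation (input) "Th \<equiv> taft_gen gen_h"
private abbreviation (input) "Tx \<equiv> taft_gen gen_x"

lemma taft_comult:
  "algebra_hom Taft (tensor Taft Taft) (comult Taft)"
  "comult Taft Th = pure_tensor Taft Taft Th Th"
  "comult Taft Tx = pure_tensor Taft Taft Tx Th \<oplus>\<^bsub>tensor Taft Taft\<^esub> pure_tensor Taft Taft \<one>\<^bsub>Taft\<^esub> Tx"
proof -
  define \<Delta> where "\<Delta> s = (if s = gen_h then pure_tensor Taft Taft Th Th
     else pure_tensor Taft Taft Tx Th \<oplus>\<^bsub>tensor Taft Taft\<^esub> pure_tensor Taft Taft \<one>\<^bsub>Taft\<^esub> Tx)" for s
  note TT = same_algebra_tensor[OF same_algebra_taft same_algebra_taft]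
  have one: "\<one>\<^bsub>Taft\<^esub> = \<one>\<^bsub>presented_algebra taft_gens (taft_relators m q)\<^esub>"
    using same_algebra_taft by (simp add: same_algebra_def)
  have \<Delta>: "comult Taft = presented_hom taft_gens (taft_relators m q) (tensor Taft Taft) \<Delta>"
    unfolding \<Delta>_def TT[symmetric] one taft_gen_def
    by (simp add: taft_algebra_def presented_hopf_def Let_def module.defs hopf.defs fun_eq_iff)
  have rel: "taft_relations (tensor Taft Taft) m q (\<Delta> gen_h) (\<Delta> gen_x)"
    using T_generators.tensor_T_relations[OF taft_T_generators q] by (simp add: \<Delta>_def T_relations_def)
  note hom = taft_presented_hom[OF k_algebra_tensor[OF k_algebra_taft k_algebra_taft] rel]
  show "algebra_hom Taft (tensor Taft Taft) (comult Taft)"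
    unfolding \<Delta> same_algebra_algebra_hom[OF same_algebra_taft same_algebra_refl, symmetric] by (rule hom(1))
  show "comult Taft Th = pure_tensor Taft Taft Th Th"
    "comult Taft Tx = pure_tensor Taft Taft Tx Th \<oplus>\<^bsub>tensor Taft Taft\<^esub> pure_tensor Taft Taft \<one>\<^bsub>Taft\<^esub> Tx"
    unfolding \<Delta> hom(2,3) by (simp_all add: \<Delta>_def)
qed

lemma taft_counit:
  "algebra_hom Taft scalars (counit Taft)" "counit Taft Th = 1" "counit Taft Tx = 0"
proof -
  define \<epsilon> where "\<epsilon> s = (if s = gen_h then 1 else (0::'k))" for s
  have \<epsilon>: "counit Taft = presented_hom taft_gens (taft_relators m q) scalars \<epsilon>"
    unfolding \<epsilon>_def by (simp add: taft_algebra_def presented_hopf_def Let_def module.defs hopf.defs)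
  have rel: "taft_relations scalars m q (\<epsilon> gen_h) (\<epsilon> gen_x)"
    using scalars_T_relations[of m 1 1 q] order_ge_2[OF q] by (simp add: \<epsilon>_def T_relations_def)
  note hom = taft_presented_hom[OF k_algebra_scalars rel]
  show "algebra_hom Taft scalars (counit Taft)"
    unfolding \<epsilon> same_algebra_algebra_hom[OF same_algebra_taft same_algebra_refl, symmetric] by (rule hom(1))
  show "counit Taft Th = 1" "counit Taft Tx = 0"
    unfolding \<epsilon> hom(2,3) by (simp_all add: \<epsilon>_def)
qed

lemma taft_prebialgebra: "prebialgebra Taft"
  by (intro prebialgebra.intro prebialgebra_axioms.intro k_algebra_taft taft_comult taft_counit)

lemma taft_dual_basis:
  "\<exists>co. dual_basis Taft (monomial_index m 1) (monomial Taft \<one>\<^bsub>Taft\<^esub> Th Tx) co"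
proof -
  interpret OP: k_algebra OP by (rule k_algebra_operator)
  let ?b = "case_gen (op_g 1 1) (op_h m) (op_x m q)"
  have rel: "T_relations OP 1 m 1 q (op_g 1 1) (op_h m) (op_x m q)"
    by (rule op_T_relations[OF q]) auto
  obtain \<rho> where \<rho>: "algebra_hom Taft OP \<rho>" "\<rho> Th = op_h m" "\<rho> Tx = op_x m q"
    using taft_hom_exists[OF k_algebra_operator, of ?b] rel by (auto simp: T_relations_def)
  \<comment> \<open>For \<open>n = 1\<close> the relation \<open>g^n = 1\<close> forces
    \<open>op_g 1 1\<close> to be the identity operator, so the unit can play the role of
    \<open>g\<close>.\<close>
  have "\<rho> \<one>\<^bsub>Taft\<^esub> = op_g 1 1"
    using rel OP.l_one[of "op_g 1 1"] by (auto simp: algebra_hom_one[OF \<rho>(1)] T_relations_def)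
  moreover have "carrier Taft \<subseteq> alg_span Taft {\<one>\<^bsub>Taft\<^esub>, Th, Tx}"
  proof -
    have "y \<in> alg_span Taft S \<Longrightarrow> S \<subseteq> S' \<Longrightarrow> y \<in> alg_span Taft S'" for y S S'
      by (induction rule: alg_span.induct) (auto intro: alg_span.intros)
    then show ?thesis using taft_generated by blast
  qed
  ultimately show ?thesis
    using \<rho> by (intro T_generators.dual_basis_if_represented[OF taft_T_generators q, of \<rho>]) auto
qed

end

end


section \<open>Group algebras of cyclic groups\<close>

lemma same_algebra_group: "same_algebra (monoid_algebra G) (group_hopf_algebra G)"
  by (simp add: same_algebra_def group_hopf_algebra_def Let_def module.defs hopf.defs)

context
  fixes G :: "('g, 'z) monoid_scheme" (structure)
  assumes G: "Group.group G"
begin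

interpretation Group.group G by (rule G)

lemma group_algebra_prebialgebra: "prebialgebra (group_hopf_algebra G :: ('k::field, 'g \<Rightarrow>\<^sub>0 'k) hopf)"
  and group_algebra_comult: "g \<in> carrier G \<Longrightarrow> comult (group_hopf_algebra G :: ('k, 'g \<Rightarrow>\<^sub>0 'k) hopf) (Poly_Mapping.single g 1) =
    pure_tensor (group_hopf_algebra G) (group_hopf_algebra G) (Poly_Mapping.single g 1) (Poly_Mapping.single g 1)"
  and group_algebra_counit: "g \<in> carrier G \<Longrightarrow> counit (group_hopf_algebra G :: ('k, 'g \<Rightarrow>\<^sub>0 'k) hopf) (Poly_Mapping.single g 1) = 1"
proof -
  let ?K = "group_hopf_algebra G :: ('k, 'g \<Rightarrow>\<^sub>0 'k) hopf"
  let ?A = "monoid_algebra G :: ('k, 'g \<Rightarrow>\<^sub>0 'k) module"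
  let ?\<Delta> = "\<lambda>g. pure_tensor ?A ?A (Poly_Mapping.single g 1) (Poly_Mapping.single g 1)"
  have AA: "k_algebra ?A" by (rule k_algebra_monoid_algebra[OF is_monoid])
  have KK: "k_algebra ?K" by (rule same_algebra_k_algebra[OF same_algebra_group AA])
  note TT = same_algebra_tensor[OF same_algebra_group same_algebra_group, of G G]
  have \<Delta>: "comult ?K = linear_extension (tensor ?A ?A) ?\<Delta>"
    and \<epsilon>: "counit ?K = linear_extension scalars (\<lambda>g. 1)"
    by (simp_all add: group_hopf_algebra_def Let_def module.defs hopf.defs)
  have cl: "?\<Delta> g \<in> carrier (tensor ?A ?A)" if "g \<in> carrier G" for g
    using that by (intro pure_tensor_closed[OF AA AA]) auto
  have "algebra_hom ?A (tensor ?A ?A) (comult ?K)"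
    unfolding \<Delta>
    by (rule linear_extension_algebra_hom[OF k_algebra_tensor[OF AA AA] is_monoid])
       (auto simp: cl pure_tensor_mult[OF AA AA] monoid_algebra_mult_single[OF is_monoid] one_tensor[OF AA AA]
          monoid_algebra_simps(2))
  moreover have "algebra_hom ?A scalars (counit ?K)"
    unfolding \<epsilon> by (rule linear_extension_algebra_hom[OF k_algebra_scalars is_monoid]) auto
  ultimately show "prebialgebra ?K"
    unfolding TT(1) same_algebra_algebra_hom[OF same_algebra_group same_algebra_refl]
    by (intro prebialgebra.intro prebialgebra_axioms.intro KK)
  assume g: "g \<in> carrier G"
  interpret TA: k_algebra "tensor ?A ?A" by (rule k_algebra_tensor[OF AA AA])
  show "comult ?K (Poly_Mapping.single g 1) =
      pure_tensor ?K ?K (Poly_Mapping.single g 1) (Poly_Mapping.single g 1)"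
    unfolding TT(2)[symmetric] \<Delta> using cl[OF g] by (simp add: linear_extension_single[OF TA.is_k_algebra])
  show "counit ?K (Poly_Mapping.single g 1) = 1"
    unfolding \<epsilon> by (simp add: linear_extension_single[OF k_algebra_scalars])
qed

end

section \<open>Coordinates in tensor products, Hopf algebra maps, and group-like and skew-primitive
  elements\<close>

section \<open>Dual bases and linear maps\<close>

lemma dual_basisD:
  assumes "dual_basis A I b co"
  shows "finite I" "b \<in> I \<rightarrow> carrier A" "p \<in> I \<Longrightarrow> b p \<in> carrier A" "p \<in> I \<Longrightarrow> linear_map A scalars (co p)"
    "p \<in> I \<Longrightarrow> p' \<in> I \<Longrightarrow> co p (b p') = (if p = p' then 1 else 0)"
    "y \<in> carrier A \<Longrightarrow> y = (\<Oplus>\<^bsub>A\<^esub>p\<in>I. co p y \<odot>\<^bsub>A\<^esub> b p)"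
  using assms by (auto simp: dual_basis_def)

lemma linear_map_dual_basis_eq:
  assumes "k_algebra A" "k_algebra B" "dual_basis A I b co" "linear_map A B f" "linear_map A B f'"
    and "\<And>p. p \<in> I \<Longrightarrow> f (b p) = f' (b p)" and "y \<in> carrier A"
  shows "f y = f' y"
proof -
  interpret A: k_algebra A by fact
  interpret B: k_algebra B by fact
  note D = dual_basisD[OF assms(3)]
  have "f (\<Oplus>\<^bsub>A\<^esub>p\<in>I. co p y \<odot>\<^bsub>A\<^esub> b p) = (\<Oplus>\<^bsub>B\<^esub>p\<in>I. f (co p y \<odot>\<^bsub>A\<^esub> b p))"
    by (rule linear_map_finsum[OF assms(1,2,4)]) (use D(3) in auto)
  also have "\<dots> = (\<Oplus>\<^bsub>B\<^esub>p\<in>I. f' (co p y \<odot>\<^bsub>A\<^esub> b p))"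
    by (rule B.finsum_cong')
       (use D(3) in \<open>auto simp: assms(6) linear_map_smult[OF assms(4)] linear_map_smult[OF assms(5)] linear_map_closed[OF assms(5)]\<close>)
  also have "\<dots> = f' (\<Oplus>\<^bsub>A\<^esub>p\<in>I. co p y \<odot>\<^bsub>A\<^esub> b p)"
    by (rule linear_map_finsum[OF assms(1,2,5), symmetric]) (use D(3) in auto)
  finally show ?thesis using D(6)[OF assms(7)] by simp
qed

lemma lin_combs_image:
  assumes "k_algebra A" "k_algebra B" "linear_map A B f" "b \<in> I \<rightarrow> carrier A" "y \<in> lin_combs A b I"
  shows "f y \<in> lin_combs B (\<lambda>p. f (b p)) I"
proof -
  interpret A: k_algebra A by fact
  interpret B: k_algebra B by fact
  obtain c where y: "y = (\<Oplus>\<^bsub>A\<^esub>p\<in>I. c p \<odot>\<^bsub>A\<^esub> b p)" using assms(5) by (auto simp: lin_combs_def)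
  have "f y = (\<Oplus>\<^bsub>B\<^esub>p\<in>I. f (c p \<odot>\<^bsub>A\<^esub> b p))"
    unfolding y by (rule linear_map_finsum[OF assms(1-3)]) (use assms(4) in auto)
  also have "\<dots> = (\<Oplus>\<^bsub>B\<^esub>p\<in>I. c p \<odot>\<^bsub>B\<^esub> f (b p))"
    by (rule B.finsum_cong')
       (use funcset_mem[OF assms(4)] in \<open>auto simp: linear_map_smult[OF assms(3)] linear_map_closed[OF assms(3)]\<close>)
  finally show ?thesis by (auto simp: lin_combs_def)
qed

lemma dual_basis_lin_combs:
  assumes "dual_basis A I b co" "y \<in> carrier A" shows "y \<in> lin_combs A b I"
  unfolding lin_combs_def using dual_basisD(6)[OF assms] by (rule image_eqI[of _ _ "\<lambda>p. co p y"]) simp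

lemma dual_basis_bij:
  assumes "k_algebra A" "k_algebra E" "dual_basis A I b co" "linear_map A E f" "bij_betw f (carrier A) (carrier E)"
  shows "dual_basis E I (\<lambda>p. f (b p)) (\<lambda>p y. co p (inv_into (carrier A) f y))"
proof -
  interpret E: k_algebra E by fact
  note D = dual_basisD[OF assms(3)]
  show ?thesis
  proof (rule E.dual_basisI)
    show "linear_map E scalars (\<lambda>y. co p (inv_into (carrier A) f y))" if "p \<in> I" for p
      by (rule linear_map_compose[OF inverse_linear_map[OF assms(1,4,5)] D(4)[OF that]])
    show "co p (inv_into (carrier A) f (f (b p'))) = (if p = p' then 1 else 0)" if "p \<in> I" "p' \<in> I" for p p'
      using assms(5) D(3,5) that by (simp add: bij_betw_def)
    show "carrier E \<subseteq> lin_combs E (\<lambda>p. f (b p)) I"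
    proof
      fix y assume "y \<in> carrier E"
      then obtain a where "a \<in> carrier A" "y = f a" using assms(5) by (auto simp: bij_betw_def)
      then show "y \<in> lin_combs E (\<lambda>p. f (b p)) I"
        using lin_combs_image[OF assms(1,2,4) D(2)] dual_basis_lin_combs[OF assms(3)] by blast
    qed
  qed (use D linear_map_closed[OF assms(4)] in auto)
qed

text \<open>The coordinate of \<open>f y\<close> at \<open>\<pi> p\<close> equals that of
  \<open>y\<close> at \<open>p\<close>, so \<open>f y\<close> determines all coordinates of
  \<open>y\<close>.\<close>

lemma dual_basis_inj:
  assumes "k_algebra A" "k_algebra E" "dual_basis A I b co" "linear_map A E f" "dual_basis E J c co'"
    and "\<pi> \<in> I \<rightarrow> J" "inj_on \<pi> I" "\<And>p. p \<in> I \<Longrightarrow> f (b p) = c (\<pi> p)"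
  shows "inj_on f (carrier A)"
proof (rule inj_onI)
  interpret A: k_algebra A by fact
  note D = dual_basisD[OF assms(3)] and D' = dual_basisD[OF assms(5)]
  have co: "co' (\<pi> p) (f y) = co p y" if "p \<in> I" "y \<in> carrier A" for p y
  proof (rule linear_map_dual_basis_eq[OF assms(1) k_algebra_scalars assms(3) _ D(4)[OF that(1)] _ that(2)])
    show "linear_map A scalars (\<lambda>y. co' (\<pi> p) (f y))"
      using that(1) assms(6) by (intro linear_map_compose[OF assms(4)] D'(4)) auto
    fix p' assume "p' \<in> I"
    then show "co' (\<pi> p) (f (b p')) = co p (b p')"
      using that(1) assms(6-8) D'(5)[of "\<pi> p" "\<pi> p'"] D(5)[of p p'] by (auto simp: inj_on_eq_iff Pi_iff)
  qed
  fix y z assume yz: "y \<in> carrier A" "z \<in> carrier A" "f y = f z"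
  show "y = z"
    by (rule A.dual_basis_eqI[OF assms(3) yz(1,2)]) (use co yz in metis)
qed

lemma dual_basis_bijI:
  assumes "k_algebra A" "k_algebra E" "dual_basis A I b co" "linear_map A E f" "dual_basis E J c co'"
    and "bij_betw \<pi> I J" "\<And>p. p \<in> I \<Longrightarrow> f (b p) = c (\<pi> p)"
  shows "bij_betw f (carrier A) (carrier E)"
  unfolding bij_betw_def
proof (intro conjI equalityI subsetI)
  interpret A: k_algebra A by fact
  interpret E: k_algebra E by fact
  note D = dual_basisD[OF assms(3)] and D' = dual_basisD[OF assms(5)]
  show "inj_on f (carrier A)"
    using assms(6) by (intro dual_basis_inj[OF assms(1-5) _ _ assms(7)]) (auto simp: bij_betw_def)
  fix y assume "y \<in> carrier E"
  with D'(2) have "y \<in> lin_combs E c J" using dual_basis_lin_combs[OF assms(5)] by blast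
  with D'(2) show "y \<in> f ` carrier A"
  proof (induction rule: E.lin_combs_induct)
    case zero
    have "f \<zero>\<^bsub>A\<^esub> = \<zero>\<^bsub>E\<^esub>" by (rule linear_map_zero[OF assms(1,2,4)])
    then show ?case by (metis A.zero_closed image_eqI)
  next
    case (step k r y)
    obtain p where p: "p \<in> I" "r = \<pi> p" using step(1) assms(6) by (auto simp: bij_betw_def)
    obtain a where a: "a \<in> carrier A" "y = f a" using step(3) by auto
    have "f (k \<odot>\<^bsub>A\<^esub> b p \<oplus>\<^bsub>A\<^esub> a) = k \<odot>\<^bsub>E\<^esub> c r \<oplus>\<^bsub>E\<^esub> y"
      using p a D(3) by (simp add: linear_map_add[OF assms(4)] linear_map_smult[OF assms(4)] assms(7))
    then show ?case using p a D(3) by (intro image_eqI[of _ _ "k \<odot>\<^bsub>A\<^esub> b p \<oplus>\<^bsub>A\<^esub> a"]) auto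
  qed
next
  fix y assume "y \<in> f ` carrier A"
  then show "y \<in> carrier E" using linear_map_closed[OF assms(4)] by auto
qed

lemma dual_basis_reindex:
  assumes "k_algebra A" "dual_basis A I b co" "bij_betw \<pi> J I"
  shows "dual_basis A J (\<lambda>p. b (\<pi> p)) (\<lambda>p. co (\<pi> p))"
proof -
  interpret A: k_algebra A by fact
  note D = dual_basisD[OF assms(2)]
  have \<pi>: "p \<in> J \<Longrightarrow> \<pi> p \<in> I" "inj_on \<pi> J" "I = \<pi> ` J" for p
    using assms(3) by (auto simp: bij_betw_def)
  have "(\<Oplus>\<^bsub>A\<^esub>p\<in>I. co p y \<odot>\<^bsub>A\<^esub> b p) = (\<Oplus>\<^bsub>A\<^esub>p\<in>J. co (\<pi> p) y \<odot>\<^bsub>A\<^esub> b (\<pi> p))" for y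
    unfolding \<pi>(3) by (rule A.finsum_reindex) (use \<pi> D in auto)
  then show ?thesis
    using D \<pi> bij_betw_finite[OF assms(3)] unfolding dual_basis_def by (auto simp: inj_on_eq_iff)
qed

lemma bilinear_map_functionals:
  "linear_map A scalars \<phi> \<Longrightarrow> linear_map B scalars \<psi> \<Longrightarrow> bilinear_map A B scalars (\<lambda>a b. \<phi> a * \<psi> b)"
  using bilinear_map_mult[OF k_algebra_scalars] by simp

text \<open>The tensor product is a quotient, so independence of the pure tensors has to be detected
  from outside: products of coordinate functionals are bilinear and lift to functionals on
  it.\<close>

lemma dual_basis_tensor:
  assumes A: "k_algebra A" and B: "k_algebra B" and "dual_basis A I b co" "dual_basis B J c co'"
  shows "dual_basis (tensor A B) (I \<times> J) (\<lambda>(p, r). pure_tensor A B (b p) (c r))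
    (\<lambda>(p, r). tensor_lift A B scalars (\<lambda>a y. co p a * co' r y))"
proof -
  interpret A: k_algebra A by fact
  interpret B: k_algebra B by fact
  interpret T: k_algebra "tensor A B" by (rule k_algebra_tensor[OF A B])
  note D = dual_basisD[OF assms(3)] and D' = dual_basisD[OF assms(4)]
  let ?b = "\<lambda>(p, r). pure_tensor A B (b p) (c r)"
  have cl: "?b \<in> I \<times> J \<rightarrow> carrier (tensor A B)"
    using D(3) D'(3) by (auto intro!: pure_tensor_closed[OF A B])
  note V = T.lin_combs_zero[OF cl] T.lin_combs_add[OF cl] T.lin_combs_smult[OF cl] T.lin_combs_basis[OF cl]
  have 1: "pure_tensor A B (b p) y \<in> lin_combs (tensor A B) ?b (I \<times> J)" if "p \<in> I" "y \<in> carrier B" for p y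
  proof -
    have "y \<in> lin_combs B c J" using dual_basis_lin_combs[OF assms(4)] that by blast
    with D'(2) show ?thesis
    proof (induction rule: B.lin_combs_induct)
      case zero
      have "pure_tensor A B (b p) \<zero>\<^bsub>B\<^esub> = \<zero>\<^bsub>tensor A B\<^esub>"
        using pure_tensor_smult_right[OF A B D(3)[OF that(1)] B.zero_closed, of 0]
          pure_tensor_closed[OF A B D(3)[OF that(1)] B.zero_closed] by simp
      then show ?case using V(1) by simp
    next
      case (step k r y)
      then show ?case
        using D(3)[OF that(1)] D'(3)[of r] V(2,3) V(4)[of "(p, r)"] D(1) D'(1) that(1)
        by (simp add: pure_tensor_add_right[OF A B] pure_tensor_smult_right[OF A B])
    qed
  qed
  have 2: "pure_tensor A B a y \<in> lin_combs (tensor A B) ?b (I \<times> J)" if "a \<in> carrier A" "y \<in> carrier B" for a y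
  proof -
    have "a \<in> lin_combs A b I" using dual_basis_lin_combs[OF assms(3)] that by blast
    with D(2) show ?thesis
    proof (induction rule: A.lin_combs_induct)
      case zero
      have "pure_tensor A B \<zero>\<^bsub>A\<^esub> y = \<zero>\<^bsub>tensor A B\<^esub>"
        using pure_tensor_smult_left[OF A B A.zero_closed that(2), of 0]
          pure_tensor_closed[OF A B A.zero_closed that(2)] by simp
      then show ?case using V(1) by simp
    next
      case (step k p a)
      then show ?case
        using D(3)[of p] V(2,3) 1 that(2)
        by (simp add: pure_tensor_add_left[OF A B] pure_tensor_smult_left[OF A B])
    qed
  qed
  show ?thesis
  proof (rule T.dual_basisI[OF _ cl])
    show "carrier (tensor A B) \<subseteq> lin_combs (tensor A B) ?b (I \<times> J)"
    proof
      fix t assume "t \<in> carrier (tensor A B)"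
      then show "t \<in> lin_combs (tensor A B) ?b (I \<times> J)"
        by (induction rule: tensor_induct[OF A B, consumes 1, case_names pure add]) (use 2 V(2) in auto)
    qed
    fix p assume "p \<in> I \<times> J"
    then obtain i j where p: "p = (i, j)" "i \<in> I" "j \<in> J" by auto
    note bil = bilinear_map_functionals[OF D(4)[OF p(2)] D'(4)[OF p(3)]]
    show "linear_map (tensor A B) scalars ((\<lambda>(p, r). tensor_lift A B scalars (\<lambda>a y. co p a * co' r y)) p)"
      using tensor_lift_linear[OF A B k_algebra_scalars bil] p by simp
    fix p' assume "p' \<in> I \<times> J"
    then show "(\<lambda>(p, r). tensor_lift A B scalars (\<lambda>a y. co p a * co' r y)) p (?b p') = (if p = p' then 1 else 0)"
      using p D(3,5) D'(3,5) by (auto simp: tensor_lift_pure[OF A B k_algebra_scalars bil] split: if_splits)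
  qed (use D(1) D'(1) in auto)
qed

lemma monoid_algebra_dual_basis:
  fixes G :: "('g, 'z) monoid_scheme"
  assumes G: "Group.monoid G" and fin: "finite (carrier G)"
  shows "dual_basis (monoid_algebra G) (carrier G) (\<lambda>x. Poly_Mapping.single x (1::'k::field)) (\<lambda>x p. Poly_Mapping.lookup p x)"
proof -
  interpret K: k_algebra "monoid_algebra G :: ('k, 'g \<Rightarrow>\<^sub>0 'k) module"
    by (rule k_algebra_monoid_algebra[OF G])
  have cl: "(\<lambda>x. Poly_Mapping.single x (1::'k)) \<in> carrier G \<rightarrow> carrier (monoid_algebra G)" by simp
  show ?thesis
  proof (rule K.dual_basisI[OF fin cl])
    show "linear_map (monoid_algebra G) scalars (\<lambda>p. Poly_Mapping.lookup p x :: 'k)" for x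
      by (rule linear_mapI) (simp_all add: monoid_algebra_simps lookup_add)
    show "carrier (monoid_algebra G) \<subseteq> lin_combs (monoid_algebra G) (\<lambda>x. Poly_Mapping.single x (1::'k)) (carrier G)"
    proof
      fix p :: "'g \<Rightarrow>\<^sub>0 'k" assume "p \<in> carrier (monoid_algebra G)"
      then show "p \<in> lin_combs (monoid_algebra G) (\<lambda>x. Poly_Mapping.single x (1::'k)) (carrier G)"
      proof (induction rule: monoid_algebra_induct)
        case zero
        then show ?case using K.lin_combs_zero[OF cl] by (simp add: monoid_algebra_simps)
      next
        case (single x c)
        then show ?case
          using K.lin_combs_smult[OF cl K.lin_combs_basis[OF cl fin single], of c] by (simp add: monoid_algebra_simps)
      next
        case (add p r)
        then show ?case using K.lin_combs_add[OF cl add(3,4)] by (simp add: monoid_algebra_simps)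
      qed
    qed
  qed (auto simp: lookup_single)
qed

lemma same_algebra_dual_basis:
  assumes "same_algebra A A'" "k_algebra A" "dual_basis A I b co"
  shows "\<exists>co'. dual_basis A' I b co'"
proof -
  have "linear_map A A' (\<lambda>x. x)" "bij_betw (\<lambda>x. x) (carrier A) (carrier A')"
    using assms(1) by (auto simp: same_algebra_def linear_map_def bij_betw_def)
  then show ?thesis
    using dual_basis_bij[OF assms(2) same_algebra_k_algebra[OF assms(1,2)] assms(3), of "\<lambda>x. x"] by blast
qed


section \<open>Hopf algebra maps out of the three Hopf algebras\<close>

text \<open>The condition on the counit excludes the zero element.\<close>

definition group_like :: "('k::field, 'a, 'z) hopf_scheme \<Rightarrow> 'a \<Rightarrow> bool" where
  "group_like H g \<longleftrightarrow> g \<in> carrier H \<and> comult H g = pure_tensor H H g g \<and> counit H g = 1"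

definition skew_primitive :: "('k::field, 'a, 'z) hopf_scheme \<Rightarrow> 'a \<Rightarrow> 'a \<Rightarrow> 'a \<Rightarrow> bool" where
  "skew_primitive H u v x \<longleftrightarrow> x \<in> carrier H \<and>
     comult H x = pure_tensor H H x v \<oplus>\<^bsub>tensor H H\<^esub> pure_tensor H H u x \<and> counit H x = 0"

context
  fixes E :: "('k::field, 'e, 'z) hopf_scheme" (structure) and h x :: 'e and m :: nat and q :: 'k
  assumes E: "prebialgebra E" and q: "has_order q m"
    and h: "group_like E h" and x: "skew_primitive E \<one> h x"
begin

interpretation E: prebialgebra E by (rule E)

lemma taft_hopf_hom:
  assumes rel: "taft_relations E m q h x"
  obtains f where "hopf_hom (taft_algebra m q) E f" "f (taft_gen m q gen_h) = h" "f (taft_gen m q gen_x) = x"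
proof -
  let ?A = "taft_algebra m q"
  interpret A: prebialgebra ?A by (rule taft_prebialgebra[OF q])
  obtain f where f: "algebra_hom ?A E f" "f (taft_gen m q gen_h) = h" "f (taft_gen m q gen_x) = x"
    using taft_hom_exists[OF E.is_k_algebra, of m q "case_gen h h x"] rel by auto
  note tl = tensor_map_linear[OF A.is_k_algebra A.is_k_algebra E.is_k_algebra E.is_k_algebra
      algebra_hom_linear[OF f(1)] algebra_hom_linear[OF f(1)]]
    and tp = tensor_map_pure[OF A.is_k_algebra A.is_k_algebra E.is_k_algebra E.is_k_algebra
      algebra_hom_linear[OF f(1)] algebra_hom_linear[OF f(1)]]
  have "hopf_hom ?A E f"
    by (rule hopf_hom_on_generators[OF A.prebialgebra_axioms E f(1) _ taft_generated])
       (use h x in \<open>auto simp: f taft_comult[OF q] taft_counit[OF q] tp linear_map_add[OF tl] group_like_def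
          skew_primitive_def algebra_hom_one[OF f(1)] pure_tensor_closed[OF A.is_k_algebra A.is_k_algebra]\<close>)
  with f(2,3) show thesis using that by blast
qed

lemma T_hopf_hom:
  assumes g: "group_like E g" and rel: "T_relations E n m \<omega> q g h x"
  obtains f where "hopf_hom (T_algebra n m \<omega> q) E f" "f (T_gen n m \<omega> q gen_g) = g"
    "f (T_gen n m \<omega> q gen_h) = h" "f (T_gen n m \<omega> q gen_x) = x"
proof -
  let ?A = "T_algebra n m \<omega> q"
  interpret A: pointed_generators ?A "T_gen n m \<omega> q gen_g" "T_gen n m \<omega> q gen_h" "T_gen n m \<omega> q gen_x"
    by (rule T_pointed[OF q])
  obtain f where f: "algebra_hom ?A E f" "\<And>s. f (T_gen n m \<omega> q s) = case_gen g h x s"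
    using T_hom_exists[OF E.is_k_algebra, of n m \<omega> q "case_gen g h x"] rel by auto
  note tl = tensor_map_linear[OF A.is_k_algebra A.is_k_algebra E.is_k_algebra E.is_k_algebra
      algebra_hom_linear[OF f(1)] algebra_hom_linear[OF f(1)]]
    and tp = tensor_map_pure[OF A.is_k_algebra A.is_k_algebra E.is_k_algebra E.is_k_algebra
      algebra_hom_linear[OF f(1)] algebra_hom_linear[OF f(1)]]
  have "hopf_hom ?A E f"
    by (rule hopf_hom_on_generators[OF A.prebialgebra_axioms E f(1) _ A.generated])
       (use g h x in \<open>auto simp: f A.comult_g A.comult_h A.comult_x A.counit_g A.counit_h A.counit_x tp
          linear_map_add[OF tl] group_like_def skew_primitive_def algebra_hom_one[OF f(1)]
          pure_tensor_closed[OF A.is_k_algebra A.is_k_algebra]\<close>)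
  with f(2) show thesis using that[of f] by simp
qed

end

lemma (in prebialgebra) cyclic_hopf_hom:
  assumes g: "group_like H g" and n: "0 < n" "g [^] n = \<one>"
  obtains j where "hopf_hom (group_hopf_algebra (integer_mod_group n)) H j"
    "\<And>k. k < n \<Longrightarrow> j (Poly_Mapping.single (int k) 1) = g [^] k"
proof -
  let ?G = "integer_mod_group n"
  let ?K = "group_hopf_algebra ?G :: ('k, int \<Rightarrow>\<^sub>0 'k) hopf"
  interpret G: Group.group ?G by simp
  interpret K: prebialgebra ?K by (rule group_algebra_prebialgebra[OF G.is_group])
  note KA = is_k_algebra
  have gc: "g \<in> carrier H" and \<Delta>g: "comult H g = pure_tensor H H g g" and \<epsilon>g: "counit H g = 1"
    using g by (auto simp: group_like_def)
  let ?b = "\<lambda>k. g [^] (nat k)"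
  let ?j = "linear_extension H ?b"
  have b: "?b \<in> carrier ?G \<rightarrow> carrier H" using gc by simp
  have "algebra_hom (monoid_algebra ?G) H ?j"
  proof (rule linear_extension_algebra_hom[OF KA G.is_monoid b])
    fix a b assume "a \<in> carrier ?G" "b \<in> carrier ?G"
    then have ab: "0 \<le> a" "0 \<le> b" using n by (auto simp: carrier_integer_mod_group)
    have "g [^] nat ((a + b) mod int n) = g [^] (nat (a + b) mod n)"
      using ab by (simp add: nat_mod_distrib)
    also have "\<dots> = g [^] nat (a + b)" by (rule pow_mod[OF gc n(2), symmetric])
    also have "\<dots> = g [^] nat a \<otimes> g [^] nat b" by (simp only: nat_add_distrib[OF ab] nat_pow_mult[OF gc])
    finally show "g [^] nat (a \<otimes>\<^bsub>?G\<^esub> b) = g [^] nat a \<otimes> g [^] nat b" by simp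
  qed simp
  then have hom: "algebra_hom ?K H ?j"
    using same_algebra_algebra_hom[OF same_algebra_group same_algebra_refl] by metis
  have j: "?j (Poly_Mapping.single k 1) = g [^] nat k" for k
    using gc by (simp add: linear_extension_single[OF KA])
  note lj = algebra_hom_linear[OF hom]
  note tl = tensor_map_linear[OF K.is_k_algebra K.is_k_algebra KA KA lj lj]
    and tp = tensor_map_pure[OF K.is_k_algebra K.is_k_algebra KA KA lj lj]
  have KG: "linear_map ?K B = linear_map (monoid_algebra ?G) B" "carrier ?K = carrier (monoid_algebra ?G)" for B :: "('k, 'b, 'y) module_scheme"
    using same_algebra_linear_map[OF same_algebra_group same_algebra_refl]
      same_algebra_group by (metis, metis same_algebra_def)
  have c1: "linear_map ?K (tensor H H) (\<lambda>p. comult H (?j p))"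
    by (rule linear_map_compose[OF lj algebra_hom_linear[OF comult_hom]])
  have c2: "linear_map ?K (tensor H H) (\<lambda>p. tensor_map ?K ?K H H ?j ?j (comult ?K p))"
    by (rule linear_map_compose[OF algebra_hom_linear[OF K.comult_hom] tl])
  have c3: "linear_map ?K scalars (\<lambda>p. counit H (?j p))"
    by (rule linear_map_compose[OF lj algebra_hom_linear[OF counit_hom]])
  have \<Delta>: "comult H (g [^] k) = pure_tensor H H (g [^] k) (g [^] k)" for k :: nat
    using algebra_hom_pow[OF KA k_algebra_tensor[OF KA KA] comult_hom gc]
    by (simp add: \<Delta>g pure_tensor_pow[OF KA KA] gc)
  have \<epsilon>: "counit H (g [^] k) = 1" for k :: nat
    using algebra_hom_pow[OF KA k_algebra_scalars counit_hom gc] by (simp add: \<epsilon>g scalars_pow)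
  have "comult H (?j p) = tensor_map ?K ?K H H ?j ?j (comult ?K p)" if "p \<in> carrier ?K" for p
  proof (rule linear_map_monoid_algebra_eq[OF G.is_monoid k_algebra_tensor[OF KA KA]])
    show "linear_map (monoid_algebra ?G) (tensor H H) (\<lambda>p. comult H (?j p))"
      "linear_map (monoid_algebra ?G) (tensor H H) (\<lambda>p. tensor_map ?K ?K H H ?j ?j (comult ?K p))"
      using c1 c2 by (simp_all add: KG)
    fix k assume k: "k \<in> carrier ?G"
    then have "Poly_Mapping.single k 1 \<in> carrier ?K" by (simp add: KG)
    then show "comult H (?j (Poly_Mapping.single k 1)) =
        tensor_map ?K ?K H H ?j ?j (comult ?K (Poly_Mapping.single k 1))"
      by (simp add: group_algebra_comult[OF G.is_group k] tp j \<Delta>)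
  qed (use that in \<open>simp add: KG\<close>)
  moreover have "counit H (?j p) = counit ?K p" if "p \<in> carrier ?K" for p
  proof (rule linear_map_monoid_algebra_eq[OF G.is_monoid k_algebra_scalars])
    show "linear_map (monoid_algebra ?G) scalars (\<lambda>p. counit H (?j p))"
      "linear_map (monoid_algebra ?G) scalars (counit ?K)"
      using c3 algebra_hom_linear[OF K.counit_hom] by (simp_all add: KG)
    fix k assume k: "k \<in> carrier ?G"
    show "counit H (?j (Poly_Mapping.single k 1)) = counit ?K (Poly_Mapping.single k 1)"
      by (simp add: group_algebra_counit[OF G.is_group k] j \<epsilon>)
  qed (use that in \<open>simp add: KG\<close>)
  ultimately have "hopf_hom ?K H ?j" using hom by (simp add: hopf_hom_def)
  then show thesis using that j by simp
qed

lemma group_like_hopf_hom: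
  assumes "prebialgebra A" "prebialgebra B" "hopf_hom A B f" "group_like A g"
  shows "group_like B (f g)"
proof -
  interpret A: prebialgebra A by fact
  interpret B: prebialgebra B by fact
  note tp = tensor_map_pure[OF A.is_k_algebra A.is_k_algebra B.is_k_algebra B.is_k_algebra
      hopf_homD(2)[OF assms(3)] hopf_homD(2)[OF assms(3)]]
  show ?thesis
    using assms(4) hopf_homD[OF assms(3)] by (simp add: group_like_def tp)
qed

lemma skew_primitive_hopf_hom:
  assumes "prebialgebra A" "prebialgebra B" "hopf_hom A B f" "skew_primitive A u v x" "u \<in> carrier A" "v \<in> carrier A"
  shows "skew_primitive B (f u) (f v) (f x)"
proof -
  interpret A: prebialgebra A by fact
  interpret B: prebialgebra B by fact
  note tp = tensor_map_pure[OF A.is_k_algebra A.is_k_algebra B.is_k_algebra B.is_k_algebra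
      hopf_homD(2)[OF assms(3)] hopf_homD(2)[OF assms(3)]]
    and tl = tensor_map_linear[OF A.is_k_algebra A.is_k_algebra B.is_k_algebra B.is_k_algebra
      hopf_homD(2)[OF assms(3)] hopf_homD(2)[OF assms(3)]]
  show ?thesis
    using assms(4-6) hopf_homD[OF assms(3)]
    by (simp add: skew_primitive_def tp linear_map_add[OF tl] pure_tensor_closed[OF A.is_k_algebra A.is_k_algebra])
qed

lemma (in prebialgebra) group_like_mult:
  "group_like H a \<Longrightarrow> group_like H b \<Longrightarrow> group_like H (a \<otimes> b)"
  using algebra_hom_mult[OF counit_hom]
  by (simp add: group_like_def algebra_hom_mult[OF comult_hom] pure_tensor_mult[OF is_k_algebra is_k_algebra])

lemma (in prebialgebra) group_like_one: "group_like H \<one>"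
  using algebra_hom_one[OF counit_hom]
  by (simp add: group_like_def algebra_hom_one[OF comult_hom] one_tensor[OF is_k_algebra is_k_algebra])

lemma (in prebialgebra) group_like_pow: "group_like H a \<Longrightarrow> group_like H (a [^] (k::nat))"
  by (induction k) (simp_all add: group_like_one group_like_mult)

lemma (in pointed_generators) group_like_gens: "group_like H g" "group_like H h" "skew_primitive H \<one> h x"
  using gens by (simp_all add: group_like_def skew_primitive_def comult_g comult_h comult_x counit_g counit_h counit_x)

section \<open>Group-like and skew-primitive elements\<close>

text \<open>Covers at once the algebras T and every Hopf algebra that factorizes as in the theorem.
  Nothing is assumed about how \<open>g\<close> commutes with \<open>h\<close> and \<open>x\<close>;
  that is derived from the basis.\<close>

locale pointed_basis = prebialgebra H for H :: "('k::field, 'a, 'z) hopf_scheme" (structure) +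
  fixes g h x :: 'a and m n :: nat and q :: 'k and co :: "nat \<times> nat \<times> nat \<Rightarrow> 'a \<Rightarrow> 'k"
  assumes q: "has_order q m" and n: "0 < n"
    and g: "group_like H g" and h: "group_like H h" and x: "skew_primitive H \<one> h x"
    and taft: "taft_relations H m q h x" and g_order: "g [^] n = \<one>"
    and basis: "dual_basis H (monomial_index m n) (monomial H g h x) co"
begin

abbreviation M where "M \<equiv> monomial H g h x"

lemmas KA = is_k_algebra
lemmas D = dual_basisD[OF basis]

lemma elems [simp]: "g \<in> carrier H" "h \<in> carrier H" "x \<in> carrier H"
  using g h x by (auto simp: group_like_def skew_primitive_def)

lemma comult_elems: "comult H g = pure_tensor H H g g" "comult H h = pure_tensor H H h h"
  "comult H x = pure_tensor H H x h \<oplus>\<^bsub>tensor H H\<^esub> pure_tensor H H \<one> x"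
  using g h x by (auto simp: group_like_def skew_primitive_def)

lemma h_order: "h [^] m = \<one>" and xh: "x \<otimes> h = q \<odot> (h \<otimes> x)"
  using taft by (auto simp: taft_relations_def)

lemma m: "0 < m" "1 < m"
  using order_ge_2[OF q] by auto

lemma M_closed [simp]: "M p \<in> carrier H"
  by (cases p) (simp add: monomial_def)

lemma M_mod: "M (i, j, k) = M (i mod m, j, k mod n)"
  using pow_mod[OF _ h_order, of i] pow_mod[OF _ g_order, of k] by (simp add: monomial_def)

text \<open>Since \<open>h^i\<close> stands on the left and \<open>g^k\<close> on the right of a
  monomial, both can be pulled out of the binomial sum for \<open>x^j\<close>. The formula therefore
  rests on the Taft relations alone, before any commutation rule for \<open>g\<close> is known. The
  exponent \<open>i + l\<close> may leave the index range and is reduced later by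
  \<open>M_mod\<close>.\<close>

lemma comult_M:
  "comult H (M (i, j, k)) =
    (\<Oplus>\<^bsub>tensor H H\<^esub>l\<in>{..j}. qbin q j l \<odot>\<^bsub>tensor H H\<^esub> pure_tensor H H (M (i, l, k)) (M (i + l, j - l, k)))"
proof -
  let ?T = "tensor H H"
  interpret T: k_algebra ?T by (rule k_algebra_tensor[OF KA KA])
  note pm = pure_tensor_mult[OF KA KA] and ptc = pure_tensor_closed[OF KA KA] and pp = pure_tensor_pow[OF KA KA]
    and pr = pure_tensor_smult_right[OF KA KA] and pw = algebra_hom_pow[OF KA T.is_k_algebra comult_hom]
  let ?a = "pure_tensor H H x h" and ?b = "pure_tensor H H \<one> x"
  let ?t = "\<lambda>l. pure_tensor H H (x [^] l) (h [^] l \<otimes> x [^] (j - l))"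
  define L where "L t = pure_tensor H H (h [^] i) (h [^] i) \<otimes>\<^bsub>?T\<^esub> t \<otimes>\<^bsub>?T\<^esub> pure_tensor H H (g [^] k) (g [^] k)" for t
  have L: "linear_map ?T ?T L"
    by (rule linear_mapI) (simp_all add: L_def ptc T.l_distr T.r_distr T.smult_mult_left T.smult_mult_right)
  have "comult H (x [^] j) = (?a \<oplus>\<^bsub>?T\<^esub> ?b) [^]\<^bsub>?T\<^esub> j"
    by (simp add: pw comult_elems)
  also have "\<dots> = (\<Oplus>\<^bsub>?T\<^esub>l\<in>{..j}. qbin q j l \<odot>\<^bsub>?T\<^esub> (?a [^]\<^bsub>?T\<^esub> l \<otimes>\<^bsub>?T\<^esub> ?b [^]\<^bsub>?T\<^esub> (j - l)))"
    by (rule T.qbinomial) (simp_all add: ptc pm xh pr)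
  also have "\<dots> = (\<Oplus>\<^bsub>?T\<^esub>l\<in>{..j}. qbin q j l \<odot>\<^bsub>?T\<^esub> ?t l)"
    by (simp add: pp pm)
  finally have x_pow: "comult H (x [^] j) = (\<Oplus>\<^bsub>?T\<^esub>l\<in>{..j}. qbin q j l \<odot>\<^bsub>?T\<^esub> ?t l)" .
  have "comult H (M (i, j, k)) = L (comult H (x [^] j))"
    by (simp add: monomial_def algebra_hom_mult[OF comult_hom] pw comult_elems(1,2) pp L_def)
  also have "\<dots> = (\<Oplus>\<^bsub>?T\<^esub>l\<in>{..j}. L (qbin q j l \<odot>\<^bsub>?T\<^esub> ?t l))"
    unfolding x_pow by (rule linear_map_finsum[OF T.is_k_algebra T.is_k_algebra L]) (auto simp: ptc)
  also have "\<dots> = (\<Oplus>\<^bsub>?T\<^esub>l\<in>{..j}. qbin q j l \<odot>\<^bsub>?T\<^esub> pure_tensor H H (M (i, l, k)) (M (i + l, j - l, k)))"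
  proof (rule T.finsum_cong')
    fix l
    have "L (?t l) = pure_tensor H H (M (i, l, k)) (M (i + l, j - l, k))"
      by (simp add: L_def pm monomial_def nat_pow_mult[symmetric] m_assoc)
    then show "L (qbin q j l \<odot>\<^bsub>?T\<^esub> ?t l) = qbin q j l \<odot>\<^bsub>?T\<^esub> pure_tensor H H (M (i, l, k)) (M (i + l, j - l, k))"
      by (simp add: linear_map_smult[OF L] ptc)
  qed (auto simp: ptc)
  finally show ?thesis .
qed

definition co2 where "co2 p p' = tensor_lift H H scalars (\<lambda>a b. co p a * co p' b)"

context
  fixes p p' assumes p: "p \<in> monomial_index m n" "p' \<in> monomial_index m n"
begin

lemma co2_linear: "linear_map (tensor H H) scalars (co2 p p')"
  unfolding co2_def
  by (rule tensor_lift_linear[OF KA KA k_algebra_scalars bilinear_map_functionals[OF D(4)[OF p(1)] D(4)[OF p(2)]]])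

lemma co2_pure: "a \<in> carrier H \<Longrightarrow> b \<in> carrier H \<Longrightarrow> co2 p p' (pure_tensor H H a b) = co p a * co p' b"
  unfolding co2_def
  by (rule tensor_lift_pure[OF KA KA k_algebra_scalars bilinear_map_functionals[OF D(4)[OF p(1)] D(4)[OF p(2)]]])

end

text \<open>Coordinates of a comultiplication in terms of those of the element. By
  \<open>comult_M\<close>, at most one basis monomial contributes to a given pair: exponents of
  \<open>x\<close> add up, the exponent of \<open>g\<close> is common to both sides, and the right
  exponent of \<open>h\<close> is shifted by the left exponent of \<open>x\<close>.\<close>

lemma co2_comult:
  assumes "i < m" "j < m" "k < n" "i' < m" "j' < m" "k' < n" and y: "y \<in> carrier H"
  shows "co2 (i, j, k) (i', j', k') (comult H y) =
    (if k' = k \<and> i' = (i + j) mod m \<and> j + j' < m then qbin q (j + j') j * co (i, j + j', k) y else 0)"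
proof -
  interpret T: k_algebra "tensor H H" by (rule k_algebra_tensor[OF KA KA])
  have p: "(i, j, k) \<in> monomial_index m n" "(i', j', k') \<in> monomial_index m n" using assms by auto
  note F = co2_linear[OF p]
  let ?R = "\<lambda>y. if k' = k \<and> i' = (i + j) mod m \<and> j + j' < m then qbin q (j + j') j * co (i, j + j', k) y else 0"
  show ?thesis
  proof (rule linear_map_dual_basis_eq[OF KA k_algebra_scalars basis _ _ _ y])
    show "linear_map H scalars (\<lambda>y. co2 (i, j, k) (i', j', k') (comult H y))"
      by (rule linear_map_compose[OF algebra_hom_linear[OF comult_hom] F])
    show "linear_map H scalars ?R"
    \<comment> \<open>The functional \<open>co\<close> is known to be linear only for an index in
      range, which the condition supplies.\<close>
    proof (cases "k' = k \<and> i' = (i + j) mod m \<and> j + j' < m")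
      case True
      then have l: "linear_map H scalars (co (i, j + j', k))" using assms by (intro D(4)) auto
      show ?thesis
        using True by (intro linear_mapI) (simp_all add: linear_map_add[OF l] linear_map_smult[OF l] algebra_simps)
    next
      case False
      show ?thesis by (rule linear_mapI) (simp_all only: False scalars_simps if_False mult_zero_right add_0 UNIV_I)
    qed
    fix P assume P: "P \<in> monomial_index m n"
    obtain I J K where P': "P = (I, J, K)" by (cases P)
    have IJK: "I < m" "J < m" "K < n" using P P' by auto
    have "co2 (i, j, k) (i', j', k') (comult H (M P)) =
        (\<Sum>l\<le>J. co2 (i, j, k) (i', j', k') (qbin q J l \<odot>\<^bsub>tensor H H\<^esub> pure_tensor H H (M (I, l, K)) (M (I + l, J - l, K))))"
      unfolding P' comult_M
      by (subst linear_map_finsum[OF T.is_k_algebra k_algebra_scalars F])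
         (auto simp: pure_tensor_closed[OF KA KA] finsum_scalars)
    also have "\<dots> = (\<Sum>l\<le>J. qbin q J l * (co (i, j, k) (M (I, l, K)) * co (i', j', k') (M ((I + l) mod m, J - l, K))))"
      by (intro sum.cong refl)
         (use IJK(3) in \<open>simp add: linear_map_smult[OF F] pure_tensor_closed[OF KA KA] co2_pure[OF p] M_mod[of "I + _"]\<close>)
    also have "\<dots> = (\<Sum>l\<le>J. if l = j then
        (if I = i \<and> K = k \<and> i' = (I + j) mod m \<and> j' = J - j \<and> k' = K then qbin q J j else 0) else 0)"
      using IJK m assms by (intro sum.cong refl) (auto simp: D(5))
    also have "\<dots> = (if j \<le> J \<and> I = i \<and> K = k \<and> i' = (I + j) mod m \<and> j' = J - j \<and> k' = K then qbin q J j else 0)"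
      by simp
    also have "\<dots> = ?R (M P)"
    proof -
      have R: "j + j' < m \<Longrightarrow> co (i, j + j', k) (M P) = (if i = I \<and> j + j' = J \<and> k = K then 1 else 0)"
        using IJK assms by (simp add: P' D(5))
      show ?thesis
      proof (cases "I = i \<and> K = k \<and> j + j' = J \<and> k' = K \<and> i' = (i + j) mod m")
        case True
        then have "j \<le> J" "j' = J - j" "j + j' < m" using IJK by auto
        then show ?thesis using True R by simp
      next
        case False
        then have "\<not> (j \<le> J \<and> I = i \<and> K = k \<and> i' = (I + j) mod m \<and> j' = J - j \<and> k' = K)" by auto
        moreover have "?R (M P) = 0" using False R by auto
        ultimately show ?thesis by (simp only: if_False)
      qed
    qed
    finally show "co2 (i, j, k) (i', j', k') (comult H (M P)) = ?R (M P)" .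
  qed
qed

text \<open>Compare coordinates of \<open>\<Delta>(y)\<close> and \<open>y \<otimes> y\<close>.
  First no monomial with a positive power of \<open>x\<close> can occur; then the coefficients are
  orthogonal idempotents of the field, so exactly one of them is 1, as the counit excludes
  zero.\<close>

lemma group_like_cases:
  assumes "group_like H y"
  obtains i k where "i < m" "k < n" "y = M (i, 0, k)"
proof -
  have y: "y \<in> carrier H" "comult H y = pure_tensor H H y y" "counit H y = 1"
    using assms by (auto simp: group_like_def)
  have eq: "co (i, j, k) y * co (i', j', k') y =
      (if k' = k \<and> i' = (i + j) mod m \<and> j + j' < m then qbin q (j + j') j * co (i, j + j', k) y else 0)"
    if "i < m" "j < m" "k < n" "i' < m" "j' < m" "k' < n" for i j k i' j' k'
    using co2_comult[OF that y(1)] that y by (simp add: co2_pure)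
  have "\<exists>p\<in>monomial_index m n. co p y \<noteq> 0"
  proof (rule ccontr)
    assume "\<not> ?thesis"
    moreover have "co p \<zero> = 0" if "p \<in> monomial_index m n" for p
      using linear_map_zero[OF KA k_algebra_scalars D(4)[OF that]] by simp
    ultimately have "y = \<zero>" using y(1) by (intro dual_basis_eqI[OF basis]) auto
    then show False
      using linear_map_zero[OF KA k_algebra_scalars algebra_hom_linear[OF counit_hom]] y(3) by simp
  qed
  then obtain p0 where p0: "p0 \<in> monomial_index m n" "co p0 y \<noteq> 0" by blast
  let ?S = "{p \<in> monomial_index m n. co p y \<noteq> 0}"
  define J where "J = Max ((\<lambda>(i, j, k). j) ` ?S)"
  have fin: "finite ((\<lambda>(i, j, k). j) ` ?S)" by simp
  have le: "j \<le> J" if "(i, j, k) \<in> ?S" for i j k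
    unfolding J_def using that by (intro Max_ge[OF fin]) force
  have "J \<in> (\<lambda>(i, j, k). j) ` ?S"
    unfolding J_def using p0 by (intro Max_in[OF fin]) auto
  then obtain i k where ik: "(i, J, k) \<in> ?S" by auto
  \<comment> \<open>With \<open>J\<close> the highest occurring exponent of \<open>x\<close>, the
    square of a nonzero coefficient in degree \<open>J\<close> would have to come from a monomial of
    degree \<open>2 J\<close>. For \<open>J > 0\<close> such a monomial is absent from
    \<open>y\<close> or already zero.\<close>
  have "J = 0"
  proof (rule ccontr)
    assume "J \<noteq> 0"
    then have "J + J < m \<Longrightarrow> co (i, J + J, k) y = 0" using le[of i "J + J" k] ik by fastforce
    then show False using eq[of i J k i J k] ik by (auto split: if_splits)
  qed
  then have ik0: "i < m" "k < n" "co (i, 0, k) y \<noteq> 0" using ik by auto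
  have "y = M (i, 0, k)"
  proof (rule dual_basis_eqI[OF basis y(1)])
    fix p assume p: "p \<in> monomial_index m n"
    obtain i' j' k' where p': "p = (i', j', k')" by (cases p)
    have "j' \<noteq> 0 \<Longrightarrow> co p y = 0" using le[of i' j' k'] p p' \<open>J = 0\<close> by auto
    moreover have "co (i, 0, k) y = 1" using eq[of i 0 k i 0 k] ik0 m by simp
    moreover have "j' = 0 \<Longrightarrow> p \<noteq> (i, 0, k) \<Longrightarrow> co p y = 0"
      using eq[of i 0 k i' 0 k'] ik0 m p p' by (auto split: if_splits)
    ultimately show "co p y = co p (M (i, 0, k))"
      using p p' ik0 m by (cases "p = (i, 0, k)") (auto simp: D(5))
  qed simp
  with ik0 show thesis using that by blast
qed

text \<open>Coordinates are compared according to the exponent of \<open>x\<close>. Degree at least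
  2 is excluded by the nonvanishing Gaussian binomials, degree 1 leaves the single monomial with
  coefficient \<open>\<gamma>\<close>, and degree 0 leaves a multiple of the difference of the two
  group-likes.\<close>

lemma skew_primitive_cases:
  assumes y: "y \<in> carrier H"
    and \<Delta>: "comult H y = pure_tensor H H y (M (a', 0, b')) \<oplus>\<^bsub>tensor H H\<^esub> pure_tensor H H (M (a, 0, b)) y"
    and ab: "a < m" "b < n" "a' < m" "b' < n"
  obtains \<gamma> \<mu> where "y = \<gamma> \<odot> M (a, 1, b) \<oplus> \<mu> \<odot> (M (a', 0, b') \<ominus> M (a, 0, b))"
    "\<gamma> \<noteq> 0 \<Longrightarrow> a' = Suc a mod m \<and> b' = b"
proof -
  interpret T: k_algebra "tensor H H" by (rule k_algebra_tensor[OF KA KA])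
  define c where "c i j k = co (i, j, k) y" for i j k
  have eq: "c i j k * (if (i', j', k') = (a', 0, b') then 1 else 0) + (if (i, j, k) = (a, 0, b) then 1 else 0) * c i' j' k' =
      (if k' = k \<and> i' = (i + j) mod m \<and> j + j' < m then qbin q (j + j') j * c i (j + j') k else 0)"
    if "i < m" "j < m" "k < n" "i' < m" "j' < m" "k' < n" for i j k i' j' k'
  proof -
    have p: "(i, j, k) \<in> monomial_index m n" "(i', j', k') \<in> monomial_index m n" using that by auto
    have "co (i', j', k') (M (a', 0, b')) = (if (i', j', k') = (a', 0, b') then 1 else 0)"
      "co (i, j, k) (M (a, 0, b)) = (if (i, j, k) = (a, 0, b) then 1 else 0)"
      using p ab m by (auto simp: D(5))
    then show ?thesis
      using co2_comult[OF that y] unfolding \<Delta> c_def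
      by (simp add: linear_map_add[OF co2_linear[OF p]] co2_pure[OF p] y pure_tensor_closed[OF KA KA])
  qed
  \<comment> \<open>Look at the part of the comultiplication with exponents of \<open>x\<close>
    equal to 1 on the left and \<open>j - 1\<close> on the right. A skew-primitive element has none
    there, since each of its two terms has a group-like factor.\<close>
  have c2: "c i j k = 0" if "i < m" "j < m" "k < n" "2 \<le> j" for i j k
  proof -
    have "qbin q j 1 * c i j k = 0"
      using eq[of i 1 k "(i + 1) mod m" "j - 1" k] that m by (simp split: if_splits)
    then show ?thesis using qbin_nonzero[OF q, of 1 j] that by simp
  qed
  \<comment> \<open>The two ways to place the single \<open>x\<close> give two conditions: with
    \<open>x\<close> on the left the right factor must be the second group-like, and with
    \<open>x\<close> on the right the left factor must be the first.\<close>
  have c1: "c i 1 k = 0 \<or> i = a \<and> k = b \<and> a' = Suc a mod m \<and> b' = b" if "i < m" "k < n" for i k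
  proof -
    have "c i 1 k * (if (Suc i mod m, k) = (a', b') then 1 else 0) = c i 1 k"
      using eq[of i 1 k "(i + 1) mod m" 0 k] that m by (simp split: if_splits)
    moreover have "(if (i, k) = (a, b) then 1 else 0) * c i 1 k = c i 1 k"
      using eq[of i 0 k i 1 k] that m by (simp split: if_splits)
    ultimately show ?thesis by (auto split: if_splits)
  qed
  have c0: "c i 0 k = 0" if "i < m" "k < n" "(i, k) \<noteq> (a, b)" "(i, k) \<noteq> (a', b')" for i k
    using eq[of i 0 k i 0 k] that m by (auto split: if_splits)
  \<comment> \<open>Used when the two group-likes coincide: the comparison then reads
    \<open>c + c = c\<close>.\<close>
  have "(2::'k) \<noteq> 1"
    by (metis add_cancel_right_right one_add_one zero_neq_one)
  then have c_uv: "(a, b) \<noteq> (a', b') \<Longrightarrow> c a 0 b = - c a' 0 b'" "(a, b) = (a', b') \<Longrightarrow> c a 0 b = 0"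
    using eq[of a 0 b a' 0 b'] ab m by (auto simp: eq_neg_iff_add_eq_0 add.commute split: if_splits)
  let ?z = "c a 1 b \<odot> M (a, 1, b) \<oplus> c a' 0 b' \<odot> (M (a', 0, b') \<ominus> M (a, 0, b))"
  have "y = ?z"
  proof (rule dual_basis_eqI[OF basis y])
    fix p assume p: "p \<in> monomial_index m n"
    obtain i j k where p': "p = (i, j, k)" by (cases p)
    have ijk: "i < m" "j < m" "k < n" using p p' by auto
    note l = D(4)[OF p]
    have "co p ?z = c a 1 b * (if p = (a, 1, b) then 1 else 0) +
        c a' 0 b' * ((if p = (a', 0, b') then 1 else 0) - (if p = (a, 0, b) then 1 else 0))"
    proof -
      have "co p (\<ominus> M (a, 0, b)) = - co p (M (a, 0, b))"
        using linear_map_smult[OF l, of "M (a, 0, b)" "- 1"] by (simp add: smult_minus1)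
      then show ?thesis
        using p ab m by (simp add: linear_map_add[OF l] linear_map_smult[OF l] a_minus_def D(5))
    qed
    also have "\<dots> = co p y"
    proof (cases "j = 0")
      case True
      then show ?thesis
        using c0[of i k] c_uv ijk p' by (auto simp: c_def)
    next
      case False
      then consider "j = 1" | "2 \<le> j" by linarith
      then show ?thesis
        using c1[of i k] c2[of i j k] ijk p' by cases (auto simp: c_def)
    qed
    finally show "co p y = co p ?z" ..
  qed simp
  moreover have "c a 1 b \<noteq> 0 \<Longrightarrow> a' = Suc a mod m \<and> b' = b" using c1[of a b] ab by auto
  ultimately show thesis using that by blast
qed

end

section \<open>Factorizations as monomial bases, and the relations that they force\<close>

section \<open>Hopf algebras factorizing through a Taft algebra and a cyclic group algebra\<close>

abbreviation cyclic_algebra :: "nat \<Rightarrow> ('k::field, int \<Rightarrow>\<^sub>0 'k) hopf" where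
  "cyclic_algebra n \<equiv> group_hopf_algebra (integer_mod_group n)"

lemma group_hopf_algebra_simps:
  "carrier (group_hopf_algebra G) = carrier (monoid_algebra G)"
  "a \<otimes>\<^bsub>group_hopf_algebra G\<^esub> b = a \<otimes>\<^bsub>monoid_algebra G\<^esub> b"
  "\<one>\<^bsub>group_hopf_algebra G\<^esub> = Poly_Mapping.single \<one>\<^bsub>G\<^esub> 1"
  by (simp_all add: group_hopf_algebra_def Let_def module.defs hopf.defs monoid_algebra_simps)

lemma cyclic_prebialgebra: "prebialgebra (cyclic_algebra n)"
  by (rule group_algebra_prebialgebra) simp

lemma cyclic_dual_basis:
  assumes "0 < n"
  shows "\<exists>co. dual_basis (cyclic_algebra n :: ('k::field, int \<Rightarrow>\<^sub>0 'k) hopf) {..<n} (\<lambda>k. Poly_Mapping.single (int k) 1) co"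
proof -
  let ?G = "integer_mod_group n"
  interpret G: Group.group ?G by simp
  have car: "carrier ?G = int ` {..<n}"
    using assms by (simp add: carrier_integer_mod_group image_int_atLeastLessThan lessThan_atLeast0)
  have "dual_basis (monoid_algebra ?G) (carrier ?G) (\<lambda>x. Poly_Mapping.single x (1::'k)) (\<lambda>x p. Poly_Mapping.lookup p x)"
    by (rule monoid_algebra_dual_basis[OF G.is_monoid]) (simp add: car)
  then obtain co where co: "dual_basis (cyclic_algebra n :: ('k, int \<Rightarrow>\<^sub>0 'k) hopf) (carrier ?G) (\<lambda>x. Poly_Mapping.single x 1) co"
    using same_algebra_dual_basis[OF same_algebra_group k_algebra_monoid_algebra[OF G.is_monoid]] by blast
  have "bij_betw int {..<n} (carrier ?G)"
    unfolding car by (rule bij_betw_imageI) auto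
  from dual_basis_reindex[OF prebialgebra.axioms(1)[OF cyclic_prebialgebra] co this] show ?thesis by blast
qed

lemma dual_basis_cong:
  assumes A: "k_algebra A" and eq: "\<And>p. p \<in> I \<Longrightarrow> b p = b' p" and b: "dual_basis A I b co"
  shows "dual_basis A I b' co"
proof -
  interpret A: k_algebra A by (rule A)
  note D = dual_basisD[OF b]
  have cl: "p \<in> I \<Longrightarrow> b' p \<in> carrier A" for p using D(3)[of p] eq by simp
  have "(\<Oplus>\<^bsub>A\<^esub>p\<in>I. co p y \<odot>\<^bsub>A\<^esub> b p) = (\<Oplus>\<^bsub>A\<^esub>p\<in>I. co p y \<odot>\<^bsub>A\<^esub> b' p)" for y
    by (rule A.finsum_cong') (use cl eq in auto)
  then show ?thesis using D cl eq unfolding dual_basis_def by auto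
qed

lemma bij_betw_monomial_index:
  "bij_betw (\<lambda>(i, j, k). ((i, j, 0), k)) (monomial_index m n) (monomial_index m 1 \<times> {..<n})"
  by (rule bij_betw_byWitness[of _ "\<lambda>((i, j, _), k). (i, j, k)"]) auto

context
  fixes E :: "('k::field, 'e, 'z) hopf_scheme" (structure) and m n :: nat and q :: 'k
    and i :: "(gen list \<Rightarrow>\<^sub>0 'k) set \<Rightarrow> 'e" and j :: "(int \<Rightarrow>\<^sub>0 'k) \<Rightarrow> 'e"
  assumes E: "prebialgebra E" and q: "has_order q m" and n: "0 < n"
    and i: "hopf_hom (taft_algebra m q) E i" and j: "hopf_hom (cyclic_algebra n) E j"
begin

interpretation E: prebialgebra E by (rule E)
interpretation A: prebialgebra "taft_algebra m q" by (rule taft_prebialgebra[OF q])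
interpretation C: prebialgebra "cyclic_algebra n :: ('k, int \<Rightarrow>\<^sub>0 'k) hopf" by (rule cyclic_prebialgebra)

private abbreviation (input) "TA \<equiv> taft_algebra m q"
private abbreviation (input) "CA \<equiv> cyclic_algebra n :: ('k, int \<Rightarrow>\<^sub>0 'k) hopf"
private abbreviation (input) "hT \<equiv> taft_gen m q gen_h"
private abbreviation (input) "xT \<equiv> taft_gen m q gen_x"
private abbreviation (input) "M \<equiv> monomial E (j (Poly_Mapping.single (1 mod int n) 1)) (i hT) (i xT)"
private abbreviation (input) "L \<equiv> tensor_lift TA CA E (\<lambda>a y. i a \<otimes> j y)"

lemma factor_bilinear: "bilinear_map TA CA E (\<lambda>a y. i a \<otimes> j y)"
  by (rule bilinear_map_mult[OF E.is_k_algebra hopf_homD(2)[OF i] hopf_homD(2)[OF j]])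

text \<open>The generator is written \<open>1 mod int n\<close> so that it lies in the carrier also
  for \<open>n = 1\<close>.\<close>

lemma cyclic_single_pow: "Poly_Mapping.single (1 mod int n) (1::'k) [^]\<^bsub>CA\<^esub> k = Poly_Mapping.single (int k mod int n) 1"
proof (induction k)
  case 0
  show ?case
    by (simp add: group_hopf_algebra_simps)
next
  case (Suc k)
  have mono: "Group.monoid (integer_mod_group n)"
    by (rule group.is_monoid) simp
  show ?case
    by (simp add: Suc group_hopf_algebra_simps monoid_algebra_mult_single[OF mono] mod_add_eq add.commute)
qed

lemma cyclic_single_closed: "Poly_Mapping.single (1 mod int n) (1::'k) \<in> carrier CA"
  using n by (simp add: group_hopf_algebra_simps monoid_algebra_simps carrier_integer_mod_group)

lemma factor_elements:
  "group_like E (j (Poly_Mapping.single (1 mod int n) 1))" "j (Poly_Mapping.single (1 mod int n) 1) [^] n = \<one>"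
  "group_like E (i hT)" "skew_primitive E \<one> (i hT) (i xT)" "taft_relations E m q (i hT) (i xT)"
proof -
  have c: "1 mod int n \<in> carrier (integer_mod_group n)" using n by (simp add: carrier_integer_mod_group)
  have "group_like CA (Poly_Mapping.single (1 mod int n) 1)"
    using cyclic_single_closed group_algebra_comult[OF _ c] group_algebra_counit[OF _ c]
    by (simp add: group_like_def)
  then show "group_like E (j (Poly_Mapping.single (1 mod int n) 1))"
    by (rule group_like_hopf_hom[OF C.prebialgebra_axioms E j])
  have "j (Poly_Mapping.single (1 mod int n) 1 [^]\<^bsub>CA\<^esub> n) = j \<one>\<^bsub>CA\<^esub>"
    using cyclic_single_pow[of n] cyclic_single_pow[of 0] by simp
  then show "j (Poly_Mapping.single (1 mod int n) 1) [^] n = \<one>"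
    by (simp add: algebra_hom_pow[OF C.is_k_algebra E.is_k_algebra hopf_homD(1)[OF j] cyclic_single_closed]
        algebra_hom_one[OF hopf_homD(1)[OF j]])
  show "group_like E (i hT)"
    by (rule group_like_hopf_hom[OF A.prebialgebra_axioms E i])
       (simp add: group_like_def taft_comult[OF q] taft_counit[OF q])
  have "skew_primitive E (i \<one>\<^bsub>TA\<^esub>) (i hT) (i xT)"
    by (rule skew_primitive_hopf_hom[OF A.prebialgebra_axioms E i])
       (simp_all add: skew_primitive_def taft_comult[OF q] taft_counit[OF q])
  then show "skew_primitive E \<one> (i hT) (i xT)" by (simp add: algebra_hom_one[OF hopf_homD(1)[OF i]])
  note hom = hopf_homD(1)[OF i]
  have rel: "taft_relations TA m q hT xT" by (rule taft_relations_taft)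
  have "i (xT \<otimes>\<^bsub>TA\<^esub> hT) = i (q \<odot>\<^bsub>TA\<^esub> (hT \<otimes>\<^bsub>TA\<^esub> xT))" "i (hT [^]\<^bsub>TA\<^esub> m) = i \<one>\<^bsub>TA\<^esub>" "i (xT [^]\<^bsub>TA\<^esub> m) = i \<zero>\<^bsub>TA\<^esub>"
    using rel by (simp_all add: taft_relations_def)
  then show "taft_relations E m q (i hT) (i xT)"
    by (simp add: taft_relations_def algebra_hom_mult[OF hom] algebra_hom_smult[OF hom] algebra_hom_one[OF hom]
        algebra_hom_pow[OF A.is_k_algebra E.is_k_algebra hom] linear_map_zero[OF A.is_k_algebra E.is_k_algebra hopf_homD(2)[OF i]]
        algebra_hom_closed[OF hom])
qed

lemma factor_maps:
  "i (monomial TA \<one>\<^bsub>TA\<^esub> hT xT (a, b, 0)) = M (a, b, 0)"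
  "c < n \<Longrightarrow> j (Poly_Mapping.single (int c) 1) = M (0, 0, c)"
  "c < n \<Longrightarrow> L (pure_tensor TA CA (monomial TA \<one>\<^bsub>TA\<^esub> hT xT (a, b, 0)) (Poly_Mapping.single (int c) 1)) = M (a, b, c)"
proof -
  note homi = hopf_homD(1)[OF i] and homj = hopf_homD(1)[OF j]
  have g: "j (Poly_Mapping.single (1 mod int n) 1) \<in> carrier E"
    by (rule algebra_hom_closed[OF homj cyclic_single_closed])
  show 1: "i (monomial TA \<one>\<^bsub>TA\<^esub> hT xT (a, b, 0)) = M (a, b, 0)"
    by (simp add: monomial_def algebra_hom_mult[OF homi] algebra_hom_one[OF homi]
        algebra_hom_pow[OF A.is_k_algebra E.is_k_algebra homi] algebra_hom_closed[OF homi])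
  have 2: "j (Poly_Mapping.single (int c) 1) = j (Poly_Mapping.single (1 mod int n) 1) [^] c" if "c < n"
    using algebra_hom_pow[OF C.is_k_algebra E.is_k_algebra homj cyclic_single_closed, of c] cyclic_single_pow[of c] that
    by simp
  show "c < n \<Longrightarrow> j (Poly_Mapping.single (int c) 1) = M (0, 0, c)"
    using g by (simp add: 2 monomial_def)
  assume c: "c < n"
  have "int c \<in> carrier (integer_mod_group n)" using c by (simp add: carrier_integer_mod_group)
  then have cl: "Poly_Mapping.single (int c) (1::'k) \<in> carrier CA"
    by (simp add: group_hopf_algebra_simps)
  have mc: "monomial TA \<one>\<^bsub>TA\<^esub> hT xT (a, b, 0) \<in> carrier TA" by (simp add: monomial_def)
  show "L (pure_tensor TA CA (monomial TA \<one>\<^bsub>TA\<^esub> hT xT (a, b, 0)) (Poly_Mapping.single (int c) 1)) = M (a, b, c)"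
    using g unfolding tensor_lift_pure[OF A.is_k_algebra C.is_k_algebra E.is_k_algebra factor_bilinear mc cl] 1 2[OF c]
    by (simp add: monomial_def algebra_hom_closed[OF homi])
qed

lemma tensor_factor_dual_basis:
  "\<exists>co. dual_basis (tensor TA CA) (monomial_index m n)
    (\<lambda>(a, b, c). pure_tensor TA CA (monomial TA \<one>\<^bsub>TA\<^esub> hT xT (a, b, 0)) (Poly_Mapping.single (int c) 1)) co"
proof -
  obtain co co' where co: "dual_basis TA (monomial_index m 1) (monomial TA \<one>\<^bsub>TA\<^esub> hT xT) co"
    "dual_basis CA {..<n} (\<lambda>k. Poly_Mapping.single (int k) 1) co'"
    using taft_dual_basis[OF q] cyclic_dual_basis[OF n] by blast
  from dual_basis_reindex[OF k_algebra_tensor[OF A.is_k_algebra C.is_k_algebra]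
      dual_basis_tensor[OF A.is_k_algebra C.is_k_algebra co] bij_betw_monomial_index]
  show ?thesis by (simp add: case_prod_unfold) blast
qed

text \<open>The multiplication map carries a basis of the tensor product to the monomials, so its
  bijectivity says exactly that these form a basis. This converts factorizations into
  \<open>pointed_basis\<close> and back.\<close>

lemma factor_bij_iff:
  "bij_betw L (carrier (tensor TA CA)) (carrier E) \<longleftrightarrow> (\<exists>co. dual_basis E (monomial_index m n) M co)"
proof -
  let ?b = "\<lambda>(a, b, c). pure_tensor TA CA (monomial TA \<one>\<^bsub>TA\<^esub> hT xT (a, b, 0)) (Poly_Mapping.single (int c) 1)"
  obtain co where co: "dual_basis (tensor TA CA) (monomial_index m n) ?b co"
    using tensor_factor_dual_basis by blast
  note TT = k_algebra_tensor[OF A.is_k_algebra C.is_k_algebra]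
  note L = tensor_lift_linear[OF A.is_k_algebra C.is_k_algebra E.is_k_algebra factor_bilinear]
  have Lb: "L (?b p) = M p" if "p \<in> monomial_index m n" for p
    using that factor_maps(3) by (cases p) auto
  show ?thesis
  proof
    assume "bij_betw L (carrier (tensor TA CA)) (carrier E)"
    from dual_basis_bij[OF TT E.is_k_algebra co L this]
    obtain co' where "dual_basis E (monomial_index m n) (\<lambda>p. L (?b p)) co'" by blast
    then have "dual_basis E (monomial_index m n) M co'"
      by (rule dual_basis_cong[OF E.is_k_algebra, rotated]) (rule Lb)
    then show "\<exists>co. dual_basis E (monomial_index m n) M co" by blast
  next
    assume "\<exists>co. dual_basis E (monomial_index m n) M co"
    then obtain co' where "dual_basis E (monomial_index m n) M co'" by blast
    from dual_basis_bijI[OF TT E.is_k_algebra co L this bij_betw_id] Lb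
    show "bij_betw L (carrier (tensor TA CA)) (carrier E)" by simp
  qed
qed

text \<open>Both embeddings send a basis injectively into the monomial basis: those with
  \<open>k = 0\<close> for the Taft algebra, the powers of the group-like for the group
  algebra.\<close>

lemma factor_inj:
  assumes "dual_basis E (monomial_index m n) M co"
  shows "inj_on i (carrier TA)" "inj_on j (carrier CA)"
proof -
  obtain co1 co2 where co: "dual_basis TA (monomial_index m 1) (monomial TA \<one>\<^bsub>TA\<^esub> hT xT) co1"
    "dual_basis CA {..<n} (\<lambda>k. Poly_Mapping.single (int k) 1) co2"
    using taft_dual_basis[OF q] cyclic_dual_basis[OF n] by blast
  have m: "0 < m" using order_ge_2[OF q] by simp
  show "inj_on i (carrier TA)"
    by (rule dual_basis_inj[OF A.is_k_algebra E.is_k_algebra co(1) hopf_homD(2)[OF i] assms, of "\<lambda>p. p"])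
       (use n factor_maps(1) in auto)
  show "inj_on j (carrier CA)"
    by (rule dual_basis_inj[OF C.is_k_algebra E.is_k_algebra co(2) hopf_homD(2)[OF j] assms, of "\<lambda>c. (0, 0, c)"])
       (use m factor_maps(2) in \<open>auto simp: inj_on_def\<close>)
qed

end

lemma factorizes_imp_pointed_basis:
  fixes E :: "('k::field, 'e, 'z) hopf_scheme"
  assumes "prebialgebra E" "has_order q m" "0 < n" "factorizes_through E (taft_algebra m q) (cyclic_algebra n)"
  obtains g h x co where "pointed_basis E g h x m n q co"
proof -
  obtain i j where ij: "hopf_hom (taft_algebra m q) E i" "hopf_hom (cyclic_algebra n) E j"
    "bij_betw (tensor_lift (taft_algebra m q) (cyclic_algebra n) E (\<lambda>a y. i a \<otimes>\<^bsub>E\<^esub> j y))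
      (carrier (tensor (taft_algebra m q) (cyclic_algebra n))) (carrier E)"
    using assms(4) unfolding factorizes_through_def by blast
  note e = factor_elements[OF assms(1-3) ij(1,2)]
  obtain co where "dual_basis E (monomial_index m n)
      (monomial E (j (Poly_Mapping.single (1 mod int n) 1)) (i (taft_gen m q gen_h)) (i (taft_gen m q gen_x))) co"
    using factor_bij_iff[OF assms(1-3) ij(1,2)] ij(3) by blast
  then have "pointed_basis E (j (Poly_Mapping.single (1 mod int n) 1)) (i (taft_gen m q gen_h)) (i (taft_gen m q gen_x)) m n q co"
    by (intro pointed_basis.intro pointed_basis_axioms.intro assms e)
  then show thesis using that by blast
qed

lemma (in pointed_basis) factorizes:
  "factorizes_through H (taft_algebra m q) (cyclic_algebra n)"
proof -
  obtain i where i: "hopf_hom (taft_algebra m q) H i" "i (taft_gen m q gen_h) = h" "i (taft_gen m q gen_x) = x"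
    using taft_hopf_hom[OF prebialgebra_axioms q h x taft] by blast
  obtain j where j: "hopf_hom (cyclic_algebra n) H j" "\<And>k. k < n \<Longrightarrow> j (Poly_Mapping.single (int k) 1) = g [^] k"
    using cyclic_hopf_hom[OF g n g_order] by blast
  have e: "1 mod int n = int (1 mod n)" by (simp only: of_nat_mod of_nat_1)
  have "j (Poly_Mapping.single (1 mod int n) 1) = g [^] (1 mod n)"
    unfolding e by (rule j(2)[OF mod_less_divisor[OF n]])
  also have "\<dots> = g [^] (1::nat)" by (rule pow_mod[OF elems(1) g_order, symmetric])
  also have "\<dots> = g" by simp
  finally have b: "dual_basis H (monomial_index m n)
      (monomial H (j (Poly_Mapping.single (1 mod int n) 1)) (i (taft_gen m q gen_h)) (i (taft_gen m q gen_x))) co"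
    using basis i by simp
  show ?thesis
    unfolding factorizes_through_def
    using i(1) j(1) factor_inj[OF prebialgebra_axioms q n i(1) j(1) b]
      factor_bij_iff[OF prebialgebra_axioms q n i(1) j(1)] b by blast
qed

text \<open>Excludes \<open>\<gamma> = 0\<close> in \<open>skew_primitive_cases\<close>, both for
  \<open>g x\<close> and for the image of \<open>x\<close> under an isomorphism.\<close>

lemma (in pointed_basis) x_neq: "x \<noteq> \<mu> \<odot> (h \<ominus> \<one>)"
proof
  have idx: "(0, 1, 0) \<in> monomial_index m n" "(1, 0, 0) \<in> monomial_index m n" "(0, 0, 0) \<in> monomial_index m n"
    using m n by auto
  have M_eq: "M (0, 1, 0) = x" "M (1, 0, 0) = h" "M (0, 0, 0) = \<one>"
    by (simp_all add: monomial_def)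
  note l = D(4)[OF idx(1)]
  assume e: "x = \<mu> \<odot> (h \<ominus> \<one>)"
  have "co (0, 1, 0) (\<mu> \<odot> (M (1, 0, 0) \<oplus> (- 1) \<odot> M (0, 0, 0))) = 0"
    using idx by (simp add: linear_map_add[OF l] linear_map_smult[OF l] D(5) del: One_nat_def)
  moreover have "M (1, 0, 0) \<oplus> (- 1) \<odot> M (0, 0, 0) = h \<ominus> \<one>"
    unfolding M_eq by (simp add: smult_minus1 a_minus_def)
  moreover have "co (0, 1, 0) x = 1"
    using D(5)[OF idx(1) idx(1)] unfolding M_eq by simp
  ultimately show False using e by (metis zero_neq_one)
qed

text \<open>The element \<open>g x\<close> is \<open>(g, g h)\<close>-skew-primitive and not in the span of the group-likes,
  which forces \<open>g h = h g\<close> and \<open>g x = \<gamma> x g + \<mu> (h g - g)\<close>; multiplying by \<open>h\<close> gives \<open>(q - 1) \<mu> = 0\<close>.\<close>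

lemma (in pointed_basis) T_relations_exist:
  assumes "2 \<le> n"
  obtains \<gamma> where "\<gamma> ^ n = 1" "T_relations H n m \<gamma> q g h x"
proof -
  note pm = pure_tensor_mult[OF KA KA]
  interpret T: k_algebra "tensor H H" by (rule k_algebra_tensor[OF KA KA])
  have idx: "(0, 1, 1) \<in> monomial_index m n" "(0, 0, 1) \<in> monomial_index m n" "(1, 0, 1) \<in> monomial_index m n"
    "(2 mod m, 0, 1) \<in> monomial_index m n" "(0, 1, 0) \<in> monomial_index m n"
    "(1, 0, 0) \<in> monomial_index m n" "(0, 0, 0) \<in> monomial_index m n"
    using m n assms by auto
  have M_eq: "M (0, 1, 1) = x \<otimes> g" "M (0, 0, 1) = g" "M (1, 0, 1) = h \<otimes> g" "M (0, 1, 0) = x" "M (1, 0, 0) = h"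
    "M (0, 0, 0) = \<one>" "M (2 mod m, 0, 1) = h \<otimes> (h \<otimes> g)"
    using M_mod[of 2 0 1] assms by (simp_all add: monomial_def numeral_2_eq_2 m_assoc)
  \<comment> \<open>At this point \<open>g h\<close> is only known to be group-like, hence some
    monomial in \<open>h\<close> and \<open>g\<close>. That it equals \<open>h g\<close> comes out
    of the exponents forced by \<open>\<gamma> \<noteq> 0\<close>.\<close>
  obtain a' b' where ab: "a' < m" "b' < n" "g \<otimes> h = M (a', 0, b')"
    using group_like_cases[OF group_like_mult[OF g h]] by blast
  have "comult H (g \<otimes> x) = pure_tensor H H (g \<otimes> x) (M (a', 0, b')) \<oplus>\<^bsub>tensor H H\<^esub> pure_tensor H H (M (0, 0, 1)) (g \<otimes> x)"
    by (simp add: algebra_hom_mult[OF comult_hom] comult_elems pm T.r_distr pure_tensor_closed[OF KA KA] ab(3)[symmetric] M_eq del: One_nat_def)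
  from skew_primitive_cases[OF _ this] ab m n assms
  obtain \<gamma> \<mu> where gx': "g \<otimes> x = \<gamma> \<odot> M (0, 1, 1) \<oplus> \<mu> \<odot> (M (a', 0, b') \<ominus> M (0, 0, 1))"
    and \<gamma>: "\<gamma> \<noteq> 0 \<Longrightarrow> a' = Suc 0 mod m \<and> b' = 1"
    by auto
  have g_inv: "g [^] (n - 1) \<otimes> g = \<one>" using g_order n by (cases n) auto
  have "\<gamma> \<noteq> 0"
  proof
    assume "\<gamma> = 0"
    then have "g \<otimes> x = \<mu> \<odot> (g \<otimes> h \<ominus> g)" using gx' by (simp add: M_eq ab(3) del: One_nat_def)
    also have "\<dots> = g \<otimes> (\<mu> \<odot> (h \<ominus> \<one>))"
      by (simp add: smult_mult_right a_minus_def r_distr r_minus)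
    finally have "g [^] (n - 1) \<otimes> (g \<otimes> x) = g [^] (n - 1) \<otimes> (g \<otimes> (\<mu> \<odot> (h \<ominus> \<one>)))" by simp
    then have "x = \<mu> \<odot> (h \<ominus> \<one>)" by (simp add: m_assoc[symmetric] g_inv[simplified])
    then show False using x_neq by blast
  qed
  with \<gamma> ab(3) m have gh: "g \<otimes> h = h \<otimes> g" by (simp add: M_eq(3)[symmetric])
  have gx: "g \<otimes> x = \<gamma> \<odot> (x \<otimes> g) \<oplus> \<mu> \<odot> (h \<otimes> g \<ominus> g)"
    using gx' gh ab(3) by (simp add: M_eq del: One_nat_def)
  have "\<mu> = 0"
  proof -
    have "g \<otimes> x \<otimes> h = q \<odot> (h \<otimes> (g \<otimes> x))"
    proof -
      have "g \<otimes> x \<otimes> h = g \<otimes> (x \<otimes> h)" by (simp add: m_assoc)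
      also have "\<dots> = q \<odot> (g \<otimes> h \<otimes> x)" unfolding xh by (simp add: smult_mult_right m_assoc)
      finally show ?thesis unfolding gh by (simp add: m_assoc)
    qed
    moreover have "g \<otimes> x \<otimes> h = (\<gamma> * q) \<odot> (h \<otimes> (x \<otimes> g)) \<oplus> \<mu> \<odot> (h \<otimes> (h \<otimes> g) \<ominus> h \<otimes> g)"
    proof -
      have "x \<otimes> g \<otimes> h = q \<odot> (h \<otimes> (x \<otimes> g))"
      proof -
        have "x \<otimes> g \<otimes> h = x \<otimes> h \<otimes> g" by (simp add: m_assoc gh)
        then show ?thesis by (simp add: xh smult_mult_left m_assoc)
      qed
      moreover have "(h \<otimes> g \<ominus> g) \<otimes> h = h \<otimes> (h \<otimes> g) \<ominus> h \<otimes> g"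
        by (simp add: a_minus_def l_distr l_minus m_assoc gh)
      ultimately show ?thesis
        unfolding gx by (simp add: l_distr smult_mult_left smult_smult)
    qed
    moreover have "q \<odot> (h \<otimes> (g \<otimes> x)) = (\<gamma> * q) \<odot> (h \<otimes> (x \<otimes> g)) \<oplus> (q * \<mu>) \<odot> (h \<otimes> (h \<otimes> g) \<ominus> h \<otimes> g)"
      unfolding gx by (simp add: r_distr smult_mult_right smult_smult smult_add_right a_minus_def r_minus mult.commute)
    ultimately have "(\<gamma> * q) \<odot> (h \<otimes> (x \<otimes> g)) \<oplus> \<mu> \<odot> (h \<otimes> (h \<otimes> g) \<ominus> h \<otimes> g) =
        (\<gamma> * q) \<odot> (h \<otimes> (x \<otimes> g)) \<oplus> (q * \<mu>) \<odot> (h \<otimes> (h \<otimes> g) \<ominus> h \<otimes> g)" by simp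
    then have "\<mu> \<odot> (M (2 mod m, 0, 1) \<oplus> (- 1) \<odot> M (1, 0, 1)) = (q * \<mu>) \<odot> (M (2 mod m, 0, 1) \<oplus> (- 1) \<odot> M (1, 0, 1))"
      unfolding M_eq by (simp add: a_minus_def smult_minus1)
    then have "co (1, 0, 1) (\<mu> \<odot> (M (2 mod m, 0, 1) \<oplus> (- 1) \<odot> M (1, 0, 1))) =
        co (1, 0, 1) ((q * \<mu>) \<odot> (M (2 mod m, 0, 1) \<oplus> (- 1) \<odot> M (1, 0, 1)))" by simp
    \<comment> \<open>The coefficient of \<open>h g\<close> is compared. The monomial
      \<open>h h g\<close> does not contribute to it, not even for \<open>m = 2\<close>, where it is
      \<open>g\<close>.\<close>
    moreover have "2 mod m \<noteq> 1" using m by (cases "m = 2") auto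
    ultimately have "\<mu> = q * \<mu>"
      using idx by (simp add: linear_map_add[OF D(4)] linear_map_smult[OF D(4)] D(5) del: One_nat_def)
    then show ?thesis using order_neq_1[OF q] by simp
  qed
  with gx have gx: "g \<otimes> x = \<gamma> \<odot> (x \<otimes> g)" by simp
  \<comment> \<open>Moving \<open>x\<close> past \<open>g^n = 1\<close> multiplies it by
    \<open>\<gamma>^n\<close>, which must therefore be 1.\<close>
  have "g [^] n \<otimes> x = \<gamma> ^ n \<odot> (x \<otimes> g [^] n)"
    by (rule qcommute_pow'[OF _ _ gx]) simp_all
  then have "co (0, 1, 0) (M (0, 1, 0)) = co (0, 1, 0) (\<gamma> ^ n \<odot> M (0, 1, 0))"
    by (simp add: g_order M_eq del: One_nat_def)
  then have "\<gamma> ^ n = 1"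
    using idx by (simp add: linear_map_smult[OF D(4)] D(5) del: One_nat_def)
  moreover have "T_relations H n m \<gamma> q g h x"
    using taft g_order gh gx by (simp add: T_relations_def)
  ultimately show thesis using that by blast
qed

lemma T_pointed_basis:
  assumes "has_order q m" "\<omega> ^ n = 1" "0 < n"
  obtains co where "pointed_basis (T_algebra n m \<omega> q) (T_gen n m \<omega> q gen_g) (T_gen n m \<omega> q gen_h) (T_gen n m \<omega> q gen_x) m n q co"
proof -
  interpret P: pointed_generators "T_algebra n m \<omega> q" "T_gen n m \<omega> q gen_g" "T_gen n m \<omega> q gen_h" "T_gen n m \<omega> q gen_x"
    by (rule T_pointed[OF assms(1)])
  obtain co where "dual_basis (T_algebra n m \<omega> q) (monomial_index m n)
      (monomial (T_algebra n m \<omega> q) (T_gen n m \<omega> q gen_g) (T_gen n m \<omega> q gen_h) (T_gen n m \<omega> q gen_x)) co"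
    using T_dual_basis[OF assms] by blast
  then show thesis
    using that T_relations_T[of n m \<omega> q] P.group_like_gens P.prebialgebra_axioms assms
    by (simp add: pointed_basis_def pointed_basis_axioms_def T_relations_def)
qed

text \<open>The relations found in \<open>E\<close> induce a map from T by its presentation. It
  matches the two monomial bases and is therefore bijective.\<close>

lemma factorizes_imp_isomorphic_T:
  fixes E :: "('k::field, 'e, 'z) hopf_scheme"
  assumes E: "prebialgebra E" and q: "has_order q m" and n: "2 \<le> n"
    and fac: "factorizes_through E (taft_algebra m q) (cyclic_algebra n)"
  obtains \<omega> where "\<omega> ^ n = 1" "T_algebra n m \<omega> q \<cong>\<^sub>H E"
proof -
  have n0: "0 < n" using n by simp
  obtain g h x co where "pointed_basis E g h x m n q co"
    using factorizes_imp_pointed_basis[OF E q n0 fac] by blast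
  then interpret B: pointed_basis E g h x m n q co .
  obtain \<omega> where \<omega>: "\<omega> ^ n = 1" and rel: "T_relations E n m \<omega> q g h x"
    using B.T_relations_exist[OF n] by blast
  let ?T = "T_algebra n m \<omega> q" and ?G = "T_gen n m \<omega> q"
  obtain co' where co': "pointed_basis ?T (?G gen_g) (?G gen_h) (?G gen_x) m n q co'"
    using T_pointed_basis[OF q \<omega> n0] by blast
  interpret P: pointed_basis ?T "?G gen_g" "?G gen_h" "?G gen_x" m n q co' by (rule co')
  obtain f where f: "hopf_hom ?T E f" "f (?G gen_g) = g" "f (?G gen_h) = h" "f (?G gen_x) = x"
    using T_hopf_hom[OF E q B.h B.x B.g rel] by blast
  have "f (P.M p) = B.M p" for p
    by (cases p) (simp add: monomial_def algebra_hom_mult[OF hopf_homD(1)[OF f(1)]]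
      algebra_hom_pow[OF P.is_k_algebra B.is_k_algebra hopf_homD(1)[OF f(1)]] f(2-4))
  then have "bij_betw f (carrier ?T) (carrier E)"
    by (intro dual_basis_bijI[OF P.is_k_algebra B.is_k_algebra P.basis hopf_homD(2)[OF f(1)] B.basis bij_betw_id]) simp
  then show thesis using that \<omega> f(1) unfolding hopf_isomorphic_def by blast
qed

section \<open>Isomorphisms between the Hopf algebras T and the relation between their
  parameters\<close>

section \<open>Isomorphisms between the Hopf algebras \<open>T\<close>\<close>

lemma has_order_dvd:
  assumes "has_order q m" "q ^ k = 1" shows "m dvd k"
proof -
  have "q ^ k = (q ^ m) ^ (k div m) * q ^ (k mod m)"
    by (metis power_add power_mult mult_div_mod_eq)
  then have "q ^ (k mod m) = 1" using assms order_power[OF assms(1)] by simp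
  moreover have "k mod m < m" using order_ge_2[OF assms(1)] by simp
  ultimately have "k mod m = 0" using assms(1) by (auto simp: has_order_def)
  then show ?thesis by auto
qed

lemma (in T_generators) gh_commute: "g [^] (a::nat) \<otimes> h [^] (b::nat) = h [^] b \<otimes> g [^] a"
  using qcommute_pow'[of "h [^] b" g 1 a] by (simp add: gh_pow)

lemma (in T_generators) hg_pow: "(h [^] (b::nat) \<otimes> g [^] (a::nat)) [^] (k::nat) = h [^] (b * k) \<otimes> g [^] (a * k)"
proof (induction k)
  case (Suc k)
  have "(h [^] b \<otimes> g [^] a) [^] Suc k = h [^] (b * k) \<otimes> (g [^] (a * k) \<otimes> h [^] b) \<otimes> g [^] a"
    by (simp add: Suc m_assoc)
  also have "\<dots> = (h [^] (b * k) \<otimes> h [^] b) \<otimes> (g [^] (a * k) \<otimes> g [^] a)"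
    by (simp add: gh_commute m_assoc)
  finally show ?case by (simp add: nat_pow_mult add.commute)
qed simp

lemma (in T_generators) hg_x:
  "h [^] (b::nat) \<otimes> g [^] (a::nat) \<otimes> x = \<omega> ^ a \<odot> (h [^] b \<otimes> x \<otimes> g [^] a)"
  "x \<otimes> (h [^] b \<otimes> g [^] a) = q ^ b \<odot> (h [^] b \<otimes> x \<otimes> g [^] a)"
proof -
  have "g [^] a \<otimes> x = \<omega> ^ a \<odot> (x \<otimes> g [^] a)"
    by (rule qcommute_pow'[OF _ _ gx]) simp_all
  then show "h [^] b \<otimes> g [^] a \<otimes> x = \<omega> ^ a \<odot> (h [^] b \<otimes> x \<otimes> g [^] a)"
    by (simp add: m_assoc smult_mult_right)
  have "x \<otimes> (h [^] b \<otimes> g [^] a) = (x \<otimes> h [^] b) \<otimes> g [^] a" by (simp add: m_assoc)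
  then show "x \<otimes> (h [^] b \<otimes> g [^] a) = q ^ b \<odot> (h [^] b \<otimes> x \<otimes> g [^] a)"
    by (simp add: xh_pow smult_mult_left)
qed

text \<open>Moving \<open>x\<close> past \<open>h^b g^a\<close> costs the factor
  \<open>\<omega>\<^sub>2^a\<close> on one side and \<open>q^b\<close> on the other, so the
  hypothesis is the relation between \<open>x\<close> and the image of the first \<open>g\<close>.
  Raising it to the power \<open>n\<close> gives \<open>q^(b n) = 1\<close>, which makes that image
  have order dividing \<open>n\<close>. The resulting divisibility is exported because the inverse
  of such a map is computed with it.\<close>

lemma T_twist_hom:
  fixes q \<omega>\<^sub>1 \<omega>\<^sub>2 :: "'k::field"
  assumes q: "has_order q m" and \<omega>: "\<omega>\<^sub>1 ^ n = 1" "\<omega>\<^sub>2 ^ n = 1" and eq: "\<omega>\<^sub>2 ^ a = \<omega>\<^sub>1 * q ^ b"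
  obtains f where "hopf_hom (T_algebra n m \<omega>\<^sub>1 q) (T_algebra n m \<omega>\<^sub>2 q) f"
    "f (T_gen n m \<omega>\<^sub>1 q gen_g) = T_gen n m \<omega>\<^sub>2 q gen_h [^]\<^bsub>T_algebra n m \<omega>\<^sub>2 q\<^esub> b \<otimes>\<^bsub>T_algebra n m \<omega>\<^sub>2 q\<^esub>
       T_gen n m \<omega>\<^sub>2 q gen_g [^]\<^bsub>T_algebra n m \<omega>\<^sub>2 q\<^esub> a"
    "f (T_gen n m \<omega>\<^sub>1 q gen_h) = T_gen n m \<omega>\<^sub>2 q gen_h" "f (T_gen n m \<omega>\<^sub>1 q gen_x) = T_gen n m \<omega>\<^sub>2 q gen_x"
    "m dvd b * n"
proof -
  let ?T = "T_algebra n m \<omega>\<^sub>2 q"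
  let ?g = "T_gen n m \<omega>\<^sub>2 q gen_g" and ?h = "T_gen n m \<omega>\<^sub>2 q gen_h" and ?x = "T_gen n m \<omega>\<^sub>2 q gen_x"
  interpret P: pointed_generators ?T ?g ?h ?x by (rule T_pointed[OF q])
  interpret G: T_generators ?T n m \<omega>\<^sub>2 q ?g ?h ?x by (rule T_T_generators)
  have "(\<omega>\<^sub>2 ^ a) ^ n = (\<omega>\<^sub>1 * q ^ b) ^ n" by (simp add: eq)
  then have "q ^ (b * n) = 1"
    using \<omega> by (simp add: power_mult_distrib power_mult[symmetric] mult.commute[of a])
       (simp add: power_mult)
  then have dvd: "m dvd b * n" by (rule has_order_dvd[OF q])
  have "?h [^]\<^bsub>?T\<^esub> (b * n) = \<one>\<^bsub>?T\<^esub>"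
    using P.pow_mod[OF _ G.h_order, of "b * n"] dvd by (simp add: mod_eq_0_iff_dvd)
  moreover have "?g [^]\<^bsub>?T\<^esub> (a * n) = \<one>\<^bsub>?T\<^esub>"
    using P.pow_mod[OF _ G.g_order, of "a * n"] by simp
  ultimately have ord: "(?h [^]\<^bsub>?T\<^esub> b \<otimes>\<^bsub>?T\<^esub> ?g [^]\<^bsub>?T\<^esub> a) [^]\<^bsub>?T\<^esub> n = \<one>\<^bsub>?T\<^esub>"
    by (simp add: G.hg_pow)
  have rel: "T_relations ?T n m \<omega>\<^sub>1 q (?h [^]\<^bsub>?T\<^esub> b \<otimes>\<^bsub>?T\<^esub> ?g [^]\<^bsub>?T\<^esub> a) ?h ?x"
  proof -
    have "?h \<otimes>\<^bsub>?T\<^esub> (?h [^]\<^bsub>?T\<^esub> b \<otimes>\<^bsub>?T\<^esub> ?g [^]\<^bsub>?T\<^esub> a) = (?h [^]\<^bsub>?T\<^esub> b \<otimes>\<^bsub>?T\<^esub> ?g [^]\<^bsub>?T\<^esub> a) \<otimes>\<^bsub>?T\<^esub> ?h"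
    proof -
      have "?h \<otimes>\<^bsub>?T\<^esub> ?h [^]\<^bsub>?T\<^esub> b = ?h [^]\<^bsub>?T\<^esub> b \<otimes>\<^bsub>?T\<^esub> ?h"
        using P.nat_pow_Suc2[of ?h b] by simp
      moreover have "?g [^]\<^bsub>?T\<^esub> a \<otimes>\<^bsub>?T\<^esub> ?h = ?h \<otimes>\<^bsub>?T\<^esub> ?g [^]\<^bsub>?T\<^esub> a"
        using G.gh_commute[of a 1] by simp
      ultimately show ?thesis by (simp add: P.m_assoc) (simp add: P.m_assoc[symmetric])
    qed
    moreover have "(?h [^]\<^bsub>?T\<^esub> b \<otimes>\<^bsub>?T\<^esub> ?g [^]\<^bsub>?T\<^esub> a) \<otimes>\<^bsub>?T\<^esub> ?x =
        \<omega>\<^sub>1 \<odot>\<^bsub>?T\<^esub> (?x \<otimes>\<^bsub>?T\<^esub> (?h [^]\<^bsub>?T\<^esub> b \<otimes>\<^bsub>?T\<^esub> ?g [^]\<^bsub>?T\<^esub> a))"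
      unfolding G.hg_x by (simp add: eq P.smult_smult)
    ultimately show ?thesis
      using G.rels ord by (simp add: T_relations_def)
  qed
  show thesis
  proof (rule T_hopf_hom[OF P.prebialgebra_axioms q P.group_like_gens(2,3) _ rel])
    show "group_like ?T (?h [^]\<^bsub>?T\<^esub> b \<otimes>\<^bsub>?T\<^esub> ?g [^]\<^bsub>?T\<^esub> a)"
      by (intro P.group_like_mult P.group_like_pow P.group_like_gens)
  qed (use that dvd in blast)
qed

text \<open>The inverse is again a twist, with exponents \<open>a'\<close> inverse to
  \<open>a\<close> modulo \<open>n\<close> and \<open>b'\<close> congruent to \<open>- b a'\<close>
  modulo \<open>m\<close>. Both composites are compared with the identity on generators.\<close>

lemma T_isomorphic_if:
  fixes q \<omega>\<^sub>1 \<omega>\<^sub>2 :: "'k::field"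
  assumes q: "has_order q m" and n: "2 \<le> n" and \<omega>: "\<omega>\<^sub>1 ^ n = 1" "\<omega>\<^sub>2 ^ n = 1"
    and eq: "\<omega>\<^sub>2 ^ a = \<omega>\<^sub>1 * q ^ b" and a: "coprime a n"
  shows "T_algebra n m \<omega>\<^sub>1 q \<cong>\<^sub>H T_algebra n m \<omega>\<^sub>2 q"
proof -
  obtain a' where "[a * a' = Suc 0] (mod n)" using a cong_solve_coprime_nat by blast
  then have aa: "a * a' mod n = 1" using n by (simp add: cong_def)
  \<comment> \<open>A natural number congruent to \<open>- b a'\<close> modulo
    \<open>m\<close>.\<close>
  define b' where "b' = (m - 1) * (b * a')"
  have m: "2 \<le> m" by (rule order_ge_2[OF q])
  have b'1: "b' + b * a' = m * (b * a')"
    using m by (cases m) (simp_all add: b'_def algebra_simps)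
  have eq': "\<omega>\<^sub>1 ^ a' = \<omega>\<^sub>2 * q ^ b'"
  proof -
    have "\<omega>\<^sub>2 = \<omega>\<^sub>2 ^ (n * (a * a' div n) + a * a' mod n)"
      unfolding aa power_add power_mult \<omega>(2) by simp
    also have "\<dots> = (\<omega>\<^sub>2 ^ a) ^ a'" by (simp only: mult_div_mod_eq power_mult)
    also have "\<dots> = \<omega>\<^sub>1 ^ a' * q ^ (b * a')" by (simp add: eq power_mult_distrib power_mult)
    finally have "\<omega>\<^sub>2 * q ^ b' = \<omega>\<^sub>1 ^ a' * q ^ (b' + b * a')" by (simp add: power_add mult.assoc mult.commute)
    then show ?thesis unfolding b'1 power_mult order_power[OF q] by simp
  qed
  let ?T1 = "T_algebra n m \<omega>\<^sub>1 q" and ?T2 = "T_algebra n m \<omega>\<^sub>2 q"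
  let ?G1 = "T_gen n m \<omega>\<^sub>1 q" and ?G2 = "T_gen n m \<omega>\<^sub>2 q"
  interpret P1: pointed_generators ?T1 "?G1 gen_g" "?G1 gen_h" "?G1 gen_x" by (rule T_pointed[OF q])
  interpret P2: pointed_generators ?T2 "?G2 gen_g" "?G2 gen_h" "?G2 gen_x" by (rule T_pointed[OF q])
  interpret G1: T_generators ?T1 n m \<omega>\<^sub>1 q "?G1 gen_g" "?G1 gen_h" "?G1 gen_x" by (rule T_T_generators)
  interpret G2: T_generators ?T2 n m \<omega>\<^sub>2 q "?G2 gen_g" "?G2 gen_h" "?G2 gen_x" by (rule T_T_generators)
  obtain f where f: "hopf_hom ?T1 ?T2 f"
    "f (?G1 gen_g) = ?G2 gen_h [^]\<^bsub>?T2\<^esub> b \<otimes>\<^bsub>?T2\<^esub> ?G2 gen_g [^]\<^bsub>?T2\<^esub> a"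
    "f (?G1 gen_h) = ?G2 gen_h" "f (?G1 gen_x) = ?G2 gen_x" and bn: "m dvd b * n"
    by (rule T_twist_hom[OF q \<omega> eq])
  obtain f' where f': "hopf_hom ?T2 ?T1 f'"
    "f' (?G2 gen_g) = ?G1 gen_h [^]\<^bsub>?T1\<^esub> b' \<otimes>\<^bsub>?T1\<^esub> ?G1 gen_g [^]\<^bsub>?T1\<^esub> a'"
    "f' (?G2 gen_h) = ?G1 gen_h" "f' (?G2 gen_x) = ?G1 gen_x"
    by (rule T_twist_hom[OF q \<omega>(2,1) eq'])
  note hf = hopf_homD(1)[OF f(1)] and hf' = hopf_homD(1)[OF f'(1)]
  note pf = algebra_hom_pow[OF P1.is_k_algebra P2.is_k_algebra hf]
    and pf' = algebra_hom_pow[OF P2.is_k_algebra P1.is_k_algebra hf']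
  \<comment> \<open>Modulo \<open>m\<close> the sum is \<open>b (1 - a a')\<close>. As
    \<open>n\<close> divides \<open>1 - a a'\<close>, this is a multiple of \<open>b n\<close>,
    hence of \<open>m\<close>.\<close>
  have "m dvd b + b' * a"
  proof -
    have "a * a' = 1 + n * (a * a' div n)" using aa by (metis add.commute mult_div_mod_eq)
    then obtain s where s: "a * a' = 1 + n * s" by blast
    have "b + b' * a = b + (m - 1) * (b * (a * a'))" by (simp add: b'_def algebra_simps)
    also have "\<dots> = (b + (m - 1) * b) + (m - 1) * s * (b * n)" unfolding s by (simp add: algebra_simps)
    also have "b + (m - 1) * b = m * b" using m by (cases m) simp_all
    finally show ?thesis using bn by simp
  qed
  then have e1: "?G1 gen_h [^]\<^bsub>?T1\<^esub> (b + b' * a) = \<one>\<^bsub>?T1\<^esub>"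
    using P1.pow_mod[OF _ G1.h_order, of "b + b' * a"] by (simp add: mod_eq_0_iff_dvd)
  have e2: "?G2 gen_h [^]\<^bsub>?T2\<^esub> (b' + b * a') = \<one>\<^bsub>?T2\<^esub>"
    using P2.pow_mod[OF _ G2.h_order, of "b' + b * a'"] b'1 by simp
  have e3: "?G1 gen_g [^]\<^bsub>?T1\<^esub> (a' * a) = ?G1 gen_g" "?G2 gen_g [^]\<^bsub>?T2\<^esub> (a * a') = ?G2 gen_g"
    using P1.pow_mod[OF _ G1.g_order, of "a' * a"] P2.pow_mod[OF _ G2.g_order, of "a * a'"] aa
    by (simp_all add: mult.commute)
  have "f' (f (?G1 gen_g)) = ?G1 gen_h [^]\<^bsub>?T1\<^esub> b \<otimes>\<^bsub>?T1\<^esub> (?G1 gen_h [^]\<^bsub>?T1\<^esub> (b' * a) \<otimes>\<^bsub>?T1\<^esub> ?G1 gen_g [^]\<^bsub>?T1\<^esub> (a' * a))"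
    by (simp add: f f' algebra_hom_mult[OF hf'] pf' G1.hg_pow)
  also have "\<dots> = ?G1 gen_h [^]\<^bsub>?T1\<^esub> (b + b' * a) \<otimes>\<^bsub>?T1\<^esub> ?G1 gen_g [^]\<^bsub>?T1\<^esub> (a' * a)"
    by (simp add: P1.m_assoc[symmetric] P1.nat_pow_mult)
  also have "\<dots> = ?G1 gen_g" unfolding e1 e3 by simp
  finally have 1: "f' (f (?G1 gen_g)) = ?G1 gen_g" .
  have "f (f' (?G2 gen_g)) = ?G2 gen_h [^]\<^bsub>?T2\<^esub> b' \<otimes>\<^bsub>?T2\<^esub> (?G2 gen_h [^]\<^bsub>?T2\<^esub> (b * a') \<otimes>\<^bsub>?T2\<^esub> ?G2 gen_g [^]\<^bsub>?T2\<^esub> (a * a'))"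
    by (simp add: f f' algebra_hom_mult[OF hf] pf G2.hg_pow)
  also have "\<dots> = ?G2 gen_h [^]\<^bsub>?T2\<^esub> (b' + b * a') \<otimes>\<^bsub>?T2\<^esub> ?G2 gen_g [^]\<^bsub>?T2\<^esub> (a * a')"
    by (simp add: P2.m_assoc[symmetric] P2.nat_pow_mult)
  also have "\<dots> = ?G2 gen_g" unfolding e2 e3 by simp
  finally have 2: "f (f' (?G2 gen_g)) = ?G2 gen_g" .
  have "f' (f y) = y" if "y \<in> carrier ?T1" for y
    by (rule algebra_hom_eq_on_alg_span[where S = "{?G1 gen_g, ?G1 gen_h, ?G1 gen_x}", OF P1.is_k_algebra _ algebra_hom_compose[OF hf hf'] algebra_hom_id])
       (use that P1.generated 1 f f' in auto)
  moreover have "f (f' y) = y" if "y \<in> carrier ?T2" for y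
    by (rule algebra_hom_eq_on_alg_span[where S = "{?G2 gen_g, ?G2 gen_h, ?G2 gen_x}", OF P2.is_k_algebra _ algebra_hom_compose[OF hf' hf] algebra_hom_id])
       (use that P2.generated 2 f f' in auto)
  ultimately have "bij_betw f (carrier ?T1) (carrier ?T2)"
    using hopf_homD(5)[OF f(1)] hopf_homD(5)[OF f'(1)] by (intro bij_betw_byWitness[of _ f']) auto
  then show ?thesis using f(1) unfolding hopf_isomorphic_def by blast
qed

text \<open>The image of \<open>g\<close> is some \<open>h^b g^a\<close>, and that of
  \<open>x\<close> is \<open>\<gamma> x + \<mu> (h - 1)\<close> with \<open>\<gamma>\<close>
  nonzero. The relation between \<open>\<omega>\<^sub>1\<close> and \<open>\<omega>\<^sub>2\<close>
  is the coefficient of \<open>h^b x g^a\<close> in the image of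
  \<open>g x = \<omega>\<^sub>1 x g\<close>.\<close>

lemma T_isomorphic_imp:
  fixes q \<omega>\<^sub>1 \<omega>\<^sub>2 :: "'k::field"
  assumes q: "has_order q m" and n: "0 < n" and \<omega>: "\<omega>\<^sub>1 ^ n = 1" "\<omega>\<^sub>2 ^ n = 1"
    and iso: "T_algebra n m \<omega>\<^sub>1 q \<cong>\<^sub>H T_algebra n m \<omega>\<^sub>2 q"
  obtains a b where "\<omega>\<^sub>2 ^ a = \<omega>\<^sub>1 * q ^ b"
proof -
  let ?T1 = "T_algebra n m \<omega>\<^sub>1 q" and ?T2 = "T_algebra n m \<omega>\<^sub>2 q"
  let ?G1 = "T_gen n m \<omega>\<^sub>1 q" and ?G2 = "T_gen n m \<omega>\<^sub>2 q"
  let ?g = "?G2 gen_g" and ?h = "?G2 gen_h" and ?x = "?G2 gen_x"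
  obtain co1 co where co: "pointed_basis ?T1 (?G1 gen_g) (?G1 gen_h) (?G1 gen_x) m n q co1"
    "pointed_basis ?T2 ?g ?h ?x m n q co"
    using T_pointed_basis[OF q \<omega>(1) n] T_pointed_basis[OF q \<omega>(2) n] by metis
  interpret B1: pointed_basis ?T1 "?G1 gen_g" "?G1 gen_h" "?G1 gen_x" m n q co1 by (rule co)
  interpret B: pointed_basis ?T2 ?g ?h ?x m n q co by (rule co)
  interpret G1: T_generators ?T1 n m \<omega>\<^sub>1 q "?G1 gen_g" "?G1 gen_h" "?G1 gen_x" by (rule T_T_generators)
  interpret G: T_generators ?T2 n m \<omega>\<^sub>2 q ?g ?h ?x by (rule T_T_generators)
  obtain f where f: "hopf_hom ?T1 ?T2 f" "bij_betw f (carrier ?T1) (carrier ?T2)"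
    using iso unfolding hopf_isomorphic_def by blast
  note hf = hopf_homD(1)[OF f(1)] and lf = hopf_homD(2)[OF f(1)]
  have m: "1 < m" using order_ge_2[OF q] by simp
  obtain i0 k0 where h: "i0 < m" "k0 < n" "f (?G1 gen_h) = B.M (i0, 0, k0)"
    using B.group_like_cases[OF group_like_hopf_hom[OF B1.prebialgebra_axioms B.prebialgebra_axioms f(1) B1.h]] by blast
  obtain b a where g: "b < m" "a < n" "f (?G1 gen_g) = B.M (b, 0, a)"
    using B.group_like_cases[OF group_like_hopf_hom[OF B1.prebialgebra_axioms B.prebialgebra_axioms f(1) B1.g]] by blast
  have M_simps: "B.M (0, 0, 0) = \<one>\<^bsub>?T2\<^esub>" "B.M (0, 1, 0) = ?x" "B.M (1, 0, 0) = ?h"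
    by (simp_all add: monomial_def)
  have "skew_primitive ?T2 (f \<one>\<^bsub>?T1\<^esub>) (f (?G1 gen_h)) (f (?G1 gen_x))"
    by (rule skew_primitive_hopf_hom[OF B1.prebialgebra_axioms B.prebialgebra_axioms f(1) B1.x]) simp_all
  then have sx: "f (?G1 gen_x) \<in> carrier ?T2"
    "comult ?T2 (f (?G1 gen_x)) = pure_tensor ?T2 ?T2 (f (?G1 gen_x)) (B.M (i0, 0, k0)) \<oplus>\<^bsub>tensor ?T2 ?T2\<^esub>
      pure_tensor ?T2 ?T2 (B.M (0, 0, 0)) (f (?G1 gen_x))"
    by (simp_all add: skew_primitive_def h(3) algebra_hom_one[OF hf] M_simps)
  obtain \<gamma> \<mu> where fx: "f (?G1 gen_x) = \<gamma> \<odot>\<^bsub>?T2\<^esub> B.M (0, 1, 0) \<oplus>\<^bsub>?T2\<^esub> \<mu> \<odot>\<^bsub>?T2\<^esub> (B.M (i0, 0, k0) \<ominus>\<^bsub>?T2\<^esub> B.M (0, 0, 0))"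
    and \<gamma>: "\<gamma> \<noteq> 0 \<Longrightarrow> i0 = Suc 0 mod m \<and> k0 = 0"
    by (rule B.skew_primitive_cases[OF sx]) (use m n h in auto)
  \<comment> \<open>Otherwise \<open>x\<close> and a multiple of \<open>h - 1\<close> would have the
    same image, against injectivity and \<open>x_neq\<close>.\<close>
  have "\<gamma> \<noteq> 0"
  proof
    assume "\<gamma> = 0"
    then have "f (?G1 gen_x) = f (\<mu> \<odot>\<^bsub>?T1\<^esub> (?G1 gen_h \<ominus>\<^bsub>?T1\<^esub> \<one>\<^bsub>?T1\<^esub>))"
      using fx by (simp add: h(3)[symmetric] M_simps a_minus_def linear_map_smult[OF lf] linear_map_add[OF lf]
          linear_map_minus[OF B1.is_k_algebra B.is_k_algebra lf] algebra_hom_one[OF hf] del: One_nat_def)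
        (simp add: linear_map_closed[OF lf])
    moreover have "\<mu> \<odot>\<^bsub>?T1\<^esub> (?G1 gen_h \<ominus>\<^bsub>?T1\<^esub> \<one>\<^bsub>?T1\<^esub>) \<in> carrier ?T1"
      by (intro B1.smult_closed B1.minus_closed B1.one_closed) simp
    ultimately have "?G1 gen_x = \<mu> \<odot>\<^bsub>?T1\<^esub> (?G1 gen_h \<ominus>\<^bsub>?T1\<^esub> \<one>\<^bsub>?T1\<^esub>)"
      using f(2) inj_onD[of f "carrier ?T1"] by (simp add: bij_betw_def)
    then show False using B1.x_neq by blast
  qed
  then have fh: "f (?G1 gen_h) = ?h" using h \<gamma> m M_simps by simp
  have fx: "f (?G1 gen_x) = \<gamma> \<odot>\<^bsub>?T2\<^esub> ?x \<oplus>\<^bsub>?T2\<^esub> \<mu> \<odot>\<^bsub>?T2\<^esub> (?h \<ominus>\<^bsub>?T2\<^esub> \<one>\<^bsub>?T2\<^esub>)"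
    using fx h(3) fh by (simp add: M_simps del: One_nat_def)
  let ?g' = "?h [^]\<^bsub>?T2\<^esub> b \<otimes>\<^bsub>?T2\<^esub> ?g [^]\<^bsub>?T2\<^esub> a"
  have fg: "f (?G1 gen_g) = ?g'" by (simp add: g monomial_def)
  have idx: "(b, 1, a) \<in> monomial_index m n" "(b, 0, a) \<in> monomial_index m n" "(Suc b mod m, 0, a) \<in> monomial_index m n"
    using g m by auto
  note l = B.D(4)[OF idx(1)]
  have Ms: "?h [^]\<^bsub>?T2\<^esub> b \<otimes>\<^bsub>?T2\<^esub> ?x \<otimes>\<^bsub>?T2\<^esub> ?g [^]\<^bsub>?T2\<^esub> a = B.M (b, 1, a)" "?g' = B.M (b, 0, a)"
    by (simp_all add: monomial_def)
  have g'h: "?g' \<otimes>\<^bsub>?T2\<^esub> ?h = B.M (Suc b mod m, 0, a)" "?h \<otimes>\<^bsub>?T2\<^esub> ?g' = B.M (Suc b mod m, 0, a)"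
  proof -
    have "?g' \<otimes>\<^bsub>?T2\<^esub> ?h = ?h [^]\<^bsub>?T2\<^esub> b \<otimes>\<^bsub>?T2\<^esub> (?g [^]\<^bsub>?T2\<^esub> a \<otimes>\<^bsub>?T2\<^esub> ?h [^]\<^bsub>?T2\<^esub> (1::nat))" by (simp add: B.m_assoc)
    also have "\<dots> = ?h [^]\<^bsub>?T2\<^esub> Suc b \<otimes>\<^bsub>?T2\<^esub> ?g [^]\<^bsub>?T2\<^esub> a" unfolding G.gh_commute by (simp add: B.m_assoc)
    also have "\<dots> = B.M (Suc b, 0, a)" by (simp add: monomial_def)
    finally show "?g' \<otimes>\<^bsub>?T2\<^esub> ?h = B.M (Suc b mod m, 0, a)" using B.M_mod[of "Suc b" 0 a] g(2) by simp
    have "?h \<otimes>\<^bsub>?T2\<^esub> ?g' = B.M (Suc b, 0, a)" using G.h_monomial[of b 0 a] by (simp add: Ms)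
    then show "?h \<otimes>\<^bsub>?T2\<^esub> ?g' = B.M (Suc b mod m, 0, a)" using B.M_mod[of "Suc b" 0 a] g(2) by simp
  qed
  have "f (?G1 gen_g \<otimes>\<^bsub>?T1\<^esub> ?G1 gen_x) = f (\<omega>\<^sub>1 \<odot>\<^bsub>?T1\<^esub> (?G1 gen_x \<otimes>\<^bsub>?T1\<^esub> ?G1 gen_g))"
    by (simp add: G1.gx)
  then have "?g' \<otimes>\<^bsub>?T2\<^esub> f (?G1 gen_x) = \<omega>\<^sub>1 \<odot>\<^bsub>?T2\<^esub> (f (?G1 gen_x) \<otimes>\<^bsub>?T2\<^esub> ?g')"
    by (simp add: algebra_hom_mult[OF hf] algebra_hom_smult[OF hf] fg)
  \<comment> \<open>The terms with \<open>\<mu>\<close> contain no \<open>x\<close> and are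
    invisible to this coordinate.\<close>
  then have main: "co (b, 1, a) (?g' \<otimes>\<^bsub>?T2\<^esub> f (?G1 gen_x)) = \<omega>\<^sub>1 * co (b, 1, a) (f (?G1 gen_x) \<otimes>\<^bsub>?T2\<^esub> ?g')"
    using linear_map_smult[OF l, of "f (?G1 gen_x) \<otimes>\<^bsub>?T2\<^esub> ?g'" \<omega>\<^sub>1] sx(1) by simp
  have "?g' \<otimes>\<^bsub>?T2\<^esub> f (?G1 gen_x) = (\<gamma> * \<omega>\<^sub>2 ^ a) \<odot>\<^bsub>?T2\<^esub> B.M (b, 1, a) \<oplus>\<^bsub>?T2\<^esub>
      \<mu> \<odot>\<^bsub>?T2\<^esub> (B.M (Suc b mod m, 0, a) \<oplus>\<^bsub>?T2\<^esub> (- 1) \<odot>\<^bsub>?T2\<^esub> B.M (b, 0, a))"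
  proof -
    have "?g' \<otimes>\<^bsub>?T2\<^esub> f (?G1 gen_x) = \<gamma> \<odot>\<^bsub>?T2\<^esub> (?g' \<otimes>\<^bsub>?T2\<^esub> ?x) \<oplus>\<^bsub>?T2\<^esub> \<mu> \<odot>\<^bsub>?T2\<^esub> (?g' \<otimes>\<^bsub>?T2\<^esub> ?h \<oplus>\<^bsub>?T2\<^esub> (- 1) \<odot>\<^bsub>?T2\<^esub> ?g')"
      unfolding fx by (simp add: B.r_distr B.smult_mult_right a_minus_def B.r_minus B.smult_minus1)
    then show ?thesis unfolding G.hg_x g'h unfolding Ms by (simp add: B.smult_smult)
  qed
  then have 1: "co (b, 1, a) (?g' \<otimes>\<^bsub>?T2\<^esub> f (?G1 gen_x)) = \<gamma> * \<omega>\<^sub>2 ^ a"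
    using idx by (simp add: linear_map_add[OF l] linear_map_smult[OF l] B.D(5) del: One_nat_def)
  have "f (?G1 gen_x) \<otimes>\<^bsub>?T2\<^esub> ?g' = (\<gamma> * q ^ b) \<odot>\<^bsub>?T2\<^esub> B.M (b, 1, a) \<oplus>\<^bsub>?T2\<^esub>
      \<mu> \<odot>\<^bsub>?T2\<^esub> (B.M (Suc b mod m, 0, a) \<oplus>\<^bsub>?T2\<^esub> (- 1) \<odot>\<^bsub>?T2\<^esub> B.M (b, 0, a))"
  proof -
    have "f (?G1 gen_x) \<otimes>\<^bsub>?T2\<^esub> ?g' = \<gamma> \<odot>\<^bsub>?T2\<^esub> (?x \<otimes>\<^bsub>?T2\<^esub> ?g') \<oplus>\<^bsub>?T2\<^esub> \<mu> \<odot>\<^bsub>?T2\<^esub> (?h \<otimes>\<^bsub>?T2\<^esub> ?g' \<oplus>\<^bsub>?T2\<^esub> (- 1) \<odot>\<^bsub>?T2\<^esub> ?g')"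
      unfolding fx by (simp add: B.l_distr B.smult_mult_left a_minus_def B.l_minus B.smult_minus1)
    then show ?thesis unfolding G.hg_x g'h unfolding Ms by (simp add: B.smult_smult)
  qed
  then have 2: "co (b, 1, a) (f (?G1 gen_x) \<otimes>\<^bsub>?T2\<^esub> ?g') = \<gamma> * q ^ b"
    using idx by (simp add: linear_map_add[OF l] linear_map_smult[OF l] B.D(5) del: One_nat_def)
  have "\<omega>\<^sub>2 ^ a = \<omega>\<^sub>1 * q ^ b"
    using main \<open>\<gamma> \<noteq> 0\<close> unfolding 1 2 by simp
  then show thesis using that by blast
qed

section \<open>Copies of the algebras T with carrier in a prescribed type\<close>

section \<open>Transport of structure\<close>

text \<open>Classes are counted among records over \<open>'e\<close>, whereas T is made of cosets in
  a free algebra. An injection of its carrier into \<open>'e\<close> produces a copy that can be a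
  member of the counted set.\<close>

definition transport_algebra ::
  "('a \<Rightarrow> 'e) \<Rightarrow> ('k::field, 'a, 'z) module_scheme \<Rightarrow> ('k, 'e) module" where
  "transport_algebra \<phi> A = (let \<psi> = inv_into (carrier A) \<phi> in
     \<lparr>carrier = \<phi> ` carrier A, monoid.mult = (\<lambda>a b. \<phi> (\<psi> a \<otimes>\<^bsub>A\<^esub> \<psi> b)), one = \<phi> \<one>\<^bsub>A\<^esub>, zero = \<phi> \<zero>\<^bsub>A\<^esub>,
      add = (\<lambda>a b. \<phi> (\<psi> a \<oplus>\<^bsub>A\<^esub> \<psi> b)), smult = (\<lambda>c a. \<phi> (c \<odot>\<^bsub>A\<^esub> \<psi> a))\<rparr>)"

lemma transport_algebra_iso:
  assumes A: "k_algebra A" and inj: "inj_on \<phi> (carrier A)"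
  shows "k_algebra (transport_algebra \<phi> A)" "algebra_hom A (transport_algebra \<phi> A) \<phi>"
    "bij_betw \<phi> (carrier A) (carrier (transport_algebra \<phi> A))"
proof -
  interpret A: k_algebra A by (rule A)
  let ?B = "transport_algebra \<phi> A"
  have inv: "inv_into (carrier A) \<phi> (\<phi> a) = a" if "a \<in> carrier A" for a
    using inj that by simp
  have car: "carrier ?B = \<phi> ` carrier A" and one: "\<one>\<^bsub>?B\<^esub> = \<phi> \<one>\<^bsub>A\<^esub>" and zero: "\<zero>\<^bsub>?B\<^esub> = \<phi> \<zero>\<^bsub>A\<^esub>"
    by (simp_all add: transport_algebra_def Let_def)
  have ops: "\<phi> a \<otimes>\<^bsub>?B\<^esub> \<phi> b = \<phi> (a \<otimes>\<^bsub>A\<^esub> b)" "\<phi> a \<oplus>\<^bsub>?B\<^esub> \<phi> b = \<phi> (a \<oplus>\<^bsub>A\<^esub> b)"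
    "c \<odot>\<^bsub>?B\<^esub> \<phi> a = \<phi> (c \<odot>\<^bsub>A\<^esub> a)" if "a \<in> carrier A" "b \<in> carrier A" for a b c
    using that by (simp_all add: transport_algebra_def Let_def inv)
  have smult: "c \<odot>\<^bsub>?B\<^esub> \<phi> a = \<phi> (c \<odot>\<^bsub>A\<^esub> a)" if "a \<in> carrier A" for a c
    using ops(3)[OF that that] .
  have "ring ?B"
  proof (rule ringI)
    show "abelian_group ?B"
    proof (rule abelian_groupI)
      fix y assume "y \<in> carrier ?B"
      then obtain a where "a \<in> carrier A" "y = \<phi> a" by (auto simp: car)
      then show "\<exists>z\<in>carrier ?B. z \<oplus>\<^bsub>?B\<^esub> y = \<zero>\<^bsub>?B\<^esub>"
        by (intro bexI[of _ "\<phi> (\<ominus>\<^bsub>A\<^esub> a)"]) (simp_all add: ops car zero A.l_neg)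
    qed (auto simp: car ops zero A.a_ac)
    show "Group.monoid ?B"
      by (rule monoidI) (auto simp: car ops one A.m_assoc)
  qed (auto simp: car ops A.l_distr A.r_distr)
  then show "k_algebra ?B"
    by (rule k_algebraI)
       (auto simp: car ops smult A.smult_add_left A.smult_add_right A.smult_smult A.smult_mult_left A.smult_mult_right)
  show "algebra_hom A ?B \<phi>"
    by (intro algebra_homI linear_mapI) (simp_all add: car ops smult one)
  show "bij_betw \<phi> (carrier A) (carrier ?B)"
    using inj by (simp add: bij_betw_def car)
qed

text \<open>The antipode of the copy is built from the given antihomomorphism \<open>S\<close>.
  Isomorphism compares comultiplications and counits, so it suffices that these are carried along by
  the injection.\<close>

lemma (in pointed_generators) transport_hopf_algebra:
  fixes \<phi> :: "'a \<Rightarrow> 'e"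
  assumes inj: "inj_on \<phi> (carrier H)"
    and S: "algebra_hom H (opposite_algebra H) S"
    and Sg: "S g \<otimes> g = \<one>" "g \<otimes> S g = \<one>" and Sh: "S h \<otimes> h = \<one>" "h \<otimes> S h = \<one>" and Sx: "S x = \<ominus> (x \<otimes> S h)"
  shows "\<exists>E :: ('k, 'e) hopf. hopf_algebra E \<and> H \<cong>\<^sub>H E"
proof -
  note KA = is_k_algebra
  let ?B = "transport_algebra \<phi> H" and ?\<psi> = "inv_into (carrier H) \<phi>"
  note B = transport_algebra_iso[OF KA inj]
  define E :: "('k, 'e) hopf" where "E = module.extend ?B (hopf.fields
     (\<lambda>a. tensor_map H H ?B ?B \<phi> \<phi> (comult H (?\<psi> a))) (\<lambda>a. counit H (?\<psi> a)) (\<lambda>a. \<phi> (S (?\<psi> a))))"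
  have same: "same_algebra ?B E"
    by (simp add: E_def same_algebra_def module.defs hopf.defs)
  note T = same_algebra_tensor[OF same same]
  have EE: "k_algebra E" by (rule same_algebra_k_algebra[OF same B(1)])
  interpret E: k_algebra E by (rule EE)
  have hom: "algebra_hom H E \<phi>"
    using B(2) same_algebra_algebra_hom[OF same_algebra_refl same] by metis
  note lin = algebra_hom_linear[OF hom]
  have bij: "bij_betw \<phi> (carrier H) (carrier E)"
    using B(3) same by (simp add: same_algebra_def)
  have hom': "algebra_hom E H ?\<psi>" by (rule inverse_algebra_hom[OF KA hom bij])
  have inv: "?\<psi> (\<phi> a) = a" if "a \<in> carrier H" for a using inj that by simp
  have ops: "comult E a = tensor_map H H E E \<phi> \<phi> (comult H (?\<psi> a))" "counit E a = counit H (?\<psi> a)"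
    "antipode E a = \<phi> (S (?\<psi> a))" for a
    unfolding tensor_map_def T[symmetric] by (simp_all add: E_def tensor_map_def module.defs hopf.defs)
  note tm = tensor_map_algebra_hom[OF KA KA EE EE hom hom]
  note tl = tensor_map_linear[OF KA KA EE EE lin lin] and tp = tensor_map_pure[OF KA KA EE EE lin lin]
  have "prebialgebra E"
  proof (intro prebialgebra.intro prebialgebra_axioms.intro EE)
    show "algebra_hom E (tensor E E) (comult E)"
      unfolding ops(1)[abs_def] by (rule algebra_hom_compose[OF algebra_hom_compose[OF hom' comult_hom] tm])
    show "algebra_hom E scalars (counit E)"
      unfolding ops(2)[abs_def] by (rule algebra_hom_compose[OF hom' counit_hom])
  qed
  then interpret E: prebialgebra E .
  have S_sub: "{g, h, x} \<subseteq> carrier H" using gens by auto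
  interpret P: pointed_generators E "\<phi> g" "\<phi> h" "\<phi> x"
  proof
    show "carrier E \<subseteq> alg_span E {\<phi> g, \<phi> h, \<phi> x}"
    proof
      fix y assume "y \<in> carrier E"
      then obtain a where a: "a \<in> carrier H" "y = \<phi> a" using bij by (auto simp: bij_betw_def)
      then have "a \<in> alg_span H {g, h, x}" using generated by auto
      from alg_span_hom_image[OF KA S_sub hom this] show "y \<in> alg_span E {\<phi> g, \<phi> h, \<phi> x}" using a by simp
    qed
  qed (use gens in \<open>simp_all add: ops inv comult_g comult_h comult_x counit_g counit_h counit_x tp
      linear_map_add[OF tl] algebra_hom_closed[OF hom] algebra_hom_one[OF hom] pure_tensor_closed[OF KA KA]\<close>)
  have S_cl: "S a \<in> carrier H" if "a \<in> carrier H" for a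
    using algebra_hom_closed[OF S that] by simp
  have "hopf_algebra E"
  proof (rule P.hopf_algebra_if_antipode)
    have "algebra_hom (opposite_algebra H) (opposite_algebra E) \<phi>"
      using hom by (auto simp: algebra_hom_def linear_map_def ring_hom_def)
    from algebra_hom_compose[OF algebra_hom_compose[OF hom' S] this]
    show "algebra_hom E (opposite_algebra E) (antipode E)" unfolding ops(3)[abs_def] .
    show "antipode E (\<phi> g) \<otimes>\<^bsub>E\<^esub> \<phi> g = \<one>\<^bsub>E\<^esub>" "\<phi> g \<otimes>\<^bsub>E\<^esub> antipode E (\<phi> g) = \<one>\<^bsub>E\<^esub>"
      "antipode E (\<phi> h) \<otimes>\<^bsub>E\<^esub> \<phi> h = \<one>\<^bsub>E\<^esub>" "\<phi> h \<otimes>\<^bsub>E\<^esub> antipode E (\<phi> h) = \<one>\<^bsub>E\<^esub>"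
      using gens S_cl Sg Sh by (simp_all add: ops inv flip: algebra_hom_mult[OF hom] algebra_hom_one[OF hom])
    show "antipode E (\<phi> x) = \<ominus>\<^bsub>E\<^esub> (\<phi> x \<otimes>\<^bsub>E\<^esub> antipode E (\<phi> h))"
      using gens S_cl by (simp add: ops inv Sx linear_map_minus[OF KA EE lin] algebra_hom_mult[OF hom])
  qed
  moreover have "hopf_hom H E \<phi>"
    using hom by (simp add: hopf_hom_def ops inv)
  ultimately show ?thesis
    using bij unfolding hopf_isomorphic_def by blast
qed

text \<open>The place where the size of \<open>'e\<close> enters: T has as many elements as there
  are coordinate vectors of length \<open>n m^2\<close>, and these can be injected into
  \<open>'e\<close>.\<close>

lemma T_hopf_algebra_exists:
  fixes q \<omega> :: "'k::field"
  assumes q: "has_order q m" and n: "0 < n" and \<omega>: "\<omega> ^ n = 1"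
    and large: "({..<n * m\<^sup>2} \<rightarrow>\<^sub>E (UNIV :: 'k set)) \<lesssim> (UNIV :: 'e set)"
  shows "\<exists>E :: ('k, 'e) hopf. hopf_algebra E \<and> T_algebra n m \<omega> q \<cong>\<^sub>H E"
proof -
  let ?T = "T_algebra n m \<omega> q" and ?G = "T_gen n m \<omega> q"
  obtain co where "pointed_basis ?T (?G gen_g) (?G gen_h) (?G gen_x) m n q co"
    using T_pointed_basis[OF q \<omega> n] by blast
  then interpret B: pointed_basis ?T "?G gen_g" "?G gen_h" "?G gen_x" m n q co .
  interpret P: pointed_generators ?T "?G gen_g" "?G gen_h" "?G gen_x" by (rule T_pointed[OF q])
  interpret G: T_generators ?T n m \<omega> q "?G gen_g" "?G gen_h" "?G gen_x" by (rule T_T_generators)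
  have card: "card (monomial_index m n) = n * m\<^sup>2" by (simp add: card_cartesian_product power2_eq_square)
  have "finite (monomial_index m n)" by simp
  from ex_bij_betw_nat_finite[OF this] obtain e where e: "bij_betw e {..<n * m\<^sup>2} (monomial_index m n)"
    unfolding card atLeast0LessThan by blast
  obtain F :: "(nat \<Rightarrow> 'k) \<Rightarrow> 'e" where F: "inj_on F ({..<n * m\<^sup>2} \<rightarrow>\<^sub>E UNIV)"
    using large unfolding lepoll_def by blast
  \<comment> \<open>The coordinate vector of \<open>y\<close>, restricted to the indices in range so
    that it is an element of the extensional function space that \<open>F\<close> injects.\<close>
  define c where "c y = (\<lambda>t\<in>{..<n * m\<^sup>2}. co (e t) y)" for y
  have "inj_on c (carrier ?T)"
  proof (rule inj_onI)
    fix y z assume yz: "y \<in> carrier ?T" "z \<in> carrier ?T" "c y = c z"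
    have "co p y = co p z" if "p \<in> monomial_index m n" for p
    proof -
      have "p \<in> e ` {..<n * m\<^sup>2}" using bij_betw_imp_surj_on[OF e] that by (simp only:)
      then obtain t where "p = e t" "t \<in> {..<n * m\<^sup>2}" by (rule imageE)
      then show ?thesis using fun_cong[OF yz(3), of t] by (simp add: c_def)
    qed
    then show "y = z" by (rule B.dual_basis_eqI[OF B.basis yz(1,2)])
  qed
  moreover have "c ` carrier ?T \<subseteq> {..<n * m\<^sup>2} \<rightarrow>\<^sub>E UNIV" by (auto simp: c_def split: if_splits)
  ultimately have inj: "inj_on (F \<circ> c) (carrier ?T)"
    using F by (intro comp_inj_on) (auto intro: inj_on_subset)
  have m: "0 < m" using B.m by simp
  let ?b = "case_gen (?G gen_g [^]\<^bsub>?T\<^esub> (n - 1)) (?G gen_h [^]\<^bsub>?T\<^esub> (m - 1)) (\<ominus>\<^bsub>?T\<^esub> (?G gen_x \<otimes>\<^bsub>?T\<^esub> ?G gen_h [^]\<^bsub>?T\<^esub> (m - 1)))"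
  \<comment> \<open>The presentation of T applied to the opposite algebra; the prescribed values are
    those of the antipode.\<close>
  obtain S where S: "algebra_hom ?T (opposite_algebra ?T) S" "\<And>s. S (?G s) = ?b s"
    using T_hom_exists[OF k_algebra_opposite[OF B.is_k_algebra], of n m \<omega> q ?b]
      G.opposite_T_relations[OF order_power[OF q] \<omega> m n] by auto
  have inv: "y [^]\<^bsub>?T\<^esub> (k - 1) \<otimes>\<^bsub>?T\<^esub> y = \<one>\<^bsub>?T\<^esub>" "y \<otimes>\<^bsub>?T\<^esub> y [^]\<^bsub>?T\<^esub> (k - 1) = \<one>\<^bsub>?T\<^esub>"
    if "y \<in> carrier ?T" "y [^]\<^bsub>?T\<^esub> k = \<one>\<^bsub>?T\<^esub>" "0 < k" for y and k :: nat
    using that B.nat_pow_Suc2[OF that(1), of "k - 1"] B.nat_pow_Suc[of y "k - 1"] by simp_all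
  show ?thesis
    by (rule P.transport_hopf_algebra[OF inj S(1)])
       (simp_all only: S(2) gen.case inv[OF T_gen_closed G.g_order n] inv[OF T_gen_closed G.h_order m])
qed


section \<open>Arithmetic of roots of unity, and the count of isomorphism types\<close>

section \<open>Roots of unity and divisors\<close>

text \<open>The multiplicative order of \<open>\<xi>\<close> is the number of its distinct powers,
  which is the number of roots of unity that it generates.\<close>

lemma generates_roots_order:
  fixes \<xi> :: "'k::field"
  assumes n: "0 < n" and gen: "generates_roots n \<xi>" and \<nu>: "\<nu> = card (roots_of_unity n :: 'k set)"
  shows "0 < \<nu>" "\<xi> ^ k = 1 \<longleftrightarrow> \<nu> dvd k" "\<nu> dvd n" "\<xi> ^ n = 1" "\<omega> ^ n = 1 \<Longrightarrow> \<exists>t<\<nu>. \<omega> = \<xi> ^ t"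
proof -
  have roots: "roots_of_unity n = range (\<lambda>i::nat. \<xi> ^ i)"
    using gen by (simp add: generates_roots_def)
  have "\<xi> \<in> roots_of_unity n" unfolding roots by (rule range_eqI[of _ _ 1]) simp
  then show \<xi>n: "\<xi> ^ n = 1" by (simp add: roots_of_unity_def)
  then have \<xi>0: "\<xi> \<noteq> 0" using n by (auto simp: power_0_left)
  define o' where "o' = (LEAST k. 0 < k \<and> \<xi> ^ k = 1)"
  have o': "0 < o'" "\<xi> ^ o' = 1"
    using LeastI[of "\<lambda>k. 0 < k \<and> \<xi> ^ k = 1" n] n \<xi>n by (auto simp: o'_def)
  have least: "\<not> (0 < k \<and> \<xi> ^ k = 1)" if "k < o'" for k
    using not_less_Least[of k "\<lambda>k. 0 < k \<and> \<xi> ^ k = 1"] that by (auto simp: o'_def)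
  have red: "\<xi> ^ k = \<xi> ^ (k mod o')" for k
  proof -
    have "\<xi> ^ k = (\<xi> ^ o') ^ (k div o') * \<xi> ^ (k mod o')" by (metis power_add power_mult mult_div_mod_eq)
    then show ?thesis using o' by simp
  qed
  have ord: "\<xi> ^ k = 1 \<longleftrightarrow> o' dvd k" for k
    using red[of k] least[of "k mod o'"] o' by (auto simp: dvd_eq_mod_eq_0)
  have "inj_on (\<lambda>i. \<xi> ^ i) {..<o'}"
  proof (rule linorder_inj_onI')
    fix i j assume ij: "i \<in> {..<o'}" "j \<in> {..<o'}" "i < j"
    have "\<xi> ^ j = \<xi> ^ i * \<xi> ^ (j - i)" using ij by (simp flip: power_add)
    moreover have "\<xi> ^ (j - i) \<noteq> 1" using least[of "j - i"] ij by auto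
    ultimately show "\<xi> ^ i \<noteq> \<xi> ^ j" using \<xi>0 by auto
  qed
  moreover have img: "range (\<lambda>i::nat. \<xi> ^ i) = (\<lambda>i. \<xi> ^ i) ` {..<o'}"
  proof (intro equalityI subsetI)
    fix y assume "y \<in> range (\<lambda>i::nat. \<xi> ^ i)"
    then obtain i where "y = \<xi> ^ (i mod o')" using red by auto
    then show "y \<in> (\<lambda>i. \<xi> ^ i) ` {..<o'}" using o' by auto
  qed auto
  ultimately have "\<nu> = o'" unfolding \<nu> roots img by (simp add: card_image)
  then show "0 < \<nu>" "\<xi> ^ k = 1 \<longleftrightarrow> \<nu> dvd k" "\<nu> dvd n" using o' ord \<xi>n by auto
  assume "\<omega> ^ n = 1"
  then have "\<omega> \<in> roots_of_unity n" by (simp add: roots_of_unity_def)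
  then show "\<exists>t<\<nu>. \<omega> = \<xi> ^ t" unfolding roots img \<open>\<nu> = o'\<close> by auto
qed

lemma power_eq_iff_cong:
  fixes \<xi> :: "'k::field"
  assumes "\<xi> \<noteq> 0" and ord: "\<And>k. \<xi> ^ k = 1 \<longleftrightarrow> \<nu> dvd k"
  shows "\<xi> ^ i = \<xi> ^ j \<longleftrightarrow> [i = j] (mod \<nu>)"
proof (induction i j rule: linorder_wlog)
  case (le i j)
  have "\<xi> ^ j = \<xi> ^ i * \<xi> ^ (j - i)" using le by (simp flip: power_add)
  then have "\<xi> ^ i = \<xi> ^ j \<longleftrightarrow> \<xi> ^ (j - i) = 1" using assms(1) by auto
  also have "\<dots> \<longleftrightarrow> [i = j] (mod \<nu>)"
    using le ord by (metis cong_altdef_nat cong_sym_eq)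
  finally show ?case .
next
  case (sym i j)
  then show ?case by (metis cong_sym_eq)
qed

text \<open>Put \<open>u = gcd t N\<close>, \<open>t = u t'\<close> and \<open>N = u N'\<close>.
  Every \<open>a = t' + N' s\<close> satisfies the congruence. With \<open>s\<close> the product of
  the primes that divide \<open>n\<close> but not \<open>t'\<close>, each prime divisor of
  \<open>n\<close> divides exactly one of \<open>t'\<close> and \<open>N' s\<close>, because
  \<open>t'\<close> and \<open>N'\<close> are coprime; hence it does not divide
  \<open>a\<close>.\<close>

lemma unit_multiplier_exists:
  fixes N n t :: nat
  assumes N: "0 < N" and n: "0 < n"
  obtains a where "coprime a n" "[a * gcd t N = t] (mod N)"
proof -
  define u where "u = gcd t N"
  have u: "0 < u" using N by (simp add: u_def)
  obtain t' N' where t': "t = u * t'" "N = u * N'" "coprime t' N'"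
    unfolding u_def by (metis N gcd_coprime_exists gcd_nat.eq_neutr_iff gr_implies_not0 mult.commute)
  define s where "s = \<Prod>{p. prime p \<and> p dvd n \<and> \<not> p dvd t'}"
  have fin: "finite {p. prime p \<and> p dvd n \<and> \<not> p dvd t'}"
    using n by (auto intro: finite_subset[OF _ finite_divisors_nat])
  have dvd_s: "p dvd s \<longleftrightarrow> \<not> p dvd t'" if p: "prime p" "p dvd n" for p
  proof
    assume "p dvd s"
    then obtain r where "prime r" "\<not> r dvd t'" "p dvd r"
      using prime_dvd_prod_iff[OF fin p(1), of "\<lambda>r. r"] by (auto simp: s_def)
    then show "\<not> p dvd t'" using p(1) primes_dvd_imp_eq by blast
  next
    assume "\<not> p dvd t'"
    then show "p dvd s" unfolding s_def using p by (intro dvd_prodI[OF fin, of p "\<lambda>r. r", simplified]) auto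
  qed
  define a where "a = t' + N' * s"
  have "coprime a n"
  proof (rule ccontr)
    assume "\<not> coprime a n"
    then obtain p where p: "prime p" "p dvd a" "p dvd n"
      by (metis coprime_iff_gcd_eq_1 gcd_greatest_iff prime_factor_nat)
    show False
    proof (cases "p dvd t'")
      case True
      then have "p dvd N' * s" using p(2) by (simp add: a_def dvd_add_right_iff)
      moreover have "\<not> p dvd N'" using True t'(3) p(1) by (meson coprime_common_divisor not_prime_unit)
      ultimately show False using p dvd_s True by (auto simp: prime_dvd_mult_iff)
    next
      case False
      then have "p dvd N' * s" using p dvd_s by simp
      then show False using p(2) False by (simp add: a_def dvd_add_left_iff)
    qed
  qed
  moreover have "[a * u = t] (mod N)"
  proof -
    have "a * u = t + N * s" by (simp add: a_def t' algebra_simps)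
    then show ?thesis by (simp add: cong_def)
  qed
  ultimately show thesis using that by (simp add: u_def)
qed

text \<open>A divisor of a product of two coprime numbers splits uniquely into divisors of the
  factors, so the number of divisors is multiplicative along the induction.\<close>

lemma card_divisors_prime_powers:
  fixes p \<alpha> :: "'i \<Rightarrow> nat"
  assumes "finite I" "inj_on p I" "\<And>i. i \<in> I \<Longrightarrow> prime (p i)"
  shows "card {d. d dvd (\<Prod>i\<in>I. p i ^ \<alpha> i)} = (\<Prod>i\<in>I. \<alpha> i + 1)"
  using assms
proof (induction I rule: finite_induct)
  case (insert i I)
  let ?a = "p i ^ \<alpha> i" and ?b = "\<Prod>i\<in>I. p i ^ \<alpha> i"
  have p: "prime (p i)" using insert by auto
  have cop: "coprime ?a ?b"
  proof (rule prod_coprime_right)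
    fix j assume "j \<in> I"
    then have "p j \<noteq> p i" "prime (p j)" using insert by (auto simp: inj_on_def)
    then show "coprime ?a (p j ^ \<alpha> j)" using p by (simp add: primes_coprime)
  qed
  have "bij_betw (\<lambda>(x, y). x * y) ({d. d dvd ?a} \<times> {d. d dvd ?b}) {d. d dvd ?a * ?b}"
    unfolding bij_betw_def
  proof
    show "inj_on (\<lambda>(x, y). x * y) ({d. d dvd ?a} \<times> {d. d dvd ?b})"
    proof (rule inj_onI, clarify)
      fix x y x' y' :: nat
      assume *: "x dvd ?a" "x' dvd ?a" "y dvd ?b" "y' dvd ?b" "x * y = x' * y'"
      have cx: "coprime x y'" "coprime x' y" "coprime y x'" "coprime y' x"
        using * cop by (meson coprime_divisors coprime_commute)+
      have "x dvd x'" using cx(1) *(5) by (metis coprime_dvd_mult_left_iff dvd_triv_left)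
      moreover have "x' dvd x" using cx(2) *(5) by (metis coprime_dvd_mult_left_iff dvd_triv_left)
      ultimately have "x = x'" by (rule dvd_antisym)
      moreover have "x \<noteq> 0" using *(1) p by (metis dvd_0_left not_prime_0 power_not_zero)
      ultimately show "x = x' \<and> y = y'" using *(5) by simp
    qed
    show "(\<lambda>(x, y). x * y) ` ({d. d dvd ?a} \<times> {d. d dvd ?b}) = {d. d dvd ?a * ?b}"
    proof (intro equalityI subsetI)
      fix d assume "d \<in> {d. d dvd ?a * ?b}"
      then obtain x y where "d = x * y" "x dvd ?a" "y dvd ?b" using division_decomp[of d ?a ?b] by blast
      then show "d \<in> (\<lambda>(x, y). x * y) ` ({d. d dvd ?a} \<times> {d. d dvd ?b})" by auto
    qed (auto intro: mult_dvd_mono)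
  qed
  then have "card {d. d dvd ?a * ?b} = card {d. d dvd ?a} * card {d. d dvd ?b}"
    using bij_betw_same_card by (fastforce simp: card_cartesian_product)
  also have "card {d. d dvd ?a} = \<alpha> i + 1"
  proof -
    have "{d. d dvd ?a} = (\<lambda>k. p i ^ k) ` {..\<alpha> i}"
      using divides_primepow_nat[OF p] by auto
    moreover have "inj_on (\<lambda>k. p i ^ k) {..\<alpha> i}"
      using prime_gt_1_nat[OF p] by (auto simp: inj_on_def)
    ultimately show ?thesis by (simp add: card_image)
  qed
  finally show ?case using insert by simp
qed simp


section \<open>Classification\<close>

lemma (in prebialgebra) factorizes_imp_T_root:
  assumes "has_order q m" "2 \<le> n" "generates_roots n \<xi>" "\<nu> = card (roots_of_unity n :: 'k set)"
    and "factorizes_through H (taft_algebra m q) (cyclic_algebra n)"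
  obtains t where "t < \<nu>" "T_algebra n m (\<xi> ^ t) q \<cong>\<^sub>H H"
proof -
  obtain \<omega> where "\<omega> ^ n = 1" "T_algebra n m \<omega> q \<cong>\<^sub>H H"
    using factorizes_imp_isomorphic_T[OF prebialgebra_axioms assms(1,2,5)] by blast
  then show thesis
    using generates_roots_order(5)[OF _ assms(3,4)] assms(2) that by fastforce
qed

theorem theorem3p5:
  fixes m n \<nu> d :: nat and q \<xi> :: "'k::field"
  assumes "m \<ge> 3" and "n \<ge> 2"
    and "primitive_root_of_unity m q"
    and "generates_roots n \<xi>"
    and "\<nu> = card (roots_of_unity n :: 'k set)"
    and "d = gcd m \<nu>"
  shows "(\<forall>t<\<nu>. T_algebra n m (\<xi> ^ t) q \<cong>\<^sub>H T_algebra n m (\<xi> ^ gcd t (\<nu> div d)) q) \<and>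
    (\<forall>d\<^sub>1 d\<^sub>2. d\<^sub>1 > 0 \<and> d\<^sub>2 > 0 \<and> d\<^sub>1 dvd \<nu> div d \<and> d\<^sub>2 dvd \<nu> div d \<and> d\<^sub>1 \<noteq> d\<^sub>2 \<longrightarrow>
       \<not> T_algebra n m (\<xi> ^ d\<^sub>1) q \<cong>\<^sub>H T_algebra n m (\<xi> ^ d\<^sub>2) q) \<and>
    (\<comment> \<open>Hopf algebras with carriers in any type large enough to hold a copy of \<open>K\<close> to the power \<open>nm\<^sup>2\<close>\<close>
     ({..<n * m\<^sup>2} \<rightarrow>\<^sub>E (UNIV :: 'k set)) \<lesssim> (UNIV :: 'e set) \<longrightarrow>
     (\<forall>r (p :: nat \<Rightarrow> nat) \<alpha>.
        inj_on p {1..r} \<and> (\<forall>i\<in>{1..r}. prime (p i) \<and> \<alpha> i > 0) \<and>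
        \<nu> div d = (\<Prod>i = 1..r. p i ^ \<alpha> i) \<longrightarrow>
        card (isomorphism_types
          {E :: ('k, 'e) hopf. hopf_algebra E \<and>
             factorizes_through E (taft_algebra m q) (group_hopf_algebra (integer_mod_group n))})
        = (\<Prod>i = 1..r. (\<alpha> i + 1))))"
proof -
  \<comment> \<open>The index of the group of \<open>d\<close>-th roots of unity in the group
    generated by \<open>\<xi>\<close>.\<close>
  define N where "N = \<nu> div d"
  have q: "has_order q m" by (rule primitive_root_has_order[OF assms(3)]) (use assms(1) in simp)
  have n0: "0 < n" using assms(2) by simp
  note root = generates_roots_order[OF n0 assms(4,5)]
  have \<xi>0: "\<xi> \<noteq> 0" using root(4) n0 by (auto simp: power_0_left)
  note pow_eq = power_eq_iff_cong[OF \<xi>0 root(2)]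
  have \<nu>: "\<nu> = N * d" and d: "0 < d" using root(1) by (simp_all add: N_def assms(6))
  have N: "0 < N" using \<nu> root(1) by (cases N) auto
  define m' where "m' = m div d"
  have m': "m = m' * d" by (simp add: m'_def assms(6))
  have cop: "coprime m' N"
    using div_gcd_coprime[of m \<nu>] root(1) by (simp add: m'_def N_def assms(6))
  have \<omega>n: "(\<xi> ^ t) ^ n = 1" for t by (metis root(4) power_commutes power_mult mult.commute power_one)
  have part1: "T_algebra n m (\<xi> ^ t) q \<cong>\<^sub>H T_algebra n m (\<xi> ^ gcd t N) q" for t
  proof -
    obtain a where a: "coprime a n" "[a * gcd t N = t] (mod N)"
      using unit_multiplier_exists[OF N n0] by blast
    let ?u = "gcd t N"
    \<comment> \<open>After multiplication by \<open>m\<close> the congruence holds modulo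
      \<open>N m\<close>, a multiple of \<open>\<nu> = N d\<close>. The quotient of the two powers
      of \<open>\<xi>\<close> is thus an \<open>m\<close>-th root of unity, hence a power of
      \<open>q\<close>.\<close>
    have "[a * ?u * m = t * m] (mod (N * m))"
      using a(2) by (simp add: cong_def mod_mult_mult2)
    moreover have "\<nu> dvd N * m" by (simp add: \<nu> m')
    ultimately have "\<xi> ^ (a * ?u * m) = \<xi> ^ (t * m)"
      unfolding pow_eq by (rule cong_dvd_modulus_nat)
    then have "(\<xi> ^ (a * ?u) / \<xi> ^ t) ^ m = 1"
      using \<xi>0 by (simp add: power_divide power_mult)
    then have "\<xi> ^ (a * ?u) / \<xi> ^ t \<in> roots_of_unity m" by (simp add: roots_of_unity_def)
    then obtain b where "\<xi> ^ (a * ?u) / \<xi> ^ t = q ^ b"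
      using assms(3) by (auto simp: primitive_root_of_unity_def generates_roots_def)
    then have "(\<xi> ^ ?u) ^ a = \<xi> ^ t * q ^ b"
      using \<xi>0 by (simp add: field_simps power_mult[symmetric])
    then show ?thesis
      by (rule T_isomorphic_if[OF q assms(2) \<omega>n \<omega>n _ a(1)])
  qed
  \<comment> \<open>The \<open>m\<close>-th power removes \<open>q\<close>. With
    \<open>m = m' d\<close> and \<open>\<nu> = N d\<close>, the factor \<open>d\<close> cancels from
    the congruence of exponents, and so does \<open>m'\<close>, being prime to \<open>N\<close>.
    Reduction modulo \<open>d\<^sub>2\<close>, a divisor of \<open>N\<close>, leaves
    \<open>d\<^sub>1\<close> congruent to 0.\<close>
  have dvd: "d\<^sub>2 dvd d\<^sub>1" if iso: "T_algebra n m (\<xi> ^ d\<^sub>1) q \<cong>\<^sub>H T_algebra n m (\<xi> ^ d\<^sub>2) q" and "d\<^sub>2 dvd N" for d\<^sub>1 d\<^sub>2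
  proof -
    obtain a b where "(\<xi> ^ d\<^sub>2) ^ a = \<xi> ^ d\<^sub>1 * q ^ b"
      using T_isomorphic_imp[OF q n0 \<omega>n \<omega>n iso] by blast
    then have "((\<xi> ^ d\<^sub>2) ^ a) ^ m = (\<xi> ^ d\<^sub>1) ^ m * (q ^ m) ^ b"
      by (simp add: power_mult_distrib power_mult[symmetric] mult.commute)
    then have "((\<xi> ^ d\<^sub>2) ^ a) ^ m = (\<xi> ^ d\<^sub>1) ^ m"
      by (simp only: order_power[OF q] power_one mult_1_right)
    then have "\<xi> ^ (d\<^sub>2 * a * m' * d) = \<xi> ^ (d\<^sub>1 * m' * d)"
      by (simp add: power_mult[symmetric] m' mult.assoc)
    then have "[d\<^sub>2 * a * m' = d\<^sub>1 * m'] (mod N)"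
      using d unfolding pow_eq \<nu> by (simp add: cong_def mod_mult_mult2)
    then have "[d\<^sub>2 * a = d\<^sub>1] (mod N)"
      using cop by (simp add: cong_mult_rcancel_nat)
    then have "[d\<^sub>2 * a = d\<^sub>1] (mod d\<^sub>2)"
      using \<open>d\<^sub>2 dvd N\<close> by (rule cong_dvd_modulus_nat)
    then show ?thesis by (metis cong_dvd_iff dvd_refl dvd_triv_left)
  qed
  \<comment> \<open>Applying the divisibility to the isomorphism and to its inverse replaces any
    information on whether the exponent \<open>a\<close> is invertible.\<close>
  have part2: "d\<^sub>1 = d\<^sub>2" if "d\<^sub>1 dvd N" "d\<^sub>2 dvd N" and iso: "T_algebra n m (\<xi> ^ d\<^sub>1) q \<cong>\<^sub>H T_algebra n m (\<xi> ^ d\<^sub>2) q" for d\<^sub>1 d\<^sub>2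
    using dvd[OF iso that(2)]
      dvd[OF hopf_isomorphic_sym[OF pointed_generators.axioms(1)[OF T_pointed[OF q]]
          pointed_generators.axioms(1)[OF T_pointed[OF q]] iso] that(1)]
    by (simp add: dvd_antisym)
  have part3: "card (isomorphism_types
          {E :: ('k, 'e) hopf. hopf_algebra E \<and>
             factorizes_through E (taft_algebra m q) (cyclic_algebra n)})
        = card {\<delta>. \<delta> dvd N}"
    if large: "({..<n * m\<^sup>2} \<rightarrow>\<^sub>E (UNIV :: 'k set)) \<lesssim> (UNIV :: 'e set)"
  proof -
    let ?P = "{E :: ('k, 'e) hopf. hopf_algebra E \<and> factorizes_through E (taft_algebra m q) (cyclic_algebra n)}"
    let ?r = "{(E, F). E \<in> ?P \<and> F \<in> ?P \<and> E \<cong>\<^sub>H F}"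
    let ?T = "\<lambda>t. T_algebra n m (\<xi> ^ t) q"
    have pre: "prebialgebra E" if "E \<in> ?P" for E
      using that hopf_algebra.prebialgebra by blast
    have preT: "prebialgebra (?T t)" for t
      by (rule pointed_generators.axioms(1)[OF T_pointed[OF q]])
    have equiv: "equiv ?P ?r"
    proof (rule equivI)
      show "refl_on ?P ?r" using pre hopf_isomorphic_refl by (auto simp: refl_on_def)
      show "sym ?r" using pre hopf_isomorphic_sym by (blast intro: symI)
      show "trans ?r" using pre hopf_isomorphic_trans by (blast intro: transI)
    qed auto
    \<comment> \<open>Each T has a copy in the counted set: it factorizes by its monomial basis, and
      factorization passes to the copy along the isomorphism.\<close>
    have "\<forall>\<delta>. \<exists>E. E \<in> ?P \<and> ?T \<delta> \<cong>\<^sub>H E"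
    proof
      fix \<delta>
      obtain E :: "('k, 'e) hopf" where E: "hopf_algebra E" "?T \<delta> \<cong>\<^sub>H E"
        using T_hopf_algebra_exists[OF q n0 \<omega>n large] by blast
      obtain co where "pointed_basis (?T \<delta>) (T_gen n m (\<xi> ^ \<delta>) q gen_g) (T_gen n m (\<xi> ^ \<delta>) q gen_h)
          (T_gen n m (\<xi> ^ \<delta>) q gen_x) m n q co"
        using T_pointed_basis[OF q \<omega>n n0] by blast
      then have "factorizes_through (?T \<delta>) (taft_algebra m q) (cyclic_algebra n)"
        by (rule pointed_basis.factorizes)
      then have "factorizes_through E (taft_algebra m q) (cyclic_algebra n)"
        by (rule factorizes_through_isomorphic[OF taft_prebialgebra[OF q] cyclic_prebialgebra preT
            hopf_algebra.prebialgebra[OF E(1)] _ E(2)])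
      then show "\<exists>E. E \<in> ?P \<and> ?T \<delta> \<cong>\<^sub>H E" using E by blast
    qed
    from choice[OF this] obtain F :: "nat \<Rightarrow> ('k, 'e) hopf"
      where "\<forall>\<delta>. F \<delta> \<in> ?P \<and> ?T \<delta> \<cong>\<^sub>H F \<delta>" ..
    then have F: "F \<delta> \<in> ?P" "?T \<delta> \<cong>\<^sub>H F \<delta>" for \<delta> by simp_all
    \<comment> \<open>The copies for the divisors of \<open>N\<close> represent the classes:
      pairwise non-isomorphic by \<open>part2\<close>, and exhaustive because \<open>part1\<close>
      replaces the exponent \<open>t\<close> by the divisor \<open>gcd t N\<close>.\<close>
    have "bij_betw (\<lambda>\<delta>. ?r `` {F \<delta>}) {\<delta>. \<delta> dvd N} (?P // ?r)"
      unfolding bij_betw_def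
    proof (intro conjI equalityI subsetI)
      show "inj_on (\<lambda>\<delta>. ?r `` {F \<delta>}) {\<delta>. \<delta> dvd N}"
      proof (rule inj_onI)
        fix \<delta> \<delta>' assume *: "\<delta> \<in> {\<delta>. \<delta> dvd N}" "\<delta>' \<in> {\<delta>. \<delta> dvd N}" "?r `` {F \<delta>} = ?r `` {F \<delta>'}"
        have "(F \<delta>, F \<delta>') \<in> ?r"
          using *(3) eq_equiv_class_iff[OF equiv F(1) F(1)] by blast
        then have "F \<delta> \<cong>\<^sub>H F \<delta>'" by blast
        then have "?T \<delta> \<cong>\<^sub>H F \<delta>'"
          by (rule hopf_isomorphic_trans[OF preT pre[OF F(1)] pre[OF F(1)] F(2)])
        then have "?T \<delta> \<cong>\<^sub>H ?T \<delta>'"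
          by (rule hopf_isomorphic_trans[OF preT pre[OF F(1)] preT _ hopf_isomorphic_sym[OF preT pre[OF F(1)] F(2)]])
        then show "\<delta> = \<delta>'" using part2 * by blast
      qed
    next
      fix C assume "C \<in> ?P // ?r"
      then obtain E where E: "E \<in> ?P" "C = ?r `` {E}" by (rule quotientE)
      obtain t where t: "?T t \<cong>\<^sub>H E"
        using prebialgebra.factorizes_imp_T_root[OF pre[OF E(1)] q assms(2,4,5)] E(1) by blast
      let ?u = "gcd t N"
      have "E \<cong>\<^sub>H ?T ?u"
        by (rule hopf_isomorphic_trans[OF pre[OF E(1)] preT preT hopf_isomorphic_sym[OF preT pre[OF E(1)] t] part1])
      then have "E \<cong>\<^sub>H F ?u"
        by (rule hopf_isomorphic_trans[OF pre[OF E(1)] preT pre[OF F(1)] _ F(2)])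
      then have "(E, F ?u) \<in> ?r" using E(1) F(1) by blast
      then have "C = ?r `` {F ?u}" unfolding E(2) by (rule equiv_class_eq[OF equiv])
      then show "C \<in> (\<lambda>\<delta>. ?r `` {F \<delta>}) ` {\<delta>. \<delta> dvd N}" by blast
    next
      fix C assume "C \<in> (\<lambda>\<delta>. ?r `` {F \<delta>}) ` {\<delta>. \<delta> dvd N}"
      then obtain \<delta> where "C = ?r `` {F \<delta>}" by (rule imageE)
      then show "C \<in> ?P // ?r" by (simp only: quotientI[OF F(1)])
    qed
    then show ?thesis
      unfolding isomorphism_types_def by (rule bij_betw_same_card[symmetric])
  qed
  show ?thesis
    unfolding N_def[symmetric]
  proof (intro conjI allI impI)
    fix r and p \<alpha> :: "nat \<Rightarrow> nat"
    assume large: "({..<n * m\<^sup>2} \<rightarrow>\<^sub>E (UNIV :: 'k set)) \<lesssim> (UNIV :: 'e set)"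
      and p: "inj_on p {1..r} \<and> (\<forall>i\<in>{1..r}. prime (p i) \<and> \<alpha> i > 0) \<and> N = (\<Prod>i = 1..r. p i ^ \<alpha> i)"
    have "card {\<delta>. \<delta> dvd N} = (\<Prod>i = 1..r. \<alpha> i + 1)"
      using p card_divisors_prime_powers[of "{1..r}" p \<alpha>] by simp
    then show "card (isomorphism_types
          {E :: ('k, 'e) hopf. hopf_algebra E \<and>
             factorizes_through E (taft_algebra m q) (cyclic_algebra n)})
        = (\<Prod>i = 1..r. \<alpha> i + 1)"
      using part3[OF large] by simp
  qed (use part1 part2 in auto)
qed

end
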